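(* Let $T$ be a bilinear Calderón–Zygmund operator defined on an upper doubling, geometrically doubling metric measure space $(X,d,\mu)$. Then $T^*$ is bounded from $L^1(X,d,\mu)\times L^1(X,d,\mu)$ to $L^{\frac12,\infty}(X,d,\mu)$. In particular, $T^*$ satisfies the Cotlar-type inequality $$T^*(f_1,f_2)(x)\le C_{\eta,\lambda,T}\,M_\lambda(f_1)(x)M_\lambda(f_2)(x)+\mathscr M_\eta(|T(f_1,f_2)|)(x)+\mathscr M(f_1)(x)\mathscr M(f_2)(x),$$ where $\eta\in(0,\frac12)$ and $\mathscr M_\eta(f):=(\mathscr M(|f|^\eta))^{\frac1\eta}$.
   Context: **Space.** $(X,d,\mu)$ is a metric measure space and $B(x,r)$ denotes the ball with center $x$ and radius $r$. *Upper doubling*: there are a dominating function $\lambda:X\times(0,\infty)\to(0,\infty)$ and a constant $C_\lambda>0$ such that for all $x\in X$, $r>0$: $\mu(B(x,r))\le\lambda(x,r)$; $r\mapsto\lambda(x,r)$ is non-decreasing; $\lambda(x,r)\le C_\lambda\lambda(x,\frac r2)$. *Geometrically doubling* (with doubling dimension $N$): any ball $B(x,r)\subset X$ can contain at most $N$ centres $y_i$ of disjoint balls $B(y_i,r/4)$. **Bilinear Calderón–Zygmund operator.** A Calderón–Zygmund kernel is a $\mu$-locally integrable function $K$ defined away from the diagonal $x=y_1=y_2$ in $X^3$ for which there are a constant $C_K>0$ and a modulus of continuity $\omega$ (a monotonically increasing subadditive function with $\omega(0)=0$ and $\|\omega\|_{Dini(1)}=\int_0^1\frac{\omega(t)}{t}\,dt<\infty$)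 such that: (size) $|K(x,y_1,y_2)|\le C_K(\lambda(x,d(x,y_1))+\lambda(x,d(x,y_2)))^{-2}$ whenever $x\ne y_j$ for some $j=1,2$; (regularity) $$|K(x,y_1,y_2)-K(x',y_1,y_2)|\le \frac{C_K}{(\lambda(x,d(x,y_1))+\lambda(x,d(x,y_2)))^{2}}\,\omega\Big(\frac{d(x,x')}{d(x,y_1)+d(x,y_2)}\Big)$$ whenever $d(x,x')\le\frac12\max_{i=1,2} d(x,y_i)$; and similar regularity conditions hold for the other components $y_1$, $y_2$. An operator $T$ is a bilinear Calderón–Zygmund operator if it is bounded from $L^{p_1}(X,d,\mu)\times L^{p_2}(X,d,\mu)$ into $L^p(X,d,\mu)$, where $\frac1p=\frac1{p_1}+\frac1{p_2}$, $1<p,p_1,p_2<\infty$, and there is a Calderón–Zygmund kernel $K$ such that for compactly supported bounded functions $f_1,f_2$, $T(f_1,f_2)(x)=\int_{X^2}K(x,y_1,y_2)f_1(y_1)f_2(y_2)\,d\mu(y_1)d\mu(y_2)$ for a.e. $x\notin\operatorname{supp}f_1\cap\operatorname{supp}f_2$. **Maximal operators.** $T^*(f_1,f_2)(x)=\sup_{\epsilon>0}|T_\epsilon(f_1,f_2)(x)|$, where $T_\epsilon(f_1,f_2)(x)=\int_{d(x,y_1)^2+d(x,y_2)^2>\epsilon^2}K(x,y_1,y_2)f_1(y_1)f_2(y_2)\,d\mu(y_1)d\mu(y_2)$. Further $$\mathscr M(f)(x)=\sup_{r>0}\frac1{\mu(B(x,5r))}\int_{B(x,r)}|f|\,d\mu,\qquad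 M_\lambda(f)(x)=\sup_{r>0}\frac1{\lambda(x,r)}\int_{B(x,r)}|f|\,d\mu.$$ $C_{\eta,\lambda,T}$ denotes a constant depending on $\eta$, $\lambda$ and $T$. Boundedness of $T^*$ into $L^{\frac12,\infty}$ means $\sup_{t>0}t\,\mu(\{T^*(f_1,f_2)>t\})^{2}\le C\|f_1\|_{L^1(X,d,\mu)}\|f_2\|_{L^1(X,d,\mu)}$ with $C$ independent of $f_1,f_2$.
   Formalization: The constant C_{η,λ,T} multiplies the whole right-hand side of the Cotlar inequality, not only its first term (false as printed), and μ is assumed to be a Borel measure inner regular by compact sets (automatic if X is complete). *)

theory Defs
  imports "HOL-Analysis.Analysis"
begin

text \<open>
  The underlying metric space is the whole type \<open>'a\<close>. Theorems below use types of class
  \<^class>\<open>second_countable_topology\<close>; this is no restriction, since a geometrically doubling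
  metric space is separable. It makes the Borel algebra of a product the product of the Borel
  algebras. Balls are open, and functions and kernels are complex-valued.
\<close>

section \<open>The space\<close>

text \<open>
  The inner regularity clause is automatic when the space is complete and balls have finite
  measure, see \<open>metric_measure_spaceI_complete\<close> below. It cannot be dropped altogether: on a
  Bernstein subset of \<open>[0,1]\<close> with the trace of Lebesgue measure every compactly supported function
  vanishes almost everywhere, so the kernel representation of an operator would say nothing.
\<close>

definition metric_measure_space :: "'a::metric_space measure \<Rightarrow> bool" where
  "metric_measure_space M \<longleftrightarrow>
     sets M = sets borel \<and>
     (\<forall>A\<in>sets M. emeasure M A = (SUP K\<in>{K. K \<subseteq> A \<and> compact K}. emeasure M K))"

definition upper_doubling ::
    "'a::metric_space measure \<Rightarrow> ('a \<Rightarrow> real \<Rightarrow> real) \<Rightarrow> bool" where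
  "upper_doubling M lam \<longleftrightarrow>
     (\<forall>x r. r > 0 \<longrightarrow> lam x r > 0 \<and> emeasure M (ball x r) \<le> ennreal (lam x r)) \<and>
     (\<forall>x r s. 0 < r \<longrightarrow> r \<le> s \<longrightarrow> lam x r \<le> lam x s) \<and>
     (\<exists>C>0. \<forall>x r. r > 0 \<longrightarrow> lam x r \<le> C * lam x (r / 2))"

definition geometrically_doubling :: "nat \<Rightarrow> 'a::metric_space itself \<Rightarrow> bool" where
  "geometrically_doubling N _ \<longleftrightarrow>
     (\<forall>(x::'a) r S. r > 0 \<longrightarrow> S \<subseteq> ball x r \<longrightarrow> disjoint_family_on (\<lambda>y. ball y (r / 4)) S
        \<longrightarrow> finite S \<and> card S \<le> N)"

section \<open>Lebesgue spaces\<close>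

definition in_Lp :: "'a measure \<Rightarrow> real \<Rightarrow> ('a \<Rightarrow> complex) \<Rightarrow> bool" where
  "in_Lp M p f \<longleftrightarrow> f \<in> borel_measurable M \<and> integrable M (\<lambda>x. cmod (f x) powr p)"

definition Lp_norm :: "'a measure \<Rightarrow> real \<Rightarrow> ('a \<Rightarrow> complex) \<Rightarrow> real" where
  "Lp_norm M p f = (\<integral>x. cmod (f x) powr p \<partial>M) powr (1 / p)"

definition weak_L_half :: "'a measure \<Rightarrow> ('a \<Rightarrow> ennreal) \<Rightarrow> ennreal" where
  "weak_L_half M F =
     (SUP t\<in>{0<..}. ennreal t * (emeasure M {x \<in> space M. ennreal t < F x})\<^sup>2)"

section \<open>Bilinear Calderon--Zygmund operators\<close>

definition dini_modulus :: "(real \<Rightarrow> real) \<Rightarrow> bool" where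
  "dini_modulus \<omega> \<longleftrightarrow>
     mono_on {0..} \<omega> \<and> (\<forall>s\<ge>0. \<forall>t\<ge>0. \<omega> (s + t) \<le> \<omega> s + \<omega> t) \<and> \<omega> 0 = 0 \<and>
     set_integrable lborel {0<..1} (\<lambda>t. \<omega> t / t)"

text \<open>
  The dominating function is only given for positive radii, whereas one of the two distances in
  the kernel bounds may vanish. We put \<open>\<lambda>(x,0) = 0\<close>. Every other monotone choice leads to the same
  kernels, with \<open>C\<^sub>K\<close> changed by a factor of at most 4.
\<close>

definition kernel_bound ::
    "('a::metric_space \<Rightarrow> real \<Rightarrow> real) \<Rightarrow> 'a \<Rightarrow> 'a \<Rightarrow> 'a \<Rightarrow> real" where
  "kernel_bound lam x y1 y2 =
     (let l = (\<lambda>r. if r > 0 then lam x r else 0)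
      in 1 / (l (dist x y1) + l (dist x y2))\<^sup>2)"

definition diagonal3 :: "('a \<times> 'a \<times> 'a) set" where
  "diagonal3 = {(x, y1, y2). x = y1 \<and> x = y2}"

definition locally_integrable_off_diagonal ::
    "'a::metric_space measure \<Rightarrow> ('a \<Rightarrow> 'a \<Rightarrow> 'a \<Rightarrow> complex) \<Rightarrow> bool" where
  "locally_integrable_off_diagonal M K \<longleftrightarrow>
     set_borel_measurable (M \<Otimes>\<^sub>M M \<Otimes>\<^sub>M M) (- diagonal3) (\<lambda>(x, y1, y2). K x y1 y2) \<and>
     (\<forall>Q. compact Q \<longrightarrow> Q \<inter> diagonal3 = {} \<longrightarrow>
        set_integrable (M \<Otimes>\<^sub>M M \<Otimes>\<^sub>M M) Q (\<lambda>(x, y1, y2). K x y1 y2))"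

definition CZ_kernel ::
    "'a::metric_space measure \<Rightarrow> ('a \<Rightarrow> real \<Rightarrow> real) \<Rightarrow> ('a \<Rightarrow> 'a \<Rightarrow> 'a \<Rightarrow> complex) \<Rightarrow> bool" where
  "CZ_kernel M lam K \<longleftrightarrow>
     locally_integrable_off_diagonal M K \<and>
     (\<exists>CK>0. \<exists>\<omega>. dini_modulus \<omega> \<and>
        (\<forall>x y1 y2. x \<noteq> y1 \<or> x \<noteq> y2 \<longrightarrow>
           cmod (K x y1 y2) \<le> CK * kernel_bound lam x y1 y2 \<and>
           (\<forall>x'. dist x x' \<le> max (dist x y1) (dist x y2) / 2 \<longrightarrow>
              cmod (K x y1 y2 - K x' y1 y2)
                \<le> CK * kernel_bound lam x y1 y2 * \<omega> (dist x x' / (dist x y1 + dist x y2))) \<and>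
           (\<forall>y1'. dist y1 y1' \<le> max (dist x y1) (dist x y2) / 2 \<longrightarrow>
              cmod (K x y1 y2 - K x y1' y2)
                \<le> CK * kernel_bound lam x y1 y2 * \<omega> (dist y1 y1' / (dist x y1 + dist x y2))) \<and>
           (\<forall>y2'. dist y2 y2' \<le> max (dist x y1) (dist x y2) / 2 \<longrightarrow>
              cmod (K x y1 y2 - K x y1 y2')
                \<le> CK * kernel_bound lam x y1 y2 * \<omega> (dist y2 y2' / (dist x y1 + dist x y2)))))"

text \<open>
  Elements of the Lebesgue spaces are represented by functions, so bilinearity is required almost
  everywhere. Together with boundedness it implies that \<open>T f1 f2\<close> depends, up to null sets, only on
  the almost-everywhere classes of \<open>f1\<close> and \<open>f2\<close>.
\<close>

definition bounded_bilinear_Lp ::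
    "'a measure \<Rightarrow> real \<Rightarrow> real \<Rightarrow> real
      \<Rightarrow> (('a \<Rightarrow> complex) \<Rightarrow> ('a \<Rightarrow> complex) \<Rightarrow> 'a \<Rightarrow> complex) \<Rightarrow> bool" where
  "bounded_bilinear_Lp M p1 p2 p T \<longleftrightarrow>
     (\<forall>f g h a b. in_Lp M p1 f \<longrightarrow> in_Lp M p1 g \<longrightarrow> in_Lp M p2 h \<longrightarrow>
        (AE x in M. T (\<lambda>y. a * f y + b * g y) h x = a * T f h x + b * T g h x)) \<and>
     (\<forall>f g h a b. in_Lp M p1 f \<longrightarrow> in_Lp M p2 g \<longrightarrow> in_Lp M p2 h \<longrightarrow>
        (AE x in M. T f (\<lambda>y. a * g y + b * h y) x = a * T f g x + b * T f h x)) \<and>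
     (\<exists>C>0. \<forall>f1 f2. in_Lp M p1 f1 \<longrightarrow> in_Lp M p2 f2 \<longrightarrow>
        in_Lp M p (T f1 f2) \<and> Lp_norm M p (T f1 f2) \<le> C * Lp_norm M p1 f1 * Lp_norm M p2 f2)"

definition supp :: "('a::topological_space \<Rightarrow> complex) \<Rightarrow> 'a set" where
  "supp f = closure {x. f x \<noteq> 0}"

definition bilinear_CZ_operator ::
    "'a::metric_space measure \<Rightarrow> ('a \<Rightarrow> real \<Rightarrow> real) \<Rightarrow> real \<Rightarrow> real \<Rightarrow> real
      \<Rightarrow> ('a \<Rightarrow> 'a \<Rightarrow> 'a \<Rightarrow> complex)
      \<Rightarrow> (('a \<Rightarrow> complex) \<Rightarrow> ('a \<Rightarrow> complex) \<Rightarrow> 'a \<Rightarrow> complex) \<Rightarrow> bool" where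
  "bilinear_CZ_operator M lam p1 p2 p K T \<longleftrightarrow>
     1 < p1 \<and> 1 < p2 \<and> 1 < p \<and> 1 / p = 1 / p1 + 1 / p2 \<and>
     bounded_bilinear_Lp M p1 p2 p T \<and>
     CZ_kernel M lam K \<and>
     (\<forall>f1 f2. f1 \<in> borel_measurable M \<longrightarrow> bounded (range f1) \<longrightarrow> compact (supp f1) \<longrightarrow>
              f2 \<in> borel_measurable M \<longrightarrow> bounded (range f2) \<longrightarrow> compact (supp f2) \<longrightarrow>
        (AE x in M. x \<notin> supp f1 \<inter> supp f2 \<longrightarrow>
           T f1 f2 x = (\<integral>(y1, y2). K x y1 y2 * f1 y1 * f2 y2 \<partial>(M \<Otimes>\<^sub>M M))))"

text \<open>
  \<open>T\<close> is a priori defined on \<open>L\<^sup>p\<^sup>1 \<times> L\<^sup>p\<^sup>2\<close>. On \<open>L\<^sup>1 \<times> L\<^sup>1\<close>, \<open>T f1 f2\<close> means the extension by density: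
  \<open>g\<close> is a value of this extension if it is an almost-everywhere limit of \<open>T\<close> along \<open>L\<^sup>1\<close>-approximations
  of \<open>f1\<close> and \<open>f2\<close> from the domain of \<open>T\<close>.
\<close>

definition L1_extension_value ::
    "'a measure \<Rightarrow> real \<Rightarrow> real \<Rightarrow> (('a \<Rightarrow> complex) \<Rightarrow> ('a \<Rightarrow> complex) \<Rightarrow> 'a \<Rightarrow> complex)
      \<Rightarrow> ('a \<Rightarrow> complex) \<Rightarrow> ('a \<Rightarrow> complex) \<Rightarrow> ('a \<Rightarrow> complex) \<Rightarrow> bool" where
  "L1_extension_value M p1 p2 T f1 f2 g \<longleftrightarrow>
     g \<in> borel_measurable M \<and>
     (\<exists>u v. (\<forall>n::nat. integrable M (u n) \<and> in_Lp M p1 (u n) \<and>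
                      integrable M (v n) \<and> in_Lp M p2 (v n)) \<and>
        (\<lambda>n. \<integral>x. cmod (u n x - f1 x) \<partial>M) \<longlonglongrightarrow> 0 \<and>
        (\<lambda>n. \<integral>x. cmod (v n x - f2 x) \<partial>M) \<longlonglongrightarrow> 0 \<and>
        (AE x in M. (\<lambda>n. T (u n) (v n) x) \<longlonglongrightarrow> g x))"

section \<open>Maximal operators\<close>

definition truncated_operator ::
    "'a::metric_space measure \<Rightarrow> ('a \<Rightarrow> 'a \<Rightarrow> 'a \<Rightarrow> complex) \<Rightarrow> real
      \<Rightarrow> ('a \<Rightarrow> complex) \<Rightarrow> ('a \<Rightarrow> complex) \<Rightarrow> 'a \<Rightarrow> complex" where
  "truncated_operator M K \<epsilon> f1 f2 x =
     set_lebesgue_integral (M \<Otimes>\<^sub>M M) {(y1, y2). (dist x y1)\<^sup>2 + (dist x y2)\<^sup>2 > \<epsilon>\<^sup>2}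
       (\<lambda>(y1, y2). K x y1 y2 * f1 y1 * f2 y2)"

definition maximal_truncation ::
    "'a::metric_space measure \<Rightarrow> ('a \<Rightarrow> 'a \<Rightarrow> 'a \<Rightarrow> complex)
      \<Rightarrow> ('a \<Rightarrow> complex) \<Rightarrow> ('a \<Rightarrow> complex) \<Rightarrow> 'a \<Rightarrow> ennreal" where
  "maximal_truncation M K f1 f2 x =
     (SUP \<epsilon>\<in>{0<..}. ennreal (cmod (truncated_operator M K \<epsilon> f1 f2 x)))"

text \<open>
  In \<^typ>\<open>ennreal\<close>, \<open>0 / 0 = 0\<close>, so balls \<open>B(x,5r)\<close> of measure zero do not contribute.
\<close>

definition maximal_5 ::
    "'a::metric_space measure \<Rightarrow> ('a \<Rightarrow> 'b::real_normed_vector) \<Rightarrow> 'a \<Rightarrow> ennreal" where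
  "maximal_5 M f x =
     (SUP r\<in>{0<..}. (\<integral>\<^sup>+y\<in>ball x r. ennreal (norm (f y)) \<partial>M) / emeasure M (ball x (5 * r)))"

definition maximal_lam ::
    "'a::metric_space measure \<Rightarrow> ('a \<Rightarrow> real \<Rightarrow> real) \<Rightarrow> ('a \<Rightarrow> 'b::real_normed_vector)
      \<Rightarrow> 'a \<Rightarrow> ennreal" where
  "maximal_lam M lam f x =
     (SUP r\<in>{0<..}. (\<integral>\<^sup>+y\<in>ball x r. ennreal (norm (f y)) \<partial>M) / ennreal (lam x r))"

text \<open>Real powers on \<^typ>\<open>ennreal\<close>, for positive exponents only.\<close>

definition ennreal_powr :: "ennreal \<Rightarrow> real \<Rightarrow> ennreal" where
  "ennreal_powr a s = (if a = top then top else ennreal (enn2real a powr s))"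

definition maximal_5_eta ::
    "'a::metric_space measure \<Rightarrow> real \<Rightarrow> ('a \<Rightarrow> 'b::real_normed_vector) \<Rightarrow> 'a \<Rightarrow> ennreal" where
  "maximal_5_eta M \<eta> f x =
     ennreal_powr (maximal_5 M (\<lambda>y. norm (f y) powr \<eta>) x) (1 / \<eta>)"

text \<open>
  The Cotlar-type inequality at \<open>x\<close>, where \<open>g\<close> plays the role of \<open>T f1 f2\<close>. The constant multiplies
  the whole sum: with a constant in front of the first term only, the inequality fails already for the
  bilinear Riesz transform on the real line with Lebesgue measure.
\<close>

definition cotlar_at ::
    "'a::metric_space measure \<Rightarrow> ('a \<Rightarrow> real \<Rightarrow> real) \<Rightarrow> ('a \<Rightarrow> 'a \<Rightarrow> 'a \<Rightarrow> complex) \<Rightarrow> real \<Rightarrow> real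
      \<Rightarrow> ('a \<Rightarrow> complex) \<Rightarrow> ('a \<Rightarrow> complex) \<Rightarrow> ('a \<Rightarrow> complex) \<Rightarrow> 'a \<Rightarrow> bool" where
  "cotlar_at M lam K \<eta> C f1 f2 g x \<longleftrightarrow>
     maximal_truncation M K f1 f2 x
       \<le> ennreal C * (maximal_lam M lam f1 x * maximal_lam M lam f2 x
                      + maximal_5_eta M \<eta> (\<lambda>y. cmod (g y)) x
                      + maximal_5 M f1 x * maximal_5 M f2 x)"

section \<open>Complete spaces\<close>

lemma metric_measure_spaceI_complete:
  fixes M :: "'a::{second_countable_topology, complete_space} measure"
  assumes s: "sets M = sets borel"
    and fin: "\<And>x r. emeasure M (ball x r) < \<infinity>"
  shows "metric_measure_space M"
  unfolding metric_measure_space_def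
proof (intro conjI ballI s)
  fix A assume A: "A \<in> sets M"
  obtain x0 :: 'a where True by simp
  define B where "B n = ball x0 (real n)" for n
  define R where "R n = density M (indicator (B n))" for n
  have B: "B n \<in> sets M" for n by (simp add: s B_def)
  have R: "emeasure (R n) X = emeasure M (B n \<inter> X)" if "X \<in> sets M" for n X
  proof -
    have "emeasure (R n) X = (\<integral>\<^sup>+x. indicator (B n \<inter> X) x \<partial>M)"
      unfolding R_def using that B by (simp add: emeasure_density indicator_inter_arith)
    then show ?thesis using that B by (simp add: nn_integral_indicator sets.Int)
  qed
  have sp: "space M = UNIV" using s sets_eq_imp_space_eq[of M borel] by simp
  have reg: "emeasure (R n) A = (SUP K\<in>{K. K \<subseteq> A \<and> compact K}. emeasure (R n) K)" for n
  proof (rule inner_regular)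
    show "sets (R n) = sets borel" by (simp add: R_def s)
    show "A \<in> sets borel" using A s by simp
    have "emeasure (R n) (space (R n)) = emeasure M (B n)"
      using R[of UNIV n] sets.top[of M] by (simp add: R_def sp)
    then show "emeasure (R n) (space (R n)) \<noteq> \<infinity>" using fin[of x0 n] by (simp add: B_def)
  qed
  have un: "(\<Union>n. B n \<inter> A) = A"
    by (auto simp: B_def mem_ball) (meson reals_Archimedean2)
  have "emeasure M A = (SUP n. emeasure M (B n \<inter> A))"
  proof -
    have "(SUP n. emeasure M (B n \<inter> A)) = emeasure M (\<Union>n. B n \<inter> A)"
      by (rule SUP_emeasure_incseq) (use A B in \<open>auto simp: incseq_def B_def\<close>)
    then show ?thesis by (simp only: un)
  qed
  also have "\<dots> = (SUP n. SUP K\<in>{K. K \<subseteq> A \<and> compact K}. emeasure (R n) K)"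
    using reg R[OF A] by simp
  also have "\<dots> \<le> (SUP K\<in>{K. K \<subseteq> A \<and> compact K}. emeasure M K)"
  proof (intro SUP_least)
    fix n K assume K: "K \<in> {K. K \<subseteq> A \<and> compact K}"
    then have Km: "K \<in> sets M" by (simp add: s borel_compact)
    have "emeasure (R n) K \<le> emeasure M K"
      unfolding R[OF Km] using Km by (intro emeasure_mono) auto
    also have "\<dots> \<le> (SUP K\<in>{K. K \<subseteq> A \<and> compact K}. emeasure M K)"
      using K by (intro SUP_upper)
    finally show "emeasure (R n) K \<le> (SUP K\<in>{K. K \<subseteq> A \<and> compact K}. emeasure M K)" .
  qed
  finally show "emeasure M A = (SUP K\<in>{K. K \<subseteq> A \<and> compact K}. emeasure M K)"
    using A by (intro antisym SUP_least emeasure_mono) auto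
qed

end

theory Submission
  imports Defs
begin

text \<open>
  Weak type of \<open>T\<close>: after normalisation the level sets of the maximal function of
  \<open>h = |f1| + |f2|\<close> form an open set; by inner regularity a compact part of it is covered by
  finitely many balls. Each piece \<open>f 1\<^bsub>E j\<^esub>\<close> is replaced by a multiple of the indicator of a
  set \<open>A j\<close> inside a larger doubling ball, both functions using the same pieces. Changing the
  pieces one by one, from the smallest doubling ball to the largest, writes the error as a sum of terms
  in which one argument is a single bad piece. Far away it is controlled by the regularity of the
  kernel, between the two balls by its size, and close to the larger ball by the boundedness on
  \<open>L\<^sup>p\<close>. Since \<open>\<mu>\<close> need not be doubling, the sets \<open>A j\<close> are chosen by a Carleson-type
  selection that bounds the sum of the substitutes.

  Cotlar's inequality: for given \<open>x\<close> and \<open>\<epsilon>\<close> take the first radius \<open>r = 32\<^sup>k \<epsilon> / 4\<close>, \<open>k \<ge> 1\<close>, whose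
  ball is doubling. The annuli between \<open>\<epsilon>\<close> and \<open>r\<close> contribute a geometric series because the earlier
  balls are not doubling. Beyond \<open>r\<close> the truncation at \<open>x\<close> is compared with \<open>T f1 f2\<close> at the points of
  \<open>ball x r\<close>, and the weak type of \<open>T\<close> makes the local part small at more than half of them.

  The weak type of the maximal truncation follows: off the sets where the maximal functions of
  \<open>f1\<close>, \<open>f2\<close> and of the indicator of a level set of \<open>T f1 f2\<close> are large, the same comparison
  leaves no room for a large truncation.
\<close>

text \<open>Doubling is replaced by one surplus. Over a dilation by 32 = \<open>2 ^ 5\<close> the
  function \<open>L\<close> grows at most by \<open>CL ^ 5\<close>, so a chain of balls whose
  measures grow by more than \<open>2 * CL ^ 5\<close> per dilation gains a factor 2 on
  \<open>L\<close> each time. Such a chain must end, and until then it yields a geometric series.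
  The exponent 5 leaves room for the dilations in use, such as 18 in the packing condition and 10 in
  Cotlar's inequality.

  The bilinear obstacle is that one replacement produces an error that is not estimated by the mass
  of its own piece alone: its substitute interacts with unreplaced pieces close to the point of
  evaluation. With increasing radii these belong to balls whose doubles contain the point, and the
  interactions become summable when the two indices are exchanged and the bound on the sum of all
  substitutes applies.

  Moving the centre of \<open>L\<close> requires values comparable at nearby points, which
  \<open>lam\<close> need not have. The weak type of \<open>T\<close> does not mention
  \<open>lam\<close> and is proved with a smaller comparable function; Cotlar's inequality is proved
  with \<open>lam\<close> itself.\<close>

abbreviation L1_norm :: "'a measure \<Rightarrow> ('a \<Rightarrow> complex) \<Rightarrow> real" where
  "L1_norm M f \<equiv> (\<integral>x. cmod (f x) \<partial>M)"

abbreviation nn_norm :: "'a measure \<Rightarrow> ('a \<Rightarrow> complex) \<Rightarrow> ennreal" where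
  "nn_norm M f \<equiv> (\<integral>\<^sup>+x. ennreal (cmod (f x)) \<partial>M)"

abbreviation ball_norm :: "'a::metric_space measure \<Rightarrow> ('a \<Rightarrow> complex) \<Rightarrow> 'a \<Rightarrow> real \<Rightarrow> ennreal" where
  "ball_norm M f x s \<equiv> (\<integral>\<^sup>+y\<in>ball x s. ennreal (cmod (f y)) \<partial>M)"

section \<open>Coverings in geometrically doubling spaces\<close>

text \<open>A ball of largest radius swallows, after tripling, every ball that meets it. The balls
  disjoint from it form a strictly smaller family, to which the induction applies.\<close>

lemma finite_vitali:
  fixes c :: "'i \<Rightarrow> 'a::metric_space" and r :: "'i \<Rightarrow> real"
  assumes "finite I" and "\<And>i. i \<in> I \<Longrightarrow> 0 < r i"
  shows "\<exists>J\<subseteq>I. disjoint_family_on (\<lambda>i. ball (c i) (r i)) J \<and>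
    (\<Union>i\<in>I. ball (c i) (r i)) \<subseteq> (\<Union>j\<in>J. ball (c j) (3 * r j))"
  using assms
proof (induction I rule: finite_psubset_induct)
  case (psubset I)
  show ?case
  proof (cases "I = {}")
    case False
    have "Max (r ` I) \<in> r ` I" using psubset.hyps False by (intro Max_in) auto
    then obtain m where m: "m \<in> I" "r m = Max (r ` I)" by auto
    have mx: "r i \<le> r m" if "i \<in> I" for i
      using m(2) psubset.hyps that by simp
    define I' where "I' = {i \<in> I. ball (c i) (r i) \<inter> ball (c m) (r m) = {}}"
    have "m \<notin> I'" using psubset.prems[OF m(1)] by (auto simp: I'_def)
    then have "I' \<subset> I" using m(1) unfolding I'_def by blast
    then obtain J where J: "J \<subseteq> I'" "disjoint_family_on (\<lambda>i. ball (c i) (r i)) J"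
      "(\<Union>i\<in>I'. ball (c i) (r i)) \<subseteq> (\<Union>j\<in>J. ball (c j) (3 * r j))"
      using psubset.IH[of I'] psubset.prems by auto
    have "disjoint_family_on (\<lambda>i. ball (c i) (r i)) (insert m J)"
      using J(1,2) unfolding disjoint_family_on_def I'_def by blast
    moreover have "(\<Union>i\<in>I. ball (c i) (r i)) \<subseteq> (\<Union>j\<in>insert m J. ball (c j) (3 * r j))"
    proof
      fix x assume "x \<in> (\<Union>i\<in>I. ball (c i) (r i))"
      then obtain i where i: "i \<in> I" "x \<in> ball (c i) (r i)" by auto
      show "x \<in> (\<Union>j\<in>insert m J. ball (c j) (3 * r j))"
      proof (cases "i \<in> I'")
        case True
        then have "x \<in> (\<Union>i\<in>I'. ball (c i) (r i))" using i(2) by blast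
        then show ?thesis using J(3) by blast
      next
        case False
        then obtain y where y: "dist (c i) y < r i" "dist (c m) y < r m"
          using i(1) by (auto simp: I'_def)
        have "dist (c m) x \<le> dist (c m) y + dist (c i) y + dist (c i) x"
          using dist_triangle[of "c m" x y] dist_triangle[of y x "c i"] by (simp add: dist_commute)
        also have "\<dots> < 3 * r m" using y i(2) mx[OF i(1)] by auto
        finally show ?thesis by auto
      qed
    qed
    ultimately show ?thesis using J(1) m(1) by (intro exI[of _ "insert m J"]) (auto simp: I'_def)
  qed (auto simp: disjoint_family_on_def)
qed

lemma vitali_compact:
  fixes E :: "'a::metric_space set" and r :: "'a \<Rightarrow> real"
  assumes "compact E" and r: "\<And>x. x \<in> E \<Longrightarrow> 0 < r x"
  shows "\<exists>J\<subseteq>E. finite J \<and> disjoint_family_on (\<lambda>x. ball x (r x)) J \<and>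
    E \<subseteq> (\<Union>x\<in>J. ball x (3 * r x))"
proof -
  obtain I where I: "I \<subseteq> E" "finite I" "E \<subseteq> (\<Union>x\<in>I. ball x (r x))"
    using compactE_image[OF assms(1), of E "\<lambda>x. ball x (r x)"] r by (force intro: centre_in_ball[THEN iffD2])
  obtain J where "J \<subseteq> I" "disjoint_family_on (\<lambda>x. ball x (r x)) J"
    "(\<Union>i\<in>I. ball i (r i)) \<subseteq> (\<Union>j\<in>J. ball j (3 * r j))"
    using finite_vitali[of I r "\<lambda>x. x"] I r by blast
  then show ?thesis using I by (intro exI[of _ J]) (auto intro: finite_subset)
qed

text \<open>Each halving of the scale costs one factor \<open>N\<close>: a subfamily separated at
  half the radius has at most \<open>N\<close> members, and if it is maximal, balls around its
  members capture all other centres. Iteration reaches any ratio of radii, as the overlap count for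
  dilated balls requires.\<close>

lemma card_disjoint_balls:
  fixes S :: "'a::metric_space set"
  assumes gd: "geometrically_doubling N TYPE('a)" and d: "0 < \<delta>"
  shows "finite S \<Longrightarrow> S \<subseteq> ball p (2 ^ j * \<delta>) \<Longrightarrow> disjoint_family_on (\<lambda>y. ball y \<delta>) S \<Longrightarrow> card S \<le> N ^ j"
proof (induction j arbitrary: p S)
  case 0
  have "x = y" if "x \<in> S" "y \<in> S" for x y
  proof (rule ccontr)
    assume "x \<noteq> y"
    then have "ball x \<delta> \<inter> ball y \<delta> = {}"
      using 0 that by (auto simp: disjoint_family_on_def)
    moreover have "p \<in> ball x \<delta> \<inter> ball y \<delta>"
      using 0(2) that by (auto simp: dist_commute)
    ultimately show False by auto
  qed
  then have "card S \<le> 1" using 0(1) by (metis One_nat_def card_le_Suc0_iff_eq)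
  then show ?case by simp
next
  case (Suc j)
  define R where "R = 2 ^ j * \<delta>"
  have R: "R > 0" using d by (simp add: R_def)
  \<comment> \<open>Maximality within \<open>F\<close> is what makes the balls of radius
    \<open>R\<close> around \<open>S'\<close> cover \<open>S\<close>; the radius
    \<open>R / 2\<close> is a quarter of \<open>2 * R\<close>, as the hypothesis on the space
    demands.\<close>
  define F where "F = {S'. S' \<subseteq> S \<and> disjoint_family_on (\<lambda>y. ball y (R / 2)) S'}"
  have "finite F" using Suc.prems(1) by (auto simp: F_def)
  moreover have "{} \<in> F" by (auto simp: F_def disjoint_family_on_def)
  ultimately obtain S' where S': "S' \<in> F" and max: "\<And>B. B \<in> F \<Longrightarrow> S' \<subseteq> B \<Longrightarrow> S' = B"
    using finite_has_maximal[of F] by auto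
  have c: "card S' \<le> N"
  proof -
    have "S' \<subseteq> ball p (2 * R)" using S' Suc.prems(2) by (auto simp: F_def R_def mult.assoc)
    moreover have "2 * R / 4 = R / 2" by simp
    ultimately show ?thesis
      using gd[unfolded geometrically_doubling_def, rule_format, of "2 * R" S' p] S' R by (simp add: F_def)
  qed
  have "\<exists>y\<in>S'. x \<in> ball y R" if x: "x \<in> S" for x
  proof (rule ccontr)
    assume neg: "\<not> (\<exists>y\<in>S'. x \<in> ball y R)"
    have "ball x (R / 2) \<inter> ball y (R / 2) = {}" if "y \<in> S'" for y
    proof -
      have "R \<le> dist y x" using neg that by auto
      then have "False" if "dist x z < R / 2" "dist y z < R / 2" for z
        using that dist_triangle2[of y x z] by linarith
      then show ?thesis by auto
    qed
    then have "insert x S' \<in> F"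
      using S' x by (auto simp: F_def disjoint_family_on_def)
    then have "x \<in> S'" using max[of "insert x S'"] by auto
    then show False using neg R by auto
  qed
  then have "S = (\<Union>y\<in>S'. S \<inter> ball y R)" using S' by (auto simp: F_def)
  then have "card S \<le> (\<Sum>y\<in>S'. card (S \<inter> ball y R))"
    using card_UN_le[of S' "\<lambda>y. S \<inter> ball y R"] S' Suc.prems(1) finite_subset by (auto simp: F_def)
  also have "\<dots> \<le> (\<Sum>y\<in>S'. N ^ j)"
    using Suc.prems by (intro sum_mono Suc.IH) (auto simp: R_def disjoint_family_on_def)
  also have "\<dots> \<le> N ^ Suc j" using c by simp
  finally show ?case .
qed

section \<open>Measure-theoretic preliminaries\<close>

text \<open>Slices by dyadic sublevel sets of \<open>v\<close>: quadratic decay of the weight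
  against linear growth of the mass leaves a geometric series with ratio 1/2. With \<open>v\<close>
  a value of the dominating function, this plays the role that a decomposition into annuli plays for
  powers of the distance.\<close>

lemma nn_integral_level_sets:
  fixes u :: "'a \<Rightarrow> ennreal" and v :: "'a \<Rightarrow> real"
  assumes [measurable]: "u \<in> borel_measurable M" "v \<in> borel_measurable M"
    and v: "\<And>y. 0 \<le> v y" and l: "0 < l"
    and lev: "\<And>s. l \<le> s \<Longrightarrow> (\<integral>\<^sup>+y. u y * indicator {y. v y \<le> s} y \<partial>M) \<le> m * ennreal s"
  shows "(\<integral>\<^sup>+y. u y * ennreal (1 / (l + v y)\<^sup>2) \<partial>M) \<le> m * ennreal (8 / l)"
proof -
  define g where "g k y = ennreal (4 / (4 ^ k * l\<^sup>2)) * indicator {y. v y \<le> 2 ^ k * l} y" for k y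
  have [measurable]: "g k \<in> borel_measurable M" for k unfolding g_def by measurable
  have four: "(2 ^ k)\<^sup>2 = (4::real) ^ k" for k :: nat
    by (simp add: power2_eq_square flip: power_mult_distrib)
  have pw: "ennreal (1 / (l + v y)\<^sup>2) \<le> (\<Sum>k. g k y)" for y
  proof -
    obtain k0 :: nat where "v y / l < 2 ^ k0" using real_arch_pow[of 2] by auto
    then have ex: "\<exists>k::nat. v y \<le> 2 ^ k * l" using l by (intro exI[of _ k0]) (simp add: field_simps)
    define k where "k = (LEAST k::nat. v y \<le> 2 ^ k * l)"
    have k: "v y \<le> 2 ^ k * l" unfolding k_def by (rule LeastI_ex[OF ex])
    \<comment> \<open>The least \<open>k\<close> overshoots by at most a factor 2; squaring turns
      this into the constant 4 in \<open>g\<close>.\<close>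
    have "2 ^ k * l \<le> 2 * (l + v y)"
    proof (cases k)
      case (Suc j)
      then have "\<not> v y \<le> 2 ^ j * l" using not_less_Least[of j "\<lambda>k. v y \<le> 2 ^ k * l"] k_def by auto
      then show ?thesis using Suc l by simp
    qed (use l v[of y] in auto)
    then have "(2 ^ k * l)\<^sup>2 \<le> (2 * (l + v y))\<^sup>2" using l by (intro power_mono) auto
    then have "4 ^ k * l\<^sup>2 \<le> 4 * (l + v y)\<^sup>2"
      by (simp only: power_mult_distrib four) simp
    then have "1 / (l + v y)\<^sup>2 \<le> 4 / (4 ^ k * l\<^sup>2)"
      using l v[of y] by (simp add: divide_simps)
    then have "ennreal (1 / (l + v y)\<^sup>2) \<le> g k y"
      using k by (auto simp: g_def intro!: ennreal_leI)
    also have "\<dots> \<le> (\<Sum>k. g k y)"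
      using sum_le_suminf[of "\<lambda>k. g k y" "{k}"] by simp
    finally show ?thesis .
  qed
  have "(\<integral>\<^sup>+y. u y * ennreal (1 / (l + v y)\<^sup>2) \<partial>M) \<le> (\<integral>\<^sup>+y. (\<Sum>k. u y * g k y) \<partial>M)"
    using pw by (intro nn_integral_mono) (auto intro!: mult_left_mono)
  also have "\<dots> = (\<Sum>k. \<integral>\<^sup>+y. u y * g k y \<partial>M)"
    by (rule nn_integral_suminf) measurable
  also have "\<dots> \<le> (\<Sum>k. m * ennreal (4 / l * (1 / 2) ^ k))"
  proof (rule suminf_le)
    fix k
    have "(\<integral>\<^sup>+y. u y * g k y \<partial>M) = (\<integral>\<^sup>+y. ennreal (4 / (4 ^ k * l\<^sup>2)) * (u y * indicator {y. v y \<le> 2 ^ k * l} y) \<partial>M)"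
      by (simp add: g_def ac_simps)
    also have "\<dots> = ennreal (4 / (4 ^ k * l\<^sup>2)) * (\<integral>\<^sup>+y. (u y * indicator {y. v y \<le> 2 ^ k * l} y) \<partial>M)"
      by (rule nn_integral_cmult) measurable
    also have "\<dots> \<le> ennreal (4 / (4 ^ k * l\<^sup>2)) * (m * ennreal (2 ^ k * l))"
      using l by (intro mult_left_mono lev) auto
    also have "\<dots> = m * (ennreal (4 / (4 ^ k * l\<^sup>2)) * ennreal (2 ^ k * l))"
      by (simp add: ac_simps)
    also have "ennreal (4 / (4 ^ k * l\<^sup>2)) * ennreal (2 ^ k * l) = ennreal (4 / l * (1 / 2) ^ k)"
      using l by (subst ennreal_mult[symmetric])
        (auto simp: field_simps power2_eq_square simp flip: power_mult_distrib)
    finally show "(\<integral>\<^sup>+y. u y * g k y \<partial>M) \<le> m * ennreal (4 / l * (1 / 2) ^ k)" .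
  qed auto
  also have "\<dots> = m * (\<Sum>k. ennreal (4 / l * (1 / 2) ^ k))" by simp
  also have "(\<Sum>k. ennreal (4 / l * (1 / 2) ^ k)) = ennreal (4 / l * 2)"
    using l sums_mult[OF power_half_series, of "8 / l"] by (intro suminf_ennreal_eq) (auto intro: sums_cong[THEN iffD1, rotated])
  finally show ?thesis by simp
qed

text \<open>A greedy selection under a packing condition. By Chebyshev, the sum built so far exceeds
  \<open>2 * D\<close> on at most half of the next set. That part is cut away, and what remains
  tolerates one more term of height at most \<open>2 * D\<close>.\<close>

lemma carleson_sets:
  fixes R :: "nat \<Rightarrow> 'a set" and c :: "nat \<Rightarrow> real"
  assumes "\<And>i. i < n \<Longrightarrow> R i \<in> sets M" "\<And>i. i < n \<Longrightarrow> emeasure M (R i) \<noteq> \<infinity>"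
    "\<And>i. i < n \<Longrightarrow> 0 < measure M (R i)" "\<And>i. 0 \<le> c i" "0 < D"
    "\<And>i. i < n \<Longrightarrow> (\<Sum>l | l \<le> i \<and> R l \<inter> R i \<noteq> {}. c l) \<le> D * measure M (R i)"
  shows "\<exists>A. (\<forall>i<n. A i \<subseteq> R i \<and> A i \<in> sets M \<and> measure M (R i) \<le> 2 * measure M (A i)) \<and>
    (\<forall>x. (\<Sum>i<n. c i / measure M (A i) * indicator (A i) x) \<le> 4 * D)"
  using assms
proof (induction n)
  case (Suc n)
  have "\<exists>A. (\<forall>i<n. A i \<subseteq> R i \<and> A i \<in> sets M \<and> measure M (R i) \<le> 2 * measure M (A i)) \<and>
    (\<forall>x. (\<Sum>i<n. c i / measure M (A i) * indicator (A i) x) \<le> 4 * D)"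
    by (rule Suc.IH) (use Suc.prems in \<open>simp_all add: less_SucI\<close>)
  then obtain A where A: "\<And>i. i < n \<Longrightarrow> A i \<subseteq> R i" "\<And>i. i < n \<Longrightarrow> A i \<in> sets M"
      "\<And>i. i < n \<Longrightarrow> measure M (R i) \<le> 2 * measure M (A i)"
      and S4: "\<And>x. (\<Sum>i<n. c i / measure M (A i) * indicator (A i) x) \<le> 4 * D"
    by blast
  define S where "S x = (\<Sum>i<n. c i / measure M (A i) * indicator (A i) x)" for x
  have [measurable]: "S \<in> borel_measurable M"
    unfolding S_def using A(2) by (intro borel_measurable_sum borel_measurable_times borel_measurable_indicator) auto
  have Rn [measurable]: "R n \<in> sets M" and finR: "emeasure M (R n) \<noteq> \<infinity>" and Rpos: "0 < measure M (R n)"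
    using Suc.prems by auto
  have finA: "emeasure M (A i \<inter> R n) \<noteq> \<infinity>" "emeasure M (A i) \<noteq> \<infinity>" if "i < n" for i
    using emeasure_mono[of "A i \<inter> R n" "R n" M] emeasure_mono[of "A i" "R i" M] A(1,2)[OF that] Suc.prems(1,2)[of i] Suc.prems(1,2)[of n] that
    by (auto simp: top_unique)
  have Apos: "0 < measure M (A i)" if "i < n" for i
    using A(3)[OF that] Suc.prems(3)[of i] that by auto
  define B where "B = {x \<in> space M. x \<in> R n \<and> 2 * D < S x}"
  have Bm [measurable]: "B \<in> sets M" unfolding B_def by measurable
  have BR: "B \<subseteq> R n" by (auto simp: B_def)
  have finB: "emeasure M B \<noteq> \<infinity>"
    using emeasure_mono[OF BR Rn] finR by (auto simp: top_unique)
  \<comment> \<open>Chebyshev on \<open>R n\<close>. Terms whose \<open>R i\<close> misses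
    \<open>R n\<close> contribute nothing, which is why the packing condition only has to count sets
    that meet.\<close>
  have "2 * D * measure M B = (\<integral>x. 2 * D * indicator B x \<partial>M)" using Bm finB by simp
  also have "\<dots> \<le> (\<integral>x. (\<Sum>i<n. c i / measure M (A i) * indicator (A i \<inter> R n) x) \<partial>M)"
  proof (rule integral_mono)
    show "integrable M (\<lambda>x. \<Sum>i<n. c i / measure M (A i) * indicator (A i \<inter> R n) x)"
      using A(2) finA Rn by (intro Bochner_Integration.integrable_sum integrable_mult_right integrable_real_indicator)
        (auto simp: less_top)
    show "2 * D * indicator B x \<le> (\<Sum>i<n. c i / measure M (A i) * indicator (A i \<inter> R n) x)" for x
    proof (cases "x \<in> B")
      case True
      then have "S x = (\<Sum>i<n. c i / measure M (A i) * indicator (A i \<inter> R n) x)"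
        unfolding S_def by (intro sum.cong) (auto simp: B_def indicator_def)
      then show ?thesis using True by (auto simp: B_def)
    qed (use Suc.prems(4) in \<open>auto intro!: sum_nonneg divide_nonneg_nonneg mult_nonneg_nonneg\<close>)
  qed (use Bm finB in \<open>auto simp: less_top intro!: integrable_mult_right\<close>)
  also have "\<dots> = (\<Sum>i<n. c i / measure M (A i) * measure M (A i \<inter> R n))"
    using A(2) finA Rn by (subst Bochner_Integration.integral_sum) (auto intro!: integrable_mult_right integrable_real_indicator simp: less_top)
  also have "\<dots> \<le> (\<Sum>i | i \<le> n \<and> R i \<inter> R n \<noteq> {}. c i)"
  proof -
    have "(\<Sum>i<n. c i / measure M (A i) * measure M (A i \<inter> R n)) \<le> (\<Sum>i<n. if R i \<inter> R n \<noteq> {} then c i else 0)"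
    proof (rule sum_mono)
      fix i assume "i \<in> {..<n}"
      then have i: "i < n" by simp
      have le: "measure M (A i \<inter> R n) \<le> measure M (A i)"
        using finA[OF i] A(2)[OF i] by (intro measure_mono_fmeasurable) (auto simp: fmeasurable_def less_top)
      show "c i / measure M (A i) * measure M (A i \<inter> R n) \<le> (if R i \<inter> R n \<noteq> {} then c i else 0)"
      proof (cases "R i \<inter> R n = {}")
        case True
        then have "A i \<inter> R n = {}" using A(1)[OF i] by auto
        then show ?thesis using Suc.prems(4) by simp
      next
        case False
        have "c i / measure M (A i) * measure M (A i \<inter> R n) \<le> c i / measure M (A i) * measure M (A i)"
          using le Suc.prems(4) by (intro mult_left_mono) auto
        then show ?thesis using Apos[OF i] False by simp
      qed
    qed
    also have "\<dots> = (\<Sum>i | i < n \<and> R i \<inter> R n \<noteq> {}. c i)"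
      by (subst sum.inter_filter[symmetric]) auto
    also have "\<dots> \<le> (\<Sum>i | i \<le> n \<and> R i \<inter> R n \<noteq> {}. c i)"
      using Suc.prems(4) by (intro sum_mono2) auto
    finally show ?thesis .
  qed
  also have "\<dots> \<le> D * measure M (R n)" using Suc.prems(6)[of n] by simp
  finally have B2: "2 * measure M B \<le> measure M (R n)" using \<open>0 < D\<close> by simp
  define A' where "A' = A(n := R n - B)"
  have mA: "measure M (R n - B) = measure M (R n) - measure M B"
    using BR finR finB by (intro measure_Diff) (auto simp: less_top)
  have m2: "measure M (R n) \<le> 2 * measure M (A' n)" using B2 mA by (simp add: A'_def)
  \<comment> \<open>The packing condition also counts the index \<open>n\<close> itself, because
    \<open>R n\<close> has positive measure and so is not empty.\<close>
  have cn: "c n \<le> D * measure M (R n)"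
  proof -
    have "c n \<le> (\<Sum>i | i \<le> n \<and> R i \<inter> R n \<noteq> {}. c i)"
      using Rpos Suc.prems(4) by (intro member_le_sum) auto
    then show ?thesis using Suc.prems(6)[of n] by simp
  qed
  have "(\<Sum>i<Suc n. c i / measure M (A' i) * indicator (A' i) x) \<le> 4 * D" for x
  proof -
    have eq: "(\<Sum>i<Suc n. c i / measure M (A' i) * indicator (A' i) x)
        = S x + c n / measure M (A' n) * indicator (A' n) x"
      by (simp add: S_def A'_def)
    show ?thesis
    proof (cases "x \<in> A' n")
      case True
      then have "S x \<le> 2 * D"
        using sets.sets_into_space[OF Rn] by (auto simp: A'_def B_def)
      moreover have "c n / measure M (A' n) \<le> 2 * D"
      proof -
        have "c n \<le> D * (2 * measure M (A' n))"
          using cn m2 \<open>0 < D\<close> by (meson mult_left_mono less_imp_le order_trans)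
        then show ?thesis using m2 Rpos by (simp add: divide_le_eq)
      qed
      ultimately show ?thesis using True unfolding eq by simp
    next
      case False
      then show ?thesis unfolding eq using S4[of x] by (simp add: S_def)
    qed
  qed
  moreover have "\<forall>i<Suc n. A' i \<subseteq> R i \<and> A' i \<in> sets M \<and> measure M (R i) \<le> 2 * measure M (A' i)"
    using A m2 Rn Bm by (auto simp: less_Suc_eq A'_def)
  ultimately show ?case by (intro exI[of _ A']) auto
qed auto

section \<open>Inner regular measures with balls of finite measure\<close>

locale ball_finite_space =
  fixes M :: "'a::{metric_space, second_countable_topology} measure"
  assumes sets_M [measurable_cong]: "sets M = sets borel"
    and inner: "A \<in> sets borel \<Longrightarrow> emeasure M A = (SUP K\<in>{K. K \<subseteq> A \<and> compact K}. emeasure M K)"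
    and fin_ball: "emeasure M (ball x r) < \<infinity>"
begin

lemma space_M [simp]: "space M = UNIV"
  using sets_eq_imp_space_eq[OF sets_M] by simp

sublocale sigma_finite_measure M
proof
  define x0 :: 'a where "x0 = undefined"
  show "\<exists>A. countable A \<and> A \<subseteq> sets M \<and> \<Union>A = space M \<and> (\<forall>a\<in>A. emeasure M a \<noteq> \<infinity>)"
  proof (intro exI[of _ "range (\<lambda>n::nat. ball x0 (real n))"] conjI)
    show "\<Union>(range (\<lambda>n::nat. ball x0 (real n))) = space M"
      by (auto intro: reals_Archimedean2)
    show "\<forall>a\<in>range (\<lambda>n::nat. ball x0 (real n)). emeasure M a \<noteq> \<infinity>"
      using fin_ball by (auto simp: less_top)
  qed (auto simp: sets_M)
qed

sublocale MM: pair_sigma_finite M M ..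

lemma open_sets_M [measurable]: "open S \<Longrightarrow> S \<in> sets M"
  by (simp add: sets_M)

lemma ball_sets_M [measurable, simp]: "ball x r \<in> sets M"
  by (simp add: sets_M)

lemma bounded_finite: "bounded S \<Longrightarrow> S \<in> sets borel \<Longrightarrow> emeasure M S < \<infinity>"
  using bounded_subset_ballD[of S undefined] emeasure_mono[of S _ M] fin_ball
  by (metis borel_open open_ball order.strict_trans1 sets_M)

lemma compact_finite: "compact S \<Longrightarrow> emeasure M S < \<infinity>"
  using bounded_finite compact_imp_bounded borel_compact by blast

lemma emeasure_ball: "emeasure M (ball x r) = ennreal (measure M (ball x r))"
  using fin_ball[of x r] by (simp add: emeasure_eq_ennreal_measure less_top)

lemma inner_le:
  assumes "A \<in> sets borel" and "\<And>K. compact K \<Longrightarrow> K \<subseteq> A \<Longrightarrow> emeasure M K \<le> c"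
  shows "emeasure M A \<le> c"
  unfolding inner[OF assms(1)] by (rule SUP_least) (use assms(2) in auto)

lemma inner_approx:
  assumes "A \<in> sets borel" "emeasure M A < \<infinity>" "0 < e"
  shows "\<exists>K\<subseteq>A. compact K \<and> emeasure M (A - K) < ennreal e"
proof (cases "emeasure M A = 0")
  case True
  then show ?thesis using assms by (intro exI[of _ "{}"]) auto
next
  case False
  obtain a where a: "emeasure M A = ennreal a" "a \<ge> 0" using assms(2) by (cases "emeasure M A") auto
  then have "a > 0" using False by (cases "a = 0") auto
  then have "ennreal (a - e) < emeasure M A" using a assms(3) by (auto intro!: ennreal_lessI)
  then obtain K where K: "K \<subseteq> A" "compact K" "ennreal (a - e) < emeasure M K"
    unfolding inner[OF assms(1)] less_SUP_iff by auto
  have Kb: "K \<in> sets M" using K(2) borel_compact sets_M by auto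
  obtain k where k: "emeasure M K = ennreal k" "k \<ge> 0" using compact_finite[OF K(2)] by (cases "emeasure M K") auto
  have "emeasure M (A - K) = emeasure M A - emeasure M K"
    using K Kb assms compact_finite[OF K(2)] by (intro emeasure_Diff) (auto simp: sets_M)
  also have "\<dots> = ennreal (a - k)" using a k by (simp add: ennreal_minus)
  also have "\<dots> < ennreal e"
    using K(3) k assms(3) by (intro ennreal_lessI) (auto simp: ennreal_less_iff split: if_splits intro: ccontr)
  finally show ?thesis using K by auto
qed

text \<open>Inner approximations with errors below \<open>1 / Suc n\<close> exhaust the set up to a
  null set; finite unions make them increasing.\<close>

lemma compact_exhaustion:
  assumes "A \<in> sets borel" "emeasure M A < \<infinity>"
  shows "\<exists>E :: nat \<Rightarrow> 'a set. (\<forall>n. compact (E n) \<and> E n \<subseteq> A) \<and> incseq E \<and> (AE x in M. x \<in> A \<longrightarrow> (\<exists>n. x \<in> E n))"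
proof -
  have "\<exists>F. \<forall>n::nat. F n \<subseteq> A \<and> compact (F n) \<and> emeasure M (A - F n) < ennreal (1 / Suc n)"
    using inner_approx[OF assms] by (intro choice allI) auto
  then obtain F where F: "\<And>n::nat. F n \<subseteq> A" "\<And>n. compact (F n)" "\<And>n. emeasure M (A - F n) < ennreal (1 / Suc n)"
    by blast
  have Fb: "F n \<in> sets borel" for n using F(2) borel_compact by auto
  define E where "E n = (\<Union>i\<le>n. F i)" for n
  have "emeasure M (A - (\<Union>n. F n)) \<le> ennreal (1 / Suc n)" for n
  proof -
    have "emeasure M (A - (\<Union>n. F n)) \<le> emeasure M (A - F n)"
      using Fb assms by (intro emeasure_mono) (auto simp: sets_M)
    then show ?thesis using F(3)[of n] by simp
  qed
  then have "emeasure M (A - (\<Union>n. F n)) \<le> 0"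
  proof (intro LIMSEQ_le_const[of "\<lambda>n. ennreal (1 / Suc n)"])
    show "(\<lambda>n. ennreal (1 / real (Suc n))) \<longlonglongrightarrow> 0"
      using tendsto_ennrealI[OF LIMSEQ_Suc[OF lim_1_over_n[where 'a=real]]] by simp
  qed auto
  then have "A - (\<Union>n. F n) \<in> null_sets M"
    using Fb assms by (intro null_setsI) (auto simp: sets_M)
  then have "AE x in M. x \<notin> A - (\<Union>n. F n)" by (rule AE_not_in)
  then have "AE x in M. x \<in> A \<longrightarrow> (\<exists>n. x \<in> E n)"
    by eventually_elim (auto simp: E_def)
  then show ?thesis
    using F by (intro exI[of _ E]) (force simp: E_def incseq_def intro!: compact_UN)
qed

text \<open>The kernel representation asks for compact supports, and balls need not be relatively
  compact. A diagonal union over balls of integer radius combines the local exhaustions.\<close>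

lemma compact_exhaustion_UNIV:
  shows "\<exists>E :: nat \<Rightarrow> 'a set. (\<forall>n. compact (E n)) \<and> incseq E \<and> (AE x in M. \<exists>n. x \<in> E n)"
proof -
  define x0 :: 'a where "x0 = undefined"
  have "\<exists>F. \<forall>k::nat. (\<forall>n. compact (F k n)) \<and> incseq (F k) \<and>
      (AE x in M. x \<in> ball x0 (real k) \<longrightarrow> (\<exists>n::nat. x \<in> F k n))"
  proof (rule choice, rule allI)
    fix k :: nat
    show "\<exists>F. (\<forall>n. compact (F n)) \<and> incseq F \<and> (AE x in M. x \<in> ball x0 (real k) \<longrightarrow> (\<exists>n::nat. x \<in> F n))"
      using compact_exhaustion[of "ball x0 (real k)"] fin_ball by auto
  qed
  then obtain F where F: "\<And>k n::nat. compact (F k n)" "\<And>k. incseq (F k)"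
    "\<And>k. AE x in M. x \<in> ball x0 (real k) \<longrightarrow> (\<exists>n::nat. x \<in> F k n)"
    by blast
  define E where "E n = (\<Union>k\<le>n. F k n)" for n
  have "incseq E"
  proof (rule incseq_SucI)
    fix n show "E n \<subseteq> E (Suc n)"
      using F(2) by (fastforce simp: E_def dest: incseq_SucD)
  qed
  moreover have "AE x in M. \<forall>k. x \<in> ball x0 (real k) \<longrightarrow> (\<exists>n::nat. x \<in> F k n)"
    using F(3) by (simp add: AE_all_countable)
  then have "AE x in M. \<exists>n. x \<in> E n"
  proof eventually_elim
    case (elim x)
    obtain k :: nat where "dist x0 x < real k" using reals_Archimedean2 by blast
    then obtain n where "x \<in> F k n" using elim by auto
    then have "x \<in> F k (max k n)" using incseqD[OF F(2)[of k], of n "max k n"] by auto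
    then show ?case by (intro exI[of _ "max k n"]) (auto simp: E_def)
  qed
  ultimately show ?thesis using F(1) by (intro exI[of _ E]) (auto simp: E_def intro!: compact_UN)
qed

section \<open>Stopping sets\<close>

text \<open>A superlevel set of the maximal function that divides by the measure of a dilated ball.
  Multiplying out instead of dividing spares the case of balls of measure zero.\<close>

definition stopping_set :: "real \<Rightarrow> ('a \<Rightarrow> ennreal) \<Rightarrow> ennreal \<Rightarrow> 'a set" where
  "stopping_set k h a =
    {x. \<exists>r>0. a * emeasure M (ball x (k * r)) < (\<integral>\<^sup>+y\<in>ball x r. h y \<partial>M)}"

lemma not_stopping_set:
  "x \<notin> stopping_set k h a \<Longrightarrow> 0 < r \<Longrightarrow> (\<integral>\<^sup>+y\<in>ball x r. h y \<partial>M) \<le> a * emeasure M (ball x (k * r))"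
  unfolding stopping_set_def by (metis (mono_tags, lifting) mem_Collect_eq not_le)

text \<open>By continuity from below the strict inequality survives a small shrinking of the inner
  ball. The shrunken ball fits into a slightly larger ball around any nearby point, whose dilate
  still lies in the old dilate.\<close>

lemma open_stopping_set:
  assumes [measurable]: "h \<in> borel_measurable M" and k: "1 \<le> k"
  shows "open (stopping_set k h a)"
  unfolding open_contains_ball
proof
  fix x assume "x \<in> stopping_set k h a"
  then obtain r where r: "0 < r" "a * emeasure M (ball x (k * r)) < (\<integral>\<^sup>+y\<in>ball x r. h y \<partial>M)"
    by (auto simp: stopping_set_def)
  define B where "B n = ball x (r - r / Suc n)" for n :: nat
  have "(\<Union>n. B n) = ball x r"
  proof (intro equalityI subsetI)
    fix y assume "y \<in> ball x r"
    then have "0 < (r - dist x y) / r" using r by simp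
    then obtain n where n: "inverse (real (Suc n)) < (r - dist x y) / r" using reals_Archimedean by blast
    then have "r / Suc n < r - dist x y"
      unfolding pos_less_divide_eq[OF r(1)] by (simp add: divide_inverse mult.commute)
    then have "y \<in> B n" unfolding B_def mem_ball by linarith
    then show "y \<in> (\<Union>n. B n)" by blast
  next
    fix y assume "y \<in> (\<Union>n. B n)"
    then obtain n where "dist x y < r - r / Suc n" by (auto simp: B_def)
    moreover have "0 < r / Suc n" using r(1) by (intro divide_pos_pos) auto
    ultimately show "y \<in> ball x r" by simp
  qed
  moreover have "incseq B"
    using r(1) by (auto simp: B_def incseq_def intro!: subset_ball diff_left_mono divide_left_mono)
  ultimately have "(SUP n. emeasure (density M h) (B n)) = emeasure (density M h) (ball x r)"
    using SUP_emeasure_incseq[of B "density M h"] unfolding B_def by (simp add: sets_M image_subset_iff)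
  also have "\<dots> = (\<integral>\<^sup>+y\<in>ball x r. h y \<partial>M)" by (simp add: emeasure_density sets_M)
  finally obtain n where n: "a * emeasure M (ball x (k * r)) < emeasure (density M h) (B n)"
    using r(2) by (metis less_SUP_iff)
  define r' where "r' = r - r / Suc n"
  define s where "s = (r + r') / 2"
  have "0 < r / Suc n" using r(1) by (intro divide_pos_pos) auto
  then have "r' < r" unfolding r'_def by linarith
  moreover have "r / Suc n \<le> r / 1" using r(1) by (intro divide_left_mono) auto
  ultimately have rr: "0 \<le> r'" "r' < s" "s < r" by (simp_all add: s_def) (simp add: r'_def)
  have n': "a * emeasure M (ball x (k * r)) < (\<integral>\<^sup>+y\<in>ball x r'. h y \<partial>M)"
    using n by (simp add: B_def r'_def emeasure_density sets_M)
  have "ball x (s - r') \<subseteq> stopping_set k h a"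
  proof
    fix x' assume "x' \<in> ball x (s - r')"
    then have d: "dist x x' < s - r'" by simp
    have "ball x r' \<subseteq> ball x' s"
      using d by (intro subsetI) (simp, smt (verit) dist_commute dist_triangle)
    then have i: "(\<integral>\<^sup>+y\<in>ball x r'. h y \<partial>M) \<le> (\<integral>\<^sup>+y\<in>ball x' s. h y \<partial>M)"
      by (intro nn_integral_mono mult_left_mono) (auto simp: indicator_def)
    \<comment> \<open>Here \<open>1 \<le> k\<close> enters: the gap \<open>r - s\<close> between the
      radii is multiplied by \<open>k\<close> and so still covers the displacement of the
      centre.\<close>
    have "dist x x' + k * s \<le> k * r"
    proof -
      have "dist x x' \<le> 1 * (r - s)" using d by (simp add: s_def field_simps)
      also have "\<dots> \<le> k * (r - s)" using k rr by (intro mult_right_mono) auto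
      finally show ?thesis by (simp add: algebra_simps)
    qed
    then have "ball x' (k * s) \<subseteq> ball x (k * r)"
      by (intro subsetI) (simp, smt (verit) dist_commute dist_triangle)
    then have "a * emeasure M (ball x' (k * s)) \<le> a * emeasure M (ball x (k * r))"
      by (intro mult_left_mono emeasure_mono) (auto simp: sets_M)
    then show "x' \<in> stopping_set k h a"
      unfolding stopping_set_def using i n' rr by (intro CollectI exI[of _ s]) auto
  qed
  then show "\<exists>e>0. ball x e \<subseteq> stopping_set k h a" using rr by (intro exI[of _ "s - r'"]) auto
qed

lemma sum_disjoint_nn_integral_le:
  assumes "finite J" "disjoint_family_on B J" "\<And>i. i \<in> J \<Longrightarrow> B i \<in> sets M"
    and [measurable]: "h \<in> borel_measurable M"
  shows "(\<Sum>i\<in>J. \<integral>\<^sup>+y\<in>B i. h y \<partial>M) \<le> (\<integral>\<^sup>+y. h y \<partial>M)"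
proof -
  have "(\<Sum>i\<in>J. \<integral>\<^sup>+y\<in>B i. h y \<partial>M) = (\<Sum>i\<in>J. emeasure (density M h) (B i))"
    using assms(3) by (intro sum.cong) (auto simp: emeasure_density)
  also have "\<dots> = emeasure (density M h) (\<Union>i\<in>J. B i)"
    using assms by (intro sum_emeasure) auto
  also have "\<dots> \<le> emeasure (density M h) (space M)"
    using assms by (intro emeasure_mono) auto
  finally show ?thesis by (simp add: emeasure_density)
qed

text \<open>The dilation by at least 3 absorbs the Vitali enlargement, so the measure need not be
  doubling. Inner regularity reduces to compact sets, where the covering is finite.\<close>

lemma weak_type_stopping_set:
  assumes h [measurable]: "h \<in> borel_measurable M" and k: "3 \<le> k"
  shows "a * emeasure M (stopping_set k h a) \<le> (\<integral>\<^sup>+y. h y \<partial>M)"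
proof -
  define U where "U = stopping_set k h a"
  have Ub: "U \<in> sets borel" using open_stopping_set[OF h, of k a] k by (simp add: U_def)
  have cpt: "a * emeasure M E \<le> (\<integral>\<^sup>+y. h y \<partial>M)" if E: "compact E" "E \<subseteq> U" for E
  proof -
    have "\<forall>x\<in>E. \<exists>r>0. a * emeasure M (ball x (k * r)) < (\<integral>\<^sup>+y\<in>ball x r. h y \<partial>M)"
      using E by (auto simp: U_def stopping_set_def)
    then obtain r where r: "\<And>x. x \<in> E \<Longrightarrow> 0 < r x"
      "\<And>x. x \<in> E \<Longrightarrow> a * emeasure M (ball x (k * r x)) < (\<integral>\<^sup>+y\<in>ball x (r x). h y \<partial>M)"
      by metis
    obtain J where J: "J \<subseteq> E" "finite J" "disjoint_family_on (\<lambda>x. ball x (r x)) J"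
      "E \<subseteq> (\<Union>x\<in>J. ball x (3 * r x))"
      using vitali_compact[OF E(1), of r] r(1) by blast
    have "emeasure M E \<le> emeasure M (\<Union>x\<in>J. ball x (3 * r x))"
      using J by (intro emeasure_mono) (auto simp: sets_M)
    also have "\<dots> \<le> (\<Sum>x\<in>J. emeasure M (ball x (3 * r x)))"
      using J by (intro emeasure_subadditive_finite) (auto simp: sets_M)
    also have "\<dots> \<le> (\<Sum>x\<in>J. emeasure M (ball x (k * r x)))"
      using J(1) r(1) k by (intro sum_mono emeasure_mono subset_ball mult_right_mono) (auto simp: sets_M less_imp_le)
    finally have "a * emeasure M E \<le> (\<Sum>x\<in>J. a * emeasure M (ball x (k * r x)))"
      by (simp add: mult_left_mono flip: sum_distrib_left)
    also have "\<dots> \<le> (\<Sum>x\<in>J. \<integral>\<^sup>+y\<in>ball x (r x). h y \<partial>M)"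
      using J(1) r(2) by (intro sum_mono) (auto intro: less_imp_le)
    also have "\<dots> \<le> (\<integral>\<^sup>+y. h y \<partial>M)"
      using J by (intro sum_disjoint_nn_integral_le) (auto simp: sets_M)
    finally show ?thesis .
  qed
  have "a * emeasure M U = (SUP K\<in>{K. K \<subseteq> U \<and> compact K}. a * emeasure M K)"
    unfolding inner[OF Ub] by (rule SUP_mult_left_ennreal)
  also have "\<dots> \<le> (\<integral>\<^sup>+y. h y \<partial>M)" using cpt by (intro SUP_least) auto
  finally show ?thesis by (simp add: U_def)
qed

text \<open>Takes the place of Lebesgue's differentiation theorem, at the price of a constant. On a
  compact set where \<open>h\<close> is too large, a cover by balls of one tiny radius has dilates
  of bounded overlap, by geometric doubling, and these dilates stay inside a neighbourhood of less
  than twice the measure.\<close>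

lemma AE_bound_off_stopping_set:
  assumes gd: "geometrically_doubling N TYPE('a)"
    and h [measurable]: "h \<in> borel_measurable M" and k: "1 \<le> k" "3 * k \<le> 2 ^ j" and a: "0 < a" "a \<noteq> \<infinity>"
  shows "AE x in M. x \<notin> stopping_set k h a \<longrightarrow> h x \<le> ennreal (2 * real (N ^ j) + 1) * a"
proof -
  define b where "b = ennreal (2 * real (N ^ j) + 1) * a"
  define U where "U = stopping_set k h a"
  define A where "A = {x \<in> space M. x \<notin> U \<and> b < h x}"
  have U [measurable]: "U \<in> sets M" using open_stopping_set[OF h, of k a] k by (simp add: U_def sets_M)
  have A [measurable]: "A \<in> sets M" unfolding A_def by measurable
  have null: "emeasure M E = 0" if E: "compact E" "E \<subseteq> A" for E
  proof (rule ccontr)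
    assume pos: "emeasure M E \<noteq> 0"
    then have Ene: "E \<noteq> {}" by auto
    have fin: "emeasure M E < \<infinity>" by (rule compact_finite[OF E(1)])
    \<comment> \<open>The factor \<open>3 * k\<close> is the total dilation of the balls of radius
      \<open>1 / Suc n\<close> chosen below, whose dilates therefore remain in
      \<open>V n\<close>.\<close>
    define V where "V n = {x. infdist x E < 3 * k / Suc n}" for n :: nat
    have Vo: "open (V n)" for n
      unfolding V_def by (intro open_Collect_less continuous_intros)
    have Vb: "bounded (V n)" for n
    proof -
      obtain x0 R where R: "\<And>y. y \<in> E \<Longrightarrow> dist x0 y \<le> R" using compact_imp_bounded[OF E(1)] unfolding bounded_def by blast
      have "dist x0 x \<le> R + 3 * k / Suc n" if "x \<in> V n" for x
      proof -
        have "Inf (dist x ` E) < 3 * k / Suc n" using that Ene by (simp add: V_def infdist_notempty)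
        then obtain y where "y \<in> E" "dist x y < 3 * k / Suc n"
          using cInf_lessD[of "dist x ` E"] Ene by blast
        then show ?thesis using R[of y] dist_triangle[of x0 x y] by (auto simp: dist_commute)
      qed
      then show ?thesis unfolding bounded_def by blast
    qed
    have dec: "decseq V"
    proof (rule decseq_SucI)
      fix n
      have "3 * k / real (Suc (Suc n)) \<le> 3 * k / real (Suc n)"
        using k by (intro divide_left_mono) auto
      then show "V (Suc n) \<subseteq> V n" unfolding V_def by auto
    qed
    have int: "(\<Inter>n. V n) = E"
    proof
      show "E \<subseteq> (\<Inter>n. V n)" using k by (auto simp: V_def)
      show "(\<Inter>n. V n) \<subseteq> E"
      proof
        fix x assume x: "x \<in> (\<Inter>n. V n)"
        have "infdist x E \<le> 0"
        proof (rule LIMSEQ_le_const)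
          show "(\<lambda>n. 3 * k * (1 / real (Suc n))) \<longlonglongrightarrow> 0"
            using tendsto_mult_left[OF LIMSEQ_Suc[OF lim_1_over_n[where 'a=real]], of "3 * k"] by simp
          show "\<exists>N. \<forall>n\<ge>N. infdist x E \<le> 3 * k * (1 / real (Suc n))"
            using x by (auto simp: V_def intro: less_imp_le)
        qed
        then have "infdist x E = 0" using infdist_nonneg[of x E] by linarith
        then show "x \<in> E" using in_closed_iff_infdist_zero[OF compact_imp_closed[OF E(1)] Ene] by simp
      qed
    qed
    have "(INF n. emeasure M (V n)) = emeasure M E"
    proof -
      have "emeasure M (V n) \<noteq> \<infinity>" for n
        using bounded_finite[OF Vb, of n] Vo[of n] by (simp add: less_top)
      then show ?thesis
        using INF_emeasure_decseq[of V M] dec Vo int by (simp add: image_subset_iff open_sets_M)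
    qed
    moreover have "emeasure M E < 2 * emeasure M E"
    proof -
      obtain e where "emeasure M E = ennreal e" "0 < e" using pos fin by (cases "emeasure M E") (auto simp: less_le)
      moreover have "2 * ennreal e = ennreal (2 * e)" by (simp add: ennreal_mult')
      ultimately show ?thesis by (simp add: ennreal_lessI)
    qed
    ultimately obtain n where n: "emeasure M (V n) < 2 * emeasure M E"
      by (metis INF_less_iff)
    define d where "d = 1 / real (Suc n)"
    have d: "0 < d" by (simp add: d_def)
    obtain J where J: "J \<subseteq> E" "finite J" "disjoint_family_on (\<lambda>x. ball x d) J" "E \<subseteq> (\<Union>x\<in>J. ball x (3 * d))"
      using vitali_compact[OF E(1), of "\<lambda>_. d"] d by blast
    have Eb [measurable]: "E \<in> sets M" using E(1) by (simp add: sets_M borel_compact)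
    have "b * emeasure M E \<le> b * (\<Sum>x\<in>J. emeasure M (E \<inter> ball x (3 * d)))"
    proof -
      have "emeasure M E = emeasure M (\<Union>x\<in>J. E \<inter> ball x (3 * d))"
        using J(4) by (intro arg_cong[where f = "emeasure M"]) blast
      also have "\<dots> \<le> (\<Sum>x\<in>J. emeasure M (E \<inter> ball x (3 * d)))"
        using J(2) Eb by (intro emeasure_subadditive_finite) (auto simp: sets_M)
      finally show ?thesis by (rule mult_left_mono) simp
    qed
    also have "\<dots> = (\<Sum>x\<in>J. \<integral>\<^sup>+y. b * indicator (E \<inter> ball x (3 * d)) y \<partial>M)"
      unfolding sum_distrib_left by (intro sum.cong refl nn_integral_cmult_indicator[symmetric]) (auto simp: sets_M)
    also have "\<dots> \<le> (\<Sum>x\<in>J. \<integral>\<^sup>+y\<in>ball x (3 * d). h y \<partial>M)"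
      using E(2) by (intro sum_mono nn_integral_mono) (auto simp: indicator_def A_def intro: less_imp_le)
    also have "\<dots> \<le> (\<Sum>x\<in>J. a * emeasure M (ball x (k * (3 * d))))"
      using J(1) E(2) d by (intro sum_mono not_stopping_set) (auto simp: A_def U_def)
    also have "\<dots> = a * (\<integral>\<^sup>+p. (\<Sum>x\<in>J. indicator (ball x (k * (3 * d))) p) \<partial>M)"
      by (subst nn_integral_sum) (auto simp: sum_distrib_left intro!: borel_measurable_indicator)
    also have "\<dots> \<le> a * (\<integral>\<^sup>+p. ennreal (real (N ^ j)) * indicator (V n) p \<partial>M)"
    proof (intro mult_left_mono nn_integral_mono)
      fix p
      define J' where "J' = {x \<in> J. p \<in> ball x (k * (3 * d))}"
      have eq: "(\<Sum>x\<in>J. indicator (ball x (k * (3 * d))) p :: ennreal) = of_nat (card J')"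
        using J(2) by (simp add: indicator_def J'_def sum.If_cases Int_def)
      show "(\<Sum>x\<in>J. indicator (ball x (k * (3 * d))) p) \<le> ennreal (real (N ^ j)) * indicator (V n) p"
      proof (cases "J' = {}")
        case True
        then show ?thesis unfolding eq by simp
      next
        case False
        then obtain x where x: "x \<in> E" "dist x p < k * (3 * d)" using J(1) by (auto simp: J'_def)
        then have "infdist p E < 3 * k * d" using infdist_le[OF x(1), of p] by (auto simp: dist_commute ac_simps)
        then have "p \<in> V n" by (simp add: V_def d_def)
        moreover have "card J' \<le> N ^ j"
        proof (rule card_disjoint_balls[OF gd d])
          show "J' \<subseteq> ball p (2 ^ j * d)"
          proof
            fix x assume "x \<in> J'"
            then have "dist p x < (3 * k) * d" by (simp add: J'_def dist_commute ac_simps)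
            also have "\<dots> \<le> 2 ^ j * d" using k(2) d by (intro mult_right_mono) auto
            finally show "x \<in> ball p (2 ^ j * d)" by simp
          qed
          show "disjoint_family_on (\<lambda>y. ball y d) J'"
            using J(3) by (rule disjoint_family_on_mono[rotated]) (auto simp: J'_def)
        qed (use J(2) in \<open>auto simp: J'_def\<close>)
        then have "(of_nat (card J') :: ennreal) \<le> of_nat (N ^ j)" by (rule of_nat_mono)
        ultimately show ?thesis unfolding eq by (simp add: ennreal_of_nat_eq_real_of_nat)
      qed
    qed auto
    also have "\<dots> = a * (ennreal (real (N ^ j)) * emeasure M (V n))"
      using Vo by (subst nn_integral_cmult_indicator) (auto simp: sets_M)
    also have "\<dots> \<le> a * (ennreal (real (N ^ j)) * (2 * emeasure M E))"
      using n by (intro mult_left_mono) auto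
    finally have *: "b * emeasure M E \<le> a * (ennreal (real (N ^ j)) * (2 * emeasure M E))" .
    obtain e where e: "emeasure M E = ennreal e" "0 < e" using pos fin by (cases "emeasure M E") (auto simp: less_le)
    obtain a' where a': "a = ennreal a'" "0 < a'" using a by (cases a) auto
    have "b * emeasure M E = ennreal ((2 * real (N ^ j) + 1) * a' * e)"
      unfolding b_def e(1) a'(1) using e(2) a'(2) by (simp only: ennreal_mult[symmetric] mult_nonneg_nonneg of_nat_0_le_iff add_nonneg_nonneg zero_le_numeral zero_le_one less_imp_le)
    moreover have "a * (ennreal (real (N ^ j)) * (2 * emeasure M E)) = ennreal (a' * (real (N ^ j) * (2 * e)))"
      unfolding e(1) a'(1) ennreal_numeral[symmetric] using e(2) a'(2) by (simp only: ennreal_mult[symmetric] mult_nonneg_nonneg of_nat_0_le_iff zero_le_numeral less_imp_le)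
    \<comment> \<open>The overlap and the doubled measure produce \<open>2 * real (N ^ j)\<close>;
      the summand 1 in \<open>b\<close> is what yields the contradiction.\<close>
    ultimately have "(2 * real (N ^ j) + 1) * a' * e \<le> a' * (real (N ^ j) * (2 * e))"
      using * e a' by (metis ennreal_le_iff less_imp_le mult_nonneg_nonneg of_nat_0_le_iff zero_le_numeral)
    then have "a' * e \<le> 0" by (simp add: algebra_simps)
    then show False using a'(2) e(2) by (simp add: mult_le_0_iff)
  qed
  have "emeasure M A \<le> 0"
  proof (rule inner_le)
    show "A \<in> sets borel" using A by (simp only: sets_M)
    show "emeasure M E \<le> 0" if "compact E" "E \<subseteq> A" for E using null[OF that] by simp
  qed
  then have "A \<in> null_sets M" using A by (simp add: null_setsI)
  then have "AE x in M. x \<notin> A" by (rule AE_not_in)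
  then show ?thesis by eventually_elim (auto simp: A_def U_def b_def not_less)
qed

end

section \<open>Lebesgue spaces\<close>

lemma in_LpD [dest]:
  "in_Lp M q f \<Longrightarrow> f \<in> borel_measurable M"
  "in_Lp M q f \<Longrightarrow> integrable M (\<lambda>x. cmod (f x) powr q)"
  by (auto simp: in_Lp_def)

lemma in_Lp_mono:
  assumes "in_Lp M q g" "0 \<le> q" and [measurable]: "f \<in> borel_measurable M"
    and "AE x in M. cmod (f x) \<le> cmod (g x)"
  shows "in_Lp M q f" "(\<integral>x. cmod (f x) powr q \<partial>M) \<le> (\<integral>x. cmod (g x) powr q \<partial>M)"
proof -
  have [measurable]: "g \<in> borel_measurable M" using assms(1) by auto
  have le: "AE x in M. cmod (f x) powr q \<le> cmod (g x) powr q"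
    using assms(4) by eventually_elim (use assms(2) in \<open>auto intro: powr_mono2\<close>)
  show "in_Lp M q f"
    unfolding in_Lp_def
    by (intro conjI Bochner_Integration.integrable_bound[OF in_LpD(2)[OF assms(1)]]) (use le in \<open>auto\<close>)
  then show "(\<integral>x. cmod (f x) powr q \<partial>M) \<le> (\<integral>x. cmod (g x) powr q \<partial>M)"
    using assms(1) le by (intro integral_mono_AE) auto
qed

lemma cmod_indicator_mult: "cmod (indicator A x * z) = indicator A x * cmod z"
  by (simp add: indicator_def)

lemma in_Lp_indicator:
  assumes "in_Lp M q f" "0 \<le> q" "A \<in> sets M"
  shows "in_Lp M q (\<lambda>x. indicator A x * f x)"
  using assms by (intro in_Lp_mono(1)[OF assms(1)]) (auto simp: cmod_indicator_mult indicator_def)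

lemma powr_add_le:
  fixes a b q :: real
  assumes "0 \<le> a" "0 \<le> b" "0 \<le> q"
  shows "(a + b) powr q \<le> 2 powr q * (a powr q + b powr q)"
proof -
  have "(a + b) powr q \<le> (2 * max a b) powr q" using assms by (intro powr_mono2) auto
  also have "\<dots> = 2 powr q * max a b powr q" using assms by (simp add: powr_mult)
  also have "\<dots> \<le> 2 powr q * (a powr q + b powr q)"
    by (intro mult_left_mono) (auto simp: max_def)
  finally show ?thesis .
qed

lemma in_Lp_add:
  assumes f: "in_Lp M q f" and g: "in_Lp M q g" and "0 \<le> q"
  shows "in_Lp M q (\<lambda>x. f x + g x)"
    "(\<integral>x. cmod (f x + g x) powr q \<partial>M) \<le> 2 powr q * ((\<integral>x. cmod (f x) powr q \<partial>M) + (\<integral>x. cmod (g x) powr q \<partial>M))"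
proof -
  have [measurable]: "f \<in> borel_measurable M" "g \<in> borel_measurable M" using f g by auto
  have le: "cmod (f x + g x) powr q \<le> 2 powr q * (cmod (f x) powr q + cmod (g x) powr q)" for x
    using powr_add_le[of "cmod (f x)" "cmod (g x)" q] norm_triangle_ineq[of "f x" "g x"] \<open>0 \<le> q\<close>
    by (meson norm_ge_zero order_trans powr_mono2)
  have int: "integrable M (\<lambda>x. 2 powr q * (cmod (f x) powr q + cmod (g x) powr q))"
    using f g by (intro integrable_mult_right Bochner_Integration.integrable_add) auto
  show *: "in_Lp M q (\<lambda>x. f x + g x)"
    unfolding in_Lp_def by (intro conjI Bochner_Integration.integrable_bound[OF int]) (use le in auto)
  have "(\<integral>x. cmod (f x + g x) powr q \<partial>M) \<le> (\<integral>x. 2 powr q * (cmod (f x) powr q + cmod (g x) powr q) \<partial>M)"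
    using le by (intro integral_mono int in_LpD(2)[OF *])
  then show "(\<integral>x. cmod (f x + g x) powr q \<partial>M) \<le> 2 powr q * ((\<integral>x. cmod (f x) powr q \<partial>M) + (\<integral>x. cmod (g x) powr q \<partial>M))"
    using f g by (simp add: in_LpD)
qed

lemma in_Lp_cmult:
  assumes f: "in_Lp M q f"
  shows "in_Lp M q (\<lambda>x. c * f x)" "(\<integral>x. cmod (c * f x) powr q \<partial>M) = cmod c powr q * (\<integral>x. cmod (f x) powr q \<partial>M)"
proof -
  have "(\<lambda>x. cmod (c * f x) powr q) = (\<lambda>x. cmod c powr q * cmod (f x) powr q)"
    by (simp add: norm_mult powr_mult)
  then show "in_Lp M q (\<lambda>x. c * f x)" "(\<integral>x. cmod (c * f x) powr q \<partial>M) = cmod c powr q * (\<integral>x. cmod (f x) powr q \<partial>M)"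
    using f by (auto simp: in_Lp_def)
qed

lemma in_Lp_uminus: "in_Lp M q f \<Longrightarrow> in_Lp M q (\<lambda>x. - f x)"
  using in_Lp_cmult(1)[of M q f "-1"] by simp

lemma in_Lp_diff:
  assumes f: "in_Lp M q f" and g: "in_Lp M q g" and "0 \<le> q"
  shows "in_Lp M q (\<lambda>x. f x - g x)"
  using in_Lp_add(1)[OF f in_Lp_uminus[OF g] \<open>0 \<le> q\<close>] by simp

lemma in_Lp_sum:
  assumes "\<And>i. i \<in> I \<Longrightarrow> in_Lp M q (f i)" "0 < q"
  shows "in_Lp M q (\<lambda>x. \<Sum>i\<in>I. f i x)"
  using assms
proof (induction I rule: infinite_finite_induct)
  case (insert i I)
  then show ?case using in_Lp_add(1)[of M q "f i" "\<lambda>x. \<Sum>i\<in>I. f i x"] by simp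
qed (auto simp: in_Lp_def)

text \<open>Interpolation with the sup norm: of the \<open>q\<close> factors, \<open>q - 1\<close>
  are estimated by \<open>c\<close>.\<close>

lemma in_Lp_bounded:
  assumes f: "integrable M f" and b: "AE x in M. cmod (f x) \<le> c" and q: "1 \<le> q" "0 \<le> c"
  shows "in_Lp M q f" "(\<integral>x. cmod (f x) powr q \<partial>M) \<le> c powr (q - 1) * L1_norm M f"
proof -
  have [measurable]: "f \<in> borel_measurable M" using f by auto
  have le: "AE x in M. cmod (f x) powr q \<le> c powr (q - 1) * cmod (f x)"
    using b
  proof eventually_elim
    case (elim x)
    have "cmod (f x) powr q = cmod (f x) powr (q - 1) * cmod (f x)"
      by (cases "f x = 0") (auto simp: powr_diff)
    then show ?case using elim q by (auto intro!: mult_right_mono powr_mono2)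
  qed
  show *: "in_Lp M q f"
    unfolding in_Lp_def
    by (intro conjI Bochner_Integration.integrable_bound[OF integrable_mult_right[OF integrable_norm[OF f]], of _ "c powr (q - 1)"])
       (use le q in auto)
  have "(\<integral>x. cmod (f x) powr q \<partial>M) \<le> (\<integral>x. c powr (q - 1) * cmod (f x) \<partial>M)"
    using le f by (intro integral_mono_AE in_LpD(2)[OF *]) auto
  then show "(\<integral>x. cmod (f x) powr q \<partial>M) \<le> c powr (q - 1) * L1_norm M f" by simp
qed

text \<open>Pointwise \<open>cmod (f x) \<le> 1 + cmod (f x) powr q\<close>, and the constant is
  integrable over \<open>A\<close>.\<close>

lemma in_Lp_integrable_indicator:
  assumes f: "in_Lp M q f" and q: "1 \<le> q" and A: "A \<in> sets M" "emeasure M A < \<infinity>"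
  shows "integrable M (\<lambda>x. indicator A x * f x)"
proof -
  have [measurable]: "f \<in> borel_measurable M" "A \<in> sets M" using f A by auto
  have le: "cmod (indicator A x * f x) \<le> norm (indicator A x + cmod (f x) powr q)" for x
  proof -
    have "cmod (f x) \<le> 1 + cmod (f x) powr q"
    proof (cases "cmod (f x) \<le> 1")
      case False
      then have "cmod (f x) powr 1 \<le> cmod (f x) powr q" using q by (intro powr_mono) auto
      then show ?thesis using False by simp
    qed (auto intro: add_increasing2)
    then show ?thesis by (auto simp: indicator_def)
  qed
  have "integrable M (\<lambda>x. indicator A x + cmod (f x) powr q)"
    using f A by (intro Bochner_Integration.integrable_add integrable_real_indicator) auto
  then show ?thesis by (rule Bochner_Integration.integrable_bound) (use le in auto)
qed

lemma (in pair_sigma_finite) AE_pairI: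
  assumes P: "AE x in M1. P x" and Q: "AE y in M2. Q y"
  shows "AE w in M1 \<Otimes>\<^sub>M M2. P (fst w) \<and> Q (snd w)"
proof -
  obtain N1 where N1: "\<And>x. x \<in> space M1 - N1 \<Longrightarrow> P x" "N1 \<in> null_sets M1" using AE_E3[OF P] by blast
  obtain N2 where N2: "\<And>x. x \<in> space M2 - N2 \<Longrightarrow> Q x" "N2 \<in> null_sets M2" using AE_E3[OF Q] by blast
  show ?thesis
  proof (rule AE_I')
    show "N1 \<times> space M2 \<union> space M1 \<times> N2 \<in> null_sets (M1 \<Otimes>\<^sub>M M2)"
      using N1(2) N2(2) by (intro null_sets.Un null_setsI) (subst M2.emeasure_pair_measure_Times, auto)+
    show "{x \<in> space (M1 \<Otimes>\<^sub>M M2). \<not> (P (fst x) \<and> Q (snd x))} \<subseteq> N1 \<times> space M2 \<union> space M1 \<times> N2"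
      using N1(1) N2(1) unfolding space_pair_measure by (clarsimp, meson DiffI)
  qed
qed

section \<open>Bilinear operators with a kernel\<close>

text \<open>\<open>T_bound\<close> is the norm inequality raised to the power \<open>p\<close>,
  which keeps roots out of the estimates. \<open>K_diag\<close> reflects a normalisation of the
  kernel that makes it measurable on the whole triple product.\<close>

locale bilinear_operator = ball_finite_space M
  for M :: "'a::{metric_space, second_countable_topology} measure" +
  fixes p1 p2 p CT :: real
    and K :: "'a \<Rightarrow> 'a \<Rightarrow> 'a \<Rightarrow> complex"
    and T :: "('a \<Rightarrow> complex) \<Rightarrow> ('a \<Rightarrow> complex) \<Rightarrow> 'a \<Rightarrow> complex"
  assumes exps: "1 < p1" "1 < p2" "1 < p" "1 / p = 1 / p1 + 1 / p2" and CT: "0 \<le> CT"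
    and T_lin1: "\<And>f g h a b. in_Lp M p1 f \<Longrightarrow> in_Lp M p1 g \<Longrightarrow> in_Lp M p2 h \<Longrightarrow>
        AE x in M. T (\<lambda>y. a * f y + b * g y) h x = a * T f h x + b * T g h x"
    and T_lin2: "\<And>f g h a b. in_Lp M p1 h \<Longrightarrow> in_Lp M p2 f \<Longrightarrow> in_Lp M p2 g \<Longrightarrow>
        AE x in M. T h (\<lambda>y. a * f y + b * g y) x = a * T h f x + b * T h g x"
    and T_Lp: "\<And>f g. in_Lp M p1 f \<Longrightarrow> in_Lp M p2 g \<Longrightarrow> in_Lp M p (T f g)"
    and T_bound: "\<And>f g. in_Lp M p1 f \<Longrightarrow> in_Lp M p2 g \<Longrightarrow> (\<integral>x. cmod (T f g x) powr p \<partial>M) \<le>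
        CT * (\<integral>x. cmod (f x) powr p1 \<partial>M) powr (p / p1) * (\<integral>x. cmod (g x) powr p2 \<partial>M) powr (p / p2)"
    and K_measurable: "(\<lambda>(x, y1, y2). K x y1 y2) \<in> borel_measurable (M \<Otimes>\<^sub>M M \<Otimes>\<^sub>M M)"
    and K_diag: "\<And>x. K x x x = 0"
    and T_kernel: "\<And>f g. f \<in> borel_measurable M \<Longrightarrow> bounded (range f) \<Longrightarrow> compact (supp f) \<Longrightarrow>
        g \<in> borel_measurable M \<Longrightarrow> bounded (range g) \<Longrightarrow> compact (supp g) \<Longrightarrow>
        AE x in M. x \<notin> supp f \<inter> supp g \<longrightarrow> T f g x = (\<integral>(y1, y2). K x y1 y2 * f y1 * g y2 \<partial>(M \<Otimes>\<^sub>M M))"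
begin

lemma exps_nonneg [simp]: "p \<noteq> 0" "0 \<le> p1" "0 \<le> p2" "0 \<le> p" "0 < p1" "0 < p2" "0 < p" "1 \<le> p1" "1 \<le> p2" "1 \<le> p"
  using exps by auto

lemma K_section [measurable]: "(\<lambda>w. K x (fst w) (snd w)) \<in> borel_measurable (M \<Otimes>\<^sub>M M)"
  using measurable_compose[OF measurable_Pair1'[of x M "M \<Otimes>\<^sub>M M"] K_measurable]
  by (simp add: case_prod_beta')

lemma K_section' [measurable]: "(\<lambda>(y1, y2). K x y1 y2) \<in> borel_measurable (M \<Otimes>\<^sub>M M)"
  using K_section[of x] by (simp add: case_prod_beta')

lemma K_measurable' [measurable]:
  assumes [measurable]: "a \<in> measurable N M" "b \<in> measurable N M" "c \<in> measurable N M"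
  shows "(\<lambda>x. K (a x) (b x) (c x)) \<in> borel_measurable N"
proof -
  have "(\<lambda>x. (a x, b x, c x)) \<in> measurable N (M \<Otimes>\<^sub>M M \<Otimes>\<^sub>M M)" by measurable
  from measurable_compose[OF this K_measurable] show ?thesis by simp
qed

lemma T_measurable: "in_Lp M p1 f \<Longrightarrow> in_Lp M p2 g \<Longrightarrow> T f g \<in> borel_measurable M"
  using T_Lp by auto

lemma T_diff1:
  "in_Lp M p1 f \<Longrightarrow> in_Lp M p1 g \<Longrightarrow> in_Lp M p2 h \<Longrightarrow> AE x in M. T (\<lambda>y. f y - g y) h x = T f h x - T g h x"
  using T_lin1[of f g h 1 "-1"] by simp

lemma T_diff2:
  "in_Lp M p1 h \<Longrightarrow> in_Lp M p2 f \<Longrightarrow> in_Lp M p2 g \<Longrightarrow> AE x in M. T h (\<lambda>y. f y - g y) x = T h f x - T h g x"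
  using T_lin2[of h f g 1 "-1"] by simp

lemma T_add1:
  "in_Lp M p1 f \<Longrightarrow> in_Lp M p1 g \<Longrightarrow> in_Lp M p2 h \<Longrightarrow> AE x in M. T (\<lambda>y. f y + g y) h x = T f h x + T g h x"
  using T_lin1[of f g h 1 1] by simp

lemma T_add2:
  "in_Lp M p1 h \<Longrightarrow> in_Lp M p2 f \<Longrightarrow> in_Lp M p2 g \<Longrightarrow> AE x in M. T h (\<lambda>y. f y + g y) x = T h f x + T h g x"
  using T_lin2[of h f g 1 1] by simp

lemma T_cmult1:
  "in_Lp M p1 f \<Longrightarrow> in_Lp M p2 h \<Longrightarrow> AE x in M. T (\<lambda>y. a * f y) h x = a * T f h x"
  using T_lin1[of f f h a 0] by simp

lemma T_cmult2:
  "in_Lp M p1 h \<Longrightarrow> in_Lp M p2 f \<Longrightarrow> AE x in M. T h (\<lambda>y. a * f y) x = a * T h f x"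
  using T_lin2[of h f f a 0] by simp

lemma T_zero:
  assumes "in_Lp M p1 f" "in_Lp M p2 g" and "(AE x in M. f x = 0) \<or> (AE x in M. g x = 0)"
  shows "AE x in M. T f g x = 0"
proof -
  have null: "(\<integral>x. cmod (h x) powr q \<partial>M) = 0" if "AE x in M. h x = 0" for h :: "'a \<Rightarrow> complex" and q
    by (rule integral_eq_zero_AE) (use that in \<open>eventually_elim, simp\<close>)
  have "(\<integral>x. cmod (f x) powr p1 \<partial>M) = 0 \<or> (\<integral>x. cmod (g x) powr p2 \<partial>M) = 0"
    using assms(3) null[of f p1] null[of g p2] by blast
  then have "(\<integral>x. cmod (T f g x) powr p \<partial>M) \<le> 0"
    using T_bound[OF assms(1,2)] by auto
  then have "(\<integral>x. cmod (T f g x) powr p \<partial>M) = 0"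
    by (intro antisym) auto
  then have "AE x in M. cmod (T f g x) powr p = 0"
    using T_Lp[OF assms(1,2)] by (subst (asm) integral_nonneg_eq_0_iff_AE) auto
  then show ?thesis by eventually_elim simp
qed

text \<open>Splits the difference into \<open>T\<close> of \<open>F n - f\<close> and
  \<open>G n\<close>, and \<open>T\<close> of \<open>f\<close> and \<open>G n - g\<close>. The norms
  of \<open>G n\<close> stay bounded since they are controlled by those of \<open>g\<close> and of
  the error.\<close>

lemma T_tendsto:
  assumes F: "\<And>n. in_Lp M p1 (F n)" "in_Lp M p1 f" "(\<lambda>n. \<integral>x. cmod (F n x - f x) powr p1 \<partial>M) \<longlonglongrightarrow> 0"
    and G: "\<And>n. in_Lp M p2 (G n)" "in_Lp M p2 g" "(\<lambda>n. \<integral>x. cmod (G n x - g x) powr p2 \<partial>M) \<longlonglongrightarrow> 0"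
  shows "(\<lambda>n. \<integral>x. cmod (T (F n) (G n) x - T f g x) powr p \<partial>M) \<longlonglongrightarrow> 0"
proof -
  define I where "I q h = (\<integral>x. cmod (h x) powr q \<partial>M)" for q and h :: "'a \<Rightarrow> complex"
  have I0: "0 \<le> I q h" for q h by (simp add: I_def)
  define d e where "d n = I p1 (\<lambda>x. F n x - f x)" and "e n = I p2 (\<lambda>x. G n x - g x)" for n
  define B where "B n = 2 powr p * (CT * d n powr (p / p1) * (2 powr p2 * (e n + I p2 g)) powr (p / p2)
    + CT * I p1 f powr (p / p1) * e n powr (p / p2))" for n
  have dF: "in_Lp M p1 (\<lambda>x. F n x - f x)" and dG: "in_Lp M p2 (\<lambda>x. G n x - g x)" for n
    using F G by (auto intro!: in_Lp_diff)
  have le: "I p (\<lambda>x. T (F n) (G n) x - T f g x) \<le> B n" for n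
  proof -
    have "AE x in M. T (F n) (G n) x - T f g x = T (\<lambda>x. F n x - f x) (G n) x + T f (\<lambda>x. G n x - g x) x"
      using T_diff1[OF F(1,2) G(1), of n n] T_diff2[OF F(2) G(1,2), of n] by eventually_elim simp
    then have "I p (\<lambda>x. T (F n) (G n) x - T f g x) = I p (\<lambda>x. T (\<lambda>x. F n x - f x) (G n) x + T f (\<lambda>x. G n x - g x) x)"
      unfolding I_def
    proof (intro integral_cong_AE)
      have [measurable]: "T (F n) (G n) \<in> borel_measurable M" "T f g \<in> borel_measurable M"
        "T (\<lambda>x. F n x - f x) (G n) \<in> borel_measurable M" "T f (\<lambda>x. G n x - g x) \<in> borel_measurable M"
        using F G dF dG by (auto intro!: T_measurable)
      show "(\<lambda>x. cmod (T (F n) (G n) x - T f g x) powr p) \<in> borel_measurable M"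
        "(\<lambda>x. cmod (T (\<lambda>x. F n x - f x) (G n) x + T f (\<lambda>x. G n x - g x) x) powr p) \<in> borel_measurable M"
        by measurable
    qed (auto elim: eventually_mono)
    also have "\<dots> \<le> 2 powr p * (I p (T (\<lambda>x. F n x - f x) (G n)) + I p (T f (\<lambda>x. G n x - g x)))"
      unfolding I_def using F G dF dG by (intro in_Lp_add T_Lp) auto
    also have "\<dots> \<le> 2 powr p * (CT * d n powr (p / p1) * I p2 (G n) powr (p / p2) + CT * I p1 f powr (p / p1) * e n powr (p / p2))"
      unfolding I_def d_def e_def using F G dF dG by (intro mult_left_mono add_mono T_bound) auto
    also have "\<dots> \<le> B n"
    proof -
      have "I p2 (G n) \<le> 2 powr p2 * (e n + I p2 g)"
        using in_Lp_add(2)[OF dG[of n] G(2)] by (simp add: I_def e_def)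
      then show ?thesis
        unfolding B_def using I0 CT by (intro mult_left_mono add_mono powr_mono2) (auto simp: d_def e_def intro!: mult_nonneg_nonneg)
    qed
    finally show ?thesis .
  qed
  have nn: "0 \<le> d n" "0 \<le> e n" for n by (simp_all add: d_def e_def I0)
  have "d \<longlonglongrightarrow> 0" "e \<longlonglongrightarrow> 0" using F(3) G(3) by (auto simp: d_def[abs_def] e_def[abs_def] I_def)
  then have "B \<longlonglongrightarrow> 2 powr p * (CT * 0 powr (p / p1) * (2 powr p2 * (0 + I p2 g)) powr (p / p2)
    + CT * I p1 f powr (p / p1) * 0 powr (p / p2))"
    unfolding B_def
    by (intro tendsto_intros tendsto_powr2 always_eventually) (auto simp: nn I0 intro!: divide_pos_pos)
  then have "B \<longlonglongrightarrow> 0" by simp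
  then have "(\<lambda>n. I p (\<lambda>x. T (F n) (G n) x - T f g x)) \<longlonglongrightarrow> 0"
    by (rule tendsto_sandwich[rotated 2, OF tendsto_const]) (use le I0 in auto)
  then show ?thesis by (simp add: I_def)
qed

lemma T_tendsto_AE_subseq:
  assumes F: "\<And>n. in_Lp M p1 (F n)" "in_Lp M p1 f" "(\<lambda>n. \<integral>x. cmod (F n x - f x) powr p1 \<partial>M) \<longlonglongrightarrow> 0"
    and G: "\<And>n. in_Lp M p2 (G n)" "in_Lp M p2 g" "(\<lambda>n. \<integral>x. cmod (G n x - g x) powr p2 \<partial>M) \<longlonglongrightarrow> 0"
  shows "\<exists>r. strict_mono r \<and> (AE x in M. (\<lambda>n. T (F (r n)) (G (r n)) x) \<longlonglongrightarrow> T f g x)"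
proof -
  have "\<exists>r. strict_mono r \<and> (AE x in M. (\<lambda>n. cmod (T (F (r n)) (G (r n)) x - T f g x) powr p) \<longlonglongrightarrow> 0)"
    using T_tendsto[OF assms]
    by (intro tendsto_L1_AE_subseq) (auto intro!: in_LpD(2) in_Lp_diff T_Lp F G)
  then obtain r where r: "strict_mono r" "AE x in M. (\<lambda>n. cmod (T (F (r n)) (G (r n)) x - T f g x) powr p) \<longlonglongrightarrow> 0"
    by blast
  from r(2) have "AE x in M. (\<lambda>n. T (F (r n)) (G (r n)) x) \<longlonglongrightarrow> T f g x"
  proof eventually_elim
    case (elim x)
    have "(\<lambda>n. (cmod (T (F (r n)) (G (r n)) x - T f g x) powr p) powr (1 / p)) \<longlonglongrightarrow> 0 powr (1 / p)"
      using elim by (intro tendsto_powr2 tendsto_const) auto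
    then have "(\<lambda>n. cmod (T (F (r n)) (G (r n)) x - T f g x)) \<longlonglongrightarrow> 0"
      by (simp add: powr_powr)
    then show ?case by (simp add: LIM_zero_iff tendsto_norm_zero_iff)
  qed
  with r(1) show ?thesis by blast
qed

lemma truncation_tendsto:
  assumes f: "in_Lp M q f" and q: "0 < q" and E: "\<And>n. E n \<in> sets M" "incseq E" "AE x in M. \<exists>n. x \<in> E n \<or> f x = 0"
  shows "(\<lambda>n. \<integral>x. cmod (indicator (E n \<inter> {x. cmod (f x) \<le> real n}) x * f x - f x) powr q \<partial>M) \<longlonglongrightarrow> 0"
    and "AE x in M. \<forall>\<^sub>F n in sequentially. indicator (E n \<inter> {x. cmod (f x) \<le> real n}) x * f x = f x"
proof -
  note [measurable] = in_LpD(1)[OF f] E(1)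
  show ev: "AE x in M. \<forall>\<^sub>F n in sequentially. indicator (E n \<inter> {x. cmod (f x) \<le> real n}) x * f x = f x"
    using E(3)
  proof eventually_elim
    case (elim x)
    then obtain m where m: "x \<in> E m \<or> f x = 0" by auto
    obtain k :: nat where k: "cmod (f x) \<le> real k" using real_arch_simple by blast
    have "indicator (E n \<inter> {x. cmod (f x) \<le> real n}) x * f x = f x" if "max m k \<le> n" for n
      using m k that incseqD[OF E(2), of m n] by (auto simp: indicator_def)
    then show ?case unfolding eventually_sequentially by blast
  qed
  have "(\<lambda>n. \<integral>x. cmod (indicator (E n \<inter> {x. cmod (f x) \<le> real n}) x * f x - f x) powr q \<partial>M) \<longlonglongrightarrow> (\<integral>x. 0 \<partial>M)"
  proof (rule integral_dominated_convergence[where w = "\<lambda>x. cmod (f x) powr q"])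
    show "AE x in M. (\<lambda>n. cmod (indicator (E n \<inter> {x. cmod (f x) \<le> real n}) x * f x - f x) powr q) \<longlonglongrightarrow> 0"
      using ev by eventually_elim (auto intro!: tendsto_eventually elim: eventually_mono)
    show "AE x in M. norm (cmod (indicator (E n \<inter> {x. cmod (f x) \<le> real n}) x * f x - f x) powr q) \<le> cmod (f x) powr q" for n
      by (auto simp: indicator_def)
  qed (use f in auto)
  then show "(\<lambda>n. \<integral>x. cmod (indicator (E n \<inter> {x. cmod (f x) \<le> real n}) x * f x - f x) powr q \<partial>M) \<longlonglongrightarrow> 0"
    by simp
qed

text \<open>Cutting \<open>f\<close> and \<open>g\<close> to compact sets and bounded values gives
  functions to which \<open>T_kernel\<close> applies. The operator side converges almost everywhere
  along a subsequence, the kernel side by dominated convergence; integrability at \<open>z\<close>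
  supplies the majorant. Openness of \<open>U\<close> keeps \<open>z\<close> off one of the
  supports, which are closures.\<close>

lemma kernel_representation:
  assumes f: "in_Lp M p1 f" and g: "in_Lp M p2 g" and U: "open U"
    and van: "(\<forall>x\<in>U. f x = 0) \<or> (\<forall>x\<in>U. g x = 0)"
  shows "AE z in M. z \<in> U \<longrightarrow> integrable (M \<Otimes>\<^sub>M M) (\<lambda>(y1, y2). K z y1 y2 * f y1 * g y2) \<longrightarrow>
    T f g z = (\<integral>(y1, y2). K z y1 y2 * f y1 * g y2 \<partial>(M \<Otimes>\<^sub>M M))"
proof -
  obtain E where E: "\<And>n::nat. compact (E n)" "incseq E" "AE x in M. \<exists>n. x \<in> E n"
    using compact_exhaustion_UNIV by blast
  have Es [measurable]: "E n \<in> sets M" for n using E(1) by (simp add: sets_M borel_compact)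
  note [measurable] = in_LpD(1)[OF f] in_LpD(1)[OF g]
  define tr where "tr h n x = indicator (E n \<inter> {x. cmod (h x) \<le> real n}) x * h x" for h :: "'a \<Rightarrow> complex" and n x
  have tr_m [measurable]: "tr h n \<in> borel_measurable M" if [measurable]: "h \<in> borel_measurable M" for h n
    unfolding tr_def by measurable
  have tr_le: "cmod (tr h n x) \<le> cmod (h x)" for h n x by (auto simp: tr_def indicator_def)
  have tr_sub: "{x. tr h n x \<noteq> 0} \<subseteq> E n \<inter> {x. h x \<noteq> 0}" for h n by (auto simp: tr_def indicator_def)
  have tr_b: "bounded (range (tr h n))" for h n
    by (intro boundedI[of _ "real n"]) (auto simp: tr_def indicator_def)
  have tr_supp: "supp (tr h n) \<subseteq> E n \<inter> closure {x. h x \<noteq> 0}" for h n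
    unfolding supp_def using tr_sub[of h n] E(1)[of n] closure_mono[of "{x. tr h n x \<noteq> 0}" "{x. h x \<noteq> 0}"]
    by (metis closure_minimal compact_imp_closed le_inf_iff)
  have tr_c: "compact (supp (tr h n))" for h n
    using E(1)[of n] tr_supp[of h n] compact_Int_closed[of "E n" "supp (tr h n)"]
    by (simp add: Int_absorb1 supp_def)
  have trf: "in_Lp M p1 (tr f n)" for n by (rule in_Lp_mono(1)[OF f]) (use tr_le in auto)
  have trg: "in_Lp M p2 (tr g n)" for n by (rule in_Lp_mono(1)[OF g]) (use tr_le in auto)
  have E3: "AE x in M. \<exists>n. x \<in> E n \<or> h x = 0" for h :: "'a \<Rightarrow> complex"
    using E(3) by eventually_elim auto
  note tf = truncation_tendsto[OF f exps_nonneg(5) Es E(2) E3, folded tr_def]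
  note tg = truncation_tendsto[OF g exps_nonneg(6) Es E(2) E3, folded tr_def]
  obtain r where r: "strict_mono r" "AE x in M. (\<lambda>n. T (tr f (r n)) (tr g (r n)) x) \<longlonglongrightarrow> T f g x"
    using T_tendsto_AE_subseq[OF trf f tf(1) trg g tg(1)] by blast
  \<comment> \<open>One null set serves all truncations, so that \<open>z\<close> can be fixed
    before the limit is taken.\<close>
  have "AE z in M. \<forall>n. z \<notin> supp (tr f n) \<inter> supp (tr g n) \<longrightarrow>
      T (tr f n) (tr g n) z = (\<integral>(y1, y2). K z y1 y2 * tr f n y1 * tr g n y2 \<partial>(M \<Otimes>\<^sub>M M))"
    unfolding AE_all_countable using tr_m tr_b tr_c by (intro allI T_kernel) auto
  with r(2) show ?thesis
  proof (eventually_elim, intro impI)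
    case (elim z)
    assume z: "z \<in> U" and int: "integrable (M \<Otimes>\<^sub>M M) (\<lambda>(y1, y2). K z y1 y2 * f y1 * g y2)"
    have "z \<notin> supp (tr f n) \<inter> supp (tr g n)" for n
    proof
      assume "z \<in> supp (tr f n) \<inter> supp (tr g n)"
      then have "z \<in> closure {x. f x \<noteq> 0} \<and> z \<in> closure {x. g x \<noteq> 0}" using tr_supp by blast
      then show False using van z U open_Int_closure_eq_empty[OF U] by blast
    qed
    then have eq: "T (tr f n) (tr g n) z = (\<integral>(y1, y2). K z y1 y2 * tr f n y1 * tr g n y2 \<partial>(M \<Otimes>\<^sub>M M))" for n
      using elim by blast
    have "(\<lambda>n. \<integral>(y1, y2). K z y1 y2 * tr f n y1 * tr g n y2 \<partial>(M \<Otimes>\<^sub>M M))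
        \<longlonglongrightarrow> (\<integral>(y1, y2). K z y1 y2 * f y1 * g y2 \<partial>(M \<Otimes>\<^sub>M M))"
    proof (rule integral_dominated_convergence[where w = "\<lambda>w. norm (case w of (y1, y2) \<Rightarrow> K z y1 y2 * f y1 * g y2)"])
      show "AE w in M \<Otimes>\<^sub>M M. (\<lambda>n. case w of (y1, y2) \<Rightarrow> K z y1 y2 * tr f n y1 * tr g n y2)
          \<longlonglongrightarrow> (case w of (y1, y2) \<Rightarrow> K z y1 y2 * f y1 * g y2)"
        using MM.AE_pairI[OF tf(2) tg(2)]
      proof eventually_elim
        case (elim w)
        then have "\<forall>\<^sub>F n in sequentially. tr f n (fst w) = f (fst w) \<and> tr g n (snd w) = g (snd w)"
          by (simp add: eventually_conj)
        then show ?case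
          by (intro tendsto_eventually) (rule eventually_mono, assumption, simp add: case_prod_beta)
      qed
      show "AE w in M \<Otimes>\<^sub>M M. norm (case w of (y1, y2) \<Rightarrow> K z y1 y2 * tr f n y1 * tr g n y2)
          \<le> norm (case w of (y1, y2) \<Rightarrow> K z y1 y2 * f y1 * g y2)" for n
        using tr_le by (intro AE_I2) (auto simp: norm_mult intro!: mult_mono)
      show "integrable (M \<Otimes>\<^sub>M M) (\<lambda>w. norm (case w of (y1, y2) \<Rightarrow> K z y1 y2 * f y1 * g y2))"
        using int by (rule integrable_norm)
    qed (auto intro!: borel_measurable_integrable[OF int])
    then have "(\<lambda>n. T (tr f (r n)) (tr g (r n)) z) \<longlonglongrightarrow> (\<integral>(y1, y2). K z y1 y2 * f y1 * g y2 \<partial>(M \<Otimes>\<^sub>M M))"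
      using LIMSEQ_subseq_LIMSEQ[OF _ r(1)] by (simp add: eq o_def)
    then show "T f g z = (\<integral>(y1, y2). K z y1 y2 * f y1 * g y2 \<partial>(M \<Otimes>\<^sub>M M))"
      using elim(1) LIMSEQ_unique by blast
  qed
qed

text \<open>Transposition turns an estimate for a bad piece in the first argument into one for the
  second.\<close>

lemma swap: "bilinear_operator M p2 p1 p CT (\<lambda>x y1 y2. K x y2 y1) (\<lambda>f g. T g f)"
proof (intro bilinear_operator.intro bilinear_operator_axioms.intro)
  fix f g :: "'a \<Rightarrow> complex"
  assume f [measurable]: "f \<in> borel_measurable M" "bounded (range f)" "compact (supp f)"
    and g [measurable]: "g \<in> borel_measurable M" "bounded (range g)" "compact (supp g)"
  show "AE x in M. x \<notin> supp f \<inter> supp g \<longrightarrow> T g f x = (\<integral>(y1, y2). K x y2 y1 * f y1 * g y2 \<partial>(M \<Otimes>\<^sub>M M))"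
    using T_kernel[OF g f]
  proof eventually_elim
    case (elim x)
    have "(\<integral>(y1, y2). K x y2 y1 * f y1 * g y2 \<partial>(M \<Otimes>\<^sub>M M))
        = (\<integral>(y1, y2). (\<lambda>(y1, y2). K x y1 y2 * g y1 * f y2) (y2, y1) \<partial>(M \<Otimes>\<^sub>M M))"
      by (simp add: ac_simps)
    also have "\<dots> = (\<integral>(y1, y2). K x y1 y2 * g y1 * f y2 \<partial>(M \<Otimes>\<^sub>M M))"
      by (rule MM.integral_product_swap) measurable
    finally show ?case using elim by auto
  qed
next
  show "(\<lambda>(x, y1, y2). K x y2 y1) \<in> borel_measurable (M \<Otimes>\<^sub>M M \<Otimes>\<^sub>M M)" by measurable
next
  fix f g assume "in_Lp M p2 f" "in_Lp M p1 g"
  then show "(\<integral>x. cmod (T g f x) powr p \<partial>M)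
      \<le> CT * (\<integral>x. cmod (f x) powr p2 \<partial>M) powr (p / p2) * (\<integral>x. cmod (g x) powr p1 \<partial>M) powr (p / p1)"
    using T_bound[of g f] by (simp add: ac_simps)
qed (use ball_finite_space_axioms exps CT T_lin1 T_lin2 T_Lp K_diag in auto)

end

section \<open>Dominating functions\<close>

lemma ennreal_le_suminf: "f k \<le> (\<Sum>k. f k :: ennreal)"
  using sum_le_suminf[of f "{k}"] by simp

locale dominated_space = ball_finite_space M
  for M :: "'a::{metric_space, second_countable_topology} measure" +
  fixes L :: "'a \<Rightarrow> real \<Rightarrow> real" and CL :: real
  assumes L_pos: "0 < r \<Longrightarrow> 0 < L x r"
    and L_ball: "0 < r \<Longrightarrow> measure M (ball x r) \<le> L x r"
    and L_mono: "0 < r \<Longrightarrow> r \<le> s \<Longrightarrow> L x r \<le> L x s"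
    and L_double: "0 < r \<Longrightarrow> L x (2 * r) \<le> CL * L x r"
    and CL: "1 \<le> CL"
begin

abbreviation kb :: "'a \<Rightarrow> 'a \<Rightarrow> 'a \<Rightarrow> ennreal" where
  "kb x y1 y2 \<equiv> ennreal (kernel_bound L x y1 y2)"

text \<open>The value 0 at radius 0 is the convention built into \<open>kernel_bound\<close>. On the
  triple diagonal the denominator vanishes, and division by 0 gives the bound 0 there.\<close>

definition L0 :: "'a \<Rightarrow> real \<Rightarrow> real" where
  "L0 x r = (if r > 0 then L x r else 0)"

lemma L0_nonneg [simp]: "0 \<le> L0 x r"
  using L_pos[of r x] by (auto simp: L0_def less_imp_le)

lemma L0_pos [simp]: "0 < r \<Longrightarrow> L0 x r = L x r"
  by (simp add: L0_def)

lemma L0_measurable [measurable]: "(\<lambda>y. L0 x (dist x y)) \<in> borel_measurable M"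
proof -
  have "mono (L0 x)" using L_mono[of _ _ x] L_pos[of _ x] by (auto simp: mono_def L0_def intro: less_imp_le)
  then have [measurable]: "L0 x \<in> borel_measurable borel" by (rule borel_measurable_mono)
  show ?thesis by measurable
qed

lemma kernel_bound_L0: "kernel_bound L x y1 y2 = 1 / (L0 x (dist x y1) + L0 x (dist x y2))\<^sup>2"
  by (simp add: kernel_bound_def Let_def L0_def)

lemma kernel_bound_measurable [measurable]:
  "(\<lambda>w. kernel_bound L x (fst w) (snd w)) \<in> borel_measurable (M \<Otimes>\<^sub>M M)"
  "(\<lambda>y. kernel_bound L x y y') \<in> borel_measurable M"
  "(\<lambda>y. kernel_bound L x y' y) \<in> borel_measurable M"
proof -
  have [measurable]: "(\<lambda>w. L0 x (dist x (fst w))) \<in> borel_measurable (M \<Otimes>\<^sub>M M)"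
    "(\<lambda>w. L0 x (dist x (snd w))) \<in> borel_measurable (M \<Otimes>\<^sub>M M)"
    using measurable_compose[OF measurable_fst L0_measurable[of x]] measurable_compose[OF measurable_snd L0_measurable[of x]]
    by auto
  show "(\<lambda>w. kernel_bound L x (fst w) (snd w)) \<in> borel_measurable (M \<Otimes>\<^sub>M M)"
    unfolding kernel_bound_L0 by measurable
  show "(\<lambda>y. kernel_bound L x y y') \<in> borel_measurable M" "(\<lambda>y. kernel_bound L x y' y) \<in> borel_measurable M"
    unfolding kernel_bound_L0 by measurable
qed

lemma kernel_bound_nonneg [simp]: "0 \<le> kernel_bound L x y1 y2"
  by (simp add: kernel_bound_L0)

lemma kernel_bound_commute: "kernel_bound L x y1 y2 = kernel_bound L x y2 y1"
  by (simp add: kernel_bound_L0 add.commute)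

lemma L_pow: "0 < r \<Longrightarrow> L x (2 ^ k * r) \<le> CL ^ k * L x r"
proof (induction k)
  case (Suc k)
  have "L x (2 ^ Suc k * r) \<le> CL * L x (2 ^ k * r)"
    using L_double[of "2 ^ k * r" x] Suc.prems by (simp add: mult.assoc)
  also have "\<dots> \<le> CL * (CL ^ k * L x r)" using Suc CL by (intro mult_left_mono) auto
  finally show ?case by (simp add: mult.assoc)
qed simp

lemma emeasure_ball_le: "0 < r \<Longrightarrow> emeasure M (ball x r) \<le> ennreal (L x r)"
  unfolding emeasure_ball by (intro ennreal_leI L_ball)

text \<open>The maximal function with respect to \<open>L\<close> is at most \<open>m\<close> at the
  point \<open>z\<close>, phrased without a supremum or a quotient.\<close>

definition dominated_at :: "('a \<Rightarrow> ennreal) \<Rightarrow> real \<Rightarrow> 'a \<Rightarrow> bool" where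
  "dominated_at u m z \<longleftrightarrow> (\<forall>r>0. (\<integral>\<^sup>+y\<in>ball z r. u y \<partial>M) \<le> ennreal (m * L z r))"

text \<open>Sublevel sets of \<open>L\<close> around \<open>z\<close>, rather than annuli, are the
  right slices: where \<open>L0\<close> is at most \<open>s\<close>, the mass of \<open>u\<close> is
  at most \<open>CL * m * s\<close>, whatever the corresponding radius is.\<close>

lemma size_integral_aux:
  assumes u [measurable]: "u \<in> borel_measurable M" and m: "dominated_at u m z" "0 \<le> m" and d: "0 < d"
  shows "(\<integral>\<^sup>+y. u y * ennreal (1 / (L z d + L0 z (dist z y))\<^sup>2) \<partial>M) \<le> ennreal (8 * CL * m / L z d)"
proof -
  have "(\<integral>\<^sup>+y. u y * indicator {y. L0 z (dist z y) \<le> s} y \<partial>M) \<le> ennreal (CL * m) * ennreal s"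
    if s: "L z d \<le> s" for s
  proof -
    define A where "A = {y. L0 z (dist z y) \<le> s}"
    have A [measurable]: "A \<in> sets M"
    proof -
      have "{y \<in> space M. L0 z (dist z y) \<le> s} \<in> sets M" by measurable
      then show ?thesis by (simp add: A_def)
    qed
    have *: "(\<integral>\<^sup>+y\<in>A \<inter> ball z (real n). u y \<partial>M) \<le> ennreal (CL * m) * ennreal s" for n :: nat
    proof -
      \<comment> \<open>If \<open>L\<close> is bounded, the sublevel set may be the whole space and
        have no largest radius. The restriction \<open>r < real n\<close> makes the supremum finite,
        and \<open>d\<close> makes the set nonempty.\<close>
      define W where "W = insert d {r. 0 < r \<and> r < real n \<and> L z r \<le> s}"
      have W: "W \<noteq> {}" "bdd_above W" by (auto simp: W_def bdd_above_def intro!: exI[of _ "max d (real n)"])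
      have "d \<le> Sup W" using W by (intro cSup_upper) (auto simp: W_def)
      then have "Sup W / 2 < Sup W" using d by auto
      then obtain r where r: "r \<in> W" "Sup W / 2 < r" using W by (metis less_cSup_iff)
      have r0: "0 < r" "L z r \<le> s" using r s d by (auto simp: W_def)
      have "A \<inter> ball z (real n) \<subseteq> ball z (2 * r)"
      proof
        fix y assume y: "y \<in> A \<inter> ball z (real n)"
        show "y \<in> ball z (2 * r)"
        proof (cases "dist z y = 0")
          case False
          then have "dist z y \<in> W" using y by (auto simp: W_def A_def)
          then have "dist z y \<le> Sup W" using W by (intro cSup_upper)
          then show ?thesis using r by simp
        qed (use r0 in auto)
      qed
      then have "(\<integral>\<^sup>+y\<in>A \<inter> ball z (real n). u y \<partial>M) \<le> (\<integral>\<^sup>+y\<in>ball z (2 * r). u y \<partial>M)"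
        by (intro nn_integral_mono) (auto simp: indicator_def)
      also have "\<dots> \<le> ennreal (m * L z (2 * r))"
        using m(1) r0 by (auto simp: dominated_at_def)
      also have "\<dots> \<le> ennreal (m * (CL * s))"
      proof -
        have "L z (2 * r) \<le> CL * s"
          using L_double[OF r0(1), of z] r0(2) CL by (meson mult_left_mono order_trans zero_le_one)
        then show ?thesis using m(2) by (intro ennreal_leI mult_left_mono)
      qed
      also have "\<dots> = ennreal (CL * m) * ennreal s"
        using m(2) CL s L_pos[OF d, of z] by (subst ennreal_mult[symmetric]) (auto simp: ac_simps)
      finally show ?thesis .
    qed
    have "(\<integral>\<^sup>+y\<in>A. u y \<partial>M) = emeasure (density M u) A" by (simp add: emeasure_density)
    also have "\<dots> = emeasure (density M u) (\<Union>n. A \<inter> ball z (real n))"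
      by (rule arg_cong[where f = "emeasure (density M u)"]) (auto intro: reals_Archimedean2)
    also have "\<dots> = (SUP n. emeasure (density M u) (A \<inter> ball z (real n)))"
      by (intro SUP_emeasure_incseq[symmetric]) (auto simp: incseq_def)
    also have "\<dots> \<le> ennreal (CL * m) * ennreal s"
      using * by (intro SUP_least) (simp add: emeasure_density)
    finally show ?thesis unfolding A_def .
  qed
  then have "(\<integral>\<^sup>+y. u y * ennreal (1 / (L z d + L0 z (dist z y))\<^sup>2) \<partial>M) \<le> ennreal (CL * m) * ennreal (8 / L z d)"
    using L_pos[OF d] by (intro nn_integral_level_sets) auto
  also have "\<dots> = ennreal (8 * CL * m / L z d)"
    using CL m(2) L_pos[OF d, of z] by (subst ennreal_mult[symmetric]) auto
  finally show ?thesis .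
qed

lemma size_integral:
  assumes "u \<in> borel_measurable M" and "dominated_at u m z" "0 \<le> m" and "z \<noteq> y1"
  shows "(\<integral>\<^sup>+y2. u y2 * kb z y1 y2 \<partial>M) \<le> ennreal (8 * CL * m / L z (dist z y1))"
  using size_integral_aux[OF assms(1-3), of "dist z y1"] assms(4) by (simp add: kernel_bound_L0)

text \<open>Nothing is known about the position of \<open>y1\<close>. Since \<open>u\<close> lives
  at distance at least \<open>d\<close>, the value \<open>a\<close> of \<open>L\<close> at that
  distance satisfies \<open>L z d + a \<le> 2 * a\<close>; this costs a factor 4 and reduces to the
  previous estimate.\<close>

lemma size_integral_far:
  assumes u [measurable]: "u \<in> borel_measurable M" and "dominated_at u m z" "0 \<le> m" and d: "0 < d"
    and far: "\<And>y. u y \<noteq> 0 \<Longrightarrow> d \<le> dist z y"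
  shows "(\<integral>\<^sup>+y2. u y2 * kb z y1 y2 \<partial>M) \<le> ennreal (32 * CL * m / L z d)"
proof -
  have "(\<integral>\<^sup>+y2. u y2 * kb z y1 y2 \<partial>M)
      \<le> (\<integral>\<^sup>+y. ennreal 4 * (u y * ennreal (1 / (L z d + L0 z (dist z y))\<^sup>2)) \<partial>M)"
  proof (rule nn_integral_mono)
    fix y
    show "u y * kb z y1 y \<le> ennreal 4 * (u y * ennreal (1 / (L z d + L0 z (dist z y))\<^sup>2))"
    proof (cases "u y = 0")
      case False
      define a where "a = L z (dist z y)"
      have dy: "d \<le> dist z y" by (rule far[OF False])
      have a: "0 < L z d" "L z d \<le> a" "L0 z (dist z y) = a"
        using L_pos[OF d, of z] L_mono[OF d dy, of z] less_le_trans[OF d dy] by (auto simp: a_def L0_def)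
      have "kernel_bound L z y1 y \<le> 1 / a\<^sup>2"
        unfolding kernel_bound_L0 a(3) using a by (intro divide_left_mono power_mono mult_pos_pos zero_less_power) (auto intro: add_nonneg_pos)
      also have "\<dots> = 4 / (a + a)\<^sup>2" by (simp add: power2_eq_square)
      also have "\<dots> \<le> 4 / (L z d + a)\<^sup>2"
        using a by (intro divide_left_mono power_mono mult_pos_pos zero_less_power) auto
      finally have "kb z y1 y \<le> ennreal (4 * (1 / (L z d + L0 z (dist z y))\<^sup>2))"
        using a(3) by (intro ennreal_leI) simp
      also have "\<dots> = ennreal 4 * ennreal (1 / (L z d + L0 z (dist z y))\<^sup>2)" by (intro ennreal_mult) auto
      finally show ?thesis by (metis mult.left_commute mult_left_mono zero_le)
    qed simp
  qed
  also have "\<dots> = ennreal 4 * (\<integral>\<^sup>+y. u y * ennreal (1 / (L z d + L0 z (dist z y))\<^sup>2) \<partial>M)"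
    by (rule nn_integral_cmult) measurable
  also have "\<dots> \<le> ennreal 4 * ennreal (8 * CL * m / L z d)"
    by (intro mult_left_mono size_integral_aux assms) auto
  also have "\<dots> = ennreal (32 * CL * m / L z d)"
    using assms(3) CL L_pos[OF d, of z] by (subst ennreal_mult[symmetric]) auto
  finally show ?thesis .
qed

text \<open>If no ball were doubling, measures would grow at least like
  \<open>(2 * CL ^ 5) ^ i\<close>, while \<open>L\<close> grows at most like
  \<open>(CL ^ 5) ^ i\<close>. Taking the least suitable index yields the decay of the earlier
  balls, and \<open>1 \<le> k\<close> makes the chosen radius at least
  \<open>32 * r\<close>.\<close>

lemma doubling_radius:
  assumes r: "0 < r" and pos: "emeasure M UNIV \<noteq> 0"
  shows "\<exists>k\<ge>1. 0 < measure M (ball x (32 ^ k * r)) \<and>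
    measure M (ball x (32 ^ Suc k * r)) \<le> 2 * CL ^ 5 * measure M (ball x (32 ^ k * r)) \<and>
    (\<forall>j. 1 \<le> j \<and> j \<le> k \<longrightarrow> (2 * CL ^ 5) ^ (k - j) * measure M (ball x (32 ^ j * r)) \<le> measure M (ball x (32 ^ k * r)))"
proof -
  define m where "m j = measure M (ball x (32 ^ j * r))" for j :: nat
  define D where "D = CL ^ 5"
  have D: "1 \<le> D" unfolding D_def using CL by (simp add: one_le_power)
  have mm: "m i \<le> m j" if "i \<le> j" for i j
  proof -
    have "ball x (32 ^ i * r) \<subseteq> ball x (32 ^ j * r)"
      using that r by (intro subset_ball mult_right_mono power_increasing) auto
    then show ?thesis unfolding m_def using fin_ball by (intro measure_mono_fmeasurable) (auto simp: fmeasurable_def)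
  qed
  have up: "m j \<le> D ^ j * L x r" for j
  proof -
    have "(32::real) ^ j = 2 ^ (5 * j)" by (simp add: power_mult)
    then have "m j \<le> L x (2 ^ (5 * j) * r)" unfolding m_def using r L_ball[of "2 ^ (5 * j) * r" x] by simp
    also have "\<dots> \<le> CL ^ (5 * j) * L x r" by (rule L_pow[OF r])
    finally show ?thesis by (simp add: D_def power_mult)
  qed
  have "\<exists>j\<ge>1. 0 < m j"
  proof (rule ccontr)
    assume "\<not> (\<exists>j\<ge>1. 0 < m j)"
    then have z: "m j = 0" if "1 \<le> j" for j using that by (metis m_def measure_nonneg order_le_less)
    have "(\<Union>n. ball x (32 ^ Suc n * r)) = UNIV"
    proof -
      have "\<exists>n. dist x y < 32 ^ Suc n * r" for y
      proof -
        obtain n where "dist x y / r < 32 ^ n" using real_arch_pow[of 32] by auto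
        also have "(32::real) ^ n \<le> 32 ^ Suc n" by (intro power_increasing) auto
        finally show ?thesis using r by (intro exI[of _ n]) (simp add: field_simps)
      qed
      then show ?thesis by auto
    qed
    moreover have "emeasure M (\<Union>n. ball x (32 ^ Suc n * r)) = 0"
    proof (rule emeasure_UN_eq_0)
      fix n show "emeasure M (ball x (32 ^ Suc n * r)) = 0"
        using z[of "Suc n"] unfolding emeasure_ball m_def by simp
    qed auto
    ultimately show False using pos by simp
  qed
  then obtain j0 where j0: "1 \<le> j0" "0 < m j0" by blast
  \<comment> \<open>Positivity is asked of the next ball; that of the ball itself follows from the
    doubling inequality. So a ball of measure zero is never chosen.\<close>
  define P where "P k \<longleftrightarrow> 1 \<le> k \<and> 0 < m (Suc k) \<and> m (Suc k) \<le> 2 * D * m k" for k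
  have "\<exists>k. P k"
  proof (rule ccontr)
    assume np: "\<not> (\<exists>k. P k)"
    have "(2 * D) ^ i * m j0 \<le> m (j0 + i)" for i
    proof (induction i)
      case (Suc i)
      have "0 < m (Suc (j0 + i))" using j0 mm[of j0 "Suc (j0 + i)"] by simp
      then have "2 * D * m (j0 + i) \<le> m (Suc (j0 + i))" using np j0(1) by (auto simp: P_def not_le)
      moreover have "2 * D * ((2 * D) ^ i * m j0) \<le> 2 * D * m (j0 + i)"
        using Suc D by (intro mult_left_mono) auto
      ultimately show ?case by (simp add: mult.assoc)
    qed simp
    then have "(2 * D) ^ i * m j0 \<le> D ^ (j0 + i) * L x r" for i using up order_trans by blast
    \<comment> \<open>Cancelling \<open>D ^ i\<close> leaves arbitrarily large powers of 2 below a
      fixed number.\<close>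
    then have "D ^ i * (2 ^ i * m j0) \<le> D ^ i * (D ^ j0 * L x r)" for i
      by (simp add: power_mult_distrib power_add ac_simps)
    then have le: "2 ^ i * m j0 \<le> D ^ j0 * L x r" for i
      using D by (metis mult_le_cancel_left_pos order_less_le_trans zero_less_one zero_less_power)
    obtain i where "D ^ j0 * L x r / m j0 < 2 ^ i" using real_arch_pow[of 2] by auto
    then show False using le[of i] j0(2) by (simp add: field_simps)
  qed
  then obtain k0 where "P k0" by blast
  define k where "k = (LEAST k. P k)"
  have Pk: "P k" unfolding k_def by (rule LeastI[of P, OF \<open>P k0\<close>])
  have step: "2 * D * m j \<le> m (Suc j)" if "1 \<le> j" "j < k" for j
  proof (cases "m (Suc j) = 0")
    case True
    then have "m j = 0" using mm[of j "Suc j"] by (simp add: m_def antisym)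
    then show ?thesis by (simp add: m_def)
  next
    case False
    then have "0 < m (Suc j)" by (simp add: m_def less_le)
    then show ?thesis using not_less_Least[of j P] that by (auto simp: k_def P_def)
  qed
  have "(2 * D) ^ i * m (k - i) \<le> m k" if "i < k" for i
    using that
  proof (induction i)
    case (Suc i)
    have "2 * D * m (k - Suc i) \<le> m (k - i)" using step[of "k - Suc i"] Suc.prems by (simp add: Suc_diff_Suc)
    then have "(2 * D) ^ i * (2 * D * m (k - Suc i)) \<le> (2 * D) ^ i * m (k - i)"
      using D by (intro mult_left_mono) auto
    also have "\<dots> \<le> m k" using Suc by simp
    finally show ?case by (simp add: ac_simps)
  qed simp
  then have "(2 * D) ^ (k - j) * m j \<le> m k" if "1 \<le> j" "j \<le> k" for j
  proof -
    have "k - j < k" "k - (k - j) = j" using that by auto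
    then show ?thesis using \<open>\<And>i. i < k \<Longrightarrow> (2 * D) ^ i * m (k - i) \<le> m k\<close>[of "k - j"] by simp
  qed
  moreover have "0 < m k"
  proof -
    have "0 < 2 * D * m k" using Pk by (simp add: P_def)
    then show ?thesis using D by (simp add: zero_less_mult_iff)
  qed
  ultimately show ?thesis using Pk unfolding m_def D_def P_def by (intro exI[of _ k]) auto
qed

text \<open>A step function that majorises \<open>1 / L x (dist x z)\<close> for distances between
  \<open>r\<close> and \<open>32 ^ Suc k * r\<close>. The coarse ratio 32 matches the radii of
  \<open>doubling_radius\<close>.\<close>

definition near_sum :: "'a \<Rightarrow> real \<Rightarrow> nat \<Rightarrow> 'a \<Rightarrow> ennreal" where
  "near_sum x r k z = (\<Sum>j\<le>k. ennreal (1 / L x (32 ^ j * r)) * indicator (ball x (32 ^ Suc j * r)) z)"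

text \<open>The dyadic majorant of the regularity bound at distances from \<open>2 * \<rho>\<close>
  on, with exactly the weights that the Dini condition sums.\<close>

definition far_sum :: "(real \<Rightarrow> real) \<Rightarrow> 'a \<Rightarrow> real \<Rightarrow> 'a \<Rightarrow> ennreal" where
  "far_sum \<omega> x \<rho> z = (\<Sum>k. ennreal (\<omega> ((1 / 2) ^ Suc k) / L x (2 ^ Suc k * \<rho>)) * indicator (ball x (2 ^ Suc (Suc k) * \<rho>)) z)"

lemma near_sum_measurable [measurable]: "near_sum x r k \<in> borel_measurable M"
  unfolding near_sum_def by measurable

lemma far_sum_measurable [measurable]: "far_sum \<omega> x r \<in> borel_measurable M"
  unfolding far_sum_def by measurable

lemma near_sum_ge:
  assumes "0 < r" "r \<le> dist x z" "dist x z < 32 ^ Suc k * r"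
  shows "ennreal (1 / L x (dist x z)) \<le> near_sum x r k z"
proof -
  have ex: "dist x z < 32 ^ Suc k * r" using assms by simp
  define j where "j = (LEAST j. dist x z < 32 ^ Suc j * r)"
  have j: "dist x z < 32 ^ Suc j * r" unfolding j_def by (rule LeastI[of _ k]) (rule ex)
  have jk: "j \<le> k" unfolding j_def by (rule Least_le) (rule ex)
  have le: "32 ^ j * r \<le> dist x z"
  proof (cases j)
    case (Suc i)
    then show ?thesis using not_less_Least[of i "\<lambda>j. dist x z < 32 ^ Suc j * r"] by (simp add: j_def)
  qed (use assms in simp)
  have "1 / L x (dist x z) \<le> 1 / L x (32 ^ j * r)"
    using assms(1) le L_pos[of "32 ^ j * r" x] L_mono[OF _ le, of x] by (intro divide_left_mono mult_pos_pos) auto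
  then have "ennreal (1 / L x (dist x z)) \<le> ennreal (1 / L x (32 ^ j * r)) * indicator (ball x (32 ^ Suc j * r)) z"
    using j by (simp add: ennreal_leI)
  also have "\<dots> \<le> near_sum x r k z"
    unfolding near_sum_def using jk by (intro member_le_sum[of j "{..k}" "\<lambda>j. ennreal (1 / L x (32 ^ j * r)) * indicator (ball x (32 ^ Suc j * r)) z"]) auto
  finally show ?thesis .
qed

text \<open>The number of layers is not bounded, so a uniform bound per layer is not enough. The
  failure of doubling at the earlier balls gives a factor 1/2 per layer, counted backwards from the
  last one.\<close>

lemma near_sum_integral:
  assumes r: "0 < r" and k: "1 \<le> k"
    "measure M (ball x (32 ^ Suc k * r)) \<le> 2 * CL ^ 5 * measure M (ball x (32 ^ k * r))"
    "\<And>j. 1 \<le> j \<Longrightarrow> j \<le> k \<Longrightarrow> (2 * CL ^ 5) ^ (k - j) * measure M (ball x (32 ^ j * r)) \<le> measure M (ball x (32 ^ k * r))"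
  shows "(\<integral>\<^sup>+z. near_sum x r k z \<partial>M) \<le> ennreal (4 * CL ^ 5)"
proof -
  define m where "m j = measure M (ball x (32 ^ j * r))" for j :: nat
  define D where "D = CL ^ 5"
  have D: "1 \<le> D" unfolding D_def using CL by (simp add: one_le_power)
  have Lp: "0 < L x (32 ^ j * r)" for j using r by (intro L_pos) auto
  have LL: "L x (32 ^ (j + i) * r) \<le> D ^ i * L x (32 ^ j * r)" for i j
  proof -
    have "(32::real) ^ (j + i) * r = 2 ^ (5 * i) * (32 ^ j * r)" by (simp add: power_mult power_add)
    then show ?thesis using L_pow[of "32 ^ j * r" x "5 * i"] r by (simp add: D_def power_mult mult.assoc)
  qed
  \<comment> \<open>The last layer uses doubling at \<open>k\<close> itself. For the others the
    decay starts at index \<open>Suc j\<close> while \<open>L\<close> is taken at \<open>j\<close>;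
    this shift leaves one factor \<open>D\<close>.\<close>
  have tm: "m (Suc j) / L x (32 ^ j * r) \<le> 2 * D * (1 / 2) ^ (k - j)" if j: "j \<le> k" for j
  proof (cases "j = k")
    case True
    have "m (Suc k) \<le> 2 * D * m k" using k(2) by (simp add: m_def D_def)
    also have "\<dots> \<le> 2 * D * L x (32 ^ k * r)"
      unfolding m_def using D r by (intro mult_left_mono L_ball) auto
    finally show ?thesis using True Lp[of k] by (simp add: field_simps)
  next
    case False
    define i where "i = k - Suc j"
    have i: "k = Suc j + i" "k - j = Suc i" using False j by (auto simp: i_def)
    have "(2 * D) ^ i * m (Suc j) \<le> m k" using k(3)[of "Suc j"] i by (simp add: m_def D_def)
    also have "m k \<le> L x (32 ^ k * r)" unfolding m_def using r by (intro L_ball) auto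
    also have "\<dots> \<le> D ^ Suc i * L x (32 ^ j * r)" using LL[of j "Suc i"] i by simp
    finally have "D ^ i * (2 ^ i * m (Suc j)) \<le> D ^ i * (D * L x (32 ^ j * r))"
      by (simp add: power_mult_distrib ac_simps)
    then have "2 ^ i * m (Suc j) \<le> D * L x (32 ^ j * r)"
      using D by (metis mult_le_cancel_left_pos order_less_le_trans zero_less_one zero_less_power)
    then show ?thesis using Lp[of j] i(2) by (simp add: field_simps power_one_over)
  qed
  have "(\<integral>\<^sup>+z. near_sum x r k z \<partial>M) = (\<Sum>j\<le>k. ennreal (1 / L x (32 ^ j * r)) * emeasure M (ball x (32 ^ Suc j * r)))"
    unfolding near_sum_def by (subst nn_integral_sum) (auto simp: nn_integral_cmult_indicator)
  also have "\<dots> = (\<Sum>j\<le>k. ennreal (m (Suc j) / L x (32 ^ j * r)))"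
    using Lp unfolding emeasure_ball by (intro sum.cong refl) (subst ennreal_mult[symmetric], auto simp: m_def less_imp_le)
  also have "\<dots> = ennreal (\<Sum>j\<le>k. m (Suc j) / L x (32 ^ j * r))"
    using Lp by (intro sum_ennreal) (auto simp: m_def less_imp_le)
  also have "\<dots> \<le> ennreal (\<Sum>j\<le>k. 2 * D * (1 / 2) ^ (k - j))"
    using tm by (intro ennreal_leI sum_mono) auto
  also have "(\<Sum>j\<le>k. 2 * D * (1 / 2) ^ (k - j)) = 2 * D * (\<Sum>j\<le>k. (1 / 2) ^ j)"
    unfolding sum_distrib_left by (rule sum.nat_diff_reindex[of "\<lambda>i. 2 * D * (1 / 2) ^ i" "Suc k", simplified lessThan_Suc_atMost, simplified])
  also have "\<dots> \<le> 2 * D * 2"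
  proof -
    have "(\<Sum>j\<le>k. (1 / 2 :: real) ^ j) = 2 - (1 / 2) ^ k"
      by (induction k) (auto simp: field_simps)
    then show ?thesis using D by (intro mult_left_mono) auto
  qed
  finally show ?thesis by (simp add: D_def ennreal_leI)
qed

lemma far_sum_ge:
  assumes \<omega>: "mono_on {0..} \<omega>" "\<omega> 0 = 0" and \<rho>: "0 < \<rho>" and d: "2 * \<rho> \<le> dist x z"
  shows "ennreal (\<omega> (\<rho> / dist x z) / L x (dist x z)) \<le> far_sum \<omega> x \<rho> z"
proof -
  obtain k0 where "dist x z / \<rho> < 2 ^ k0" using real_arch_pow[of 2] by auto
  then have k0: "dist x z < 2 ^ Suc (Suc k0) * \<rho>"
  proof -
    have "dist x z < 2 ^ k0 * \<rho>" using \<open>dist x z / \<rho> < 2 ^ k0\<close> \<rho> by (simp add: field_simps)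
    also have "\<dots> \<le> 2 ^ Suc (Suc k0) * \<rho>" using \<rho> by (intro mult_right_mono power_increasing) auto
    finally show ?thesis .
  qed
  define k where "k = (LEAST k. dist x z < 2 ^ Suc (Suc k) * \<rho>)"
  have k: "dist x z < 2 ^ Suc (Suc k) * \<rho>" unfolding k_def by (rule LeastI[of _ k0]) (rule k0)
  have le: "2 ^ Suc k * \<rho> \<le> dist x z"
  proof (cases k)
    case (Suc i)
    then show ?thesis using not_less_Least[of i "\<lambda>k. dist x z < 2 ^ Suc (Suc k) * \<rho>"] by (simp add: k_def)
  qed (use d in simp)
  have "0 < dist x z" using d \<rho> by linarith
  have "\<rho> / dist x z \<le> \<rho> / (2 ^ Suc k * \<rho>)"
    using le \<rho> \<open>0 < dist x z\<close> by (intro divide_left_mono mult_pos_pos) auto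
  also have "\<dots> = (1 / 2) ^ Suc k" using \<rho> by (simp add: power_one_over field_simps)
  finally have w: "\<omega> (\<rho> / dist x z) \<le> \<omega> ((1 / 2) ^ Suc k)"
    using \<rho> by (intro mono_onD[OF \<omega>(1)]) auto
  have w0: "0 \<le> \<omega> ((1 / 2) ^ Suc k)" using mono_onD[OF \<omega>(1), of 0 "(1 / 2) ^ Suc k"] \<omega>(2) by simp
  have Lp: "0 < L x (2 ^ Suc k * \<rho>)" using \<rho> by (intro L_pos) auto
  have LL: "L x (2 ^ Suc k * \<rho>) \<le> L x (dist x z)" using \<rho> by (intro L_mono le) auto
  have "\<omega> (\<rho> / dist x z) / L x (dist x z) \<le> \<omega> ((1 / 2) ^ Suc k) / L x (dist x z)"
    using w Lp LL by (intro divide_right_mono) auto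
  also have "\<dots> \<le> \<omega> ((1 / 2) ^ Suc k) / L x (2 ^ Suc k * \<rho>)"
    using w0 Lp LL by (intro divide_left_mono mult_pos_pos) auto
  finally have "ennreal (\<omega> (\<rho> / dist x z) / L x (dist x z))
      \<le> ennreal (\<omega> ((1 / 2) ^ Suc k) / L x (2 ^ Suc k * \<rho>)) * indicator (ball x (2 ^ Suc (Suc k) * \<rho>)) z"
    using k by (simp add: ennreal_leI)
  also have "\<dots> \<le> far_sum \<omega> x \<rho> z"
    unfolding far_sum_def
    by (rule ennreal_le_suminf)
  finally show ?thesis .
qed

text \<open>One doubling of \<open>L\<close> pays for the passage from the inner to the outer radius
  of a layer, so that only the Dini weights remain.\<close>

lemma far_sum_integral:
  assumes w0: "\<And>k. 0 \<le> \<omega> ((1 / 2) ^ Suc k)" and sm: "summable (\<lambda>k. \<omega> ((1 / 2) ^ Suc k))" and \<rho>: "0 < \<rho>"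
  shows "(\<integral>\<^sup>+z. far_sum \<omega> x \<rho> z \<partial>M) \<le> ennreal (CL * (\<Sum>k. \<omega> ((1 / 2) ^ Suc k)))"
proof -
  have Lp: "0 < L x (2 ^ Suc k * \<rho>)" for k using \<rho> by (intro L_pos) auto
  have "(\<integral>\<^sup>+z. far_sum \<omega> x \<rho> z \<partial>M) = (\<Sum>k. ennreal (\<omega> ((1 / 2) ^ Suc k) / L x (2 ^ Suc k * \<rho>)) * emeasure M (ball x (2 ^ Suc (Suc k) * \<rho>)))"
    unfolding far_sum_def by (subst nn_integral_suminf) (auto simp: nn_integral_cmult_indicator)
  also have "\<dots> \<le> (\<Sum>k. ennreal (CL * \<omega> ((1 / 2) ^ Suc k)))"
  proof (rule suminf_le)
    fix k
    have "emeasure M (ball x (2 ^ Suc (Suc k) * \<rho>)) \<le> ennreal (CL * L x (2 ^ Suc k * \<rho>))"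
    proof -
      have "emeasure M (ball x (2 ^ Suc (Suc k) * \<rho>)) \<le> ennreal (L x (2 * (2 ^ Suc k * \<rho>)))"
        using emeasure_ball_le[of "2 ^ Suc (Suc k) * \<rho>" x] \<rho> by (simp add: mult.assoc)
      also have "\<dots> \<le> ennreal (CL * L x (2 ^ Suc k * \<rho>))"
        using \<rho> by (intro ennreal_leI L_double) auto
      finally show ?thesis .
    qed
    then have "ennreal (\<omega> ((1 / 2) ^ Suc k) / L x (2 ^ Suc k * \<rho>)) * emeasure M (ball x (2 ^ Suc (Suc k) * \<rho>))
        \<le> ennreal (\<omega> ((1 / 2) ^ Suc k) / L x (2 ^ Suc k * \<rho>)) * ennreal (CL * L x (2 ^ Suc k * \<rho>))"
      by (intro mult_left_mono) auto
    also have "\<dots> = ennreal (CL * \<omega> ((1 / 2) ^ Suc k))"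
      using Lp[of k] w0[of k] CL by (subst ennreal_mult[symmetric]) (auto simp: less_imp_le)
    finally show "ennreal (\<omega> ((1 / 2) ^ Suc k) / L x (2 ^ Suc k * \<rho>)) * emeasure M (ball x (2 ^ Suc (Suc k) * \<rho>))
        \<le> ennreal (CL * \<omega> ((1 / 2) ^ Suc k))" .
  qed auto
  also have "\<dots> = ennreal (CL * (\<Sum>k. \<omega> ((1 / 2) ^ Suc k)))"
    using CL w0 summable_sums[OF sm] by (intro suminf_ennreal_eq sums_mult) auto
  finally show ?thesis .
qed

end

section \<open>Kernel estimates\<close>

locale cz_operator = bilinear_operator M p1 p2 p CT K T + dominated_space M L CL
  for M :: "'a::{metric_space, second_countable_topology} measure"
    and p1 p2 p CT K T and L :: "'a \<Rightarrow> real \<Rightarrow> real" and CL :: real +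
  fixes CK :: real and \<omega> :: "real \<Rightarrow> real"
  assumes CK: "0 \<le> CK"
    and omega_mono: "mono_on {0..} \<omega>" and omega_0: "\<omega> 0 = 0"
    and omega_summable: "summable (\<lambda>k. \<omega> ((1 / 2) ^ Suc k))"
    and K_size: "\<And>x y1 y2. cmod (K x y1 y2) \<le> CK * kernel_bound L x y1 y2"
    and K_reg0: "\<And>x y1 y2 x'. x \<noteq> y1 \<or> x \<noteq> y2 \<Longrightarrow> dist x x' \<le> max (dist x y1) (dist x y2) / 2 \<Longrightarrow>
      cmod (K x y1 y2 - K x' y1 y2) \<le> CK * kernel_bound L x y1 y2 * \<omega> (dist x x' / (dist x y1 + dist x y2))"
    and K_reg1: "\<And>x y1 y2 y1'. x \<noteq> y1 \<or> x \<noteq> y2 \<Longrightarrow> dist y1 y1' \<le> max (dist x y1) (dist x y2) / 2 \<Longrightarrow>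
      cmod (K x y1 y2 - K x y1' y2) \<le> CK * kernel_bound L x y1 y2 * \<omega> (dist y1 y1' / (dist x y1 + dist x y2))"
    and K_reg2: "\<And>x y1 y2 y2'. x \<noteq> y1 \<or> x \<noteq> y2 \<Longrightarrow> dist y2 y2' \<le> max (dist x y1) (dist x y2) / 2 \<Longrightarrow>
      cmod (K x y1 y2 - K x y1 y2') \<le> CK * kernel_bound L x y1 y2 * \<omega> (dist y2 y2' / (dist x y1 + dist x y2))"
begin

lemma swap_cz: "cz_operator M p2 p1 p CT (\<lambda>x y1 y2. K x y2 y1) (\<lambda>f g. T g f) L CL CK \<omega>"
proof (intro cz_operator.intro swap cz_operator_axioms.intro dominated_space_axioms)
  fix x y1 y2 x' :: 'a
  show "cmod (K x y2 y1) \<le> CK * kernel_bound L x y1 y2"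
    using K_size[of x y2 y1] by (simp add: kernel_bound_commute)
  assume *: "x \<noteq> y1 \<or> x \<noteq> y2"
  show "cmod (K x y2 y1 - K x' y2 y1) \<le> CK * kernel_bound L x y1 y2 * \<omega> (dist x x' / (dist x y1 + dist x y2))"
    if "dist x x' \<le> max (dist x y1) (dist x y2) / 2"
    using K_reg0[of x y2 y1 x'] * that by (simp add: kernel_bound_commute add.commute max.commute disj_commute)
  show "cmod (K x y2 y1 - K x y2 x') \<le> CK * kernel_bound L x y1 y2 * \<omega> (dist y1 x' / (dist x y1 + dist x y2))"
    if "dist y1 x' \<le> max (dist x y1) (dist x y2) / 2"
    using K_reg2[of x y2 y1 x'] * that by (simp add: kernel_bound_commute add.commute max.commute disj_commute)
  show "cmod (K x y2 y1 - K x x' y1) \<le> CK * kernel_bound L x y1 y2 * \<omega> (dist y2 x' / (dist x y1 + dist x y2))"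
    if "dist y2 x' \<le> max (dist x y1) (dist x y2) / 2"
    using K_reg1[of x y2 y1 x'] * that by (simp add: kernel_bound_commute add.commute max.commute disj_commute)
qed (use CK omega_mono omega_0 omega_summable in auto)

lemma omega_nonneg: "0 \<le> t \<Longrightarrow> 0 \<le> \<omega> t"
  using mono_onD[OF omega_mono, of 0 t] omega_0 by simp

lemma omega_le: "0 \<le> s \<Longrightarrow> s \<le> t \<Longrightarrow> \<omega> s \<le> \<omega> t"
  using mono_onD[OF omega_mono, of s t] by simp

lemma nn_integral_pair:
  "F \<in> borel_measurable (M \<Otimes>\<^sub>M M) \<Longrightarrow> (\<integral>\<^sup>+w. F w \<partial>(M \<Otimes>\<^sub>M M)) = (\<integral>\<^sup>+y1. \<integral>\<^sup>+y2. F (y1, y2) \<partial>M \<partial>M)"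
  by (rule nn_integral_fst[symmetric])

text \<open>The size bound of the kernel integrated against both functions. The integral over the
  second variable stands inside because it is estimated first, uniformly or in terms of
  \<open>y1\<close>.\<close>

definition size_form :: "('a \<Rightarrow> complex) \<Rightarrow> ('a \<Rightarrow> complex) \<Rightarrow> 'a \<Rightarrow> ennreal" where
  "size_form f g z = (\<integral>\<^sup>+y1. ennreal (cmod (f y1)) * (\<integral>\<^sup>+y2. ennreal (cmod (g y2)) * kb z y1 y2 \<partial>M) \<partial>M)"

lemma kernel_product_bound:
  assumes [measurable]: "f \<in> borel_measurable M" "g \<in> borel_measurable M"
  shows "(\<integral>\<^sup>+w. ennreal (norm (case w of (y1, y2) \<Rightarrow> K z y1 y2 * f y1 * g y2)) \<partial>(M \<Otimes>\<^sub>M M)) \<le> ennreal CK * size_form f g z"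
proof -
  have "(\<integral>\<^sup>+w. ennreal (norm (case w of (y1, y2) \<Rightarrow> K z y1 y2 * f y1 * g y2)) \<partial>(M \<Otimes>\<^sub>M M))
      \<le> (\<integral>\<^sup>+w. ennreal CK * (ennreal (cmod (f (fst w))) * (ennreal (cmod (g (snd w))) * kb z (fst w) (snd w))) \<partial>(M \<Otimes>\<^sub>M M))"
  proof (rule nn_integral_mono)
    fix w :: "'a \<times> 'a"
    have "norm (case w of (y1, y2) \<Rightarrow> K z y1 y2 * f y1 * g y2) = cmod (K z (fst w) (snd w)) * (cmod (f (fst w)) * cmod (g (snd w)))"
      by (simp add: case_prod_beta norm_mult)
    also have "\<dots> \<le> (CK * kernel_bound L z (fst w) (snd w)) * (cmod (f (fst w)) * cmod (g (snd w)))"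
      by (intro mult_right_mono K_size) auto
    also have "\<dots> = CK * (cmod (f (fst w)) * (cmod (g (snd w)) * kernel_bound L z (fst w) (snd w)))"
      by simp
    finally have "ennreal (norm (case w of (y1, y2) \<Rightarrow> K z y1 y2 * f y1 * g y2))
        \<le> ennreal (CK * (cmod (f (fst w)) * (cmod (g (snd w)) * kernel_bound L z (fst w) (snd w))))"
      by (rule ennreal_leI)
    then show "ennreal (norm (case w of (y1, y2) \<Rightarrow> K z y1 y2 * f y1 * g y2))
        \<le> ennreal CK * (ennreal (cmod (f (fst w))) * (ennreal (cmod (g (snd w))) * kb z (fst w) (snd w)))"
      using CK by (simp add: ennreal_mult)
  qed
  also have "\<dots> = ennreal CK * (\<integral>\<^sup>+w. (ennreal (cmod (f (fst w))) * (ennreal (cmod (g (snd w))) * kb z (fst w) (snd w))) \<partial>(M \<Otimes>\<^sub>M M))"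
    by (rule nn_integral_cmult) measurable
  also have "(\<integral>\<^sup>+w. (ennreal (cmod (f (fst w))) * (ennreal (cmod (g (snd w))) * kb z (fst w) (snd w))) \<partial>(M \<Otimes>\<^sub>M M))
      = (\<integral>\<^sup>+y1. (\<integral>\<^sup>+y2. ennreal (cmod (f y1)) * (ennreal (cmod (g y2)) * kb z y1 y2) \<partial>M) \<partial>M)"
    by (subst nn_integral_pair) auto
  also have "\<dots> = size_form f g z"
    unfolding size_form_def by (intro nn_integral_cong nn_integral_cmult) measurable
  finally show ?thesis .
qed

text \<open>Where the right side is infinite there is nothing to show; where it is finite it
  supplies the integrability that \<open>kernel_representation\<close> requires.\<close>

lemma T_size_bound:
  assumes f: "in_Lp M p1 f" and g: "in_Lp M p2 g" and U: "open U"
    and van: "(\<forall>x\<in>U. f x = 0) \<or> (\<forall>x\<in>U. g x = 0)"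
  shows "AE z in M. z \<in> U \<longrightarrow> ennreal (cmod (T f g z)) \<le> ennreal CK * size_form f g z"
  using kernel_representation[OF assms]
proof (eventually_elim, intro impI)
  fix z
  assume rep: "z \<in> U \<longrightarrow> integrable (M \<Otimes>\<^sub>M M) (\<lambda>(y1, y2). K z y1 y2 * f y1 * g y2) \<longrightarrow>
      T f g z = (\<integral>(y1, y2). K z y1 y2 * f y1 * g y2 \<partial>(M \<Otimes>\<^sub>M M))" and z: "z \<in> U"
  note [measurable] = in_LpD(1)[OF f] in_LpD(1)[OF g]
  show "ennreal (cmod (T f g z)) \<le> ennreal CK * size_form f g z"
  proof (cases "ennreal CK * size_form f g z = top")
    case fin: False
    note b = kernel_product_bound[of f g z]
    have int: "integrable (M \<Otimes>\<^sub>M M) (\<lambda>(y1, y2). K z y1 y2 * f y1 * g y2)"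
    proof (rule integrableI_bounded)
      show "(\<integral>\<^sup>+w. ennreal (norm (case w of (y1, y2) \<Rightarrow> K z y1 y2 * f y1 * g y2)) \<partial>(M \<Otimes>\<^sub>M M)) < \<infinity>"
        using b fin by (auto simp: less_top intro: le_less_trans)
    qed measurable
    then have "ennreal (cmod (T f g z)) \<le> (\<integral>\<^sup>+w. ennreal (norm (case w of (y1, y2) \<Rightarrow> K z y1 y2 * f y1 * g y2)) \<partial>(M \<Otimes>\<^sub>M M))"
      using rep z by (simp add: integral_norm_bound_ennreal)
    then show ?thesis using b by simp
  qed simp
qed

lemma dominated_at_mono:
  "dominated_at u m z \<Longrightarrow> (\<And>y. v y \<le> u y) \<Longrightarrow> dominated_at v m z"
  unfolding dominated_at_def by (meson mult_right_mono nn_integral_mono order_trans zero_le)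

text \<open>The first function stays away from \<open>z\<close>, so \<open>size_integral\<close>
  applies in \<open>y2\<close> for each \<open>y1\<close> where it does not vanish. The second
  function may charge every neighbourhood of \<open>z\<close>.\<close>

lemma size_form_near:
  assumes [measurable]: "f \<in> borel_measurable M" "g \<in> borel_measurable M"
    and m: "dominated_at (\<lambda>y. ennreal (cmod (g y))) m z" "0 \<le> m"
    and d: "0 < d" "\<And>y. f y \<noteq> 0 \<Longrightarrow> d \<le> dist z y"
  shows "size_form f g z \<le> nn_norm M f * ennreal (8 * CL * m / L z d)"
proof -
  have "size_form f g z \<le> (\<integral>\<^sup>+y. ennreal (cmod (f y)) * ennreal (8 * CL * m / L z d) \<partial>M)"
    unfolding size_form_def
  proof (rule nn_integral_mono)
    fix y1
    show "ennreal (cmod (f y1)) * (\<integral>\<^sup>+y2. ennreal (cmod (g y2)) * kb z y1 y2 \<partial>M)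
        \<le> ennreal (cmod (f y1)) * ennreal (8 * CL * m / L z d)"
    proof (cases "f y1 = 0")
      case False
      then have dy: "d \<le> dist z y1" by (rule d(2))
      then have "z \<noteq> y1" using d(1) by auto
      then have "(\<integral>\<^sup>+y2. ennreal (cmod (g y2)) * kb z y1 y2 \<partial>M) \<le> ennreal (8 * CL * m / L z (dist z y1))"
        by (intro size_integral m) auto
      also have "\<dots> \<le> ennreal (8 * CL * m / L z d)"
        using m(2) CL L_pos[OF d(1), of z] L_mono[OF d(1) dy, of z]
        by (intro ennreal_leI divide_left_mono mult_pos_pos) auto
      finally show ?thesis by (intro mult_left_mono) auto
    qed simp
  qed
  also have "\<dots> = nn_norm M f * ennreal (8 * CL * m / L z d)"
    by (rule nn_integral_multc) measurable
  finally show ?thesis .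
qed

text \<open>The roles are exchanged: only the second function stays away from \<open>z\<close>, and
  the inner integral is bounded independently of \<open>y1\<close>.\<close>

lemma size_form_far:
  assumes [measurable]: "f \<in> borel_measurable M" "g \<in> borel_measurable M"
    and m: "dominated_at (\<lambda>y. ennreal (cmod (g y))) m z" "0 \<le> m"
    and d: "0 < d" "\<And>y. g y \<noteq> 0 \<Longrightarrow> d \<le> dist z y"
  shows "size_form f g z \<le> nn_norm M f * ennreal (32 * CL * m / L z d)"
proof -
  have "size_form f g z \<le> (\<integral>\<^sup>+y. ennreal (cmod (f y)) * ennreal (32 * CL * m / L z d) \<partial>M)"
    unfolding size_form_def
    using m d by (intro nn_integral_mono mult_left_mono size_integral_far) auto
  also have "\<dots> = nn_norm M f * ennreal (32 * CL * m / L z d)"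
    by (rule nn_integral_multc) measurable
  finally show ?thesis .
qed

text \<open>As \<open>f\<close> has mean zero, \<open>K z c y2\<close> may be subtracted from
  \<open>K z y1 y2\<close>, and regularity in the first variable gains the factor
  \<open>\<omega> (\<rho> / dist c z)\<close>. The quantifier over \<open>m\<close> stands inside,
  so the domination constant may depend on \<open>z\<close>.\<close>

lemma T_cancellation_bound:
  assumes f: "in_Lp M p1 f" "integrable M f" "(\<integral>y. f y \<partial>M) = 0" "\<And>y. f y \<noteq> 0 \<Longrightarrow> dist c y < \<rho>"
    and g: "in_Lp M p2 g" and \<rho>: "0 < \<rho>"
  shows "AE z in M. 2 * \<rho> \<le> dist c z \<longrightarrow> (\<forall>m\<ge>0. dominated_at (\<lambda>y. ennreal (cmod (g y))) m z \<longrightarrow>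
    ennreal (cmod (T f g z)) \<le> ennreal (CK * \<omega> (\<rho> / dist c z) * L1_norm M f * (8 * CL * m / L z (dist z c))))"
proof -
  define U where "U = {z. \<rho> < dist c z}"
  have U: "open U" unfolding U_def by (intro open_Collect_less continuous_intros)
  have van: "(\<forall>x\<in>U. f x = 0) \<or> (\<forall>x\<in>U. g x = 0)" using f(4) by (fastforce simp: U_def)
  show ?thesis
    using kernel_representation[OF f(1) g U van]
  proof (eventually_elim, intro impI allI)
    fix z m
    assume rep: "z \<in> U \<longrightarrow> integrable (M \<Otimes>\<^sub>M M) (\<lambda>(y1, y2). K z y1 y2 * f y1 * g y2) \<longrightarrow>
      T f g z = (\<integral>(y1, y2). K z y1 y2 * f y1 * g y2 \<partial>(M \<Otimes>\<^sub>M M))"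
      and d: "2 * \<rho> \<le> dist c z" and m: "0 \<le> m" and dom: "dominated_at (\<lambda>y. ennreal (cmod (g y))) m z"
    note [measurable] = in_LpD(1)[OF f(1)] in_LpD(1)[OF g]
    have zU: "z \<in> U" using d \<rho> by (simp add: U_def)
    have zc: "z \<noteq> c" "0 < dist z c" using d \<rho> by (auto simp: dist_commute)
    have fy: "\<rho> \<le> dist z y" if "f y \<noteq> 0" for y
      using f(4)[OF that] d dist_triangle[of c z y] by (simp add: dist_commute)
    have fin: "nn_norm M f < \<infinity>"
      using f(2) by (simp add: integrable_iff_bounded)
    have int: "integrable (M \<Otimes>\<^sub>M M) (\<lambda>(y1, y2). K z y1 y2 * f y1 * g y2)"
    proof (rule integrableI_bounded)
      have "size_form f g z < \<infinity>"
        using size_form_near[of f g m z \<rho>] dom m \<rho> fy fin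
        by (auto intro: le_less_trans simp: ennreal_mult_less_top)
      then show "(\<integral>\<^sup>+w. ennreal (norm (case w of (y1, y2) \<Rightarrow> K z y1 y2 * f y1 * g y2)) \<partial>(M \<Otimes>\<^sub>M M)) < \<infinity>"
        using kernel_product_bound[of f g z] by (auto intro: le_less_trans simp: ennreal_mult_less_top)
    qed measurable
    have kb: "(\<integral>\<^sup>+y2. ennreal (cmod (g y2)) * kb z c y2 \<partial>M) \<le> ennreal (8 * CL * m / L z (dist z c))"
      using zc m dom by (intro size_integral) auto
    have intc: "integrable M (\<lambda>y2. K z c y2 * g y2)"
    proof (rule integrableI_bounded)
      have "(\<integral>\<^sup>+y2. ennreal (norm (K z c y2 * g y2)) \<partial>M) \<le> (\<integral>\<^sup>+y2. ennreal CK * (ennreal (cmod (g y2)) * kb z c y2) \<partial>M)"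
      proof (rule nn_integral_mono)
        fix y2
        have "norm (K z c y2 * g y2) \<le> CK * (cmod (g y2) * kernel_bound L z c y2)"
          using mult_right_mono[OF K_size[of z c y2], of "cmod (g y2)"] by (simp add: norm_mult ac_simps)
        then show "ennreal (norm (K z c y2 * g y2)) \<le> ennreal CK * (ennreal (cmod (g y2)) * kb z c y2)"
          using CK by (simp add: ennreal_leI flip: ennreal_mult)
      qed
      also have "\<dots> = ennreal CK * (\<integral>\<^sup>+y2. ennreal (cmod (g y2)) * kb z c y2 \<partial>M)"
        by (rule nn_integral_cmult) measurable
      also have "\<dots> < \<infinity>" using kb by (auto simp: ennreal_mult_less_top intro: le_less_trans)
      finally show "(\<integral>\<^sup>+y2. ennreal (norm (K z c y2 * g y2)) \<partial>M) < \<infinity>" .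
    qed measurable
    \<comment> \<open>The subtracted term is a product of two one-variable integrals, the first of
      which is 0.\<close>
    have prod: "integrable (M \<Otimes>\<^sub>M M) (\<lambda>(y1, y2). f y1 * (K z c y2 * g y2))"
      "(\<integral>(y1, y2). f y1 * (K z c y2 * g y2) \<partial>(M \<Otimes>\<^sub>M M)) = 0"
    proof -
      show i: "integrable (M \<Otimes>\<^sub>M M) (\<lambda>(y1, y2). f y1 * (K z c y2 * g y2))"
      proof (rule MM.Fubini_integrable)
        show "integrable M (\<lambda>x. \<integral>y. norm (case (x, y) of (y1, y2) \<Rightarrow> f y1 * (K z c y2 * g y2)) \<partial>M)"
          using f(2) by (simp add: norm_mult)
        show "AE x in M. integrable M (\<lambda>y. case (x, y) of (y1, y2) \<Rightarrow> f y1 * (K z c y2 * g y2))"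
          using intc by simp
      qed measurable
      have "(\<integral>(y1, y2). f y1 * (K z c y2 * g y2) \<partial>(M \<Otimes>\<^sub>M M)) = (\<integral>y1. (\<integral>y2. f y1 * (K z c y2 * g y2) \<partial>M) \<partial>M)"
        using MM.integral_fst'[OF i] by simp
      also have "\<dots> = (\<integral>y1. f y1 * (\<integral>y2. K z c y2 * g y2 \<partial>M) \<partial>M)"
        using intc by (intro Bochner_Integration.integral_cong) auto
      also have "\<dots> = 0" using f(2,3) by simp
      finally show "(\<integral>(y1, y2). f y1 * (K z c y2 * g y2) \<partial>(M \<Otimes>\<^sub>M M)) = 0" .
    qed
    define C where "C = CK * \<omega> (\<rho> / dist c z)"
    have C: "0 \<le> C" unfolding C_def using CK \<rho> by (intro mult_nonneg_nonneg omega_nonneg) auto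
    have "T f g z = (\<integral>(y1, y2). K z y1 y2 * f y1 * g y2 \<partial>(M \<Otimes>\<^sub>M M)) - (\<integral>(y1, y2). f y1 * (K z c y2 * g y2) \<partial>(M \<Otimes>\<^sub>M M))"
      using rep zU int prod(2) by simp
    also have "\<dots> = (\<integral>w. (case w of (y1, y2) \<Rightarrow> K z y1 y2 * f y1 * g y2) - (case w of (y1, y2) \<Rightarrow> f y1 * (K z c y2 * g y2)) \<partial>(M \<Otimes>\<^sub>M M))"
      using int prod(1) by (rule Bochner_Integration.integral_diff[symmetric])
    finally have "ennreal (cmod (T f g z)) \<le> (\<integral>\<^sup>+w. ennreal (norm ((case w of (y1, y2) \<Rightarrow> K z y1 y2 * f y1 * g y2) - (case w of (y1, y2) \<Rightarrow> f y1 * (K z c y2 * g y2)))) \<partial>(M \<Otimes>\<^sub>M M))"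
      using integral_norm_bound_ennreal[OF Bochner_Integration.integrable_diff[OF int prod(1)]] by simp
    also have "\<dots> \<le> (\<integral>\<^sup>+w. ennreal (cmod (f (fst w))) * (ennreal C * (ennreal (cmod (g (snd w))) * kb z c (snd w))) \<partial>(M \<Otimes>\<^sub>M M))"
    proof (rule nn_integral_mono)
      fix w :: "'a \<times> 'a"
      obtain y1 y2 where w: "w = (y1, y2)" by (cases w)
      show "ennreal (norm ((case w of (y1, y2) \<Rightarrow> K z y1 y2 * f y1 * g y2) - (case w of (y1, y2) \<Rightarrow> f y1 * (K z c y2 * g y2))))
          \<le> ennreal (cmod (f (fst w))) * (ennreal C * (ennreal (cmod (g (snd w))) * kb z c (snd w)))"
      proof (cases "f y1 = 0")
        case False
        have cy: "dist c y1 < \<rho>" by (rule f(4)[OF False])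
        have "dist c y1 \<le> max (dist z c) (dist z y2) / 2" using cy d by (auto simp: dist_commute max_def)
        then have "cmod (K z c y2 - K z y1 y2) \<le> CK * kernel_bound L z c y2 * \<omega> (dist c y1 / (dist z c + dist z y2))"
          using zc by (intro K_reg1) auto
        also have "\<dots> \<le> CK * kernel_bound L z c y2 * \<omega> (\<rho> / dist c z)"
          using CK cy zc by (intro mult_left_mono omega_le frac_le mult_nonneg_nonneg) (use \<rho> in \<open>auto simp: dist_commute\<close>)
        also have "\<dots> = C * kernel_bound L z c y2" by (simp add: C_def)
        finally have K: "cmod (K z y1 y2 - K z c y2) \<le> C * kernel_bound L z c y2" by (simp add: norm_minus_commute)
        have "norm ((case w of (y1, y2) \<Rightarrow> K z y1 y2 * f y1 * g y2) - (case w of (y1, y2) \<Rightarrow> f y1 * (K z c y2 * g y2)))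
            = cmod ((K z y1 y2 - K z c y2) * (f y1 * g y2))"
          unfolding w by (simp add: algebra_simps)
        also have "\<dots> = cmod (K z y1 y2 - K z c y2) * (cmod (f y1) * cmod (g y2))"
          by (simp only: norm_mult)
        also have "\<dots> \<le> C * kernel_bound L z c y2 * (cmod (f y1) * cmod (g y2))"
          by (intro mult_right_mono K) auto
        also have "\<dots> = cmod (f y1) * (C * (cmod (g y2) * kernel_bound L z c y2))" by simp
        finally have "ennreal (norm ((case w of (y1, y2) \<Rightarrow> K z y1 y2 * f y1 * g y2) - (case w of (y1, y2) \<Rightarrow> f y1 * (K z c y2 * g y2))))
            \<le> ennreal (cmod (f y1) * (C * (cmod (g y2) * kernel_bound L z c y2)))" by (rule ennreal_leI)
        then show ?thesis using C by (simp add: ennreal_mult w)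
      qed (simp add: w)
    qed
    also have "\<dots> = (\<integral>\<^sup>+y1. (\<integral>\<^sup>+y2. ennreal (cmod (f y1)) * (ennreal C * (ennreal (cmod (g y2)) * kb z c y2)) \<partial>M) \<partial>M)"
      by (subst nn_integral_pair) auto
    also have "\<dots> = (\<integral>\<^sup>+y1. ennreal (cmod (f y1)) * (ennreal C * (\<integral>\<^sup>+y2. ennreal (cmod (g y2)) * kb z c y2 \<partial>M)) \<partial>M)"
      by (simp add: nn_integral_cmult)
    also have "\<dots> = nn_norm M f * (ennreal C * (\<integral>\<^sup>+y2. ennreal (cmod (g y2)) * kb z c y2 \<partial>M))"
      by (rule nn_integral_multc) measurable
    also have "\<dots> \<le> ennreal (L1_norm M f) * (ennreal C * ennreal (8 * CL * m / L z (dist z c)))"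
      using f(2) kb by (intro mult_mono) (auto simp: nn_integral_eq_integral)
    also have "\<dots> = ennreal (CK * \<omega> (\<rho> / dist c z) * L1_norm M f * (8 * CL * m / L z (dist z c)))"
    proof -
      have "0 \<le> 8 * CL * m / L z (dist z c)" using m CL L_pos[OF zc(2), of z] by auto
      then have "ennreal (L1_norm M f) * (ennreal C * ennreal (8 * CL * m / L z (dist z c)))
          = ennreal (L1_norm M f * (C * (8 * CL * m / L z (dist z c))))"
        using C by (simp add: ennreal_mult del: times_divide_eq_right times_divide_eq_left)
      then show ?thesis by (simp add: C_def ac_simps)
    qed
    finally show "ennreal (cmod (T f g z)) \<le> ennreal (CK * \<omega> (\<rho> / dist c z) * L1_norm M f * (8 * CL * m / L z (dist z c)))" .
  qed
qed

end

section \<open>Calderon--Zygmund decomposition\<close>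

text \<open>
  \<open>E j\<close> are the pieces of the exceptional set, ordered by increasing radius \<open>rho j\<close> of the doubling
  ball around \<open>E j\<close>. \<open>env j\<close> dominates the substitute \<open>phi j f\<close> of \<open>indicator (E j) * f\<close> for all
  \<open>f\<close> bounded by \<open>h\<close>.
\<close>

locale cz_data = dominated_space M L CL
  for M :: "'a::{metric_space, second_countable_topology} measure"
    and L :: "'a \<Rightarrow> real \<Rightarrow> real" and CL :: real +
  fixes n :: nat and c :: "nat \<Rightarrow> 'a" and r :: "nat \<Rightarrow> real" and k :: "nat \<Rightarrow> nat"
    and E A :: "nat \<Rightarrow> 'a set" and h :: "'a \<Rightarrow> real" and Ch Dp :: real
  fixes rho :: "nat \<Rightarrow> real"
  defines rho_def: "rho j \<equiv> 32 ^ k j * r j"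
  fixes e :: "nat \<Rightarrow> real"
  defines e_def: "e j \<equiv> (\<integral>y. indicator (E j) y * h y \<partial>M)"
  fixes env :: "nat \<Rightarrow> 'a \<Rightarrow> real"
  defines env_def: "env j x \<equiv> e j / measure M (A j) * indicator (A j) x"
  assumes L_comp: "\<And>x y s. 0 < s \<Longrightarrow> dist x y \<le> s \<Longrightarrow> L x s \<le> CL * L y s"
    and r_pos: "\<And>j. j < n \<Longrightarrow> 0 < r j" and k_ge: "\<And>j. j < n \<Longrightarrow> 1 \<le> k j"
    and rho_mono: "\<And>i j. i \<le> j \<Longrightarrow> j < n \<Longrightarrow> rho i \<le> rho j"
    and E_sets: "\<And>j. j < n \<Longrightarrow> E j \<in> sets M" and E_sub: "\<And>j. j < n \<Longrightarrow> E j \<subseteq> ball (c j) (3 * r j)"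
    and E_disj: "disjoint_family_on E {..<n}"
    and doub: "\<And>j. j < n \<Longrightarrow> measure M (ball (c j) (32 ^ Suc (k j) * r j)) \<le> 2 * CL ^ 5 * measure M (ball (c j) (32 ^ k j * r j))"
    and doub_low: "\<And>j i. j < n \<Longrightarrow> 1 \<le> i \<Longrightarrow> i \<le> k j \<Longrightarrow>
      (2 * CL ^ 5) ^ (k j - i) * measure M (ball (c j) (32 ^ i * r j)) \<le> measure M (ball (c j) (32 ^ k j * r j))"
    and A_sets: "\<And>j. j < n \<Longrightarrow> A j \<in> sets M" and A_sub: "\<And>j. j < n \<Longrightarrow> A j \<subseteq> ball (c j) (rho j)"
    and A_pos: "\<And>j. j < n \<Longrightarrow> 0 < measure M (A j)"
    and A_large: "\<And>j. j < n \<Longrightarrow> measure M (ball (c j) (rho j)) \<le> 2 * measure M (A j)"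
    and h_int: "integrable M h" and h_nonneg: "\<And>x. 0 \<le> h x"
    and Dp: "\<And>x. (\<Sum>i<n. env i x) \<le> Dp" and Ch: "0 \<le> Ch"
begin

text \<open>The factor 6 is twice the factor 3 of the balls containing the pieces. A good point
  therefore has at least half of its distance to \<open>c j\<close> from every point of
  \<open>E j\<close>.\<close>

definition good :: "'a \<Rightarrow> bool" where
  "good z \<longleftrightarrow> (\<forall>j<n. 6 * r j \<le> dist (c j) z) \<and> dominated_at (\<lambda>y. ennreal (h y)) Ch z"

text \<open>Spreads the integral of \<open>f\<close> over the piece evenly over \<open>A j\<close>,
  so that the difference \<open>bad\<close> has mean zero.\<close>

definition phi :: "nat \<Rightarrow> ('a \<Rightarrow> complex) \<Rightarrow> 'a \<Rightarrow> complex" where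
  "phi j f x = of_real (1 / measure M (A j)) * (\<integral>y. indicator (E j) y * f y \<partial>M) * indicator (A j) x"

definition bad :: "nat \<Rightarrow> ('a \<Rightarrow> complex) \<Rightarrow> 'a \<Rightarrow> complex" where
  "bad j f x = indicator (E j) x * f x - phi j f x"

lemma h_measurable [measurable]: "h \<in> borel_measurable M"
  using h_int by auto

lemma e_nonneg: "0 \<le> e j"
  unfolding e_def using h_nonneg by (intro integral_nonneg_AE) auto

lemma env_nonneg: "0 \<le> env j x"
  unfolding env_def using e_nonneg by auto

lemma Dp_nonneg: "0 \<le> Dp"
  using Dp[of undefined] env_nonneg by (meson order_trans sum_nonneg)

lemma rho_pos: "j < n \<Longrightarrow> 0 < rho j"
  unfolding rho_def using r_pos by auto

lemma r_rho: "j < n \<Longrightarrow> 32 * r j \<le> rho j"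
  unfolding rho_def using r_pos[of j] k_ge[of j] power_increasing[of 1 "k j" "32::real"]
  by (intro mult_right_mono) auto

lemma E_dist: "j < n \<Longrightarrow> y \<in> E j \<Longrightarrow> dist (c j) y < 3 * r j"
  using E_sub[of j] by auto

lemma A_dist: "j < n \<Longrightarrow> y \<in> A j \<Longrightarrow> dist (c j) y < rho j"
  using A_sub[of j] by auto

lemma A_finite: "j < n \<Longrightarrow> emeasure M (A j) < \<infinity>"
  using A_sub[of j] fin_ball[of "c j" "rho j"] emeasure_mono[of "A j" "ball (c j) (rho j)" M]
  by (auto intro: le_less_trans)

lemma env_integrable: "j < n \<Longrightarrow> integrable M (env j)"
  unfolding env_def using A_sets A_finite by (intro integrable_mult_right integrable_real_indicator) auto

lemma env_integral: "j < n \<Longrightarrow> (\<integral>x. env j x \<partial>M) = e j"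
  unfolding env_def using A_sets[of j] A_finite[of j] A_pos[of j] by simp

lemma env_measurable [measurable]: "j < n \<Longrightarrow> env j \<in> borel_measurable M"
  using env_integrable by blast

lemma env_nn_integral: "j < n \<Longrightarrow> (\<integral>\<^sup>+x. ennreal (env j x) \<partial>M) = ennreal (e j)"
  using env_integrable env_integral env_nonneg by (simp add: nn_integral_eq_integral)

lemma hE_integrable: "j < n \<Longrightarrow> integrable M (\<lambda>y. indicator (E j) y * h y)"
  using integrable_real_mult_indicator[OF E_sets h_int] by (simp add: mult.commute)

lemma sum_e_le: "(\<Sum>j<n. e j) \<le> (\<integral>x. h x \<partial>M)"
proof -
  have "(\<Sum>j<n. e j) = (\<integral>x. (\<Sum>j<n. indicator (E j) x * h x) \<partial>M)"
    unfolding e_def using hE_integrable by (subst Bochner_Integration.integral_sum) auto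
  also have "\<dots> \<le> (\<integral>x. h x \<partial>M)"
  proof (intro integral_mono h_int Bochner_Integration.integrable_sum)
    fix x
    have "(\<Sum>j<n. indicator (E j) x * h x) = indicator (\<Union>j<n. E j) x * h x"
      by (simp only: indicator_UN_disjoint[OF finite_lessThan E_disj] sum_distrib_right)
    also have "\<dots> \<le> h x" using h_nonneg[of x] by (auto simp: indicator_def)
    finally show "(\<Sum>j<n. indicator (E j) x * h x) \<le> h x" .
  qed (use hE_integrable in auto)
  finally show ?thesis .
qed

context
  fixes f :: "'a \<Rightarrow> complex"
  assumes f_meas [measurable]: "f \<in> borel_measurable M" and f_le: "\<And>x. cmod (f x) \<le> h x"
begin

lemma Ef_integrable: "j < n \<Longrightarrow> integrable M (\<lambda>y. indicator (E j) y * f y)"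
proof -
  assume j: "j < n"
  note [measurable] = E_sets[OF j]
  show ?thesis
    by (rule Bochner_Integration.integrable_bound[OF h_int])
       (use f_le h_nonneg in \<open>auto simp: indicator_def\<close>)
qed

lemma Ef_norm: "j < n \<Longrightarrow> (\<integral>y. cmod (indicator (E j) y * f y) \<partial>M) \<le> e j"
  unfolding e_def
  by (intro integral_mono integrable_norm Ef_integrable hE_integrable)
     (use E_sets f_le in \<open>auto simp: indicator_def\<close>)

lemma phi_le: "j < n \<Longrightarrow> cmod (phi j f x) \<le> env j x"
proof -
  assume j: "j < n"
  have "cmod (\<integral>y. indicator (E j) y * f y \<partial>M) \<le> e j"
    using integral_norm_bound[of M "\<lambda>y. indicator (E j) y * f y"] Ef_norm[OF j] by linarith
  then have "cmod (\<integral>y. indicator (E j) y * f y \<partial>M) / measure M (A j) \<le> e j / measure M (A j)"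
    by (intro divide_right_mono) auto
  then show ?thesis
    by (auto simp: phi_def env_def norm_mult norm_divide indicator_def)
qed

lemma phi_measurable [measurable]: "j < n \<Longrightarrow> phi j f \<in> borel_measurable M"
  unfolding phi_def using A_sets by measurable

lemma phi_integrable: "j < n \<Longrightarrow> integrable M (phi j f)"
  by (rule Bochner_Integration.integrable_bound[OF env_integrable]) (use phi_le env_nonneg in auto)

lemma phi_integral: "j < n \<Longrightarrow> (\<integral>x. phi j f x \<partial>M) = (\<integral>y. indicator (E j) y * f y \<partial>M)"
proof -
  assume j: "j < n"
  have "(\<integral>x. (indicator (A j) x :: complex) \<partial>M) = of_real (measure M (A j))"
  proof -
    have "(\<lambda>x. indicator (A j) x :: complex) = (\<lambda>x. of_real (indicator (A j) x))"
      by (auto simp: indicator_def)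
    then show ?thesis using A_sets[OF j] A_finite[OF j] by simp
  qed
  then show ?thesis
    unfolding phi_def using A_pos[OF j] by simp
qed

lemma bad_integrable: "j < n \<Longrightarrow> integrable M (bad j f)"
  unfolding bad_def by (intro Bochner_Integration.integrable_diff Ef_integrable phi_integrable)

lemma bad_integral: "j < n \<Longrightarrow> (\<integral>x. bad j f x \<partial>M) = 0"
  unfolding bad_def using Ef_integrable phi_integrable phi_integral by simp

lemma bad_norm: "j < n \<Longrightarrow> (\<integral>x. cmod (bad j f x) \<partial>M) \<le> 2 * e j"
proof -
  assume j: "j < n"
  have "(\<integral>x. cmod (bad j f x) \<partial>M) \<le> (\<integral>x. cmod (indicator (E j) x * f x) + env j x \<partial>M)"
  proof (intro integral_mono Bochner_Integration.integrable_add integrable_norm bad_integrable Ef_integrable env_integrable j)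
    show "cmod (bad j f x) \<le> cmod (indicator (E j) x * f x) + env j x" for x
      unfolding bad_def using phi_le[OF j, of x] norm_triangle_ineq4[of "indicator (E j) x * f x" "phi j f x"] by linarith
  qed
  also have "\<dots> = (\<integral>x. cmod (indicator (E j) x * f x) \<partial>M) + e j"
    using Ef_integrable[OF j] env_integrable[OF j] env_integral[OF j]
    by (subst Bochner_Integration.integral_add) auto
  finally show ?thesis using Ef_norm[OF j] by linarith
qed

lemma phi_supp: "j < n \<Longrightarrow> phi j f x \<noteq> 0 \<Longrightarrow> dist (c j) x < rho j"
  using A_dist[of j x] by (auto simp: phi_def indicator_def split: if_splits)

lemma bad_supp: "j < n \<Longrightarrow> bad j f x \<noteq> 0 \<Longrightarrow> dist (c j) x < rho j"
  using phi_supp[of j x] E_dist[of j x] r_rho[of j] r_pos[of j]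
  by (cases "phi j f x = 0") (auto simp: bad_def indicator_def split: if_splits)

lemma phi_in_Lp: "j < n \<Longrightarrow> 1 \<le> q \<Longrightarrow> in_Lp M q (phi j f)"
proof (rule in_Lp_bounded(1)[OF phi_integrable])
  assume j: "j < n"
  have "cmod (phi j f x) \<le> e j / measure M (A j)" for x
    using phi_le[OF j, of x] e_nonneg[of j] by (auto simp: env_def indicator_def split: if_splits intro: order_trans)
  then show "AE x in M. cmod (phi j f x) \<le> e j / measure M (A j)" by simp
qed (use e_nonneg in auto)

lemma bad_in_Lp: "j < n \<Longrightarrow> 1 \<le> q \<Longrightarrow> in_Lp M q f \<Longrightarrow> in_Lp M q (bad j f)"
  unfolding bad_def using E_sets phi_in_Lp by (intro in_Lp_diff in_Lp_indicator) auto

end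

lemma dominated_at_env: "dominated_at (\<lambda>y. ennreal (\<Sum>i<n. env i y)) Dp z"
  unfolding dominated_at_def
proof (intro allI impI)
  fix s :: real assume s: "0 < s"
  have "(\<integral>\<^sup>+y\<in>ball z s. ennreal (\<Sum>i<n. env i y) \<partial>M) \<le> (\<integral>\<^sup>+y. ennreal Dp * indicator (ball z s) y \<partial>M)"
    using Dp by (intro nn_integral_mono mult_right_mono ennreal_leI) auto
  also have "\<dots> = ennreal Dp * emeasure M (ball z s)" by (simp add: nn_integral_cmult_indicator)
  also have "\<dots> \<le> ennreal Dp * ennreal (L z s)" using emeasure_ball_le[OF s] by (intro mult_left_mono) auto
  also have "\<dots> = ennreal (Dp * L z s)" using Dp_nonneg L_pos[OF s] by (simp add: ennreal_mult less_imp_le)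
  finally show "(\<integral>\<^sup>+y\<in>ball z s. ennreal (\<Sum>i<n. env i y) \<partial>M) \<le> ennreal (Dp * L z s)" .
qed

lemma dominated_at_add:
  assumes "dominated_at u a z" "dominated_at v b z" "0 \<le> a" "0 \<le> b"
    and [measurable]: "u \<in> borel_measurable M" "v \<in> borel_measurable M"
  shows "dominated_at (\<lambda>y. u y + v y) (a + b) z"
  unfolding dominated_at_def
proof (intro allI impI)
  fix s :: real assume s: "0 < s"
  have "(\<integral>\<^sup>+y\<in>ball z s. u y + v y \<partial>M) = (\<integral>\<^sup>+y\<in>ball z s. u y \<partial>M) + (\<integral>\<^sup>+y\<in>ball z s. v y \<partial>M)"
    unfolding distrib_right by (rule nn_integral_add) auto
  also have "\<dots> \<le> ennreal (a * L z s) + ennreal (b * L z s)"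
    using assms s by (intro add_mono) (auto simp: dominated_at_def)
  also have "\<dots> = ennreal ((a + b) * L z s)"
    using assms(3,4) L_pos[OF s, of z] by (simp add: distrib_right ennreal_plus)
  finally show "(\<integral>\<^sup>+y\<in>ball z s. u y + v y \<partial>M) \<le> ennreal ((a + b) * L z s)" .
qed

text \<open>Covers at once what occurs as the other argument of \<open>T\<close>: a good part and
  unreplaced pieces, each bounded by \<open>h\<close>, and a partial sum of substitutes.\<close>

lemma good_dominated:
  assumes "good z"
  shows "dominated_at (\<lambda>y. ennreal (2 * h y + (\<Sum>i<n. env i y))) (2 * Ch + Dp) z"
proof -
  have h: "dominated_at (\<lambda>y. ennreal (h y)) Ch z" using assms by (simp add: good_def)
  have m: "(\<lambda>y. ennreal (\<Sum>i<n. env i y)) \<in> borel_measurable M"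
    by (intro measurable_compose[OF _ measurable_ennreal] borel_measurable_sum) auto
  have *: "dominated_at (\<lambda>y. ennreal (h y) + ennreal (h y) + ennreal (\<Sum>i<n. env i y)) (Ch + Ch + Dp) z"
    using h Ch Dp_nonneg m by (intro dominated_at_add dominated_at_env) auto
  have "ennreal (h y) + ennreal (h y) + ennreal (\<Sum>i<n. env i y) = ennreal (2 * h y + (\<Sum>i<n. env i y))" for y
  proof -
    have "0 \<le> (\<Sum>i<n. env i y)" using env_nonneg by (intro sum_nonneg) auto
    then show ?thesis using h_nonneg[of y] by (simp flip: ennreal_plus)
  qed
  then show ?thesis using * unfolding mult_2[symmetric] by presburger
qed

text \<open>The interaction of the substitute of piece \<open>j\<close> with the pieces whose
  doubled ball contains \<open>z\<close>. No bound for a single \<open>j\<close> is attempted; only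
  the sum over \<open>j\<close> is estimated.\<close>

definition overlap :: "nat \<Rightarrow> 'a \<Rightarrow> ennreal" where
  "overlap j z = (\<Sum>i<n. indicator (ball (c i) (2 * rho i)) z *
     (\<integral>\<^sup>+y2. ennreal (indicator (E i) y2 * h y2) * (\<integral>\<^sup>+y1. ennreal (env j y1) * kb z y2 y1 \<partial>M) \<partial>M))"

text \<open>One integrable bump per piece: regularity decay outside the doubled ball, decay by
  kernel size between the stopping ball and the doubling ball, and on the doubled ball a constant
  for the substitute tested against distant mass.\<close>

definition profile :: "(real \<Rightarrow> real) \<Rightarrow> nat \<Rightarrow> 'a \<Rightarrow> ennreal" where
  "profile \<omega> j z = far_sum \<omega> (c j) (rho j) z + near_sum (c j) (r j) (k j) z
     + ennreal (1 / L (c j) (rho j)) * indicator (ball (c j) (2 * rho j)) z"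

lemma profile_measurable [measurable]: "profile \<omega> j \<in> borel_measurable M"
  unfolding profile_def by measurable

lemma profile_integral:
  assumes "\<And>i. 0 \<le> \<omega> ((1 / 2) ^ Suc i)" "summable (\<lambda>i. \<omega> ((1 / 2) ^ Suc i))" and j: "j < n"
  shows "(\<integral>\<^sup>+z. profile \<omega> j z \<partial>M) \<le> ennreal (CL * (\<Sum>i. \<omega> ((1 / 2) ^ Suc i)) + 4 * CL ^ 5 + CL)"
proof -
  have "(\<integral>\<^sup>+z. profile \<omega> j z \<partial>M) = (\<integral>\<^sup>+z. far_sum \<omega> (c j) (rho j) z \<partial>M) + (\<integral>\<^sup>+z. near_sum (c j) (r j) (k j) z \<partial>M)
      + ennreal (1 / L (c j) (rho j)) * emeasure M (ball (c j) (2 * rho j))"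
    unfolding profile_def by (simp add: nn_integral_add nn_integral_cmult_indicator)
  also have "\<dots> \<le> ennreal (CL * (\<Sum>i. \<omega> ((1 / 2) ^ Suc i))) + ennreal (4 * CL ^ 5) + ennreal CL"
  proof (intro add_mono)
    show "(\<integral>\<^sup>+z. far_sum \<omega> (c j) (rho j) z \<partial>M) \<le> ennreal (CL * (\<Sum>i. \<omega> ((1 / 2) ^ Suc i)))"
      by (intro far_sum_integral assms rho_pos)
    show "(\<integral>\<^sup>+z. near_sum (c j) (r j) (k j) z \<partial>M) \<le> ennreal (4 * CL ^ 5)"
      by (intro near_sum_integral r_pos k_ge doub doub_low j)
    have p: "0 < L (c j) (rho j)" by (intro L_pos rho_pos j)
    have "emeasure M (ball (c j) (2 * rho j)) \<le> ennreal (CL * L (c j) (rho j))"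
      using emeasure_ball_le[of "2 * rho j" "c j"] L_double[OF rho_pos[OF j], of "c j"] rho_pos[OF j]
      by (auto intro: order_trans ennreal_leI)
    then have "ennreal (1 / L (c j) (rho j)) * emeasure M (ball (c j) (2 * rho j)) \<le> ennreal (1 / L (c j) (rho j)) * ennreal (CL * L (c j) (rho j))"
      by (rule mult_left_mono) simp
    also have "\<dots> = ennreal CL" using p CL by (subst ennreal_mult[symmetric]) (auto simp: less_imp_le)
    finally show "ennreal (1 / L (c j) (rho j)) * emeasure M (ball (c j) (2 * rho j)) \<le> ennreal CL" .
  qed
  also have "\<dots> = ennreal (CL * (\<Sum>i. \<omega> ((1 / 2) ^ Suc i)) + 4 * CL ^ 5 + CL)"
    using CL suminf_nonneg[OF assms(2,1)] by (simp add: ennreal_plus)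
  finally show ?thesis .
qed

text \<open>Moves the centre from \<open>z\<close> to \<open>x\<close> and uses one doubling; this
  is a typical use of the comparability \<open>L_comp\<close>.\<close>

lemma recip_L_half:
  assumes d: "0 < dist x z"
  shows "1 / L z (dist x z / 2) \<le> CL\<^sup>2 / L x (dist x z)"
proof -
  have "L x (dist x z) \<le> CL * L z (dist x z)" by (rule L_comp[OF d]) simp
  also have "\<dots> \<le> CL * (CL * L z (dist x z / 2))"
    using L_double[of "dist x z / 2" z] d CL by (intro mult_left_mono) auto
  finally show ?thesis
    using L_pos[OF d, of x] L_pos[of "dist x z / 2" z] d by (simp add: field_simps power2_eq_square)
qed

text \<open>Exchanging the sums brings the sum of all \<open>env j\<close>, bounded by
  \<open>Dp\<close>, under the inner integral, so each piece \<open>i\<close> is tested against one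
  bounded function. Goodness keeps \<open>z\<close> away from \<open>E i\<close>, and the resulting
  reciprocals of \<open>L\<close> are majorised by \<open>near_sum\<close>.\<close>

lemma sum_overlap:
  assumes z: "good z"
  shows "(\<Sum>j<n. overlap j z) \<le> ennreal (8 * CL ^ 3 * Dp) * (\<Sum>i<n. ennreal (e i) * near_sum (c i) (r i) (k i) z)"
proof -
  have [measurable]: "env j \<in> borel_measurable M" "E j \<in> sets M" if "j < n" for j
    using that env_measurable E_sets by auto
  have "(\<Sum>j<n. overlap j z) = (\<Sum>i<n. \<Sum>j<n. indicator (ball (c i) (2 * rho i)) z *
     (\<integral>\<^sup>+y2. ennreal (indicator (E i) y2 * h y2) * (\<integral>\<^sup>+y1. ennreal (env j y1) * kb z y2 y1 \<partial>M) \<partial>M))"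
    unfolding overlap_def by (rule sum.swap)
  also have "\<dots> \<le> (\<Sum>i<n. ennreal (8 * CL ^ 3 * Dp) * (ennreal (e i) * near_sum (c i) (r i) (k i) z))"
  proof (rule sum_mono)
    fix i assume "i \<in> {..<n}"
    then have i: "i < n" by simp
    define d where "d = dist (c i) z"
    have d6: "6 * r i \<le> d" using z i by (simp add: good_def d_def)
    have d0: "0 < d" using d6 r_pos[OF i] by linarith
    have Lp: "0 < L z (d / 2)" using d0 by (intro L_pos) auto
    show "(\<Sum>j<n. indicator (ball (c i) (2 * rho i)) z *
        (\<integral>\<^sup>+y2. ennreal (indicator (E i) y2 * h y2) * (\<integral>\<^sup>+y1. ennreal (env j y1) * kb z y2 y1 \<partial>M) \<partial>M))
      \<le> ennreal (8 * CL ^ 3 * Dp) * (ennreal (e i) * near_sum (c i) (r i) (k i) z)"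
    proof (cases "z \<in> ball (c i) (2 * rho i)")
      case True
      then have d2: "d < 32 ^ Suc (k i) * r i"
        using rho_pos[OF i] by (simp add: d_def rho_def)
      have meas: "(\<lambda>y2. ennreal (indicator (E i) y2 * h y2) * (\<integral>\<^sup>+y1. ennreal (env j y1) * kb z y2 y1 \<partial>M)) \<in> borel_measurable M"
        if j: "j < n" for j
      proof -
        note [measurable] = env_measurable[OF j] E_sets[OF i]
        have "(\<lambda>w. ennreal (env j (snd w)) * kb z (fst w) (snd w)) \<in> borel_measurable (M \<Otimes>\<^sub>M M)"
          by measurable
        then have "(\<lambda>(y2, y1). ennreal (env j y1) * kb z y2 y1) \<in> borel_measurable (M \<Otimes>\<^sub>M M)"
          by (simp add: case_prod_beta')
        then have "(\<lambda>y2. \<integral>\<^sup>+y1. ennreal (env j y1) * kb z y2 y1 \<partial>M) \<in> borel_measurable M"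
          by (rule borel_measurable_nn_integral[where f = "\<lambda>y2 y1. ennreal (env j y1) * kb z y2 y1"])
        then show ?thesis by measurable
      qed
      have "(\<Sum>j<n. indicator (ball (c i) (2 * rho i)) z *
          (\<integral>\<^sup>+y2. ennreal (indicator (E i) y2 * h y2) * (\<integral>\<^sup>+y1. ennreal (env j y1) * kb z y2 y1 \<partial>M) \<partial>M))
        = (\<Sum>j<n. \<integral>\<^sup>+y2. ennreal (indicator (E i) y2 * h y2) * (\<integral>\<^sup>+y1. ennreal (env j y1) * kb z y2 y1 \<partial>M) \<partial>M)"
        using True by simp
      also have "\<dots> = (\<integral>\<^sup>+y2. (\<Sum>j<n. ennreal (indicator (E i) y2 * h y2) * (\<integral>\<^sup>+y1. ennreal (env j y1) * kb z y2 y1 \<partial>M)) \<partial>M)"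
        by (rule nn_integral_sum[symmetric]) (rule meas, simp)
      also have "\<dots> = (\<integral>\<^sup>+y2. ennreal (indicator (E i) y2 * h y2) * (\<Sum>j<n. \<integral>\<^sup>+y1. ennreal (env j y1) * kb z y2 y1 \<partial>M) \<partial>M)"
        by (simp only: sum_distrib_left)
      also have "\<dots> = (\<integral>\<^sup>+y2. ennreal (indicator (E i) y2 * h y2) * (\<integral>\<^sup>+y1. ennreal (\<Sum>j<n. env j y1) * kb z y2 y1 \<partial>M) \<partial>M)"
      proof (intro nn_integral_cong arg_cong2[where f = "(*)"] refl)
        fix y2
        have "(\<Sum>j<n. \<integral>\<^sup>+y1. ennreal (env j y1) * kb z y2 y1 \<partial>M)
            = (\<integral>\<^sup>+y1. (\<Sum>j<n. ennreal (env j y1) * kb z y2 y1) \<partial>M)"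
          by (subst nn_integral_sum) auto
        also have "\<dots> = (\<integral>\<^sup>+y1. ennreal (\<Sum>j<n. env j y1) * kb z y2 y1 \<partial>M)"
          using env_nonneg by (simp add: sum_distrib_right[symmetric] sum_ennreal)
        finally show "(\<Sum>j<n. \<integral>\<^sup>+y1. ennreal (env j y1) * kb z y2 y1 \<partial>M)
            = (\<integral>\<^sup>+y1. ennreal (\<Sum>j<n. env j y1) * kb z y2 y1 \<partial>M)" .
      qed
      also have "\<dots> \<le> (\<integral>\<^sup>+y2. ennreal (indicator (E i) y2 * h y2) * ennreal (8 * CL * Dp / L z (d / 2)) \<partial>M)"
      proof (rule nn_integral_mono)
        fix y2
        show "ennreal (indicator (E i) y2 * h y2) * (\<integral>\<^sup>+y1. ennreal (\<Sum>j<n. env j y1) * kb z y2 y1 \<partial>M)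
          \<le> ennreal (indicator (E i) y2 * h y2) * ennreal (8 * CL * Dp / L z (d / 2))"
        proof (cases "y2 \<in> E i")
          case True
          have "d \<le> dist (c i) y2 + dist z y2" unfolding d_def by (metis dist_commute dist_triangle)
          then have dd: "d / 2 \<le> dist z y2" using E_dist[OF i True] d6 by linarith
          then have "z \<noteq> y2" using d0 by auto
          have m: "(\<lambda>y. ennreal (\<Sum>i<n. env i y)) \<in> borel_measurable M"
            by (intro measurable_compose[OF _ measurable_ennreal] borel_measurable_sum) auto
          have "(\<integral>\<^sup>+y1. ennreal (\<Sum>j<n. env j y1) * kb z y2 y1 \<partial>M)
              \<le> ennreal (8 * CL * Dp / L z (dist z y2))"
            by (rule size_integral[OF m dominated_at_env Dp_nonneg \<open>z \<noteq> y2\<close>])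
          also have "\<dots> \<le> ennreal (8 * CL * Dp / L z (d / 2))"
            using Dp_nonneg CL Lp L_mono[OF _ dd, of z] d0
            by (intro ennreal_leI divide_left_mono mult_pos_pos) (auto intro: less_le_trans)
          finally show ?thesis by (rule mult_left_mono) simp
        qed simp
      qed
      also have "\<dots> = ennreal (e i) * ennreal (8 * CL * Dp / L z (d / 2))"
      proof -
        have "(\<integral>\<^sup>+y2. ennreal (indicator (E i) y2 * h y2) \<partial>M) = ennreal (e i)"
          unfolding e_def using h_nonneg hE_integrable[OF i] by (intro nn_integral_eq_integral) auto
        then show ?thesis using E_sets[OF i] by (simp add: nn_integral_multc)
      qed
      also have "\<dots> \<le> ennreal (e i) * (ennreal (8 * CL ^ 3 * Dp) * ennreal (1 / L (c i) d))"
      proof (rule mult_left_mono)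
        have "8 * CL * Dp * (1 / L z (d / 2)) \<le> 8 * CL * Dp * (CL\<^sup>2 / L (c i) d)"
          using recip_L_half[of "c i" z] d0 CL Dp_nonneg by (intro mult_left_mono) (auto simp: d_def)
        then have "8 * CL * Dp / L z (d / 2) \<le> 8 * CL ^ 3 * Dp * (1 / L (c i) d)"
          by (simp add: power2_eq_square power3_eq_cube ac_simps)
        then show "ennreal (8 * CL * Dp / L z (d / 2)) \<le> ennreal (8 * CL ^ 3 * Dp) * ennreal (1 / L (c i) d)"
          using CL Dp_nonneg L_pos[OF d0, of "c i"] by (subst ennreal_mult[symmetric]) (auto intro!: ennreal_leI simp: less_imp_le)
      qed simp
      also have "\<dots> \<le> ennreal (e i) * (ennreal (8 * CL ^ 3 * Dp) * near_sum (c i) (r i) (k i) z)"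
        using near_sum_ge[of "r i" "c i" z "k i"] r_pos[OF i] d2 d6 by (intro mult_left_mono) (auto simp: d_def)
      finally show ?thesis by (simp only: ac_simps)
    qed simp
  qed
  also have "\<dots> = ennreal (8 * CL ^ 3 * Dp) * (\<Sum>i<n. ennreal (e i) * near_sum (c i) (r i) (k i) z)"
    by (simp add: sum_distrib_left)
  finally show ?thesis .
qed

end

lemma ennreal_mult3:
  "0 \<le> a \<Longrightarrow> 0 \<le> b \<Longrightarrow> 0 \<le> c \<Longrightarrow> ennreal a * (ennreal b * ennreal c) = ennreal (a * (b * c))"
  by (simp add: ennreal_mult)

locale cz_term = cz_operator M p1 p2 p CT K T L CL CK \<omega> + cz_data M L CL n c r k E A h Ch Dp rho e env
  for M :: "'a::{metric_space, second_countable_topology} measure"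
    and p1 p2 p CT K T L CL CK \<omega> n c r k E A h Ch Dp rho e env
begin

lemma recip_L_near:
  assumes "j < n" "dist (c j) z < 2 * rho j"
  shows "1 / L z (rho j) \<le> CL\<^sup>2 / L (c j) (rho j)"
proof -
  have \<rho>: "0 < rho j" by (rule rho_pos[OF assms(1)])
  have "L (c j) (rho j) \<le> L (c j) (2 * rho j)" using \<rho> by (intro L_mono) auto
  also have "\<dots> \<le> CL * L z (2 * rho j)" using \<rho> assms(2) by (intro L_comp) auto
  also have "\<dots> \<le> CL * (CL * L z (rho j))" using L_double[OF \<rho>, of z] CL by (intro mult_left_mono) auto
  finally show ?thesis
    using L_pos[OF \<rho>, of "c j"] L_pos[OF \<rho>, of z] by (simp add: field_simps power2_eq_square)
qed

definition bad_const :: real where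
  "bad_const = CK * (32 * CL ^ 3 * (2 * Ch + Dp))"

lemma bad_const_nonneg: "0 \<le> bad_const"
  unfolding bad_const_def using CK CL Ch Dp_nonneg by auto

text \<open>The function \<open>v\<close> stands for the good part and the substitutes made so far,
  \<open>w\<close> for pieces with index at least \<open>j\<close>. Only the substitute of piece
  \<open>j\<close> against \<open>v\<close> near its ball escapes pointwise bounds; this term is
  kept on the right for the \<open>L^p\<close> estimate.\<close>

lemma T_bad_bound:
  assumes j: "j < n" and f: "in_Lp M p1 f" "\<And>x. cmod (f x) \<le> h x"
    and v: "in_Lp M p2 v" "\<And>x. cmod (v x) \<le> h x + (\<Sum>i<n. env i x)"
    and w: "in_Lp M p2 w" "\<And>x. cmod (w x) \<le> indicator (\<Union>i\<in>{j..<n}. E i) x * h x"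
  shows "AE z in M. good z \<longrightarrow> ennreal (cmod (T (bad j f) (\<lambda>x. v x + w x) z)) \<le>
    ennreal bad_const * (ennreal (e j) * profile \<omega> j z) + ennreal CK * overlap j z +
    indicator (ball (c j) (2 * rho j)) z * ennreal (cmod (T (phi j f) (\<lambda>x. indicator (ball (c j) (4 * rho j)) x * v x) z))"
proof -
  define F where "F x = v x + w x" for x
  \<comment> \<open>\<open>W\<close> drops from \<open>v\<close> what lies in the ball of radius
    \<open>4 * rho j\<close> but keeps all of \<open>w\<close>. For \<open>w\<close> only the bound
    by \<open>h\<close> is known, so it must not enter the \<open>L^p\<close> estimate.\<close>
  define W where "W x = indicator (- ball (c j) (4 * rho j)) x * v x + w x" for x
  define V where "V x = indicator (ball (c j) (4 * rho j)) x * v x" for x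
  define Ef where "Ef x = indicator (E j) x * f x" for x
  define m where "m = 2 * Ch + Dp"
  have m: "0 \<le> m" using Ch Dp_nonneg by (simp add: m_def)
  have C: "bad_const = CK * (32 * CL ^ 3 * m)" by (simp add: bad_const_def m_def)
  have \<rho>: "0 < rho j" and rj: "0 < r j" "32 * r j \<le> rho j" using rho_pos[OF j] r_pos[OF j] r_rho[OF j] by auto
  have CLp: "1 \<le> CL ^ i" for i using CL by (rule one_le_power)
  note f_meas [measurable] = in_LpD(1)[OF f(1)] and [measurable] = in_LpD(1)[OF v(1)] in_LpD(1)[OF w(1)]
  note fm = f_meas f(2)
  have WLp: "in_Lp M p2 W" and VLp: "in_Lp M p2 V" and FLp: "in_Lp M p2 F"
    unfolding W_def V_def F_def using v w sets.compl_sets[OF ball_sets_M, of "c j" "4 * rho j"]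
    by (auto intro!: in_Lp_add in_Lp_indicator simp: Compl_eq_Diff_UNIV)
  have EfLp: "in_Lp M p1 Ef" unfolding Ef_def using f(1) E_sets[OF j] by (intro in_Lp_indicator) auto
  have phiLp: "in_Lp M p1 (phi j f)" by (rule phi_in_Lp[OF fm j]) simp
  have badLp: "in_Lp M p1 (bad j f)" by (rule bad_in_Lp[OF fm j _ f(1)]) simp
  note [measurable] = in_LpD(1)[OF WLp] in_LpD(1)[OF VLp] in_LpD(1)[OF FLp] in_LpD(1)[OF EfLp] in_LpD(1)[OF phiLp] E_sets[OF j]
  have w_le: "cmod (w x) \<le> h x" for x
    using order_trans[OF w(2)[of x] mult_right_mono[OF indicator_le_1 h_nonneg]] by simp
  have env0: "0 \<le> (\<Sum>i<n. env i x)" for x using env_nonneg by (intro sum_nonneg) auto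
  have F_le: "cmod (F x) \<le> 2 * h x + (\<Sum>i<n. env i x)" for x
    unfolding F_def using norm_triangle_ineq[of "v x" "w x"] v(2)[of x] w_le[of x] by linarith
  have W_le: "cmod (W x) \<le> 2 * h x + (\<Sum>i<n. env i x)" for x
    unfolding W_def using norm_triangle_ineq[of "indicator (- ball (c j) (4 * rho j)) x * v x" "w x"] v(2)[of x] w_le[of x] h_nonneg[of x] env0[of x]
    by (auto simp: indicator_def split: if_splits)
  have far: "AE z in M. 2 * rho j \<le> dist (c j) z \<longrightarrow> (\<forall>m\<ge>0. dominated_at (\<lambda>y. ennreal (cmod (F y))) m z \<longrightarrow>
    ennreal (cmod (T (bad j f) F z)) \<le> ennreal (CK * \<omega> (rho j / dist (c j) z) * (\<integral>y. cmod (bad j f y) \<partial>M) * (8 * CL * m / L z (dist z (c j)))))"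
    using bad_integrable[OF fm j] bad_integral[OF fm j] bad_supp[OF fm j] \<rho>
    by (intro T_cancellation_bound badLp FLp) auto
  define U1 where "U1 = {z. 4 * r j < dist (c j) z}"
  have "open U1" unfolding U1_def by (intro open_Collect_less continuous_intros)
  then have near1: "AE z in M. z \<in> U1 \<longrightarrow> ennreal (cmod (T Ef F z)) \<le> ennreal CK * size_form Ef F z"
    using E_dist[OF j] rj by (intro T_size_bound EfLp FLp) (fastforce simp: U1_def Ef_def indicator_def)+
  \<comment> \<open>On \<open>U2\<close> the function \<open>W\<close> vanishes: the cut removes
    \<open>v\<close>, and the points are too far from every \<open>c i\<close> to belong to a piece.
    Hence the kernel represents \<open>T\<close> there although \<open>phi j f\<close> may be
    nonzero.\<close>
  define U2 where "U2 = ball (c j) (3 * rho j) \<inter> (\<Inter>i\<in>{..<n}. {z. 4 * r i < dist (c i) z})"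
  have "open U2"
    unfolding U2_def by (intro open_Int open_ball open_INT ballI open_Collect_less continuous_intros) auto
  moreover have "W x = 0" if "x \<in> U2" for x
  proof -
    have "x \<notin> (\<Union>i\<in>{j..<n}. E i)"
    proof
      assume "x \<in> (\<Union>i\<in>{j..<n}. E i)"
      then obtain i where i: "i < n" "x \<in> E i" by auto
      have "4 * r i < dist (c i) x" using that i(1) by (auto simp: U2_def)
      then show False using E_dist[OF i] r_pos[OF i(1)] by linarith
    qed
    then have "w x = 0" using w(2)[of x] by simp
    moreover have "x \<in> ball (c j) (4 * rho j)" using that \<rho> by (auto simp: U2_def)
    ultimately show ?thesis by (simp add: W_def)
  qed
  ultimately have near2: "AE z in M. z \<in> U2 \<longrightarrow> ennreal (cmod (T (phi j f) W z)) \<le> ennreal CK * size_form (phi j f) W z"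
    by (intro T_size_bound phiLp WLp) auto
  have "AE z in M. T (bad j f) F z = T Ef F z - T (phi j f) F z"
    using T_diff1[OF EfLp phiLp FLp] by (simp add: bad_def[abs_def] Ef_def)
  moreover have "AE z in M. T (phi j f) F z = T (phi j f) V z + T (phi j f) W z"
  proof -
    have "F = (\<lambda>x. V x + W x)" by (auto simp: F_def V_def W_def indicator_def)
    then show ?thesis using T_add2[OF phiLp VLp WLp] by simp
  qed
  ultimately have lin: "AE z in M. T (bad j f) F z = T Ef F z - T (phi j f) V z - T (phi j f) W z"
    by eventually_elim simp
  show ?thesis
    unfolding F_def[symmetric] V_def[symmetric]
    using far near1 near2 lin
  proof (eventually_elim, intro impI)
    fix z
    assume far: "2 * rho j \<le> dist (c j) z \<longrightarrow> (\<forall>m\<ge>0. dominated_at (\<lambda>y. ennreal (cmod (F y))) m z \<longrightarrow>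
        ennreal (cmod (T (bad j f) F z)) \<le> ennreal (CK * \<omega> (rho j / dist (c j) z) * (\<integral>y. cmod (bad j f y) \<partial>M) * (8 * CL * m / L z (dist z (c j)))))"
      and near1: "z \<in> U1 \<longrightarrow> ennreal (cmod (T Ef F z)) \<le> ennreal CK * size_form Ef F z"
      and near2: "z \<in> U2 \<longrightarrow> ennreal (cmod (T (phi j f) W z)) \<le> ennreal CK * size_form (phi j f) W z"
      and lin: "T (bad j f) F z = T Ef F z - T (phi j f) V z - T (phi j f) W z"
      and z: "good z"
    define d where "d = dist (c j) z"
    have d6: "6 * r j \<le> d" using z j by (simp add: good_def d_def)
    have d0: "0 < d" using d6 rj by linarith
    have Lc: "0 < L (c j) d" "0 < L z d" using d0 by (auto intro: L_pos)
    have domF: "dominated_at (\<lambda>y. ennreal (cmod (F y))) m z" and domW: "dominated_at (\<lambda>y. ennreal (cmod (W y))) m z"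
      using good_dominated[OF z] F_le W_le unfolding m_def by (auto elim!: dominated_at_mono intro: ennreal_leI)
    show "ennreal (cmod (T (bad j f) F z)) \<le> ennreal bad_const * (ennreal (e j) * profile \<omega> j z) + ennreal CK * overlap j z +
        indicator (ball (c j) (2 * rho j)) z * ennreal (cmod (T (phi j f) V z))"
    proof (cases "2 * rho j \<le> d")
      case True
      define om where "om = \<omega> (rho j / d)"
      have om: "0 \<le> om" unfolding om_def using \<rho> d0 by (intro omega_nonneg) auto
      have "L (c j) d \<le> CL * L z d" using d0 by (intro L_comp) (auto simp: d_def)
      then have rec: "1 / L z d \<le> CL / L (c j) d" using Lc by (simp add: field_simps)
      have "ennreal (cmod (T (bad j f) F z)) \<le> ennreal (CK * om * (\<integral>y. cmod (bad j f y) \<partial>M) * (8 * CL * m / L z d))"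
        using far True m domF by (simp add: d_def om_def dist_commute)
      also have "\<dots> \<le> ennreal (bad_const * (e j * (om / L (c j) d)))"
      proof (rule ennreal_leI)
        have "CK * om * (\<integral>y. cmod (bad j f y) \<partial>M) * (8 * CL * m / L z d)
            \<le> CK * om * (2 * e j) * (8 * CL * m * (CL / L (c j) d))"
        proof (intro mult_mono mult_nonneg_nonneg)
          show "(\<integral>y. cmod (bad j f y) \<partial>M) \<le> 2 * e j" by (rule bad_norm[OF fm j])
          show "8 * CL * m / L z d \<le> 8 * CL * m * (CL / L (c j) d)"
            using mult_left_mono[OF rec, of "8 * CL * m"] CL m by simp
        qed (use CK om e_nonneg CL m Lc in auto)
        also have "\<dots> = CK * (16 * CL ^ 2 * m) * (e j * (om / L (c j) d))" by (simp add: power2_eq_square)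
        also have "\<dots> \<le> bad_const * (e j * (om / L (c j) d))"
        proof (rule mult_right_mono)
          have "CL ^ 2 \<le> CL ^ 3" using CL by (intro power_increasing) auto
          then have "16 * CL ^ 2 * m \<le> 32 * CL ^ 3 * m"
            using m CLp[of 3] by (intro mult_right_mono) auto
          then show "CK * (16 * CL ^ 2 * m) \<le> bad_const" unfolding C using CK by (intro mult_left_mono) auto
        qed (use e_nonneg om Lc in auto)
        finally show "CK * om * (\<integral>y. cmod (bad j f y) \<partial>M) * (8 * CL * m / L z d) \<le> bad_const * (e j * (om / L (c j) d))" .
      qed
      also have "\<dots> = ennreal bad_const * (ennreal (e j) * ennreal (om / L (c j) d))"
        using bad_const_nonneg e_nonneg[of j] om Lc by (intro ennreal_mult3[symmetric]) auto
      also have "\<dots> \<le> ennreal bad_const * (ennreal (e j) * profile \<omega> j z)"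
      proof (intro mult_left_mono)
        have "ennreal (om / L (c j) d) \<le> far_sum \<omega> (c j) (rho j) z"
          unfolding om_def d_def using omega_mono omega_0 \<rho> True by (intro far_sum_ge) (auto simp: d_def)
        then show "ennreal (om / L (c j) d) \<le> profile \<omega> j z"
          unfolding profile_def by (simp add: add_increasing2)
      qed auto
      finally show ?thesis by (simp add: add_increasing2)
    next
      case False
      \<comment> \<open>Inside the doubled ball the mean value zero is of no help, and the two parts
        of \<open>bad j f\<close> are estimated separately: the piece here, the substitute
        below.\<close>
      then have d2: "d < 2 * rho j" by simp
      have zb: "z \<in> ball (c j) (2 * rho j)" using d2 by (simp add: d_def)
      have fin1: "ennreal (cmod (T Ef F z)) \<le> ennreal bad_const * (ennreal (e j) * near_sum (c j) (r j) (k j) z)"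
      proof -
        have "z \<in> U1" using d6 rj by (simp add: U1_def d_def)
        then have "ennreal (cmod (T Ef F z)) \<le> ennreal CK * size_form Ef F z" using near1 by blast
        also have "ennreal CK * size_form Ef F z \<le> ennreal CK * (ennreal (e j) * ennreal (8 * CL * m / L z (d / 2)))"
        proof (rule mult_left_mono)
          have "size_form Ef F z \<le> nn_norm M Ef * ennreal (8 * CL * m / L z (d / 2))"
        proof (rule size_form_near[OF _ _ domF m])
          fix y assume "Ef y \<noteq> 0"
          then have "dist (c j) y < 3 * r j" using E_dist[OF j] by (auto simp: Ef_def indicator_def split: if_splits)
          then show "d / 2 \<le> dist z y" using d6 dist_triangle[of "c j" z y] by (simp add: d_def dist_commute)
        qed (use d0 in auto)
          also have "\<dots> \<le> ennreal (e j) * ennreal (8 * CL * m / L z (d / 2))"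
            using Ef_norm[OF fm j] Ef_integrable[OF fm j]
            by (intro mult_right_mono) (simp_all add: Ef_def[abs_def] nn_integral_eq_integral ennreal_leI)
          finally show "size_form Ef F z \<le> ennreal (e j) * ennreal (8 * CL * m / L z (d / 2))" .
        qed simp
        also have "ennreal CK * (ennreal (e j) * ennreal (8 * CL * m / L z (d / 2))) \<le> ennreal (bad_const * (e j * (1 / L (c j) d)))"
        proof -
          have Lz: "0 < L z (d / 2)" using d0 by (intro L_pos) auto
          have "8 * CL * m * (1 / L z (d / 2)) \<le> 8 * CL * m * (CL\<^sup>2 / L (c j) d)"
            using recip_L_half[of "c j" z] d0 CL m by (intro mult_left_mono) (auto simp: d_def)
          also have "\<dots> \<le> 32 * CL ^ 3 * m * (1 / L (c j) d)"
            using CL m Lc CLp[of 3] by (simp add: power2_eq_square power3_eq_cube field_simps)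
          finally have "CK * (e j * (8 * CL * m / L z (d / 2))) \<le> CK * (e j * (32 * CL ^ 3 * m * (1 / L (c j) d)))"
            using CK e_nonneg by (intro mult_left_mono) auto
          also have "\<dots> = bad_const * (e j * (1 / L (c j) d))" by (simp add: C)
          finally have "ennreal (CK * (e j * (8 * CL * m / L z (d / 2)))) \<le> ennreal (bad_const * (e j * (1 / L (c j) d)))"
            by (rule ennreal_leI)
          moreover have "0 \<le> 8 * CL * m / L z (d / 2)" using CL m Lz by auto
          ultimately show ?thesis using CK e_nonneg by (simp add: ennreal_mult3 del: times_divide_eq_right times_divide_eq_left)
        qed
        also have "\<dots> = ennreal bad_const * (ennreal (e j) * ennreal (1 / L (c j) d))"
          using bad_const_nonneg e_nonneg[of j] Lc by (intro ennreal_mult3[symmetric]) auto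
        also have "\<dots> \<le> ennreal bad_const * (ennreal (e j) * near_sum (c j) (r j) (k j) z)"
          using d2 d6 \<rho> rj by (intro mult_left_mono, unfold d_def, intro near_sum_ge) (auto simp: d_def rho_def)
        finally show ?thesis .
      qed
      define q where "q = ennreal (1 / L (c j) (rho j)) * indicator (ball (c j) (2 * rho j)) z"
      have fin2: "ennreal (cmod (T (phi j f) W z)) \<le> ennreal bad_const * (ennreal (e j) * q) + ennreal CK * overlap j z"
      proof -
        \<comment> \<open>\<open>g1\<close> is the part of \<open>W\<close> at distance at least
          \<open>rho j\<close> from \<open>z\<close>. What is left comes from pieces
          \<open>E i\<close> with \<open>j \<le> i\<close>; since \<open>rho j \<le> rho i\<close>
          and \<open>3 * r i < rho i\<close>, the point \<open>z\<close> lies in the doubled ball of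
          piece \<open>i\<close>. \<open>g2\<close> sums these pieces.\<close>
        define g1 where "g1 y = indicator {y. rho j \<le> dist z y} y * W y" for y
        define g2 where "g2 y = (\<Sum>i<n. indicator (ball (c i) (2 * rho i)) z * ennreal (indicator (E i) y * h y))" for y
        have [measurable]: "{y. rho j \<le> dist z y} \<in> sets M"
        proof -
          have "closed {y. rho j \<le> dist z y}" by (intro closed_Collect_le continuous_intros)
          then show ?thesis by (simp add: sets_M)
        qed
        have g1m [measurable]: "g1 \<in> borel_measurable M" unfolding g1_def by measurable
        have hE [measurable]: "(\<lambda>y. ennreal (indicator (E i) y * h y)) \<in> borel_measurable M" if "i < n" for i
          using E_sets[OF that] by measurable
        have g2m [measurable]: "g2 \<in> borel_measurable M"
          unfolding g2_def using hE by (intro borel_measurable_sum borel_measurable_times_ennreal) auto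
        have split: "ennreal (cmod (W y)) \<le> ennreal (cmod (g1 y)) + g2 y" for y
        proof (cases "rho j \<le> dist z y \<or> W y = 0")
          case True
          then show ?thesis by (auto simp: g1_def)
        next
          case False
          then have zy: "dist z y < rho j" and Wy: "W y \<noteq> 0" by auto
          have "dist (c j) y < 4 * rho j" using zy d2 dist_triangle[of "c j" y z] \<rho> by (simp add: d_def)
          then have Ww: "W y = w y" by (simp add: W_def)
          have "y \<in> (\<Union>i\<in>{j..<n}. E i)"
          proof (rule ccontr)
            assume "y \<notin> (\<Union>i\<in>{j..<n}. E i)"
            then have "indicator (\<Union>i\<in>{j..<n}. E i) y = (0::real)" by (rule indicator_simps(2))
            then show False using w(2)[of y] Wy Ww by simp
          qed
          then obtain i where i: "j \<le> i" "i < n" "y \<in> E i" by auto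
          have "dist (c i) z \<le> dist (c i) y + dist z y" by (metis dist_commute dist_triangle)
          also have "\<dots> < 2 * rho i"
            using E_dist[OF i(2,3)] zy rho_mono[OF i(1,2)] r_rho[OF i(2)] r_pos[OF i(2)] by linarith
          finally have zi: "z \<in> ball (c i) (2 * rho i)" by simp
          have "cmod (W y) \<le> h y" using Ww w_le by simp
          then have "ennreal (cmod (W y)) \<le> indicator (ball (c i) (2 * rho i)) z * ennreal (indicator (E i) y * h y)"
            using zi i(3) by (simp add: ennreal_leI)
          also have "\<dots> \<le> g2 y" unfolding g2_def using i(2)
            by (intro member_le_sum[of i "{..<n}" "\<lambda>i. indicator (ball (c i) (2 * rho i)) z * ennreal (indicator (E i) y * h y)"]) auto
          finally show ?thesis by (simp add: add_increasing)
        qed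
        have zU2: "z \<in> U2"
          using d2 \<rho> z r_pos by (fastforce simp: U2_def d_def good_def)
        have "size_form (phi j f) W z \<le> (\<integral>\<^sup>+y1. ennreal (cmod (phi j f y1)) * (\<integral>\<^sup>+y2. (ennreal (cmod (g1 y2)) + g2 y2) * kb z y1 y2 \<partial>M) \<partial>M)"
          unfolding size_form_def using split by (intro nn_integral_mono mult_left_mono mult_right_mono) auto
        also have "\<dots> = (\<integral>\<^sup>+y1. ennreal (cmod (phi j f y1)) * (\<integral>\<^sup>+y2. ennreal (cmod (g1 y2)) * kb z y1 y2 \<partial>M)
            + ennreal (cmod (phi j f y1)) * (\<integral>\<^sup>+y2. g2 y2 * kb z y1 y2 \<partial>M) \<partial>M)"
          by (intro nn_integral_cong) (simp add: distrib_right distrib_left nn_integral_add)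
        also have "\<dots> = size_form (phi j f) g1 z + (\<integral>\<^sup>+y1. ennreal (cmod (phi j f y1)) * (\<integral>\<^sup>+y2. g2 y2 * kb z y1 y2 \<partial>M) \<partial>M)"
          unfolding size_form_def
        proof (rule nn_integral_add)
          have "(\<lambda>w. g (snd w) * kb z (fst w) (snd w)) \<in> borel_measurable (M \<Otimes>\<^sub>M M)"
            if [measurable]: "g \<in> borel_measurable M" for g :: "'a \<Rightarrow> ennreal"
            by measurable
          then have *: "(\<lambda>y1. \<integral>\<^sup>+y2. g y2 * kb z y1 y2 \<partial>M) \<in> borel_measurable M"
            if "g \<in> borel_measurable M" for g :: "'a \<Rightarrow> ennreal"
            using that by (intro borel_measurable_nn_integral) (simp add: case_prod_beta')
          show "(\<lambda>y1. ennreal (cmod (phi j f y1)) * (\<integral>\<^sup>+y2. ennreal (cmod (g1 y2)) * kb z y1 y2 \<partial>M)) \<in> borel_measurable M"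
            "(\<lambda>y1. ennreal (cmod (phi j f y1)) * (\<integral>\<^sup>+y2. g2 y2 * kb z y1 y2 \<partial>M)) \<in> borel_measurable M"
            by (intro borel_measurable_times_ennreal * measurable_compose[OF _ measurable_ennreal]; measurable)+
        qed
        also have "\<dots> \<le> ennreal (e j) * ennreal (32 * CL * m / L z (rho j)) + overlap j z"
        proof (rule add_mono)
          have phin: "(\<integral>\<^sup>+y. ennreal (cmod (phi j f y)) \<partial>M) \<le> ennreal (e j)"
            unfolding env_nn_integral[OF j, symmetric] using phi_le[OF fm j] by (intro nn_integral_mono ennreal_leI)
          have "size_form (phi j f) g1 z \<le> (\<integral>\<^sup>+y. ennreal (cmod (phi j f y)) \<partial>M) * ennreal (32 * CL * m / L z (rho j))"
          proof (rule size_form_far[OF _ _ _ m \<rho>])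
            show "dominated_at (\<lambda>y. ennreal (cmod (g1 y))) m z"
              using domW by (rule dominated_at_mono) (auto simp: g1_def indicator_def)
          qed (auto simp: g1_def indicator_def split: if_splits)
          also have "\<dots> \<le> ennreal (e j) * ennreal (32 * CL * m / L z (rho j))" by (intro mult_right_mono phin) simp
          finally show "size_form (phi j f) g1 z \<le> ennreal (e j) * ennreal (32 * CL * m / L z (rho j))" .
          have "(\<integral>\<^sup>+y1. ennreal (cmod (phi j f y1)) * (\<integral>\<^sup>+y2. g2 y2 * kb z y1 y2 \<partial>M) \<partial>M)
              \<le> (\<integral>\<^sup>+y1. ennreal (env j y1) * (\<integral>\<^sup>+y2. g2 y2 * kb z y1 y2 \<partial>M) \<partial>M)"
            using phi_le[OF fm j] by (intro nn_integral_mono mult_right_mono ennreal_leI) auto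
          also have "\<dots> = (\<integral>\<^sup>+y1. \<integral>\<^sup>+y2. ennreal (env j y1) * (g2 y2 * kb z y1 y2) \<partial>M \<partial>M)"
            by (intro nn_integral_cong nn_integral_cmult[symmetric]) measurable
          \<comment> \<open>Fubini puts the pieces outside and the substitute inside, which is the
            form of \<open>overlap\<close> that can later be summed over \<open>j\<close>.\<close>
          also have "\<dots> = (\<integral>\<^sup>+y2. \<integral>\<^sup>+y1. ennreal (env j y1) * (g2 y2 * kb z y1 y2) \<partial>M \<partial>M)"
          proof (rule MM.Fubini'[symmetric])
            note [measurable] = env_measurable[OF j]
            have "(\<lambda>w. ennreal (env j (fst w)) * (g2 (snd w) * kb z (fst w) (snd w))) \<in> borel_measurable (M \<Otimes>\<^sub>M M)"
              by measurable
            then show "(\<lambda>(y1, y2). ennreal (env j y1) * (g2 y2 * kb z y1 y2)) \<in> borel_measurable (M \<Otimes>\<^sub>M M)"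
              by (simp add: case_prod_beta')
          qed
          also have "\<dots> = (\<integral>\<^sup>+y2. g2 y2 * (\<integral>\<^sup>+y1. ennreal (env j y1) * kb z y2 y1 \<partial>M) \<partial>M)"
          proof (rule nn_integral_cong)
            fix y2
            note [measurable] = env_measurable[OF j]
            have "(\<integral>\<^sup>+y1. ennreal (env j y1) * (g2 y2 * kb z y1 y2) \<partial>M)
                = (\<integral>\<^sup>+y1. g2 y2 * (ennreal (env j y1) * kb z y2 y1) \<partial>M)"
              by (intro nn_integral_cong) (simp add: kernel_bound_commute[of z y2] ac_simps)
            also have "\<dots> = g2 y2 * (\<integral>\<^sup>+y1. ennreal (env j y1) * kb z y2 y1 \<partial>M)"
              by (rule nn_integral_cmult) measurable
            finally show "(\<integral>\<^sup>+y1. ennreal (env j y1) * (g2 y2 * kb z y1 y2) \<partial>M)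
                = g2 y2 * (\<integral>\<^sup>+y1. ennreal (env j y1) * kb z y2 y1 \<partial>M)" .
          qed
          also have "\<dots> = (\<integral>\<^sup>+y2. (\<Sum>i<n. indicator (ball (c i) (2 * rho i)) z * (ennreal (indicator (E i) y2 * h y2) * (\<integral>\<^sup>+y1. ennreal (env j y1) * kb z y2 y1 \<partial>M))) \<partial>M)"
            by (intro nn_integral_cong) (simp add: g2_def sum_distrib_right mult.assoc)
          also have "\<dots> = overlap j z"
          proof -
            note [measurable] = env_measurable[OF j]
            have "(\<lambda>w. ennreal (env j (snd w)) * kb z (fst w) (snd w)) \<in> borel_measurable (M \<Otimes>\<^sub>M M)"
              by measurable
            then have km: "(\<lambda>y2. \<integral>\<^sup>+y1. ennreal (env j y1) * kb z y2 y1 \<partial>M) \<in> borel_measurable M"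
              by (intro borel_measurable_nn_integral) (simp add: case_prod_beta')
            have "(\<lambda>y2. ennreal (indicator (E i) y2 * h y2) * (\<integral>\<^sup>+y1. ennreal (env j y1) * kb z y2 y1 \<partial>M)) \<in> borel_measurable M"
              if "i < n" for i
              using hE[OF that] km by (rule borel_measurable_times_ennreal)
            then show ?thesis
              unfolding overlap_def by (subst nn_integral_sum) (auto simp: nn_integral_cmult)
          qed
          finally show "(\<integral>\<^sup>+y1. ennreal (cmod (phi j f y1)) * (\<integral>\<^sup>+y2. g2 y2 * kb z y1 y2 \<partial>M) \<partial>M) \<le> overlap j z" .
        qed
        finally have "ennreal CK * size_form (phi j f) W z \<le> ennreal CK * (ennreal (e j) * ennreal (32 * CL * m / L z (rho j)) + overlap j z)"
          by (rule mult_left_mono) simp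
        moreover have "ennreal CK * (ennreal (e j) * ennreal (32 * CL * m / L z (rho j))) \<le> ennreal bad_const * (ennreal (e j) * q)"
        proof -
          have Lz: "0 < L z (rho j)" "0 < L (c j) (rho j)" using \<rho> by (auto intro: L_pos)
          have "32 * CL * m * (1 / L z (rho j)) \<le> 32 * CL * m * (CL\<^sup>2 / L (c j) (rho j))"
            using recip_L_near[OF j, of z] d2 CL m by (intro mult_left_mono) (auto simp: d_def)
          also have "\<dots> = 32 * CL ^ 3 * m * (1 / L (c j) (rho j))"
            by (simp add: power2_eq_square power3_eq_cube)
          finally have "CK * (e j * (32 * CL * m / L z (rho j))) \<le> CK * (e j * (32 * CL ^ 3 * m * (1 / L (c j) (rho j))))"
            using CK e_nonneg by (intro mult_left_mono) auto
          also have "\<dots> = bad_const * (e j * (1 / L (c j) (rho j)))" by (simp add: C)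
          finally have "ennreal (CK * (e j * (32 * CL * m / L z (rho j)))) \<le> ennreal (bad_const * (e j * (1 / L (c j) (rho j))))"
            by (rule ennreal_leI)
          moreover have "0 \<le> 32 * CL * m / L z (rho j)" "0 \<le> 1 / L (c j) (rho j)" using CL m Lz by auto
          ultimately show ?thesis
            using CK e_nonneg[of j] bad_const_nonneg zb by (simp add: ennreal_mult3 q_def del: times_divide_eq_right times_divide_eq_left)
        qed
        ultimately have "ennreal CK * size_form (phi j f) W z \<le> ennreal bad_const * (ennreal (e j) * q) + ennreal CK * overlap j z"
          unfolding distrib_left by (meson add_right_mono order_trans)
        then show ?thesis using near2 zU2 by (blast intro: order_trans)
      qed
      have "cmod (T (bad j f) F z) \<le> cmod (T Ef F z) + cmod (T (phi j f) W z) + cmod (T (phi j f) V z)"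
        unfolding lin using norm_triangle_ineq4[of "T Ef F z - T (phi j f) V z" "T (phi j f) W z"] norm_triangle_ineq4[of "T Ef F z" "T (phi j f) V z"]
        by linarith
      then have "ennreal (cmod (T (bad j f) F z)) \<le> ennreal (cmod (T Ef F z)) + ennreal (cmod (T (phi j f) W z)) + ennreal (cmod (T (phi j f) V z))"
        by (simp add: ennreal_leI flip: ennreal_plus)
      also have "\<dots> \<le> ennreal bad_const * (ennreal (e j) * near_sum (c j) (r j) (k j) z)
          + (ennreal bad_const * (ennreal (e j) * q) + ennreal CK * overlap j z) + ennreal (cmod (T (phi j f) V z))"
        by (intro add_mono fin1 fin2) simp
      also have "\<dots> = ennreal bad_const * (ennreal (e j) * (near_sum (c j) (r j) (k j) z + q)) + ennreal CK * overlap j z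
          + indicator (ball (c j) (2 * rho j)) z * ennreal (cmod (T (phi j f) V z))"
        using zb by (simp add: distrib_left add.assoc add.commute add.left_commute)
      also have "\<dots> \<le> ennreal bad_const * (ennreal (e j) * profile \<omega> j z) + ennreal CK * overlap j z
          + indicator (ball (c j) (2 * rho j)) z * ennreal (cmod (T (phi j f) V z))"
        unfolding profile_def q_def[symmetric] by (intro add_right_mono mult_left_mono) (auto simp: add_increasing add.assoc)
      finally show ?thesis .
    qed
  qed
qed

text \<open>A substitute of height at most \<open>\<tau>\<close> and a bounded function, both cut to
  balls of comparable measure, have an image of \<open>L^p\<close> average of order
  \<open>\<tau>\<close>. The elementary inequality
  \<open>u \<le> \<tau> + \<tau> powr (1 - p) * u powr p\<close> replaces Hoelder's
  inequality.\<close>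

lemma phi_local_bound:
  assumes j: "j < n" and f: "in_Lp M p1 f" "\<And>x. cmod (f x) \<le> h x"
    and v: "in_Lp M p2 v" "AE x in M. cmod (v x) \<le> Dv" "0 \<le> Dv"
  shows "(\<integral>\<^sup>+z. indicator (ball (c j) (2 * rho j)) z * ennreal (cmod (T (phi j f) (\<lambda>x. indicator (ball (c j) (4 * rho j)) x * v x) z)) \<partial>M)
    \<le> ennreal (4 * CL ^ 5 * (1 + CT * Dv powr p) * e j)"
proof -
  define V where "V x = indicator (ball (c j) (4 * rho j)) x * v x" for x
  define m where "m = measure M (ball (c j) (32 * rho j))"
  define \<tau> where "\<tau> = e j / measure M (A j)"
  have \<rho>: "0 < rho j" by (rule rho_pos[OF j])
  note f_meas [measurable] = in_LpD(1)[OF f(1)] and [measurable] = in_LpD(1)[OF v(1)]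
  note fm = f_meas f(2)
  have VLp: "in_Lp M p2 V" unfolding V_def using v by (intro in_Lp_indicator) auto
  have phiLp: "in_Lp M p1 (phi j f)" by (rule phi_in_Lp[OF fm j]) simp
  have TLp: "in_Lp M p (T (phi j f) V)" by (rule T_Lp[OF phiLp VLp])
  note [measurable] = in_LpD(1)[OF VLp] in_LpD(1)[OF phiLp] in_LpD(1)[OF TLp]
  have \<tau>0: "0 \<le> \<tau>" unfolding \<tau>_def using e_nonneg by auto
  have mball: "measure M (ball (c j) s) \<le> m" if "s \<le> 32 * rho j" for s
    unfolding m_def using that fin_ball by (intro measure_mono_fmeasurable subset_ball) (auto simp: fmeasurable_def)
  have m0: "0 \<le> m" by (simp add: m_def)
  \<comment> \<open>Doubling at radius \<open>rho j\<close> and the lower bound for the measure of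
    \<open>A j\<close> turn \<open>\<tau> * m\<close> into a multiple of the mass
    \<open>e j\<close>.\<close>
  have "m \<le> 2 * CL ^ 5 * measure M (ball (c j) (rho j))" using doub[OF j] by (simp add: m_def rho_def mult.assoc)
  also have "\<dots> \<le> 2 * CL ^ 5 * (2 * measure M (A j))" using CL A_large[OF j] by (intro mult_left_mono) auto
  finally have "\<tau> * m \<le> \<tau> * (4 * CL ^ 5 * measure M (A j))" using \<tau>0 by (intro mult_left_mono) auto
  then have \<tau>m: "\<tau> * m \<le> 4 * CL ^ 5 * e j" using A_pos[OF j] by (simp add: \<tau>_def ac_simps)
  show ?thesis
  proof (cases "\<tau> = 0")
    \<comment> \<open>The negative power of \<open>\<tau>\<close> in the main case needs
      \<open>\<tau>\<close> positive; for \<open>\<tau> = 0\<close> the substitute vanishes.\<close>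
    case True
    then have "phi j f x = 0" for x
      using phi_le[OF fm j, of x] by (auto simp: env_def \<tau>_def)
    then have "AE x in M. T (phi j f) V x = 0" by (intro T_zero phiLp VLp) auto
    then have "(\<integral>\<^sup>+z. indicator (ball (c j) (2 * rho j)) z * ennreal (cmod (T (phi j f) V z)) \<partial>M) = (\<integral>\<^sup>+z. 0 \<partial>M)"
      by (intro nn_integral_cong_AE) (auto elim: eventually_mono)
    then show ?thesis by (simp add: V_def[abs_def])
  next
    case False
    then have \<tau>p: "0 < \<tau>" using \<tau>0 by simp
    define I where "I = (\<integral>z. cmod (T (phi j f) V z) powr p \<partial>M)"
    have I0: "0 \<le> I" by (simp add: I_def)
    have "p / p1 + p / p2 = p * (1 / p1 + 1 / p2)" by (simp add: distrib_left)
    then have pe: "p / p1 + p / p2 = 1" unfolding exps(4)[symmetric] by simp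
    have p0: "p1 \<noteq> 0" "p2 \<noteq> 0" using exps by auto
    have I_le: "I \<le> CT * (\<tau> powr p * Dv powr p * m)"
    proof -
      have "(\<integral>x. cmod (phi j f x) powr p1 \<partial>M) \<le> (\<integral>x. \<tau> powr p1 * indicator (ball (c j) (rho j)) x \<partial>M)"
      proof (rule integral_mono)
        show "cmod (phi j f x) powr p1 \<le> \<tau> powr p1 * indicator (ball (c j) (rho j)) x" for x
        proof (cases "phi j f x = 0")
          case False
          then have "x \<in> ball (c j) (rho j)" using phi_supp[OF fm j] by simp
          moreover have "cmod (phi j f x) \<le> \<tau>"
            using phi_le[OF fm j, of x] \<tau>0 by (auto simp: env_def \<tau>_def indicator_def split: if_splits intro: order_trans)
          ultimately show ?thesis by (auto intro: powr_mono2)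
        qed simp
      qed (use phiLp fin_ball in \<open>auto intro!: integrable_mult_right integrable_real_indicator\<close>)
      also have "\<dots> \<le> \<tau> powr p1 * m" using mball[of "rho j"] \<rho> by (auto intro!: mult_left_mono)
      finally have 1: "(\<integral>x. cmod (phi j f x) powr p1 \<partial>M) \<le> \<tau> powr p1 * m" .
      have "(\<integral>x. cmod (V x) powr p2 \<partial>M) \<le> (\<integral>x. Dv powr p2 * indicator (ball (c j) (4 * rho j)) x \<partial>M)"
      proof (rule integral_mono_AE)
        show "AE x in M. cmod (V x) powr p2 \<le> Dv powr p2 * indicator (ball (c j) (4 * rho j)) x"
          using v(2) by eventually_elim (auto simp: V_def indicator_def intro: powr_mono2)
      qed (use VLp fin_ball in \<open>auto intro!: integrable_mult_right integrable_real_indicator\<close>)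
      also have "\<dots> \<le> Dv powr p2 * m" using mball[of "4 * rho j"] \<rho> by (auto intro!: mult_left_mono)
      finally have 2: "(\<integral>x. cmod (V x) powr p2 \<partial>M) \<le> Dv powr p2 * m" .
      have "I \<le> CT * (\<integral>x. cmod (phi j f x) powr p1 \<partial>M) powr (p / p1) * (\<integral>x. cmod (V x) powr p2 \<partial>M) powr (p / p2)"
        unfolding I_def by (rule T_bound[OF phiLp VLp])
      also have "\<dots> \<le> CT * (\<tau> powr p1 * m) powr (p / p1) * (Dv powr p2 * m) powr (p / p2)"
        using CT 1 2 by (intro mult_mono mult_nonneg_nonneg powr_mono2) auto
      also have "(\<tau> powr p1 * m) powr (p / p1) = \<tau> powr p * m powr (p / p1)"
        using m0 p0 by (simp add: powr_mult powr_powr)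
      also have "(Dv powr p2 * m) powr (p / p2) = Dv powr p * m powr (p / p2)"
        using m0 p0 by (simp add: powr_mult powr_powr)
      also have "CT * (\<tau> powr p * m powr (p / p1)) * (Dv powr p * m powr (p / p2)) = CT * (\<tau> powr p * Dv powr p * m)"
      proof -
        have "m powr (p / p1) * m powr (p / p2) = m" using m0 pe by (simp flip: powr_add)
        then show ?thesis by (metis (no_types, lifting) mult.assoc mult.left_commute)
      qed
      finally show ?thesis .
    qed
    have pw: "cmod u \<le> \<tau> + \<tau> powr (1 - p) * cmod u powr p" for u
    proof (cases "cmod u \<le> \<tau>")
      case False
      have "cmod u = cmod u powr (1 - p) * cmod u powr p" using False \<tau>p by (simp flip: powr_add)
      also have "\<dots> \<le> \<tau> powr (1 - p) * cmod u powr p"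
        using False \<tau>p exps(3) by (intro mult_right_mono powr_mono2') auto
      finally show ?thesis using \<tau>p by linarith
    qed (simp add: add_increasing2)
    have "(\<integral>\<^sup>+z. indicator (ball (c j) (2 * rho j)) z * ennreal (cmod (T (phi j f) V z)) \<partial>M)
        \<le> (\<integral>\<^sup>+z. ennreal \<tau> * indicator (ball (c j) (2 * rho j)) z + ennreal (\<tau> powr (1 - p)) * ennreal (cmod (T (phi j f) V z) powr p) \<partial>M)"
    proof (rule nn_integral_mono)
      fix z
      have "ennreal (cmod (T (phi j f) V z)) \<le> ennreal \<tau> + ennreal (\<tau> powr (1 - p)) * ennreal (cmod (T (phi j f) V z) powr p)"
        using pw[of "T (phi j f) V z"] \<tau>0 by (simp add: ennreal_leI flip: ennreal_mult ennreal_plus)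
      then show "indicator (ball (c j) (2 * rho j)) z * ennreal (cmod (T (phi j f) V z))
          \<le> ennreal \<tau> * indicator (ball (c j) (2 * rho j)) z + ennreal (\<tau> powr (1 - p)) * ennreal (cmod (T (phi j f) V z) powr p)"
        by (auto simp: indicator_def)
    qed
    also have "\<dots> = ennreal \<tau> * emeasure M (ball (c j) (2 * rho j)) + ennreal (\<tau> powr (1 - p)) * (\<integral>\<^sup>+z. ennreal (cmod (T (phi j f) V z) powr p) \<partial>M)"
      by (simp add: nn_integral_add nn_integral_cmult nn_integral_cmult_indicator)
    also have "(\<integral>\<^sup>+z. ennreal (cmod (T (phi j f) V z) powr p) \<partial>M) = ennreal I"
      unfolding I_def using TLp by (intro nn_integral_eq_integral) auto
    also have "ennreal \<tau> * emeasure M (ball (c j) (2 * rho j)) + ennreal (\<tau> powr (1 - p)) * ennreal I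
        = ennreal (\<tau> * measure M (ball (c j) (2 * rho j)) + \<tau> powr (1 - p) * I)"
      unfolding emeasure_ball using \<tau>0 I0 by (simp add: ennreal_mult ennreal_plus)
    also have "\<dots> \<le> ennreal (4 * CL ^ 5 * (1 + CT * Dv powr p) * e j)"
    proof (rule ennreal_leI)
      have "\<tau> * measure M (ball (c j) (2 * rho j)) + \<tau> powr (1 - p) * I \<le> \<tau> * m + \<tau> powr (1 - p) * (CT * (\<tau> powr p * Dv powr p * m))"
        using \<tau>0 mball[of "2 * rho j"] \<rho> I_le by (intro add_mono mult_left_mono) auto
      also have "\<tau> powr (1 - p) * (CT * (\<tau> powr p * Dv powr p * m)) = (\<tau> powr (1 - p) * \<tau> powr p) * (CT * Dv powr p * m)"
        by simp
      also have "\<tau> powr (1 - p) * \<tau> powr p = \<tau>" using \<tau>p by (simp flip: powr_add)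
      also have "\<tau> * m + \<tau> * (CT * Dv powr p * m) = (1 + CT * Dv powr p) * (\<tau> * m)" by (simp add: algebra_simps)
      also have "\<dots> \<le> (1 + CT * Dv powr p) * (4 * CL ^ 5 * e j)" using \<tau>m CT by (intro mult_left_mono) auto
      finally show "\<tau> * measure M (ball (c j) (2 * rho j)) + \<tau> powr (1 - p) * I \<le> 4 * CL ^ 5 * (1 + CT * Dv powr p) * e j"
        by (simp add: ac_simps)
    qed
    finally show ?thesis by (simp add: V_def[abs_def])
  qed
qed

end

section \<open>Replacing the pieces one by one\<close>

context cz_term
begin

text \<open>The function once the pieces below \<open>j\<close> have been replaced. The grouping
  separates the roles of \<open>v\<close> and \<open>w\<close> in
  \<open>T_bad_bound\<close>.\<close>

definition stage :: "('a \<Rightarrow> complex) \<Rightarrow> ('a \<Rightarrow> complex) \<Rightarrow> nat \<Rightarrow> 'a \<Rightarrow> complex" where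
  "stage g f j x = (g x + (\<Sum>i<j. phi i f x)) + (\<Sum>i\<in>{j..<n}. indicator (E i) x * f x)"

lemma stage_Suc: "j < n \<Longrightarrow> stage g f (Suc j) = (\<lambda>x. stage g f j x - bad j f x)"
proof
  fix x assume "j < n"
  moreover define s where "s = (\<Sum>i\<in>{Suc j..<n}. indicator (E i) x * f x)"
  ultimately have "(\<Sum>i\<in>{j..<n}. indicator (E i) x * f x) = indicator (E j) x * f x + s"
    by (simp only: sum.atLeast_Suc_lessThan)
  then show "stage g f (Suc j) x = stage g f j x - bad j f x"
    unfolding stage_def bad_def s_def[symmetric] by simp
qed

lemma stage_in_Lp:
  assumes f: "in_Lp M q f" "\<And>x. cmod (f x) \<le> h x" and g: "in_Lp M q g" and q: "1 \<le> q" and j: "j \<le> n"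
  shows "in_Lp M q (\<lambda>x. g x + (\<Sum>i<j. phi i f x))" "in_Lp M q (\<lambda>x. \<Sum>i\<in>{j..<n}. indicator (E i) x * f x)"
    "in_Lp M q (stage g f j)"
proof -
  note fm = in_LpD(1)[OF f(1)] f(2)
  show 1: "in_Lp M q (\<lambda>x. g x + (\<Sum>i<j. phi i f x))"
    using g q j by (intro in_Lp_add in_Lp_sum phi_in_Lp[OF fm]) auto
  show 2: "in_Lp M q (\<lambda>x. \<Sum>i\<in>{j..<n}. indicator (E i) x * f x)"
    using f q E_sets by (intro in_Lp_sum in_Lp_indicator) auto
  show "in_Lp M q (stage g f j)"
    unfolding stage_def[abs_def] using in_Lp_add(1)[OF 1 2] q by simp
qed

lemma sum_phi_le:
  assumes "f \<in> borel_measurable M" "\<And>x. cmod (f x) \<le> h x" "j \<le> n"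
  shows "cmod (\<Sum>i<j. phi i f x) \<le> (\<Sum>i<n. env i x)"
proof -
  have "cmod (\<Sum>i<j. phi i f x) \<le> (\<Sum>i<j. env i x)"
    using assms phi_le[OF assms(1,2)] by (intro sum_norm_le) auto
  also have "\<dots> \<le> (\<Sum>i<n. env i x)" using assms(3) env_nonneg by (intro sum_mono2) auto
  finally show ?thesis .
qed

lemma sum_indicator_le:
  assumes "\<And>x. cmod (f x) \<le> h x" "j \<le> i"
  shows "cmod (\<Sum>l\<in>{i..<n}. indicator (E l) x * f x) \<le> indicator (\<Union>l\<in>{j..<n}. E l) x * h x"
proof -
  have d: "disjoint_family_on E {i..<n}" using E_disj by (rule disjoint_family_on_mono[rotated]) auto
  have "(\<Sum>l\<in>{i..<n}. indicator (E l) x * f x) = indicator (\<Union>l\<in>{i..<n}. E l) x * f x"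
    by (simp only: indicator_UN_disjoint[OF finite_atLeastLessThan d] sum_distrib_right)
  also have "cmod \<dots> = indicator (\<Union>l\<in>{i..<n}. E l) x * cmod (f x)" by (rule cmod_indicator_mult)
  also have "\<dots> \<le> indicator (\<Union>l\<in>{j..<n}. E l) x * h x"
  proof (rule mult_mono)
    have "(\<Union>l\<in>{i..<n}. E l) \<subseteq> (\<Union>l\<in>{j..<n}. E l)" using assms(2) by (intro UN_mono) auto
    then show "indicator (\<Union>l\<in>{i..<n}. E l) x \<le> (indicator (\<Union>l\<in>{j..<n}. E l) x :: real)"
      by (meson indicator_leI subsetD)
  qed (use assms(1) in auto)
  finally show ?thesis .
qed

text \<open>In each step the first argument is changed before the second, so the second error term
  sees the first argument at stage \<open>Suc j\<close>. Its unreplaced pieces start at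
  \<open>Suc j\<close>, still within what \<open>T_bad_bound\<close> allows.\<close>

lemma telescoping:
  assumes f1: "in_Lp M p1 f1" "\<And>x. cmod (f1 x) \<le> h x" and f2: "in_Lp M p2 f2" "\<And>x. cmod (f2 x) \<le> h x"
    and g: "in_Lp M p1 g1" "in_Lp M p2 g2" and i: "i \<le> n"
  shows "AE z in M. T (stage g1 f1 0) (stage g2 f2 0) z = T (stage g1 f1 i) (stage g2 f2 i) z +
    (\<Sum>j<i. T (bad j f1) (stage g2 f2 j) z + T (stage g1 f1 (Suc j)) (bad j f2) z)"
  using i
proof (induction i)
  case (Suc i)
  then have i: "i < n" by simp
  have s1: "in_Lp M p1 (stage g1 f1 j)" if "j \<le> n" for j by (rule stage_in_Lp(3)[OF f1 g(1) _ that]) simp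
  have s2: "in_Lp M p2 (stage g2 f2 j)" if "j \<le> n" for j by (rule stage_in_Lp(3)[OF f2 g(2) _ that]) simp
  have b1: "in_Lp M p1 (bad i f1)" by (rule bad_in_Lp[OF in_LpD(1)[OF f1(1)] f1(2) i _ f1(1)]) simp
  have b2: "in_Lp M p2 (bad i f2)" by (rule bad_in_Lp[OF in_LpD(1)[OF f2(1)] f2(2) i _ f2(1)]) simp
  have "AE z in M. T (stage g1 f1 (Suc i)) (stage g2 f2 i) z = T (stage g1 f1 i) (stage g2 f2 i) z - T (bad i f1) (stage g2 f2 i) z"
    unfolding stage_Suc[OF i] using i by (intro T_diff1 s1 s2 b1) auto
  moreover have "AE z in M. T (stage g1 f1 (Suc i)) (stage g2 f2 (Suc i)) z
      = T (stage g1 f1 (Suc i)) (stage g2 f2 i) z - T (stage g1 f1 (Suc i)) (bad i f2) z"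
    unfolding stage_Suc[OF i, of g2 f2] using i by (intro T_diff2 s1 s2 b2) auto
  moreover have "AE z in M. T (stage g1 f1 0) (stage g2 f2 0) z = T (stage g1 f1 i) (stage g2 f2 i) z +
    (\<Sum>j<i. T (bad j f1) (stage g2 f2 j) z + T (stage g1 f1 (Suc j)) (bad j f2) z)"
    using Suc by simp
  ultimately show ?case by eventually_elim simp
qed simp

text \<open>In order: the \<open>L^p\<close> bound for the fully replaced functions, the pointwise
  errors from \<open>profile\<close> and \<open>overlap\<close>, and the local \<open>L^p\<close>
  estimates. The last two are counted once for each argument.\<close>

definition step_const :: "real \<Rightarrow> real" where
  "step_const Dv = 2 * CT * Dv powr (2 * p)
     + (2 * bad_const + 16 * CK * CL ^ 3 * Dp) * (CL * (\<Sum>i. \<omega> ((1 / 2) ^ Suc i)) + 4 * CL ^ 5 + CL)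
     + 8 * CL ^ 5 * (1 + CT * Dv powr p)"

text \<open>The fully replaced functions are bounded by \<open>Dv\<close> and have at most twice the
  mass of \<open>h\<close>, so interpolation puts them into every \<open>L^q\<close>. The relation
  \<open>p / p1 + p / p2 = 1\<close> makes the outcome linear in the mass.\<close>

lemma good_part_bound:
  assumes f1: "in_Lp M p1 f1" "\<And>x. cmod (f1 x) \<le> h x" and f2: "in_Lp M p2 f2" "\<And>x. cmod (f2 x) \<le> h x"
    and g1: "in_Lp M p1 g1" "\<And>x. cmod (g1 x) \<le> h x" "AE x in M. cmod (g1 x) \<le> C0"
    and g2: "in_Lp M p2 g2" "\<And>x. cmod (g2 x) \<le> h x" "AE x in M. cmod (g2 x) \<le> C0"
    and Dv: "Dv = C0 + Dp" "1 \<le> Dv"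
  shows "(\<integral>\<^sup>+z. ennreal (cmod (T (stage g1 f1 n) (stage g2 f2 n) z) powr p) \<partial>M) \<le> ennreal (2 * CT * Dv powr (2 * p) * (\<integral>x. h x \<partial>M))"
proof -
  define H where "H = (\<integral>x. h x \<partial>M)"
  have H0: "0 \<le> H" unfolding H_def using h_nonneg by (intro integral_nonneg_AE) auto
  have Iq: "(\<integral>x. cmod (stage g f n x) powr q \<partial>M) \<le> Dv powr q * (2 * H)"
    if f: "in_Lp M q f" "\<And>x. cmod (f x) \<le> h x" and g: "in_Lp M q g" "\<And>x. cmod (g x) \<le> h x" "AE x in M. cmod (g x) \<le> C0"
      and q: "1 \<le> q" for f g q
  proof -
    note [measurable] = in_LpD(1)[OF f(1)] in_LpD(1)[OF g(1)]
    have fm: "f \<in> borel_measurable M" by simp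
    have st: "stage g f n x = g x + (\<Sum>i<n. phi i f x)" for x by (simp add: stage_def)
    have gi: "integrable M g"
      by (rule Bochner_Integration.integrable_bound[OF h_int]) (use g(2) h_nonneg in auto)
    have si: "integrable M (stage g f n)"
      unfolding st[abs_def]
      by (intro Bochner_Integration.integrable_add gi Bochner_Integration.integrable_sum phi_integrable[OF fm f(2)]) auto
    have "AE x in M. cmod (stage g f n x) \<le> Dv"
      using g(3)
    proof eventually_elim
      case (elim x)
      then show ?case
        unfolding st using norm_triangle_ineq[of "g x" "\<Sum>i<n. phi i f x"] sum_phi_le[OF fm f(2) order_refl, of x] Dp[of x] Dv by linarith
    qed
    then have "(\<integral>x. cmod (stage g f n x) powr q \<partial>M) \<le> Dv powr (q - 1) * (\<integral>x. cmod (stage g f n x) \<partial>M)"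
      using si q Dv by (intro in_Lp_bounded) auto
    also have "\<dots> \<le> Dv powr q * (2 * H)"
    proof (rule mult_mono)
      show "Dv powr (q - 1) \<le> Dv powr q" using Dv by (intro powr_mono) auto
      have "(\<integral>x. cmod (stage g f n x) \<partial>M) \<le> (\<integral>x. h x + (\<Sum>i<n. env i x) \<partial>M)"
      proof (intro integral_mono integrable_norm si Bochner_Integration.integrable_add h_int Bochner_Integration.integrable_sum env_integrable)
        show "cmod (stage g f n x) \<le> h x + (\<Sum>i<n. env i x)" for x
          unfolding st using norm_triangle_ineq[of "g x" "\<Sum>i<n. phi i f x"] sum_phi_le[OF fm f(2) order_refl, of x] g(2)[of x] by linarith
      qed auto
      also have "\<dots> = H + (\<Sum>i<n. e i)"
      proof -
        have si: "integrable M (\<lambda>x. \<Sum>i<n. env i x)"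
          by (intro Bochner_Integration.integrable_sum env_integrable) auto
        have "(\<integral>x. (\<Sum>i<n. env i x) \<partial>M) = (\<Sum>i<n. e i)"
          by (subst Bochner_Integration.integral_sum) (auto simp: env_integrable env_integral)
        then show ?thesis using h_int si by (simp add: H_def)
      qed
      also have "\<dots> \<le> 2 * H" using sum_e_le by (simp add: H_def)
      finally show "(\<integral>x. cmod (stage g f n x) \<partial>M) \<le> 2 * H" .
    qed (use Dv in auto)
    finally show ?thesis .
  qed
  have s1: "in_Lp M p1 (stage g1 f1 n)" by (rule stage_in_Lp(3)[OF f1 g1(1)]) auto
  have s2: "in_Lp M p2 (stage g2 f2 n)" by (rule stage_in_Lp(3)[OF f2 g2(1)]) auto
  have "p / p1 + p / p2 = p * (1 / p1 + 1 / p2)" by (simp add: distrib_left)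
  then have pe: "p / p1 + p / p2 = 1" unfolding exps(4)[symmetric] by simp
  have p0: "p1 \<noteq> 0" "p2 \<noteq> 0" using exps by auto
  have "(\<integral>\<^sup>+z. ennreal (cmod (T (stage g1 f1 n) (stage g2 f2 n) z) powr p) \<partial>M) = ennreal (\<integral>z. cmod (T (stage g1 f1 n) (stage g2 f2 n) z) powr p \<partial>M)"
    using T_Lp[OF s1 s2] by (intro nn_integral_eq_integral) auto
  also have "\<dots> \<le> ennreal (CT * (\<integral>x. cmod (stage g1 f1 n x) powr p1 \<partial>M) powr (p / p1) * (\<integral>x. cmod (stage g2 f2 n x) powr p2 \<partial>M) powr (p / p2))"
    by (intro ennreal_leI T_bound s1 s2)
  also have "\<dots> \<le> ennreal (CT * (Dv powr p1 * (2 * H)) powr (p / p1) * (Dv powr p2 * (2 * H)) powr (p / p2))"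
    using CT Iq[OF f1 g1] Iq[OF f2 g2] by (intro ennreal_leI mult_mono mult_nonneg_nonneg powr_mono2) auto
  also have "CT * (Dv powr p1 * (2 * H)) powr (p / p1) * (Dv powr p2 * (2 * H)) powr (p / p2)
      = CT * (Dv powr p * Dv powr p) * ((2 * H) powr (p / p1) * (2 * H) powr (p / p2))"
    using H0 p0 by (simp add: powr_mult powr_powr)
  also have "(2 * H) powr (p / p1) * (2 * H) powr (p / p2) = 2 * H" using H0 pe by (simp flip: powr_add)
  also have "Dv powr p * Dv powr p = Dv powr (2 * p)" by (simp flip: powr_add)
  finally show ?thesis by (simp add: H_def ac_simps)
qed

text \<open>Chebyshev applied once to a \<open>p\<close>-th power plus integrable errors: where the
  operator exceeds 3, either the main part or the sum of the errors is at least 1.\<close>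

lemma cz_step:
  assumes f1: "in_Lp M p1 f1" "\<And>x. cmod (f1 x) \<le> h x" and f2: "in_Lp M p2 f2" "\<And>x. cmod (f2 x) \<le> h x"
    and g1: "in_Lp M p1 g1" "\<And>x. cmod (g1 x) \<le> h x" "AE x in M. cmod (g1 x) \<le> C0"
    and g2: "in_Lp M p2 g2" "\<And>x. cmod (g2 x) \<le> h x" "AE x in M. cmod (g2 x) \<le> C0"
    and Dv: "Dv = C0 + Dp" "1 \<le> Dv"
    and B: "B \<in> sets M" "\<And>z. z \<in> B \<Longrightarrow> good z"
  shows "emeasure M {z \<in> B. 3 < cmod (T (stage g1 f1 0) (stage g2 f2 0) z)} \<le> ennreal (step_const Dv * (\<integral>x. h x \<partial>M))"
proof -
  \<comment> \<open>Bad pieces in the second argument are handled by the transposed operator with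
    the same decomposition.\<close>
  interpret sw: cz_term M p2 p1 p CT "\<lambda>x y1 y2. K x y2 y1" "\<lambda>f g. T g f" L CL CK \<omega> n c r k E A h Ch Dp rho e env
    by (intro cz_term.intro swap_cz cz_data_axioms) (rule rho_def e_def env_def)+
  define H where "H = (\<integral>x. h x \<partial>M)"
  have H0: "0 \<le> H" unfolding H_def using h_nonneg by (intro integral_nonneg_AE) auto
  define v where "v g f j x = g x + (\<Sum>i<j. phi i f x)" for g f :: "'a \<Rightarrow> complex" and j x
  define w where "w f j x = (\<Sum>i\<in>{j..<n}. indicator (E i) x * f x)" for f :: "'a \<Rightarrow> complex" and j x
  have st: "stage g f j = (\<lambda>x. v g f j x + w f j x)" for g f j by (auto simp: stage_def v_def w_def)
  define CN where "CN = CL * (\<Sum>i. \<omega> ((1 / 2) ^ Suc i)) + 4 * CL ^ 5 + CL"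
  have om: "\<And>i. 0 \<le> \<omega> ((1 / 2) ^ Suc i)" by (intro omega_nonneg) auto
  have CN0: "0 \<le> CN" unfolding CN_def using CL suminf_nonneg[OF omega_summable om] by (intro add_nonneg_nonneg mult_nonneg_nonneg) auto
  define LC where "LC = 4 * CL ^ 5 * (1 + CT * Dv powr p)"
  have LC0: "0 \<le> LC" unfolding LC_def using CL CT by auto
  define X where "X j z = indicator (ball (c j) (2 * rho j)) z * ennreal (cmod (T (phi j f1) (\<lambda>x. indicator (ball (c j) (4 * rho j)) x * v g2 f2 j x) z))" for j z
  define Y where "Y j z = indicator (ball (c j) (2 * rho j)) z * ennreal (cmod (T (\<lambda>x. indicator (ball (c j) (4 * rho j)) x * v g1 f1 (Suc j) x) (phi j f2) z))" for j z
  have v_le: "cmod (v g f j x) \<le> h x + (\<Sum>i<n. env i x)"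
    if "in_Lp M q f" "\<And>x. cmod (f x) \<le> h x" "\<And>x. cmod (g x) \<le> h x" "j \<le> n" for g f :: "'a \<Rightarrow> complex" and j x q
    unfolding v_def using norm_triangle_ineq[of "g x" "\<Sum>i<j. phi i f x"] sum_phi_le[OF in_LpD(1)[OF that(1)] that(2,4), of x] that(3)[of x] by linarith
  have w_le: "cmod (w f i x) \<le> indicator (\<Union>l\<in>{j..<n}. E l) x * h x"
    if "\<And>x. cmod (f x) \<le> h x" "j \<le> i" for f :: "'a \<Rightarrow> complex" and i j x
    unfolding w_def using that by (rule sum_indicator_le)
  have v_bd: "AE x in M. cmod (v g f j x) \<le> Dv"
    if "in_Lp M q f" "\<And>x. cmod (f x) \<le> h x" "AE x in M. cmod (g x) \<le> C0" "j \<le> n" for g f :: "'a \<Rightarrow> complex" and j q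
    using that(3)
  proof eventually_elim
    case (elim x)
    then show ?case
      unfolding v_def using norm_triangle_ineq[of "g x" "\<Sum>i<j. phi i f x"] sum_phi_le[OF in_LpD(1)[OF that(1)] that(2,4), of x] Dp[of x] Dv by linarith
  qed
  have vLp1: "in_Lp M p1 (v g1 f1 j)" "in_Lp M p1 (w f1 j)" if "j \<le> n" for j
    unfolding v_def[abs_def] w_def[abs_def] by (rule stage_in_Lp[OF f1 g1(1) _ that], simp)+
  have vLp2: "in_Lp M p2 (v g2 f2 j)" "in_Lp M p2 (w f2 j)" if "j \<le> n" for j
    unfolding v_def[abs_def] w_def[abs_def] by (rule stage_in_Lp[OF f2 g2(1) _ that], simp)+
  have phiLp: "in_Lp M p1 (phi j f1)" "in_Lp M p2 (phi j f2)" if "j < n" for j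
    using phi_in_Lp[OF in_LpD(1)[OF f1(1)] f1(2) that] phi_in_Lp[OF in_LpD(1)[OF f2(1)] f2(2) that] by auto
  have "AE z in M. \<forall>j\<in>{..<n}. good z \<longrightarrow> ennreal (cmod (T (bad j f1) (stage g2 f2 j) z)) \<le>
      ennreal bad_const * (ennreal (e j) * profile \<omega> j z) + ennreal CK * overlap j z + X j z"
    unfolding st X_def
  proof (rule AE_finite_allI)
    fix j assume "j \<in> {..<n}"
    then have j: "j < n" by simp
    show "AE z in M. good z \<longrightarrow> ennreal (cmod (T (bad j f1) (\<lambda>x. v g2 f2 j x + w f2 j x) z)) \<le>
      ennreal bad_const * (ennreal (e j) * profile \<omega> j z) + ennreal CK * overlap j z +
      indicator (ball (c j) (2 * rho j)) z * ennreal (cmod (T (phi j f1) (\<lambda>x. indicator (ball (c j) (4 * rho j)) x * v g2 f2 j x) z))"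
      using j vLp2[of j] v_le[OF f2 g2(2), of j] w_le[OF f2(2), of j j]
      by (intro T_bad_bound f1) auto
  qed simp
  moreover have "AE z in M. \<forall>j\<in>{..<n}. good z \<longrightarrow> ennreal (cmod (T (stage g1 f1 (Suc j)) (bad j f2) z)) \<le>
      ennreal bad_const * (ennreal (e j) * profile \<omega> j z) + ennreal CK * overlap j z + Y j z"
    unfolding st Y_def
  proof (rule AE_finite_allI)
    fix j assume "j \<in> {..<n}"
    then have j: "j < n" by simp
    show "AE z in M. good z \<longrightarrow> ennreal (cmod (T (\<lambda>x. v g1 f1 (Suc j) x + w f1 (Suc j) x) (bad j f2) z)) \<le>
      ennreal bad_const * (ennreal (e j) * profile \<omega> j z) + ennreal CK * overlap j z +
      indicator (ball (c j) (2 * rho j)) z * ennreal (cmod (T (\<lambda>x. indicator (ball (c j) (4 * rho j)) x * v g1 f1 (Suc j) x) (phi j f2) z))"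
      using j vLp1[of "Suc j"] v_le[OF f1 g1(2), of "Suc j"] w_le[OF f1(2), of j "Suc j"]
      by (intro sw.T_bad_bound f2) auto
  qed simp
  moreover note telescoping[OF f1 f2 g1(1) g2(1) order_refl]
  ultimately have AE_bd: "AE z in M. good z \<longrightarrow> ennreal (cmod (T (stage g1 f1 0) (stage g2 f2 0) z)) \<le>
      ennreal (cmod (T (stage g1 f1 n) (stage g2 f2 n) z)) +
      (ennreal (2 * bad_const + 16 * CK * CL ^ 3 * Dp) * (\<Sum>j<n. ennreal (e j) * profile \<omega> j z) + (\<Sum>j<n. X j z + Y j z))"
  proof eventually_elim
    case (elim z)
    show ?case
    proof
    assume z: "good z"
    have "cmod (T (stage g1 f1 0) (stage g2 f2 0) z) \<le> cmod (T (stage g1 f1 n) (stage g2 f2 n) z) +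
        (\<Sum>j<n. cmod (T (bad j f1) (stage g2 f2 j) z) + cmod (T (stage g1 f1 (Suc j)) (bad j f2) z))"
      unfolding elim(3) by (intro order_trans[OF norm_triangle_ineq] add_left_mono order_trans[OF norm_sum] sum_mono norm_triangle_ineq)
    then have "ennreal (cmod (T (stage g1 f1 0) (stage g2 f2 0) z)) \<le> ennreal (cmod (T (stage g1 f1 n) (stage g2 f2 n) z) +
        (\<Sum>j<n. cmod (T (bad j f1) (stage g2 f2 j) z) + cmod (T (stage g1 f1 (Suc j)) (bad j f2) z)))"
      by (rule ennreal_leI)
    also have "\<dots> = ennreal (cmod (T (stage g1 f1 n) (stage g2 f2 n) z)) +
        (\<Sum>j<n. ennreal (cmod (T (bad j f1) (stage g2 f2 j) z)) + ennreal (cmod (T (stage g1 f1 (Suc j)) (bad j f2) z)))"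
      by (simp add: sum_nonneg sum_ennreal ennreal_plus[symmetric] del: ennreal_plus)
    also have "\<dots> \<le> ennreal (cmod (T (stage g1 f1 n) (stage g2 f2 n) z)) +
        (\<Sum>j<n. (ennreal bad_const * (ennreal (e j) * profile \<omega> j z) + ennreal CK * overlap j z + X j z)
           + (ennreal bad_const * (ennreal (e j) * profile \<omega> j z) + ennreal CK * overlap j z + Y j z))"
      using elim(1,2) z by (intro add_left_mono sum_mono add_mono) auto
    also have "(\<Sum>j<n. (ennreal bad_const * (ennreal (e j) * profile \<omega> j z) + ennreal CK * overlap j z + X j z)
           + (ennreal bad_const * (ennreal (e j) * profile \<omega> j z) + ennreal CK * overlap j z + Y j z))
        = ennreal (2 * bad_const) * (\<Sum>j<n. ennreal (e j) * profile \<omega> j z) + ennreal (2 * CK) * (\<Sum>j<n. overlap j z) + (\<Sum>j<n. X j z + Y j z)"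
    proof -
      have "ennreal (2 * bad_const) = ennreal bad_const + ennreal bad_const" "ennreal (2 * CK) = ennreal CK + ennreal CK"
        using bad_const_nonneg CK by (simp_all flip: ennreal_plus)
      then show ?thesis
        by (simp only: sum.distrib sum_distrib_left[symmetric] distrib_right add.assoc add.commute add.left_commute)
    qed
    also have "\<dots> \<le> ennreal (2 * bad_const + 16 * CK * CL ^ 3 * Dp) * (\<Sum>j<n. ennreal (e j) * profile \<omega> j z) + (\<Sum>j<n. X j z + Y j z)"
    proof (rule add_right_mono)
      \<comment> \<open>Only after summation over \<open>j\<close> are the overlaps absorbed into
        the profiles.\<close>
      have "(\<Sum>j<n. overlap j z) \<le> ennreal (8 * CL ^ 3 * Dp) * (\<Sum>i<n. ennreal (e i) * near_sum (c i) (r i) (k i) z)"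
        by (rule sum_overlap[OF z])
      also have "\<dots> \<le> ennreal (8 * CL ^ 3 * Dp) * (\<Sum>j<n. ennreal (e j) * profile \<omega> j z)"
        by (intro mult_left_mono sum_mono) (auto simp: profile_def add_increasing add_increasing2)
      finally have "ennreal (2 * CK) * (\<Sum>j<n. overlap j z) \<le> ennreal (2 * CK) * (ennreal (8 * CL ^ 3 * Dp) * (\<Sum>j<n. ennreal (e j) * profile \<omega> j z))"
        by (rule mult_left_mono) simp
      also have "\<dots> = ennreal (16 * CK * CL ^ 3 * Dp) * (\<Sum>j<n. ennreal (e j) * profile \<omega> j z)"
      proof -
        have "ennreal (2 * CK) * ennreal (8 * CL ^ 3 * Dp) = ennreal (16 * CK * CL ^ 3 * Dp)"
          using CK CL Dp_nonneg by (subst ennreal_mult[symmetric]) auto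
        then show ?thesis by (simp add: mult.assoc[symmetric])
      qed
      finally have "ennreal (2 * bad_const) * (\<Sum>j<n. ennreal (e j) * profile \<omega> j z) + ennreal (2 * CK) * (\<Sum>j<n. overlap j z)
          \<le> ennreal (2 * bad_const) * (\<Sum>j<n. ennreal (e j) * profile \<omega> j z) + ennreal (16 * CK * CL ^ 3 * Dp) * (\<Sum>j<n. ennreal (e j) * profile \<omega> j z)"
        by (rule add_left_mono)
      also have "\<dots> = ennreal (2 * bad_const + 16 * CK * CL ^ 3 * Dp) * (\<Sum>j<n. ennreal (e j) * profile \<omega> j z)"
        using bad_const_nonneg CK CL Dp_nonneg by (simp add: distrib_right)
      finally show "ennreal (2 * bad_const) * (\<Sum>j<n. ennreal (e j) * profile \<omega> j z) + ennreal (2 * CK) * (\<Sum>j<n. overlap j z)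
          \<le> ennreal (2 * bad_const + 16 * CK * CL ^ 3 * Dp) * (\<Sum>j<n. ennreal (e j) * profile \<omega> j z)" .
    qed
    finally show "ennreal (cmod (T (stage g1 f1 0) (stage g2 f2 0) z)) \<le>
      ennreal (cmod (T (stage g1 f1 n) (stage g2 f2 n) z)) +
      (ennreal (2 * bad_const + 16 * CK * CL ^ 3 * Dp) * (\<Sum>j<n. ennreal (e j) * profile \<omega> j z) + (\<Sum>j<n. X j z + Y j z))"
      by (simp add: add_left_mono)
    qed
  qed
  have s1: "in_Lp M p1 (stage g1 f1 j)" if "j \<le> n" for j by (rule stage_in_Lp(3)[OF f1 g1(1) _ that]) simp
  have s2: "in_Lp M p2 (stage g2 f2 j)" if "j \<le> n" for j by (rule stage_in_Lp(3)[OF f2 g2(1) _ that]) simp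
  have [measurable]: "T (stage g1 f1 n) (stage g2 f2 n) \<in> borel_measurable M" "T (stage g1 f1 0) (stage g2 f2 0) \<in> borel_measurable M"
    using T_measurable[OF s1 s2] by auto
  have cutLp1: "in_Lp M p1 (\<lambda>x. indicator (ball (c j) (4 * rho j)) x * v g1 f1 (Suc j) x)"
    and cutLp2: "in_Lp M p2 (\<lambda>x. indicator (ball (c j) (4 * rho j)) x * v g2 f2 j x)" if "j < n" for j
    using that vLp1[of "Suc j"] vLp2[of j] by (auto intro!: in_Lp_indicator)
  have XYm [measurable]: "X j \<in> borel_measurable M" "Y j \<in> borel_measurable M" if "j < n" for j
    unfolding X_def Y_def using T_measurable[OF phiLp(1) cutLp2, OF that that] T_measurable[OF cutLp1 phiLp(2), OF that that]
    by measurable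
  have Xi: "(\<integral>\<^sup>+z. X j z \<partial>M) \<le> ennreal (LC * e j)" if j: "j < n" for j
    unfolding X_def LC_def using j Dv v_bd[OF f2 g2(3), of j] vLp2[of j] by (intro phi_local_bound f1) auto
  have Yi: "(\<integral>\<^sup>+z. Y j z \<partial>M) \<le> ennreal (LC * e j)" if j: "j < n" for j
    unfolding Y_def LC_def using j Dv v_bd[OF f1 g1(3), of "Suc j"] vLp1[of "Suc j"] by (intro sw.phi_local_bound f2) auto
  \<comment> \<open>\<open>G\<close> will dominate the indicator of the level set. Its main part
    carries the power \<open>p\<close>, since this is the power that the bound for \<open>T\<close>
    integrates.\<close>
  define G where "G z = ennreal (cmod (T (stage g1 f1 n) (stage g2 f2 n) z) powr p) +
      (ennreal (2 * bad_const + 16 * CK * CL ^ 3 * Dp) * (\<Sum>j<n. ennreal (e j) * profile \<omega> j z) + (\<Sum>j<n. X j z + Y j z))" for z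
  have Bm [measurable]: "B \<in> sets M" by (rule B)
  define S where "S = {z \<in> B. 3 < cmod (T (stage g1 f1 0) (stage g2 f2 0) z)}"
  have Sm [measurable]: "S \<in> sets M"
  proof -
    have "{z \<in> space M. z \<in> B \<and> 3 < cmod (T (stage g1 f1 0) (stage g2 f2 0) z)} \<in> sets M" by measurable
    then show ?thesis by (simp add: S_def)
  qed
  have "emeasure M S = (\<integral>\<^sup>+z. indicator S z \<partial>M)" by simp
  also have "\<dots> \<le> (\<integral>\<^sup>+z. G z \<partial>M)"
  proof (rule nn_integral_mono_AE)
    show "AE z in M. indicator S z \<le> G z"
      using AE_bd
    proof eventually_elim
      case (elim z)
      show ?case
      proof (cases "z \<in> S")
        case True
        define t where "t = cmod (T (stage g1 f1 n) (stage g2 f2 n) z)"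
        define R where "R = ennreal (2 * bad_const + 16 * CK * CL ^ 3 * Dp) * (\<Sum>j<n. ennreal (e j) * profile \<omega> j z) + (\<Sum>j<n. X j z + Y j z)"
        have z: "good z" "3 < cmod (T (stage g1 f1 0) (stage g2 f2 0) z)" using True B by (auto simp: S_def)
        have "ennreal 3 \<le> ennreal (cmod (T (stage g1 f1 0) (stage g2 f2 0) z))" using z by (intro ennreal_leI) auto
        also have "\<dots> \<le> ennreal t + R" using elim z by (simp add: t_def R_def)
        finally have le: "ennreal 3 \<le> ennreal t + R" .
        have "1 \<le> ennreal (t powr p) + R"
        proof (cases "1 \<le> t")
          case True
          then have "1 \<le> t powr p" by (intro ge_one_powr_ge_zero) auto
          then have "1 \<le> ennreal (t powr p)" by simp
          then show ?thesis by (rule order_trans) simp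
        next
          case False
          then have "ennreal t \<le> 1" by (simp add: ennreal_le_1)
          then have "ennreal 3 \<le> 1 + R" using le by (meson add_right_mono order_trans)
          then have "1 \<le> R"
          proof (cases R)
            case (real x)
            have "ennreal (1 + x) = 1 + R" using real by simp
            then have "ennreal 3 \<le> ennreal (1 + x)" using \<open>ennreal 3 \<le> 1 + R\<close> by metis
            then have "3 \<le> 1 + x" using real by (subst (asm) ennreal_le_iff) auto
            then show ?thesis using real by simp
          qed simp
          then show ?thesis by (simp add: add_increasing)
        qed
        then show ?thesis using True by (simp add: G_def t_def R_def)
      qed simp
    qed
  qed
  also have "\<dots> = (\<integral>\<^sup>+z. ennreal (cmod (T (stage g1 f1 n) (stage g2 f2 n) z) powr p) \<partial>M) +
      (ennreal (2 * bad_const + 16 * CK * CL ^ 3 * Dp) * (\<Sum>j<n. ennreal (e j) * (\<integral>\<^sup>+z. profile \<omega> j z \<partial>M))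
        + (\<Sum>j<n. (\<integral>\<^sup>+z. X j z \<partial>M) + (\<integral>\<^sup>+z. Y j z \<partial>M)))"
  proof -
    have "(\<integral>\<^sup>+z. (\<Sum>j<n. X j z + Y j z) \<partial>M) = (\<Sum>j<n. \<integral>\<^sup>+z. X j z + Y j z \<partial>M)"
      by (intro nn_integral_sum borel_measurable_add) auto
    also have "\<dots> = (\<Sum>j<n. (\<integral>\<^sup>+z. X j z \<partial>M) + (\<integral>\<^sup>+z. Y j z \<partial>M))"
      by (intro sum.cong nn_integral_add) auto
    finally have "(\<integral>\<^sup>+z. (\<Sum>j<n. X j z + Y j z) \<partial>M) = (\<Sum>j<n. (\<integral>\<^sup>+z. X j z \<partial>M) + (\<integral>\<^sup>+z. Y j z \<partial>M))" .
    moreover have "(\<lambda>z. \<Sum>j<n. X j z + Y j z) \<in> borel_measurable M" by (intro borel_measurable_sum borel_measurable_add) auto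
    ultimately show ?thesis
      unfolding G_def by (simp add: nn_integral_add nn_integral_cmult nn_integral_sum)
  qed
  also have "\<dots> \<le> ennreal (2 * CT * Dv powr (2 * p) * H) +
      (ennreal (2 * bad_const + 16 * CK * CL ^ 3 * Dp) * (\<Sum>j<n. ennreal (e j) * ennreal CN) + (\<Sum>j<n. ennreal (LC * e j) + ennreal (LC * e j)))"
    using good_part_bound[OF f1 f2 g1 g2 Dv] profile_integral[OF om omega_summable] Xi Yi
    by (intro add_mono mult_left_mono sum_mono) (auto simp: H_def CN_def)
  also have "\<dots> = ennreal (2 * CT * Dv powr (2 * p) * H + ((2 * bad_const + 16 * CK * CL ^ 3 * Dp) * (\<Sum>j<n. e j * CN) + (\<Sum>j<n. LC * e j + LC * e j)))"
  proof -
    have 1: "(\<Sum>j<n. ennreal (e j) * ennreal CN) = ennreal (\<Sum>j<n. e j * CN)"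
      using e_nonneg CN0 by (simp add: ennreal_mult[symmetric] sum_ennreal)
    have 2: "(\<Sum>j<n. ennreal (LC * e j) + ennreal (LC * e j)) = ennreal (\<Sum>j<n. LC * e j + LC * e j)"
      using e_nonneg LC0 by (simp add: sum_ennreal ennreal_plus[symmetric] del: ennreal_plus)
    have nn: "0 \<le> 2 * bad_const + 16 * CK * CL ^ 3 * Dp" "0 \<le> (\<Sum>j<n. e j * CN)" "0 \<le> (\<Sum>j<n. LC * e j + LC * e j)" "0 \<le> 2 * CT * Dv powr (2 * p) * H"
      using bad_const_nonneg CK CL Dp_nonneg e_nonneg CN0 LC0 CT H0 by (auto intro!: sum_nonneg add_nonneg_nonneg mult_nonneg_nonneg)
    show ?thesis unfolding 1 2 using nn by (simp add: ennreal_mult ennreal_plus)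
  qed
  also have "\<dots> \<le> ennreal (step_const Dv * H)"
  proof (rule ennreal_leI)
    have eH: "(\<Sum>j<n. e j) \<le> H" using sum_e_le by (simp add: H_def)
    have "(\<Sum>j<n. e j * CN) \<le> CN * H" unfolding sum_distrib_right[symmetric] using mult_left_mono[OF eH CN0] by (simp add: mult.commute)
    then have "(2 * bad_const + 16 * CK * CL ^ 3 * Dp) * (\<Sum>j<n. e j * CN) \<le> (2 * bad_const + 16 * CK * CL ^ 3 * Dp) * (CN * H)"
      using bad_const_nonneg CK CL Dp_nonneg by (intro mult_left_mono) auto
    moreover have "(\<Sum>j<n. LC * e j + LC * e j) \<le> 2 * LC * H"
    proof -
      have "(\<Sum>j<n. LC * e j + LC * e j) = 2 * LC * (\<Sum>j<n. e j)" by (simp add: sum_distrib_left mult.assoc)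
      then show ?thesis using eH LC0 by (simp add: mult_left_mono)
    qed
    ultimately show "2 * CT * Dv powr (2 * p) * H + ((2 * bad_const + 16 * CK * CL ^ 3 * Dp) * (\<Sum>j<n. e j * CN) + (\<Sum>j<n. LC * e j + LC * e j)) \<le> step_const Dv * H"
      unfolding step_const_def CN_def[symmetric] by (simp add: LC_def algebra_simps)
  qed
  finally show ?thesis by (simp add: S_def H_def)
qed

lemma step_const_nonneg: "0 \<le> step_const Dv"
proof -
  have om: "\<And>i. 0 \<le> \<omega> ((1 / 2) ^ Suc i)" by (intro omega_nonneg) auto
  show ?thesis
    unfolding step_const_def using CT CL CK Dp_nonneg bad_const_nonneg suminf_nonneg[OF omega_summable om]
    by (intro add_nonneg_nonneg mult_nonneg_nonneg) auto
qed

end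

section \<open>The weak type estimate for bounded operators\<close>

text \<open>Convergence in \<open>L^p\<close> implies convergence in measure, so a bound for level
  sets passes to the limit once the level is raised, here by 1.\<close>

lemma (in bilinear_operator) level_set_limit:
  assumes F: "\<And>n. in_Lp M p1 (F n)" "in_Lp M p1 f" "(\<lambda>n. \<integral>x. cmod (F n x - f x) powr p1 \<partial>M) \<longlonglongrightarrow> 0"
    and G: "\<And>n. in_Lp M p2 (G n)" "in_Lp M p2 g" "(\<lambda>n. \<integral>x. cmod (G n x - g x) powr p2 \<partial>M) \<longlonglongrightarrow> 0"
    and le: "\<And>n. emeasure M {x. s < cmod (T (F n) (G n) x)} \<le> X"
  shows "emeasure M {x. s + 1 < cmod (T f g x)} \<le> X"
proof -
  define I where "I n = (\<integral>x. cmod (T (F n) (G n) x - T f g x) powr p \<partial>M)" for n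
  have I0: "0 \<le> I n" for n by (simp add: I_def)
  have [measurable]: "T (F n) (G n) \<in> borel_measurable M" "T f g \<in> borel_measurable M" for n
    using T_measurable F G by auto
  have "emeasure M {x. s + 1 < cmod (T f g x)} \<le> X + ennreal (I n)" for n
  proof -
    have [measurable]: "{x. s < cmod (T (F n) (G n) x)} \<in> sets M"
      using borel_measurable_less[of "\<lambda>_. s" M "\<lambda>x. cmod (T (F n) (G n) x)"] by simp
    have B [measurable]: "{x. 1 < cmod (T (F n) (G n) x - T f g x)} \<in> sets M"
      using borel_measurable_less[of "\<lambda>_. 1" M "\<lambda>x. cmod (T (F n) (G n) x - T f g x)"] by simp
    have "emeasure M {x. 1 < cmod (T (F n) (G n) x - T f g x)} = (\<integral>\<^sup>+x. indicator {x. 1 < cmod (T (F n) (G n) x - T f g x)} x \<partial>M)"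
      by simp
    also have "\<dots> \<le> (\<integral>\<^sup>+x. ennreal (cmod (T (F n) (G n) x - T f g x) powr p) \<partial>M)"
      by (intro nn_integral_mono) (auto simp: indicator_def intro!: ge_one_powr_ge_zero)
    also have "\<dots> = ennreal (I n)"
      unfolding I_def using F G by (intro nn_integral_eq_integral in_LpD(2) in_Lp_diff T_Lp) auto
    finally have 1: "emeasure M {x. 1 < cmod (T (F n) (G n) x - T f g x)} \<le> ennreal (I n)" .
    have "{x. s + 1 < cmod (T f g x)} \<subseteq> {x. s < cmod (T (F n) (G n) x)} \<union> {x. 1 < cmod (T (F n) (G n) x - T f g x)}"
    proof
      fix x assume "x \<in> {x. s + 1 < cmod (T f g x)}"
      then show "x \<in> {x. s < cmod (T (F n) (G n) x)} \<union> {x. 1 < cmod (T (F n) (G n) x - T f g x)}"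
        using norm_triangle_ineq3[of "T f g x" "T (F n) (G n) x"] by (auto simp: norm_minus_commute)
    qed
    then have "emeasure M {x. s + 1 < cmod (T f g x)} \<le> emeasure M ({x. s < cmod (T (F n) (G n) x)} \<union> {x. 1 < cmod (T (F n) (G n) x - T f g x)})"
      by (intro emeasure_mono) auto
    also have "\<dots> \<le> emeasure M {x. s < cmod (T (F n) (G n) x)} + emeasure M {x. 1 < cmod (T (F n) (G n) x - T f g x)}"
      by (intro emeasure_subadditive) auto
    also have "\<dots> \<le> X + ennreal (I n)" using le 1 by (intro add_mono) auto
    finally show ?thesis .
  qed
  moreover have "(\<lambda>n. X + ennreal (I n)) \<longlonglongrightarrow> X + ennreal 0"
    using T_tendsto[OF F G] unfolding I_def by (intro tendsto_add tendsto_const tendsto_ennrealI)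
  ultimately show ?thesis
    using LIMSEQ_le_const[of "\<lambda>n. X + ennreal (I n)" X] by auto
qed

text \<open>The comparability \<open>comp\<close> is not part of upper doubling; it is obtained by
  regularising the dominating function.\<close>

locale regular_cz_operator = cz_operator +
  fixes N :: nat
  assumes comp: "\<And>x y s. 0 < s \<Longrightarrow> dist x y \<le> s \<Longrightarrow> L x s \<le> CL * L y s"
    and gd: "geometrically_doubling N TYPE('a)"
begin

lemma emeasure_ball_UNIV_approx:
  assumes "a < emeasure M UNIV"
  shows "\<exists>n::nat. a < emeasure M (ball x (real n))"
proof -
  have "(SUP n. emeasure M (ball x (real n))) = emeasure M (\<Union>n. ball x (real n))"
    by (intro SUP_emeasure_incseq) (auto simp: incseq_def)
  also have "(\<Union>n. ball x (real n)) = UNIV" by (auto intro: reals_Archimedean2)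
  finally show ?thesis using assms by (metis less_SUP_iff)
qed

text \<open>Takes a stopping radius above half of the supremum of all of them. The supremum is
  finite because the total mass of \<open>h\<close> is less than the measure of the space, which
  rules out large stopping balls.\<close>

lemma stopping_radius:
  assumes "x \<in> stopping_set 6 h 1" and H: "(\<integral>\<^sup>+y. h y \<partial>M) < emeasure M UNIV"
  shows "\<exists>r>0. emeasure M (ball x (6 * r)) < (\<integral>\<^sup>+y\<in>ball x r. h y \<partial>M) \<and>
    (\<forall>s\<ge>2 * r. (\<integral>\<^sup>+y\<in>ball x s. h y \<partial>M) \<le> emeasure M (ball x (6 * s)))"
proof -
  define P where "P = {r. 0 < r \<and> emeasure M (ball x (6 * r)) < (\<integral>\<^sup>+y\<in>ball x r. h y \<partial>M)}"
  have ne: "P \<noteq> {}" using assms(1) by (auto simp: P_def stopping_set_def)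
  obtain n :: nat where n: "(\<integral>\<^sup>+y. h y \<partial>M) < emeasure M (ball x (real n))"
    using emeasure_ball_UNIV_approx[OF H] by blast
  have bd: "r \<le> real n" if "r \<in> P" for r
  proof (rule ccontr)
    assume "\<not> r \<le> real n"
    then have "real n \<le> 6 * r" by linarith
    then have "emeasure M (ball x (real n)) \<le> emeasure M (ball x (6 * r))"
      by (intro emeasure_mono subset_ball) auto
    also have "\<dots> < (\<integral>\<^sup>+y\<in>ball x r. h y \<partial>M)" using that by (simp add: P_def)
    also have "\<dots> \<le> (\<integral>\<^sup>+y. h y \<partial>M)" by (intro nn_integral_mono) (auto simp: indicator_def)
    finally show False using n by simp
  qed
  then have bdd: "bdd_above P" by (auto simp: bdd_above_def)
  have "0 < Sup P"
  proof -
    obtain r where "r \<in> P" using ne by blast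
    then have "0 < r" "r \<le> Sup P" using bdd by (auto simp: P_def intro: cSup_upper)
    then show ?thesis by linarith
  qed
  then have "Sup P / 2 < Sup P" by simp
  then obtain r where r: "r \<in> P" "Sup P / 2 < r" using less_cSup_iff[OF ne bdd] by blast
  have "(\<integral>\<^sup>+y\<in>ball x s. h y \<partial>M) \<le> emeasure M (ball x (6 * s))" if "2 * r \<le> s" for s
  proof (rule ccontr)
    assume "\<not> ?thesis"
    then have "s \<in> P" using that r by (auto simp: P_def not_le)
    then have "s \<le> Sup P" using bdd by (intro cSup_upper)
    then show False using r that by linarith
  qed
  then show ?thesis using r by (auto simp: P_def)
qed

text \<open>Four times the packing constant \<open>2 * CL ^ 5\<close>, as delivered by
  \<open>carleson_sets\<close>.\<close>

definition Dphi :: real where "Dphi = 8 * CL ^ 5"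

text \<open>The bound off the stopping set for level 1 and dilation 6; the exponent 5 comes from
  \<open>3 * 6 \<le> 2 ^ 5\<close>.\<close>

definition Cgood :: real where "Cgood = 2 * real (N ^ 5) + 1"

text \<open>The summand 2 is for the exceptional set. The rest is \<open>step_const\<close> with
  \<open>CL ^ 3\<close> for \<open>Ch\<close> and \<open>Dphi\<close> for \<open>Dp\<close>, written
  out because \<open>step_const\<close> belongs to a fixed decomposition.\<close>

definition weak_const :: real where
  "weak_const = 2 + (2 * CT * (Cgood + Dphi) powr (2 * p)
     + (2 * (CK * (32 * CL ^ 3 * (2 * CL ^ 3 + Dphi))) + 16 * CK * CL ^ 3 * Dphi) * (CL * (\<Sum>i. \<omega> ((1 / 2) ^ Suc i)) + 4 * CL ^ 5 + CL)
     + 8 * CL ^ 5 * (1 + CT * (Cgood + Dphi) powr p))"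

text \<open>Keeping only a compact part of the stopping set makes the decomposition finite, so that
  no convergence of infinite sums of pieces has to be discussed; a limit removes the restriction
  later.\<close>

lemma weak_type_compact:
  assumes f1: "in_Lp M p1 f1" "integrable M f1" and f2: "in_Lp M p2 f2" "integrable M f2"
    and h_def: "h = (\<lambda>x. cmod (f1 x) + cmod (f2 x))"
    and big: "ennreal (\<integral>x. h x \<partial>M) < emeasure M UNIV"
    and \<Omega>_def: "\<Omega> = stopping_set 6 (\<lambda>x. ennreal (h x)) 1"
    and E0: "compact E0" "E0 \<subseteq> \<Omega>"
  shows "emeasure M {x. 3 < cmod (T (\<lambda>x. indicator (- \<Omega> \<union> E0) x * f1 x) (\<lambda>x. indicator (- \<Omega> \<union> E0) x * f2 x) x)}
    \<le> ennreal (weak_const * (\<integral>x. h x \<partial>M))"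
proof -
  note [measurable] = in_LpD(1)[OF f1(1)] in_LpD(1)[OF f2(1)]
  define H where "H = (\<integral>x. h x \<partial>M)"
  have h_int: "integrable M h" unfolding h_def using f1 f2 by auto
  have h0: "0 \<le> h x" for x by (simp add: h_def)
  have f1h: "cmod (f1 x) \<le> h x" and f2h: "cmod (f2 x) \<le> h x" for x by (auto simp: h_def)
  have [measurable]: "h \<in> borel_measurable M" using h_int by auto
  have H0: "0 \<le> H" unfolding H_def using h0 by (intro integral_nonneg_AE) auto
  have nnH: "(\<integral>\<^sup>+x. ennreal (h x) \<partial>M) = ennreal H"
    unfolding H_def using h_int h0 by (intro nn_integral_eq_integral) auto
  have open\<Omega>: "open \<Omega>" unfolding \<Omega>_def by (intro open_stopping_set) auto
  have \<Omega>m [measurable]: "\<Omega> \<in> sets M" using open\<Omega> by simp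
  have E0m [measurable]: "E0 \<in> sets M" using E0(1) by (simp add: sets_M borel_compact)
  have pos: "emeasure M UNIV \<noteq> 0" using big by auto
  have *: "\<forall>x\<in>E0. \<exists>r. 0 < r \<and> emeasure M (ball x (6 * r)) < (\<integral>\<^sup>+y\<in>ball x r. ennreal (h y) \<partial>M) \<and>
    (\<forall>s\<ge>2 * r. (\<integral>\<^sup>+y\<in>ball x s. ennreal (h y) \<partial>M) \<le> emeasure M (ball x (6 * s)))"
    using stopping_radius[of _ "\<lambda>x. ennreal (h x)"] E0(2) big unfolding \<Omega>_def nnH H_def[symmetric] by blast
  obtain rr where rr: "\<And>x. x \<in> E0 \<Longrightarrow> 0 < rr x"
    "\<And>x. x \<in> E0 \<Longrightarrow> emeasure M (ball x (6 * rr x)) < (\<integral>\<^sup>+y\<in>ball x (rr x). ennreal (h y) \<partial>M)"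
    "\<And>x s. x \<in> E0 \<Longrightarrow> 2 * rr x \<le> s \<Longrightarrow> (\<integral>\<^sup>+y\<in>ball x s. ennreal (h y) \<partial>M) \<le> emeasure M (ball x (6 * s))"
    using bchoice[OF *] by blast
  obtain J where J: "J \<subseteq> E0" "finite J" "disjoint_family_on (\<lambda>x. ball x (rr x)) J" "E0 \<subseteq> (\<Union>x\<in>J. ball x (3 * rr x))"
    using vitali_compact[OF E0(1), of rr] rr(1) by blast
  have *: "\<forall>x\<in>E0. \<exists>k. 1 \<le> k \<and> 0 < measure M (ball x (32 ^ k * rr x)) \<and>
    measure M (ball x (32 ^ Suc k * rr x)) \<le> 2 * CL ^ 5 * measure M (ball x (32 ^ k * rr x)) \<and>
    (\<forall>j. 1 \<le> j \<and> j \<le> k \<longrightarrow> (2 * CL ^ 5) ^ (k - j) * measure M (ball x (32 ^ j * rr x)) \<le> measure M (ball x (32 ^ k * rr x)))"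
    using doubling_radius[OF rr(1) pos] by blast
  obtain kk where kk: "\<And>x. x \<in> E0 \<Longrightarrow> 1 \<le> kk x"
    "\<And>x. x \<in> E0 \<Longrightarrow> 0 < measure M (ball x (32 ^ kk x * rr x))"
    "\<And>x. x \<in> E0 \<Longrightarrow> measure M (ball x (32 ^ Suc (kk x) * rr x)) \<le> 2 * CL ^ 5 * measure M (ball x (32 ^ kk x * rr x))"
    "\<And>x j. x \<in> E0 \<Longrightarrow> 1 \<le> j \<Longrightarrow> j \<le> kk x \<Longrightarrow> (2 * CL ^ 5) ^ (kk x - j) * measure M (ball x (32 ^ j * rr x)) \<le> measure M (ball x (32 ^ kk x * rr x))"
    using bchoice[OF *] by blast
  obtain ys where ys: "set ys = J" "distinct ys" using finite_distinct_list[OF J(2)] by blast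
  \<comment> \<open>Sorted by the radius of the doubling ball and not by that of the stopping ball;
    the two orders may differ.\<close>
  define xs where "xs = sort_key (\<lambda>x. 32 ^ kk x * rr x) ys"
  define n where "n = length xs"
  define c where "c j = xs ! j" for j
  define r where "r j = rr (c j)" for j
  define k where "k j = kk (c j)" for j
  define rho where "rho j = 32 ^ k j * r j" for j
  have xs: "set xs = J" "distinct xs" "sorted (map (\<lambda>x. 32 ^ kk x * rr x) xs)"
    using ys by (auto simp: xs_def)
  have cJ: "c j \<in> J" if "j < n" for j using that xs(1) nth_mem[of j xs] by (simp add: c_def n_def)
  then have cE: "c j \<in> E0" if "j < n" for j using that J(1) by blast
  have Jc: "J = c ` {..<n}" using xs(1) by (auto simp: c_def n_def set_conv_nth)
  have inj: "inj_on c {..<n}" using xs(2) by (auto simp: inj_on_def c_def n_def nth_eq_iff_index_eq)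
  have rpos: "0 < r j" if "j < n" for j using rr(1) cE[OF that] by (simp add: r_def)
  have kge: "1 \<le> k j" if "j < n" for j using kk(1) cE[OF that] by (simp add: k_def)
  have rho_mono: "rho i \<le> rho j" if "i \<le> j" "j < n" for i j
    using sorted_nth_mono[OF xs(3), of i j] that by (simp add: rho_def k_def r_def c_def n_def)
  have r_rho: "32 * r j \<le> rho j" if "j < n" for j
    unfolding rho_def using rpos[OF that] power_increasing[of 1 "k j" "32::real"] kge[OF that]
    by (intro mult_right_mono) auto
  have rho_pos: "0 < rho j" if "j < n" for j using r_rho[OF that] rpos[OF that] by linarith
  define E where "E j = E0 \<inter> ball (c j) (3 * r j) - (\<Union>i<j. ball (c i) (3 * r i))" for j
  have Em [measurable]: "E j \<in> sets M" for j unfolding E_def by measurable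
  have E_sub: "E j \<subseteq> ball (c j) (3 * r j)" for j by (auto simp: E_def)
  have E_disj: "disjoint_family_on E {..<n}"
    unfolding disjoint_family_on_def
  proof (intro ballI impI)
    fix i j :: nat assume "i \<noteq> j"
    then show "E i \<inter> E j = {}"
      by (cases i j rule: linorder_cases) (auto simp: E_def)
  qed
  have E_Un: "(\<Union>j<n. E j) = E0"
  proof (intro equalityI subsetI)
    fix x assume x: "x \<in> E0"
    then obtain y where "y \<in> J" "x \<in> ball y (3 * rr y)" using J(4) by blast
    then have ex: "\<exists>j. j < n \<and> x \<in> ball (c j) (3 * r j)" unfolding Jc r_def by blast
    define j where "j = (LEAST j. j < n \<and> x \<in> ball (c j) (3 * r j))"
    have j: "j < n \<and> x \<in> ball (c j) (3 * r j)" unfolding j_def by (rule LeastI_ex[OF ex])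
    have "x \<notin> ball (c i) (3 * r i)" if "i < j" for i
      using not_less_Least[of i "\<lambda>j. j < n \<and> x \<in> ball (c j) (3 * r j)"] that j by (auto simp: j_def)
    then show "x \<in> (\<Union>j<n. E j)" using j x by (auto simp: E_def)
  qed (auto simp: E_def)
  define e where "e j = (\<integral>y. indicator (E j) y * h y \<partial>M)" for j
  have e0: "0 \<le> e j" for j unfolding e_def using h0 by (intro integral_nonneg_AE) auto
  have hE: "integrable M (\<lambda>y. indicator (E j) y * h y)" for j
    using integrable_real_mult_indicator[OF Em h_int] by (simp add: mult.commute)
  \<comment> \<open>A piece \<open>l\<close> with smaller doubling radius whose ball meets that of
    \<open>i\<close> lies in \<open>ball (c i) (3 * rho i)\<close>. This radius is too large to
    stop, so the mass of \<open>h\<close> there is at most the measure of the ball of radius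
    \<open>18 * rho i\<close>, and 18 is below 32.\<close>
  have carleson: "(\<Sum>l | l \<le> i \<and> ball (c l) (rho l) \<inter> ball (c i) (rho i) \<noteq> {}. e l) \<le> 2 * CL ^ 5 * measure M (ball (c i) (rho i))"
    if i: "i < n" for i
  proof -
    define Q where "Q = {l. l \<le> i \<and> ball (c l) (rho l) \<inter> ball (c i) (rho i) \<noteq> {}}"
    have Qf: "finite Q" by (auto simp: Q_def)
    have sub: "E l \<subseteq> ball (c i) (3 * rho i)" if lQ: "l \<in> Q" for l
    proof
      fix x assume x: "x \<in> E l"
      have l: "l \<le> i" "l < n" using lQ i by (auto simp: Q_def)
      obtain y where "y \<in> ball (c l) (rho l)" "y \<in> ball (c i) (rho i)" using lQ unfolding Q_def by blast
      then have y: "dist (c l) y < rho l" "dist (c i) y < rho i" by simp_all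
      have "dist (c l) x < rho l" using x E_sub[of l] r_rho[OF l(2)] rpos[OF l(2)] by fastforce
      moreover have "dist (c i) x \<le> dist (c i) y + dist (c l) y + dist (c l) x"
        using dist_triangle[of "c i" x y] dist_triangle[of y x "c l"] by (simp add: dist_commute)
      ultimately show "x \<in> ball (c i) (3 * rho i)" using y rho_mono[OF l(1) i] by simp
    qed
    have "(\<Sum>l\<in>Q. e l) = (\<integral>x. (\<Sum>l\<in>Q. indicator (E l) x * h x) \<partial>M)"
      unfolding e_def using hE by (subst Bochner_Integration.integral_sum) auto
    also have "\<dots> \<le> (\<integral>x. indicator (ball (c i) (3 * rho i)) x * h x \<partial>M)"
    proof (rule integral_mono)
      fix x
      have d: "disjoint_family_on E Q" using E_disj i by (rule_tac disjoint_family_on_mono[rotated]) (auto simp: Q_def)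
      have "(\<Sum>l\<in>Q. indicator (E l) x * h x) = indicator (\<Union>l\<in>Q. E l) x * h x"
        by (simp only: indicator_UN_disjoint[OF Qf d] sum_distrib_right)
      also have "\<dots> \<le> indicator (ball (c i) (3 * rho i)) x * h x"
        using sub h0 by (intro mult_right_mono indicator_leI) blast+
      finally show "(\<Sum>l\<in>Q. indicator (E l) x * h x) \<le> indicator (ball (c i) (3 * rho i)) x * h x" .
    qed (use hE integrable_real_mult_indicator[OF ball_sets_M h_int] in \<open>auto simp: mult.commute\<close>)
    also have "\<dots> \<le> measure M (ball (c i) (6 * (3 * rho i)))"
    proof -
      have "integrable M (\<lambda>x. indicator (ball (c i) (3 * rho i)) x * h x)"
        using integrable_real_mult_indicator[OF ball_sets_M h_int] by (simp add: mult.commute)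
      then have "ennreal (\<integral>x. indicator (ball (c i) (3 * rho i)) x * h x \<partial>M) = (\<integral>\<^sup>+x. ennreal (indicator (ball (c i) (3 * rho i)) x * h x) \<partial>M)"
        using h0 by (intro nn_integral_eq_integral[symmetric]) auto
      also have "\<dots> = (\<integral>\<^sup>+x\<in>ball (c i) (3 * rho i). ennreal (h x) \<partial>M)"
        by (intro nn_integral_cong) (auto simp: indicator_def)
      also have "\<dots> \<le> emeasure M (ball (c i) (6 * (3 * rho i)))"
        using r_rho[OF i] rpos[OF i] cE[OF i] by (intro rr(3)) (auto simp: r_def)
      finally show ?thesis unfolding emeasure_ball by simp
    qed
    also have "\<dots> \<le> measure M (ball (c i) (32 * rho i))"
      using rho_pos[OF i] fin_ball by (intro measure_mono_fmeasurable subset_ball) (auto simp: fmeasurable_def)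
    also have "\<dots> \<le> 2 * CL ^ 5 * measure M (ball (c i) (rho i))"
      using kk(3)[OF cE[OF i]] by (simp add: rho_def k_def r_def mult.assoc)
    finally show ?thesis by (simp add: Q_def)
  qed
  have Rpos: "0 < measure M (ball (c i) (rho i))" if "i < n" for i
    using kk(2)[OF cE[OF that]] by (simp add: rho_def k_def r_def)
  obtain A where A: "\<And>i. i < n \<Longrightarrow> A i \<subseteq> ball (c i) (rho i)" "\<And>i. i < n \<Longrightarrow> A i \<in> sets M"
    "\<And>i. i < n \<Longrightarrow> measure M (ball (c i) (rho i)) \<le> 2 * measure M (A i)"
    "\<And>x. (\<Sum>i<n. e i / measure M (A i) * indicator (A i) x) \<le> 4 * (2 * CL ^ 5)"
  proof -
    have "\<exists>A. (\<forall>i<n. A i \<subseteq> ball (c i) (rho i) \<and> A i \<in> sets M \<and> measure M (ball (c i) (rho i)) \<le> 2 * measure M (A i)) \<and>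
        (\<forall>x. (\<Sum>i<n. e i / measure M (A i) * indicator (A i) x) \<le> 4 * (2 * CL ^ 5))"
      using fin_ball CL by (intro carleson_sets carleson e0 Rpos) (auto simp: less_top)
    then show ?thesis using that by blast
  qed
  define env where "env j x = e j / measure M (A j) * indicator (A j) x" for j x
  have Ch: "0 \<le> CL ^ 3" using CL by auto
  have pred: "cz_term M p1 p2 p CT K T L CL CK \<omega> n c r k E A h (CL ^ 3) Dphi"
  proof (intro cz_term.intro cz_operator_axioms cz_data.intro cz_data_axioms.intro dominated_space_axioms,
      unfold rho_def[symmetric] e_def[symmetric] env_def[symmetric])
    show "0 < measure M (A j)" if "j < n" for j using A(3)[OF that] Rpos[OF that] by linarith
    show "measure M (ball (c j) (32 ^ Suc (k j) * r j)) \<le> 2 * CL ^ 5 * measure M (ball (c j) (rho j))" if "j < n" for j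
      using kk(3)[OF cE[OF that]] by (simp add: rho_def k_def r_def)
    show "(2 * CL ^ 5) ^ (k j - i) * measure M (ball (c j) (32 ^ i * r j)) \<le> measure M (ball (c j) (rho j))"
      if "j < n" "1 \<le> i" "i \<le> k j" for j i
      using kk(4)[OF cE[OF that(1)]] that(2,3) by (simp add: rho_def k_def r_def)
    show "(\<Sum>i<n. env i x) \<le> Dphi" for x using A(4)[of x] by (simp add: env_def Dphi_def)
  qed (use comp rpos kge rho_mono Em E_sub E_disj A(1-3) h_int h0 Ch in auto)
  interpret cz_term M p1 p2 p CT K T L CL CK \<omega> n c r k E A h "CL ^ 3" Dphi rho e env
    by (intro pred) (rule eq_reflection, rule rho_def e_def env_def)+
  define S where "S = - \<Omega>"
  have Sm [measurable]: "S \<in> sets M"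
    unfolding S_def using sets.compl_sets[OF \<Omega>m] by (simp add: Compl_eq_Diff_UNIV)
  define B where "B = S \<inter> (\<Inter>j\<in>{..<n}. - ball (c j) (6 * r j))"
  have "- ball (c j) (6 * r j) \<in> sets M" for j
    using sets.compl_sets[OF ball_sets_M, of "c j" "6 * r j"] by (simp add: Compl_eq_Diff_UNIV)
  then have Bm: "B \<in> sets M"
    unfolding B_def by (cases "n = 0") (auto intro!: sets.Int sets.finite_INT)
  \<comment> \<open>The dilation 6 of the stopping condition is rounded up to 8, which accounts for
    \<open>CL ^ 3\<close>.\<close>
  have domz: "dominated_at (\<lambda>y. ennreal (h y)) (CL ^ 3) z" if "z \<in> S" for z
    unfolding dominated_at_def
  proof (intro allI impI)
    fix s :: real assume s: "0 < s"
    have "(\<integral>\<^sup>+y\<in>ball z s. ennreal (h y) \<partial>M) \<le> 1 * emeasure M (ball z (6 * s))"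
      using that s by (intro not_stopping_set) (auto simp: S_def \<Omega>_def)
    also have "\<dots> \<le> emeasure M (ball z (8 * s))" using s by (auto intro!: emeasure_mono subset_ball)
    also have "\<dots> \<le> ennreal (L z (2 ^ 3 * s))" using emeasure_ball_le[of "8 * s" z] s by simp
    also have "\<dots> \<le> ennreal (CL ^ 3 * L z s)" using L_pow[OF s, of z 3] by (rule ennreal_leI)
    finally show "(\<integral>\<^sup>+y\<in>ball z s. ennreal (h y) \<partial>M) \<le> ennreal (CL ^ 3 * L z s)" .
  qed
  have Bgood: "good z" if "z \<in> B" for z
    unfolding good_def using that domz[of z] by (auto simp: B_def not_less)
  have bdS: "AE x in M. x \<in> S \<longrightarrow> h x \<le> Cgood"
  proof -
    have "AE x in M. x \<notin> stopping_set 6 (\<lambda>x. ennreal (h x)) 1 \<longrightarrow> ennreal (h x) \<le> ennreal (2 * real (N ^ 5) + 1) * 1"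
      by (rule AE_bound_off_stopping_set[OF gd]) auto
    then show ?thesis
    proof eventually_elim
      case (elim x)
      have "0 \<le> Cgood" by (simp add: Cgood_def)
      moreover have "ennreal (h x) \<le> ennreal Cgood" if "x \<in> S"
        using elim that unfolding Cgood_def S_def \<Omega>_def mult_1_right by blast
      ultimately show ?case by (auto simp: ennreal_le_iff)
    qed
  qed
  define g1 g2 where "g1 x = indicator S x * f1 x" and "g2 x = indicator S x * f2 x" for x
  have gb: "AE x in M. cmod (g1 x) \<le> Cgood" "AE x in M. cmod (g2 x) \<le> Cgood"
  proof -
    have C0: "0 \<le> Cgood" by (simp add: Cgood_def)
    show "AE x in M. cmod (g1 x) \<le> Cgood"
      using bdS by eventually_elim (use f1h C0 in \<open>auto simp: g1_def indicator_def intro: order_trans\<close>)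
    show "AE x in M. cmod (g2 x) \<le> Cgood"
      using bdS by eventually_elim (use f2h C0 in \<open>auto simp: g2_def indicator_def intro: order_trans\<close>)
  qed
  have stage0: "stage (\<lambda>x. indicator S x * f x) f 0 = (\<lambda>x. indicator (- \<Omega> \<union> E0) x * f x)" for f
  proof
    fix x
    have "stage (\<lambda>x. indicator S x * f x) f 0 x = indicator S x * f x + (\<Sum>j<n. indicator (E j) x * f x)"
      by (simp only: stage_def lessThan_0 sum.empty add_0_right atLeast0LessThan)
    also have "\<dots> = (indicator S x + indicator E0 x) * f x"
      by (simp only: E_Un[symmetric] indicator_UN_disjoint[OF finite_lessThan E_disj] sum_distrib_right distrib_right)
    also have "\<dots> = indicator (- \<Omega> \<union> E0) x * f x"
      using E0(2) by (auto simp: S_def indicator_def)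
    finally show "stage (\<lambda>x. indicator S x * f x) f 0 x = indicator (- \<Omega> \<union> E0) x * f x" .
  qed
  have Cg1: "1 \<le> Cgood + Dphi" using CL by (simp add: Cgood_def Dphi_def)
  define F where "F = T (\<lambda>x. indicator (- \<Omega> \<union> E0) x * f1 x) (\<lambda>x. indicator (- \<Omega> \<union> E0) x * f2 x)"
  have step: "emeasure M {z \<in> B. 3 < cmod (F z)} \<le> ennreal (step_const (Cgood + Dphi) * H)"
  proof -
    have le: "cmod (g1 x) \<le> h x" "cmod (g2 x) \<le> h x" for x
      using f1h[of x] f2h[of x] h0[of x] by (auto simp: g1_def g2_def indicator_def)
    have "in_Lp M p1 g1" "in_Lp M p2 g2"
      unfolding g1_def[abs_def] g2_def[abs_def] using f1 f2 by (auto intro!: in_Lp_indicator)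
    then have "emeasure M {z \<in> B. 3 < cmod (T (stage g1 f1 0) (stage g2 f2 0) z)} \<le> ennreal (step_const (Cgood + Dphi) * (\<integral>x. h x \<partial>M))"
      using le by (intro cz_step[where ?C0.0 = Cgood] f1 f2 f1h f2h gb Bm Bgood Cg1 refl)
    then show ?thesis unfolding g1_def[abs_def] g2_def[abs_def] stage0 F_def H_def .
  qed
  \<comment> \<open>Removing the balls of radius \<open>6 * r j\<close> costs no more than the mass
    of \<open>h\<close>: the stopping condition is stated for exactly this dilation, and the
    stopping balls are disjoint.\<close>
  have exc: "emeasure M (- B) \<le> ennreal (2 * H)"
  proof -
    have mB: "(\<Union>j<n. ball (c j) (6 * r j)) \<in> sets M" by auto
    have "- B = \<Omega> \<union> (\<Union>j<n. ball (c j) (6 * r j))" by (auto simp: B_def S_def)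
    then have "emeasure M (- B) \<le> emeasure M \<Omega> + emeasure M (\<Union>j<n. ball (c j) (6 * r j))"
      using emeasure_subadditive[OF \<Omega>m mB] by simp
    also have "\<dots> \<le> ennreal H + ennreal H"
    proof (rule add_mono)
      show "emeasure M \<Omega> \<le> ennreal H"
        using weak_type_stopping_set[of "\<lambda>x. ennreal (h x)" 6 1] nnH by (simp add: \<Omega>_def)
      have "emeasure M (\<Union>j<n. ball (c j) (6 * r j)) \<le> (\<Sum>j<n. emeasure M (ball (c j) (6 * r j)))"
        by (intro emeasure_subadditive_finite) auto
      also have "\<dots> \<le> (\<Sum>j<n. \<integral>\<^sup>+y\<in>ball (c j) (r j). ennreal (h y) \<partial>M)"
        using rr(2) cE by (intro sum_mono less_imp_le) (auto simp: r_def)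
      also have "\<dots> \<le> (\<integral>\<^sup>+y. ennreal (h y) \<partial>M)"
      proof (rule sum_disjoint_nn_integral_le)
        show "disjoint_family_on (\<lambda>j. ball (c j) (r j)) {..<n}"
          unfolding disjoint_family_on_def
        proof (intro ballI impI)
          fix i j assume ij: "i \<in> {..<n}" "j \<in> {..<n}" "i \<noteq> j"
          then have "c i \<noteq> c j" using inj by (auto simp: inj_on_def)
          then show "ball (c i) (r i) \<inter> ball (c j) (r j) = {}"
            using J(3) cJ ij by (auto simp: disjoint_family_on_def r_def)
        qed
      qed auto
      finally show "emeasure M (\<Union>j<n. ball (c j) (6 * r j)) \<le> ennreal H" using nnH by simp
    qed
    also have "\<dots> = ennreal (2 * H)" using H0 by (simp flip: ennreal_plus)
    finally show ?thesis .
  qed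
  have Fm [measurable]: "F \<in> borel_measurable M"
  proof -
    have "- \<Omega> \<union> E0 \<in> sets M" using Sm by (auto simp: S_def)
    then show ?thesis unfolding F_def using f1 f2 by (intro T_measurable in_Lp_indicator) auto
  qed
  have m: "{z \<in> B. 3 < cmod (F z)} \<in> sets M" "- B \<in> sets M"
  proof -
    note [measurable] = Bm
    have "{z \<in> space M. z \<in> B \<and> 3 < cmod (F z)} \<in> sets M" by measurable
    then show "{z \<in> B. 3 < cmod (F z)} \<in> sets M" by simp
    show "- B \<in> sets M" using sets.compl_sets[OF Bm] by (simp add: Compl_eq_Diff_UNIV)
  qed
  have "{x. 3 < cmod (F x)} \<subseteq> - B \<union> {z \<in> B. 3 < cmod (F z)}" by auto
  then have "emeasure M {x. 3 < cmod (F x)} \<le> emeasure M (- B \<union> {z \<in> B. 3 < cmod (F z)})"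
    using m by (intro emeasure_mono) auto
  also have "\<dots> \<le> emeasure M (- B) + emeasure M {z \<in> B. 3 < cmod (F z)}"
    using m by (intro emeasure_subadditive)
  also have "\<dots> \<le> ennreal (2 * H) + ennreal (step_const (Cgood + Dphi) * H)" by (intro add_mono exc step)
  also have "\<dots> = ennreal ((2 + step_const (Cgood + Dphi)) * H)"
    using H0 step_const_nonneg[of "Cgood + Dphi"] by (simp add: distrib_right flip: ennreal_plus)
  also have "2 + step_const (Cgood + Dphi) = weak_const"
    by (simp only: weak_const_def step_const_def bad_const_def)
  finally show ?thesis by (simp add: F_def H_def)
qed

lemma weak_const_ge: "1 \<le> weak_const"
proof -
  have om: "\<And>i. 0 \<le> \<omega> ((1 / 2) ^ Suc i)" by (intro omega_nonneg) auto
  have "0 \<le> Dphi" using CL by (simp add: Dphi_def)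
  then have "0 \<le> 2 * CT * (Cgood + Dphi) powr (2 * p)
     + (2 * (CK * (32 * CL ^ 3 * (2 * CL ^ 3 + Dphi))) + 16 * CK * CL ^ 3 * Dphi) * (CL * (\<Sum>i. \<omega> ((1 / 2) ^ Suc i)) + 4 * CL ^ 5 + CL)
     + 8 * CL ^ 5 * (1 + CT * (Cgood + Dphi) powr p)"
    using CT CL CK suminf_nonneg[OF omega_summable om] by (intro add_nonneg_nonneg mult_nonneg_nonneg) auto
  then show ?thesis unfolding weak_const_def by linarith
qed

text \<open>If the mass of \<open>h\<close> reaches the measure of the space, the estimate is
  trivial because \<open>1 \<le> weak_const\<close>. Otherwise stopping radii are bounded, and
  compact sets exhaust the stopping set; the limit raises the level from 3 to 4.\<close>

lemma weak_type_normalised: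
  assumes f1: "in_Lp M p1 f1" "integrable M f1" and f2: "in_Lp M p2 f2" "integrable M f2"
  shows "emeasure M {x. 4 < cmod (T f1 f2 x)} \<le> ennreal (weak_const * (L1_norm M f1 + L1_norm M f2))"
proof -
  define h where "h = (\<lambda>x. cmod (f1 x) + cmod (f2 x))"
  define H where "H = (\<integral>x. h x \<partial>M)"
  have H: "H = L1_norm M f1 + L1_norm M f2"
    unfolding H_def h_def using f1 f2 by simp
  have H0: "0 \<le> H" unfolding H by (intro add_nonneg_nonneg) auto
  have h_int: "integrable M h" unfolding h_def using f1 f2 by auto
  have "emeasure M {x. 4 < cmod (T f1 f2 x)} \<le> ennreal (weak_const * H)"
  proof (cases "ennreal H < emeasure M UNIV")
    case False
    have "emeasure M {x. 4 < cmod (T f1 f2 x)} \<le> emeasure M (space M)" by (rule emeasure_space)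
    also have "\<dots> \<le> ennreal H" using False by (simp add: not_less)
    also have "\<dots> \<le> ennreal (weak_const * H)"
      using H0 weak_const_ge mult_right_mono[of 1 weak_const H] by (intro ennreal_leI) auto
    finally show ?thesis .
  next
    case True
    define \<Omega> where "\<Omega> = stopping_set 6 (\<lambda>x. ennreal (h x)) 1"
    have hm: "(\<lambda>x. ennreal (h x)) \<in> borel_measurable M" using h_int by measurable
    have \<Omega>o: "open \<Omega>" unfolding \<Omega>_def by (intro open_stopping_set hm) auto
    have "emeasure M \<Omega> \<le> (\<integral>\<^sup>+x. ennreal (h x) \<partial>M)"
      using weak_type_stopping_set[OF hm, of 6 1] by (simp add: \<Omega>_def)
    also have "\<dots> < \<infinity>" using h_int by (subst nn_integral_eq_integral) (auto simp: h_def)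
    finally have fin: "emeasure M \<Omega> < \<infinity>" .
    obtain E where E: "\<And>n::nat. compact (E n)" "\<And>n. E n \<subseteq> \<Omega>" "incseq E" "AE x in M. x \<in> \<Omega> \<longrightarrow> (\<exists>n. x \<in> E n)"
      using compact_exhaustion[of \<Omega>] fin \<Omega>o by auto
    define D where "D n = - \<Omega> \<union> E n" for n
    have Dm: "D n \<in> sets M" for n
    proof -
      have "- \<Omega> \<in> sets M" using sets.compl_sets[OF open_sets_M[OF \<Omega>o]] by (simp add: Compl_eq_Diff_UNIV)
      then show ?thesis unfolding D_def using E(1) by (intro sets.Un) (auto simp: sets_M borel_compact)
    qed
    have Dinc: "incseq D" using E(3) unfolding D_def incseq_def by blast
    have DAE: "AE x in M. \<forall>\<^sub>F n in sequentially. x \<in> D n"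
      using E(4)
    proof eventually_elim
      case (elim x)
      then obtain m where "x \<in> D m" by (auto simp: D_def)
      then show ?case using incseqD[OF Dinc] unfolding eventually_sequentially by blast
    qed
    have conv: "(\<lambda>n. \<integral>x. cmod (indicator (D n) x * f x - f x) powr q \<partial>M) \<longlonglongrightarrow> 0"
      if f: "in_Lp M q f" and q: "0 < q" for f q
    proof -
      note [measurable] = in_LpD(1)[OF f] Dm
      have "(\<lambda>n. \<integral>x. cmod (indicator (D n) x * f x - f x) powr q \<partial>M) \<longlonglongrightarrow> (\<integral>x. 0 \<partial>M)"
      proof (rule integral_dominated_convergence[where w = "\<lambda>x. cmod (f x) powr q"])
        show "AE x in M. (\<lambda>n. cmod (indicator (D n) x * f x - f x) powr q) \<longlonglongrightarrow> 0"
          using DAE by eventually_elim (auto intro!: tendsto_eventually elim: eventually_mono)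
        show "AE x in M. norm (cmod (indicator (D n) x * f x - f x) powr q) \<le> cmod (f x) powr q" for n
          by (auto simp: indicator_def)
      qed (use f in auto)
      then show ?thesis by simp
    qed
    have "emeasure M {x. 3 + 1 < cmod (T f1 f2 x)} \<le> ennreal (weak_const * H)"
    proof (rule level_set_limit[where F = "\<lambda>n x. indicator (D n) x * f1 x" and G = "\<lambda>n x. indicator (D n) x * f2 x"])
      show "emeasure M {x. 3 < cmod (T (\<lambda>x. indicator (D n) x * f1 x) (\<lambda>x. indicator (D n) x * f2 x) x)} \<le> ennreal (weak_const * H)" for n
        unfolding D_def H_def using True E(1,2) f1 f2
        by (intro weak_type_compact h_def \<Omega>_def) (auto simp: H_def)
    qed (use f1 f2 Dm conv in \<open>auto intro!: in_Lp_indicator\<close>)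
    then show ?thesis by simp
  qed
  then show ?thesis by (simp add: H)
qed

text \<open>Homogeneity: both functions are scaled to the same mass \<open>s\<close>, chosen so that
  the level \<open>t\<close> becomes 4. The sum of the masses then turns into the square root of
  their product.\<close>

lemma weak_type:
  assumes f1: "in_Lp M p1 f1" "integrable M f1" and f2: "in_Lp M p2 f2" "integrable M f2" and t: "0 < t"
  shows "emeasure M {x. t < cmod (T f1 f2 x)}
    \<le> ennreal (4 * weak_const * sqrt (L1_norm M f1 * L1_norm M f2 / t))"
proof -
  define a b where "a = L1_norm M f1" and "b = L1_norm M f2"
  have ab: "0 \<le> a" "0 \<le> b" by (auto simp: a_def b_def)
  show ?thesis
  proof (cases "a = 0 \<or> b = 0")
    \<comment> \<open>A function of mass 0 cannot be rescaled, but then \<open>T f1 f2\<close>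
      vanishes almost everywhere.\<close>
    case True
    have "(AE x in M. f1 x = 0) \<or> (AE x in M. f2 x = 0)"
      using True f1 f2 by (simp add: a_def b_def integral_nonneg_eq_0_iff_AE)
    then have "AE x in M. T f1 f2 x = 0" by (intro T_zero f1 f2)
    then have "AE x in M. \<not> t < cmod (T f1 f2 x)" by eventually_elim (use t in auto)
    then have "emeasure M {x \<in> space M. t < cmod (T f1 f2 x)} = 0" by (rule emeasure_eq_0_AE)
    then show ?thesis by simp
  next
    case False
    then have ab: "0 < a" "0 < b" using ab by auto
    define s where "s = 2 * sqrt (a * b / t)"
    have s: "0 < s" using ab t by (simp add: s_def)
    define c1 c2 where "c1 = complex_of_real (s / a)" and "c2 = complex_of_real (s / b)"
    have cc: "cmod c1 = s / a" "cmod c2 = s / b" using s ab by (auto simp: c1_def c2_def norm_divide)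
    have prod: "cmod (c1 * c2) * t = 4"
      using s ab t by (simp add: norm_mult cc s_def field_simps power2_eq_square)
    have L: "in_Lp M p1 (\<lambda>x. c1 * f1 x)" "in_Lp M p2 (\<lambda>x. c2 * f2 x)" using f1 f2 by (auto intro: in_Lp_cmult)
    have "AE x in M. T (\<lambda>x. c1 * f1 x) (\<lambda>x. c2 * f2 x) x = c1 * (c2 * T f1 f2 x)"
      using T_cmult1[OF f1(1) L(2), of c1] T_cmult2[OF f1(1) f2(1), of c2] by eventually_elim simp
    then have AE: "AE x in M. x \<in> {x. t < cmod (T f1 f2 x)} \<longleftrightarrow> x \<in> {x. 4 < cmod (T (\<lambda>x. c1 * f1 x) (\<lambda>x. c2 * f2 x) x)}"
    proof eventually_elim
      case (elim x)
      have "cmod (T (\<lambda>x. c1 * f1 x) (\<lambda>x. c2 * f2 x) x) = cmod (c1 * c2) * cmod (T f1 f2 x)"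
        unfolding elim by (simp add: norm_mult)
      moreover have "0 < cmod (c1 * c2)" using cc s ab by (simp add: norm_mult)
      ultimately show ?case unfolding mem_Collect_eq prod[symmetric] by (simp only: mult_less_cancel_left_pos)
    qed
    have "{x \<in> space M. t < cmod (T f1 f2 x)} \<in> sets M"
      using T_measurable[OF f1(1) f2(1)] by measurable
    moreover have "{x \<in> space M. 4 < cmod (T (\<lambda>x. c1 * f1 x) (\<lambda>x. c2 * f2 x) x)} \<in> sets M"
      using T_measurable[OF L] by measurable
    ultimately have "emeasure M {x. t < cmod (T f1 f2 x)} = emeasure M {x. 4 < cmod (T (\<lambda>x. c1 * f1 x) (\<lambda>x. c2 * f2 x) x)}"
      using AE by (intro emeasure_eq_AE) auto
    also have "\<dots> \<le> ennreal (weak_const * ((\<integral>x. cmod (c1 * f1 x) \<partial>M) + (\<integral>x. cmod (c2 * f2 x) \<partial>M)))"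
      using f1 f2 L by (intro weak_type_normalised) auto
    also have "(\<integral>x. cmod (c1 * f1 x) \<partial>M) + (\<integral>x. cmod (c2 * f2 x) \<partial>M) = 2 * s"
      using ab by (simp add: norm_mult cc a_def[symmetric] b_def[symmetric])
    also have "weak_const * (2 * s) = 4 * weak_const * sqrt (a * b / t)" by (simp add: s_def)
    finally show ?thesis by (simp add: a_def b_def)
  qed
qed

end

section \<open>Truncations and the Cotlar inequality\<close>

text \<open>The assumption \<open>weak\<close> does not mention the dominating function and may
  therefore have been proved with a different one.\<close>

locale cotlar_operator = cz_operator +
  fixes CW :: real
  assumes CW: "0 \<le> CW"
    and weak: "\<And>f g t. in_Lp M p1 f \<Longrightarrow> integrable M f \<Longrightarrow> in_Lp M p2 g \<Longrightarrow> integrable M g \<Longrightarrow> 0 < t \<Longrightarrow>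
      emeasure M {x. t < cmod (T f g x)} \<le> ennreal (CW * sqrt (L1_norm M f * L1_norm M g / t))"
begin

text \<open>The complement of a product of two balls. Unlike the Euclidean truncation it respects
  the splitting of each argument into an inner and an outer part.\<close>

definition off :: "'a \<Rightarrow> real \<Rightarrow> ('a \<times> 'a) set" where
  "off x a = {w. a \<le> max (dist x (fst w)) (dist x (snd w))}"

abbreviation kernel_integral :: "'a \<Rightarrow> ('a \<times> 'a) set \<Rightarrow> ('a \<Rightarrow> complex) \<Rightarrow> ('a \<Rightarrow> complex) \<Rightarrow> complex" where
  "kernel_integral z S f g \<equiv> set_lebesgue_integral (M \<Otimes>\<^sub>M M) S (\<lambda>(y1, y2). K z y1 y2 * f y1 * g y2)"

abbreviation kernel_integrable :: "'a \<Rightarrow> ('a \<times> 'a) set \<Rightarrow> ('a \<Rightarrow> complex) \<Rightarrow> ('a \<Rightarrow> complex) \<Rightarrow> bool" where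
  "kernel_integrable z S f g \<equiv> set_integrable (M \<Otimes>\<^sub>M M) S (\<lambda>(y1, y2). K z y1 y2 * f y1 * g y2)"

lemma space_pair [simp]: "space (M \<Otimes>\<^sub>M M) = UNIV"
  by (simp add: space_pair_measure)

lemma dist_pair_measurable [measurable]:
  "(\<lambda>w. dist x (fst w)) \<in> borel_measurable (M \<Otimes>\<^sub>M M)" "(\<lambda>w. dist x (snd w)) \<in> borel_measurable (M \<Otimes>\<^sub>M M)"
  by measurable

lemma off_sets [measurable]: "off x a \<in> sets (M \<Otimes>\<^sub>M M)"
proof -
  have "{w \<in> space (M \<Otimes>\<^sub>M M). a \<le> max (dist x (fst w)) (dist x (snd w))} \<in> sets (M \<Otimes>\<^sub>M M)" by measurable
  then show ?thesis by (simp add: off_def)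
qed

lemma kernel_bound_le:
  assumes a: "0 < a" "a \<le> max (dist x y1) (dist x y2)"
  shows "kernel_bound L x y1 y2 \<le> 1 / (L x a)\<^sup>2"
proof -
  have *: "L x a \<le> L0 x d" if "a \<le> d" for d
    using that a(1) L_mono[OF a(1) that, of x] by (simp add: L0_def)
  have "L x a \<le> L0 x (dist x y1) + L0 x (dist x y2)"
    using *[of "dist x y1"] *[of "dist x y2"] a(2)
    by (auto simp: max_def intro: add_increasing add_increasing2 split: if_splits)
  then show ?thesis
    unfolding kernel_bound_L0 using L_pos[OF a(1), of x]
    by (intro divide_left_mono power_mono mult_pos_pos zero_less_power) auto
qed

lemma nn_integral_tensor:
  assumes [measurable]: "F \<in> borel_measurable M" "G \<in> borel_measurable M"
  shows "(\<integral>\<^sup>+w. F (fst w) * G (snd w) \<partial>(M \<Otimes>\<^sub>M M)) = (\<integral>\<^sup>+y. F y \<partial>M) * (\<integral>\<^sup>+y. G y \<partial>M)"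
  by (subst nn_integral_pair) (simp_all add: nn_integral_cmult nn_integral_multc)

text \<open>On the layer the kernel bound is at most its value for \<open>L x a\<close>, both
  variables lie in \<open>ball x b\<close>, and the remaining double integral factors.\<close>

lemma annulus_bound:
  assumes [measurable]: "f \<in> borel_measurable M" "g \<in> borel_measurable M" and a: "0 < a"
  shows "(\<integral>\<^sup>+w. indicator (off x a - off x b) w * ennreal (cmod (f (fst w)) * cmod (g (snd w)) * kernel_bound L x (fst w) (snd w)) \<partial>(M \<Otimes>\<^sub>M M))
    \<le> ennreal (1 / (L x a)\<^sup>2) * (ball_norm M f x b * ball_norm M g x b)"
proof -
  have "(\<integral>\<^sup>+w. indicator (off x a - off x b) w * ennreal (cmod (f (fst w)) * cmod (g (snd w)) * kernel_bound L x (fst w) (snd w)) \<partial>(M \<Otimes>\<^sub>M M))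
      \<le> (\<integral>\<^sup>+w. ennreal (1 / (L x a)\<^sup>2) * ((ennreal (cmod (f (fst w))) * indicator (ball x b) (fst w)) * (ennreal (cmod (g (snd w))) * indicator (ball x b) (snd w))) \<partial>(M \<Otimes>\<^sub>M M))"
  proof (rule nn_integral_mono)
    fix w :: "'a \<times> 'a"
    show "indicator (off x a - off x b) w * ennreal (cmod (f (fst w)) * cmod (g (snd w)) * kernel_bound L x (fst w) (snd w))
        \<le> ennreal (1 / (L x a)\<^sup>2) * ((ennreal (cmod (f (fst w))) * indicator (ball x b) (fst w)) * (ennreal (cmod (g (snd w))) * indicator (ball x b) (snd w)))"
    proof (cases "w \<in> off x a - off x b")
      case True
      then have w: "a \<le> max (dist x (fst w)) (dist x (snd w))" "fst w \<in> ball x b" "snd w \<in> ball x b"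
        by (auto simp: off_def not_le)
      have "cmod (f (fst w)) * cmod (g (snd w)) * kernel_bound L x (fst w) (snd w) \<le> cmod (f (fst w)) * cmod (g (snd w)) * (1 / (L x a)\<^sup>2)"
        by (intro mult_left_mono kernel_bound_le a w) auto
      then have "ennreal (cmod (f (fst w)) * cmod (g (snd w)) * kernel_bound L x (fst w) (snd w)) \<le> ennreal (1 / (L x a)\<^sup>2 * (cmod (f (fst w)) * cmod (g (snd w))))"
        by (intro ennreal_leI) (simp add: mult.commute)
      then show ?thesis using True w by (simp add: ennreal_mult del: times_divide_eq_left)
    qed simp
  qed
  also have "\<dots> = ennreal (1 / (L x a)\<^sup>2) * (ball_norm M f x b * ball_norm M g x b)"
    by (simp add: nn_integral_cmult nn_integral_tensor[of "\<lambda>y. ennreal (cmod (f y)) * indicator (ball x b) y" "\<lambda>y. ennreal (cmod (g y)) * indicator (ball x b) y"])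
  finally show ?thesis .
qed

abbreviation omega_sum :: real where
  "omega_sum \<equiv> \<Sum>k. \<omega> ((1 / 2) ^ Suc k)"

lemma omega_sum_nonneg: "0 \<le> omega_sum"
  by (intro suminf_nonneg omega_summable omega_nonneg) auto

text \<open>Dyadic layers of the larger of the two distances: on each layer the size bound and the
  two averages cancel up to \<open>CL ^ 2\<close>, and regularity contributes
  \<open>\<omega>\<close> at a power of 1/2. What remains is the Dini sum.\<close>

lemma off_regularity:
  assumes [measurable]: "f \<in> borel_measurable M" "g \<in> borel_measurable M"
    and r: "0 < r" "dist x z < r" and a: "0 \<le> a1" "0 \<le> a2"
    and f: "\<And>s. 2 * r \<le> s \<Longrightarrow> ball_norm M f x s \<le> ennreal (a1 * L x s)"
    and g: "\<And>s. 2 * r \<le> s \<Longrightarrow> ball_norm M g x s \<le> ennreal (a2 * L x s)"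
  shows "(\<integral>\<^sup>+w. ennreal (norm (indicator (off x (2 * r)) w *\<^sub>R ((K x (fst w) (snd w) - K z (fst w) (snd w)) * f (fst w) * g (snd w)))) \<partial>(M \<Otimes>\<^sub>M M))
    \<le> ennreal (CK * omega_sum * CL\<^sup>2 * (a1 * a2))"
proof -
  define R where "R k = 2 ^ k * (2 * r)" for k :: nat
  define om where "om k = \<omega> ((1 / 2) ^ Suc k)" for k
  define An where "An k = off x (R k) - off x (R (Suc k))" for k
  define J where "J k w = indicator (An k) w * ennreal (cmod (f (fst w)) * cmod (g (snd w)) * kernel_bound L x (fst w) (snd w))" for k and w :: "'a \<times> 'a"
  have R: "0 < R k" "2 * r \<le> R k" for k
    using r(1) mult_right_mono[of 1 "2 ^ k" "2 * r"] by (auto simp: R_def)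
  have om0: "0 \<le> om k" for k unfolding om_def by (intro omega_nonneg) auto
  have [measurable]: "J k \<in> borel_measurable (M \<Otimes>\<^sub>M M)" for k unfolding J_def An_def by measurable
  have "(\<integral>\<^sup>+w. ennreal (norm (indicator (off x (2 * r)) w *\<^sub>R ((K x (fst w) (snd w) - K z (fst w) (snd w)) * f (fst w) * g (snd w)))) \<partial>(M \<Otimes>\<^sub>M M))
      \<le> (\<integral>\<^sup>+w. (\<Sum>k. ennreal (CK * om k) * J k w) \<partial>(M \<Otimes>\<^sub>M M))"
  proof (rule nn_integral_mono)
    fix w :: "'a \<times> 'a"
    show "ennreal (norm (indicator (off x (2 * r)) w *\<^sub>R ((K x (fst w) (snd w) - K z (fst w) (snd w)) * f (fst w) * g (snd w))))
        \<le> (\<Sum>k. ennreal (CK * om k) * J k w)"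
    proof (cases "w \<in> off x (2 * r)")
      case True
      define d where "d = max (dist x (fst w)) (dist x (snd w))"
      have d: "2 * r \<le> d" using True by (simp add: off_def d_def)
      obtain k0 where "d / (2 * r) < 2 ^ k0" using real_arch_pow[of 2] by auto
      then have k0: "d < R k0" using r(1) by (simp add: R_def field_simps)
      moreover have "R (Suc k0) = 2 * R k0" by (simp add: R_def)
      ultimately have ex: "d < R (Suc k0)" using R(1)[of k0] by linarith
      define k where "k = (LEAST k. d < R (Suc k))"
      have k: "d < R (Suc k)" unfolding k_def by (rule LeastI[of _ k0]) (rule ex)
      have Rk: "R k \<le> d"
      proof (cases k)
        case (Suc i)
        then show ?thesis using not_less_Least[of i "\<lambda>k. d < R (Suc k)"] by (simp add: k_def)
      qed (use d in \<open>simp add: R_def\<close>)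
      have wA: "w \<in> An k"
        unfolding An_def off_def Diff_iff mem_Collect_eq d_def[symmetric] using k Rk by auto
      have d12: "R k \<le> dist x (fst w) + dist x (snd w)"
        using Rk zero_le_dist[of x "fst w"] zero_le_dist[of x "snd w"] unfolding d_def by linarith
      have ne: "x \<noteq> fst w \<or> x \<noteq> snd w"
        using Rk R(1)[of k] by (auto simp: d_def)
      have "cmod (K x (fst w) (snd w) - K z (fst w) (snd w)) \<le> CK * kernel_bound L x (fst w) (snd w) * \<omega> (dist x z / (dist x (fst w) + dist x (snd w)))"
        using d r by (intro K_reg0 ne) (simp add: d_def)
      also have "\<dots> \<le> CK * kernel_bound L x (fst w) (snd w) * om k"
      proof (rule mult_left_mono)
        have "dist x z / (dist x (fst w) + dist x (snd w)) \<le> r / R k"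
          using r d12 R(1)[of k] by (intro frac_le) auto
        also have "r / R k = (1 / 2) ^ Suc k" using r by (simp add: R_def field_simps power_one_over)
        finally show "\<omega> (dist x z / (dist x (fst w) + dist x (snd w))) \<le> om k"
          unfolding om_def by (intro omega_le) auto
      qed (use CK in auto)
      finally have Kd: "cmod (K x (fst w) (snd w) - K z (fst w) (snd w)) \<le> CK * kernel_bound L x (fst w) (snd w) * om k" .
      have "norm (indicator (off x (2 * r)) w *\<^sub>R ((K x (fst w) (snd w) - K z (fst w) (snd w)) * f (fst w) * g (snd w)))
          = cmod (K x (fst w) (snd w) - K z (fst w) (snd w)) * (cmod (f (fst w)) * cmod (g (snd w)))"
        using True by (simp add: norm_mult)
      also have "\<dots> \<le> CK * kernel_bound L x (fst w) (snd w) * om k * (cmod (f (fst w)) * cmod (g (snd w)))"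
        by (intro mult_right_mono Kd) auto
      also have "\<dots> = CK * om k * (cmod (f (fst w)) * cmod (g (snd w)) * kernel_bound L x (fst w) (snd w))" by simp
      finally have "ennreal (norm (indicator (off x (2 * r)) w *\<^sub>R ((K x (fst w) (snd w) - K z (fst w) (snd w)) * f (fst w) * g (snd w))))
          \<le> ennreal (CK * om k * (cmod (f (fst w)) * cmod (g (snd w)) * kernel_bound L x (fst w) (snd w)))" by (rule ennreal_leI)
      also have "\<dots> = ennreal (CK * om k) * J k w"
        unfolding J_def using wA CK om0[of k] by (simp only: indicator_simps mult_1 ennreal_mult mult_nonneg_nonneg norm_ge_zero kernel_bound_nonneg)
      also have "\<dots> \<le> (\<Sum>k. ennreal (CK * om k) * J k w)" by (rule ennreal_le_suminf)
      finally show ?thesis .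
    qed simp
  qed
  also have "\<dots> = (\<Sum>k. ennreal (CK * om k) * (\<integral>\<^sup>+w. J k w \<partial>(M \<Otimes>\<^sub>M M)))"
    by (simp add: nn_integral_suminf nn_integral_cmult)
  also have "\<dots> \<le> (\<Sum>k. ennreal (CK * CL\<^sup>2 * (a1 * a2) * om k))"
  proof (rule suminf_le)
    fix k
    have Lp: "0 < L x (R k)" "0 < L x (R (Suc k))" using R by (auto intro: L_pos)
    have "(\<integral>\<^sup>+w. J k w \<partial>(M \<Otimes>\<^sub>M M)) \<le> ennreal (1 / (L x (R k))\<^sup>2) * ((\<integral>\<^sup>+y\<in>ball x (R (Suc k)). ennreal (cmod (f y)) \<partial>M) * (\<integral>\<^sup>+y\<in>ball x (R (Suc k)). ennreal (cmod (g y)) \<partial>M))"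
      unfolding J_def An_def by (rule annulus_bound) (auto intro: R)
    also have "\<dots> \<le> ennreal (1 / (L x (R k))\<^sup>2) * (ennreal (a1 * L x (R (Suc k))) * ennreal (a2 * L x (R (Suc k))))"
      by (intro mult_left_mono mult_mono f g R) auto
    also have "\<dots> = ennreal (1 / (L x (R k))\<^sup>2 * ((a1 * L x (R (Suc k))) * (a2 * L x (R (Suc k)))))"
      using a Lp by (simp add: ennreal_mult3 less_imp_le del: times_divide_eq_left)
    also have "\<dots> \<le> ennreal (CL\<^sup>2 * (a1 * a2))"
    proof (rule ennreal_leI)
      have "L x (R (Suc k)) \<le> CL * L x (R k)" using L_double[OF R(1)[of k], of x] by (simp add: R_def mult.assoc)
      then have "(L x (R (Suc k)))\<^sup>2 \<le> (CL * L x (R k))\<^sup>2" using Lp by (intro power_mono) auto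
      then have "(a1 * a2) * (L x (R (Suc k)))\<^sup>2 \<le> (a1 * a2) * (CL * L x (R k))\<^sup>2" using a by (intro mult_left_mono) auto
      then show "1 / (L x (R k))\<^sup>2 * ((a1 * L x (R (Suc k))) * (a2 * L x (R (Suc k)))) \<le> CL\<^sup>2 * (a1 * a2)"
        using Lp by (simp add: divide_le_eq power_mult_distrib power2_eq_square ac_simps)
    qed
    finally have "ennreal (CK * om k) * (\<integral>\<^sup>+w. J k w \<partial>(M \<Otimes>\<^sub>M M)) \<le> ennreal (CK * om k) * ennreal (CL\<^sup>2 * (a1 * a2))"
      by (rule mult_left_mono) simp
    also have "\<dots> = ennreal (CK * CL\<^sup>2 * (a1 * a2) * om k)"
      using CK om0[of k] a by (subst ennreal_mult[symmetric]) (auto simp: ac_simps)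
    finally show "ennreal (CK * om k) * (\<integral>\<^sup>+w. J k w \<partial>(M \<Otimes>\<^sub>M M)) \<le> ennreal (CK * CL\<^sup>2 * (a1 * a2) * om k)" .
  qed auto
  also have "\<dots> = ennreal (CK * CL\<^sup>2 * (a1 * a2) * omega_sum)"
    using CK a om0 summable_sums[OF omega_summable] unfolding om_def
    by (intro suminf_ennreal_eq sums_mult mult_nonneg_nonneg) auto
  finally show ?thesis by (simp add: ac_simps)
qed

text \<open>Removing the pair of inner parts \<open>fi\<close>, \<open>gi\<close> leaves
  \<open>fo\<close> against \<open>g\<close> and \<open>fi\<close> against \<open>go\<close>. Each
  has a factor vanishing on \<open>ball x r\<close>, so the kernel represents \<open>T\<close>
  there, and together they are exactly the truncation by \<open>off\<close> with the kernel taken at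
  \<open>z\<close> instead of \<open>x\<close>.\<close>

lemma T_off_comparison:
  assumes f: "in_Lp M p1 f" and g: "in_Lp M p2 g" and int: "kernel_integrable x (off x (2 * r)) f g"
    and r: "0 < r" and a: "0 \<le> a1" "0 \<le> a2"
    and fa: "\<And>s. 2 * r \<le> s \<Longrightarrow> ball_norm M f x s \<le> ennreal (a1 * L x s)"
    and ga: "\<And>s. 2 * r \<le> s \<Longrightarrow> ball_norm M g x s \<le> ennreal (a2 * L x s)"
  shows "AE z in M. z \<in> ball x r \<longrightarrow>
    cmod (kernel_integral x (off x (2 * r)) f g) \<le> cmod (T f g z) +
      cmod (T (\<lambda>y. indicator (ball x (2 * r)) y * f y) (\<lambda>y. indicator (ball x (2 * r)) y * g y) z) +
      CK * omega_sum * CL\<^sup>2 * (a1 * a2)"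
proof -
  define B where "B = ball x (2 * r)"
  define fi fo gi go where "fi y = indicator B y * f y" and "fo y = indicator (- B) y * f y"
    and "gi y = indicator B y * g y" and "go y = indicator (- B) y * g y" for y
  have Bm [measurable]: "B \<in> sets M" by (simp add: B_def)
  have Bcm [measurable]: "- B \<in> sets M" using sets.compl_sets[OF Bm] by (simp add: Compl_eq_Diff_UNIV)
  note [measurable] = in_LpD(1)[OF f] in_LpD(1)[OF g]
  have Lp: "in_Lp M p1 fi" "in_Lp M p1 fo" "in_Lp M p2 gi" "in_Lp M p2 go"
    unfolding fi_def fo_def gi_def go_def using f g by (auto intro!: in_Lp_indicator)
  note [measurable] = in_LpD(1)[OF Lp(1)] in_LpD(1)[OF Lp(2)] in_LpD(1)[OF Lp(3)] in_LpD(1)[OF Lp(4)]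
  have van: "fo y = 0" "go y = 0" if "y \<in> ball x r" for y
    using that r by (auto simp: fo_def go_def B_def)
  have "f = (\<lambda>y. fi y + fo y)" "g = (\<lambda>y. gi y + go y)" by (auto simp: fi_def fo_def gi_def go_def indicator_def)
  then have "AE z in M. T f g z = T fi g z + T fo g z" "AE z in M. T fi g z = T fi gi z + T fi go z"
    using T_add1[OF Lp(1,2) g] T_add2[OF Lp(1,3,4)] by simp_all
  moreover have "AE z in M. z \<in> ball x r \<longrightarrow> integrable (M \<Otimes>\<^sub>M M) (\<lambda>(y1, y2). K z y1 y2 * fo y1 * g y2) \<longrightarrow>
      T fo g z = (\<integral>(y1, y2). K z y1 y2 * fo y1 * g y2 \<partial>(M \<Otimes>\<^sub>M M))"
    using van by (intro kernel_representation Lp g) auto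
  moreover have "AE z in M. z \<in> ball x r \<longrightarrow> integrable (M \<Otimes>\<^sub>M M) (\<lambda>(y1, y2). K z y1 y2 * fi y1 * go y2) \<longrightarrow>
      T fi go z = (\<integral>(y1, y2). K z y1 y2 * fi y1 * go y2 \<partial>(M \<Otimes>\<^sub>M M))"
    using van by (intro kernel_representation Lp) auto
  ultimately show ?thesis
    unfolding B_def[symmetric] fi_def[symmetric] gi_def[symmetric]
  proof eventually_elim
    case (elim z)
    show ?case
    proof
      assume z: "z \<in> ball x r"
      define Kd where "Kd w = indicator (off x (2 * r)) w *\<^sub>R ((K x (fst w) (snd w) - K z (fst w) (snd w)) * f (fst w) * g (snd w))" for w
      define Kx where "Kx w = indicator (off x (2 * r)) w *\<^sub>R (K x (fst w) (snd w) * f (fst w) * g (snd w))" for w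
      define Kz where "Kz w = indicator (off x (2 * r)) w *\<^sub>R (K z (fst w) (snd w) * f (fst w) * g (snd w))" for w
      have Kzm [measurable]: "Kz \<in> borel_measurable (M \<Otimes>\<^sub>M M)" unfolding Kz_def by measurable
      have Kdm: "Kd \<in> borel_measurable (M \<Otimes>\<^sub>M M)" unfolding Kd_def by measurable
      have bnd: "(\<integral>\<^sup>+w. ennreal (norm (Kd w)) \<partial>(M \<Otimes>\<^sub>M M)) \<le> ennreal (CK * omega_sum * CL\<^sup>2 * (a1 * a2))"
        unfolding Kd_def using z by (intro off_regularity r a fa ga) auto
      have iKx: "integrable (M \<Otimes>\<^sub>M M) Kx"
        using int by (simp add: set_integrable_def Kx_def[abs_def] case_prod_beta')
      have iKd: "integrable (M \<Otimes>\<^sub>M M) Kd"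
        by (rule integrableI_bounded[OF Kdm]) (use bnd in \<open>auto intro: le_less_trans\<close>)
      \<comment> \<open>Integrability at the moving point \<open>z\<close> is deduced from
        integrability at \<open>x\<close> and of the difference of the kernels.\<close>
      have KzE: "Kz = (\<lambda>w. Kx w - Kd w)" by (auto simp: Kz_def Kx_def Kd_def algebra_simps)
      have iKz: "integrable (M \<Otimes>\<^sub>M M) Kz" unfolding KzE using iKx iKd by (rule Bochner_Integration.integrable_diff)
      have split: "Kz w = K z (fst w) (snd w) * fo (fst w) * g (snd w) + K z (fst w) (snd w) * fi (fst w) * go (snd w)" for w
        by (auto simp: Kz_def fo_def fi_def go_def off_def B_def indicator_def max_def)
      have 1: "integrable (M \<Otimes>\<^sub>M M) (\<lambda>(y1, y2). K z y1 y2 * fo y1 * g y2)"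
        by (rule Bochner_Integration.integrable_bound[OF iKz]) (measurable, auto simp: Kz_def fo_def off_def B_def indicator_def max_def)
      have 2: "integrable (M \<Otimes>\<^sub>M M) (\<lambda>(y1, y2). K z y1 y2 * fi y1 * go y2)"
        by (rule Bochner_Integration.integrable_bound[OF iKz]) (measurable, auto simp: Kz_def fi_def go_def off_def B_def indicator_def max_def)
      have "T f g z - T fi gi z = (\<integral>w. Kz w \<partial>(M \<Otimes>\<^sub>M M))"
      proof -
        have "(\<integral>w. Kz w \<partial>(M \<Otimes>\<^sub>M M)) = (\<integral>(y1, y2). K z y1 y2 * fo y1 * g y2 \<partial>(M \<Otimes>\<^sub>M M)) + (\<integral>(y1, y2). K z y1 y2 * fi y1 * go y2 \<partial>(M \<Otimes>\<^sub>M M))"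
          using Bochner_Integration.integral_add[OF 1 2] by (simp add: split case_prod_beta')
        then show ?thesis using elim z 1 2 by simp
      qed
      also have "\<dots> = (\<integral>w. Kx w \<partial>(M \<Otimes>\<^sub>M M)) - (\<integral>w. Kd w \<partial>(M \<Otimes>\<^sub>M M))"
        unfolding KzE using iKx iKd by (rule Bochner_Integration.integral_diff)
      also have "(\<integral>w. Kx w \<partial>(M \<Otimes>\<^sub>M M)) = kernel_integral x (off x (2 * r)) f g"
        by (simp add: set_lebesgue_integral_def Kx_def[abs_def] case_prod_beta')
      finally have eq: "kernel_integral x (off x (2 * r)) f g = T f g z - T fi gi z + (\<integral>w. Kd w \<partial>(M \<Otimes>\<^sub>M M))" by simp
      have "ennreal (cmod (\<integral>w. Kd w \<partial>(M \<Otimes>\<^sub>M M))) \<le> ennreal (CK * omega_sum * CL\<^sup>2 * (a1 * a2))"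
        using integral_norm_bound_ennreal[OF iKd] bnd by simp
      then have Kd: "cmod (\<integral>w. Kd w \<partial>(M \<Otimes>\<^sub>M M)) \<le> CK * omega_sum * CL\<^sup>2 * (a1 * a2)"
        using CK omega_sum_nonneg a by (subst (asm) ennreal_le_iff) auto
      show "cmod (kernel_integral x (off x (2 * r)) f g) \<le> cmod (T f g z) + cmod (T fi gi z) + CK * omega_sum * CL\<^sup>2 * (a1 * a2)"
        unfolding eq using Kd norm_triangle_ineq[of "T f g z - T fi gi z" "\<integral>w. Kd w \<partial>(M \<Otimes>\<^sub>M M)"] norm_triangle_ineq4[of "T f g z" "T fi gi z"]
        by linarith
    qed
  qed
qed

text \<open>\<open>A\<close> is the doubling constant of the balls chosen by \<open>doubling_radius\<close>.\<close>

abbreviation A :: real where "A \<equiv> 2 * CL ^ 5"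

lemma A_ge: "2 \<le> A"
  using CL one_le_power[of CL 5] by simp

text \<open>The local masses are at most \<open>m1 * A\<close> and \<open>m2 * A\<close> times the
  measure of the ball, so by the weak type the level \<open>(4 * CW * A)\<^sup>2 * (m1 * m2)\<close>
  makes the exceptional set at most a quarter of the ball. The summand \<open>\<delta>\<close> keeps
  the level positive when \<open>m1 * m2\<close> is 0.\<close>

lemma most_points_estimate:
  assumes f: "in_Lp M p1 f" and g: "in_Lp M p2 g" and int: "kernel_integrable x (off x (2 * r)) f g"
    and r: "0 < r" and a: "0 \<le> a1" "0 \<le> a2" and m: "0 \<le> m1" "0 \<le> m2" and \<delta>: "0 < \<delta>"
    and fa: "\<And>s. 2 * r \<le> s \<Longrightarrow> ball_norm M f x s \<le> ennreal (a1 * L x s)"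
    and ga: "\<And>s. 2 * r \<le> s \<Longrightarrow> ball_norm M g x s \<le> ennreal (a2 * L x s)"
    and doub: "0 < measure M (ball x r)" "measure M (ball x (32 * r)) \<le> A * measure M (ball x r)"
    and fm: "ball_norm M f x (2 * r) \<le> ennreal (m1 * measure M (ball x (32 * r)))"
    and gm: "ball_norm M g x (2 * r) \<le> ennreal (m2 * measure M (ball x (32 * r)))"
  shows "emeasure M {z \<in> ball x r. cmod (T f g z) + (CK * omega_sum * CL\<^sup>2 * (a1 * a2) + (4 * CW * A)\<^sup>2 * (m1 * m2) + \<delta>)
      < cmod (kernel_integral x (off x (2 * r)) f g)} \<le> ennreal (measure M (ball x r) / 4)"
proof -
  define fi gi where "fi y = indicator (ball x (2 * r)) y * f y" and "gi y = indicator (ball x (2 * r)) y * g y" for y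
  define \<mu> where "\<mu> = measure M (ball x r)"
  define t where "t = (4 * CW * A)\<^sup>2 * (m1 * m2) + \<delta>"
  have t: "0 < t" unfolding t_def using m \<delta> by (intro add_nonneg_pos mult_nonneg_nonneg) auto
  have Lp: "in_Lp M p1 fi" "in_Lp M p2 gi" unfolding fi_def gi_def using f g by (auto intro!: in_Lp_indicator)
  have I: "integrable M fi" "integrable M gi"
    unfolding fi_def gi_def using f g fin_ball
    by (auto intro: in_Lp_integrable_indicator[where q = p1] in_Lp_integrable_indicator[where q = p2])
  have intle: "(\<integral>y. cmod (indicator (ball x (2 * r)) y * u y) \<partial>M) \<le> m * measure M (ball x (32 * r))"
    if "ball_norm M u x (2 * r) \<le> ennreal (m * measure M (ball x (32 * r)))"
      "integrable M (\<lambda>y. indicator (ball x (2 * r)) y * u y)" "0 \<le> m" for u :: "'a \<Rightarrow> complex" and m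
  proof -
    have "ennreal (\<integral>y. cmod (indicator (ball x (2 * r)) y * u y) \<partial>M) = (\<integral>\<^sup>+y. ennreal (cmod (indicator (ball x (2 * r)) y * u y)) \<partial>M)"
      using that(2) by (intro nn_integral_eq_integral[symmetric]) auto
    also have "\<dots> = ball_norm M u x (2 * r)"
      by (intro nn_integral_cong) (auto simp: indicator_def)
    finally have "ennreal (\<integral>y. cmod (indicator (ball x (2 * r)) y * u y) \<partial>M) \<le> ennreal (m * measure M (ball x (32 * r)))"
      using that(1) by simp
    then show ?thesis using that(3) by (subst (asm) ennreal_le_iff) auto
  qed
  have Ifi: "L1_norm M fi \<le> m1 * (A * \<mu>)"
    using intle[OF fm I(1)[unfolded fi_def] m(1)] mult_left_mono[OF doub(2) m(1)] by (simp add: fi_def \<mu>_def)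
  have Igi: "L1_norm M gi \<le> m2 * (A * \<mu>)"
    using intle[OF gm I(2)[unfolded gi_def] m(2)] mult_left_mono[OF doub(2) m(2)] by (simp add: gi_def \<mu>_def)
  have "emeasure M {z. t < cmod (T fi gi z)} \<le> ennreal (CW * sqrt (L1_norm M fi * L1_norm M gi / t))"
    by (rule weak[OF Lp(1) I(1) Lp(2) I(2) t])
  also have "\<dots> \<le> ennreal (\<mu> / 4)"
  proof (rule ennreal_leI)
    have "(4 * CW)\<^sup>2 * (L1_norm M fi * L1_norm M gi) \<le> (4 * CW)\<^sup>2 * ((m1 * (A * \<mu>)) * (m2 * (A * \<mu>)))"
      using m A_ge CL by (intro mult_left_mono mult_mono Ifi Igi mult_nonneg_nonneg) (auto simp: \<mu>_def)
    also have "\<dots> = ((4 * CW * A)\<^sup>2 * (m1 * m2)) * \<mu>\<^sup>2" by (simp add: power2_eq_square ac_simps)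
    also have "\<dots> \<le> t * \<mu>\<^sup>2" unfolding t_def using \<delta> by (intro mult_right_mono) auto
    finally have "(4 * CW)\<^sup>2 * (L1_norm M fi * L1_norm M gi / t) \<le> \<mu>\<^sup>2"
      using t by (simp add: field_simps)
    then have "sqrt ((4 * CW)\<^sup>2 * (L1_norm M fi * L1_norm M gi / t)) \<le> sqrt (\<mu>\<^sup>2)"
      by (rule real_sqrt_le_mono)
    then have "4 * CW * sqrt (L1_norm M fi * L1_norm M gi / t) \<le> \<mu>"
      unfolding real_sqrt_mult real_sqrt_abs using CW by (simp add: \<mu>_def)
    then show "CW * sqrt (L1_norm M fi * L1_norm M gi / t) \<le> \<mu> / 4" by simp
  qed
  finally have wk: "emeasure M {z. t < cmod (T fi gi z)} \<le> ennreal (\<mu> / 4)" .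
  note [measurable] = T_measurable[OF Lp] T_measurable[OF f g]
  have "{z \<in> space M. t < cmod (T fi gi z)} \<in> sets M" by measurable
  then have meas: "{z. t < cmod (T fi gi z)} \<in> sets M" by simp
  have "emeasure M {z \<in> ball x r. cmod (T f g z) + (CK * omega_sum * CL\<^sup>2 * (a1 * a2) + (4 * CW * A)\<^sup>2 * (m1 * m2) + \<delta>)
      < cmod (kernel_integral x (off x (2 * r)) f g)} \<le> emeasure M {z. t < cmod (T fi gi z)}"
  proof (rule emeasure_mono_AE[OF _ meas])
    have "AE z in M. z \<in> ball x r \<longrightarrow> cmod (kernel_integral x (off x (2 * r)) f g) \<le> cmod (T f g z) + cmod (T fi gi z) +
      CK * omega_sum * CL\<^sup>2 * (a1 * a2)"
      unfolding fi_def gi_def by (rule T_off_comparison[OF f g int r a]) (use fa ga in auto)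
    then show "AE z in M. z \<in> {z \<in> ball x r. cmod (T f g z) + (CK * omega_sum * CL\<^sup>2 * (a1 * a2) + (4 * CW * A)\<^sup>2 * (m1 * m2) + \<delta>)
        < cmod (kernel_integral x (off x (2 * r)) f g)} \<longrightarrow> z \<in> {z. t < cmod (T fi gi z)}"
      by eventually_elim (auto simp: t_def)
  qed
  then show ?thesis using wk by (simp add: \<mu>_def)
qed

text \<open>A version of \<open>near_sum_integral\<close> for two functions. The mass in a layer is
  controlled by the measure at index \<open>j + 2\<close>, since
  \<open>10 * 32 ^ Suc j \<le> 32 ^ (j + 2)\<close>. The failure of doubling gives a factor 1/2 per
  layer for each function, hence the ratio 1/4.\<close>

lemma near_annuli:
  assumes [measurable]: "f \<in> borel_measurable M" "g \<in> borel_measurable M"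
    and r0: "0 < r0" and k: "1 \<le> k" and m: "0 \<le> m1" "0 \<le> m2"
    and doub: "measure M (ball x (32 ^ Suc k * r0)) \<le> A * measure M (ball x (32 ^ k * r0))"
      "\<And>j. 1 \<le> j \<Longrightarrow> j \<le> k \<Longrightarrow> A ^ (k - j) * measure M (ball x (32 ^ j * r0)) \<le> measure M (ball x (32 ^ k * r0))"
    and fm: "\<And>s. 0 < s \<Longrightarrow> ball_norm M f x s \<le> ennreal (m1 * measure M (ball x (5 * s)))"
    and gm: "\<And>s. 0 < s \<Longrightarrow> ball_norm M g x s \<le> ennreal (m2 * measure M (ball x (5 * s)))"
  shows "(\<integral>\<^sup>+w. indicator (off x (2 * r0) - off x (2 * (32 ^ k * r0))) w * ennreal (cmod (f (fst w)) * cmod (g (snd w)) * kernel_bound L x (fst w) (snd w)) \<partial>(M \<Otimes>\<^sub>M M))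
    \<le> ennreal (A ^ 4 * (m1 * m2))"
proof -
  define mu where "mu j = measure M (ball x (32 ^ j * r0))" for j :: nat
  define R where "R j = 2 * (32 ^ j * r0)" for j :: nat
  define D where "D = CL ^ 5"
  have D: "1 \<le> D" unfolding D_def using CL by (rule one_le_power)
  have AD: "A = 2 * D" by (simp add: D_def)
  have mu0: "0 \<le> mu j" for j by (simp add: mu_def)
  have Rp: "0 < R j" for j using r0 by (simp add: R_def)
  have Lp: "0 < L x (32 ^ j * r0)" for j using r0 by (intro L_pos) auto
  have LL: "L x (32 ^ (j + i) * r0) \<le> D ^ i * L x (32 ^ j * r0)" for i j
  proof -
    have "(32::real) ^ (j + i) * r0 = 2 ^ (5 * i) * (32 ^ j * r0)" by (simp add: power_mult power_add)
    then show ?thesis using L_pow[of "32 ^ j * r0" x "5 * i"] r0 by (simp add: D_def power_mult mult.assoc)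
  qed
  \<comment> \<open>Two cases, because \<open>j + 2\<close> may exceed \<open>k\<close> by one,
    where only the doubling inequality at \<open>k\<close> itself is available.\<close>
  have key: "mu (j + 2) \<le> (2 * D)\<^sup>2 * (1 / 2) ^ (k - j) * L x (32 ^ j * r0)" if j: "j < k" for j
  proof (cases "j + 1 = k")
    case True
    have "mu (j + 2) \<le> 2 * D * mu k" using doub(1) True by (simp add: mu_def AD flip: True)
    also have "mu k \<le> L x (32 ^ (j + 1) * r0)" unfolding mu_def using r0 True by (intro order_trans[OF L_ball]) auto
    also have "\<dots> \<le> D * L x (32 ^ j * r0)" using LL[of j 1] by simp
    finally show ?thesis using D True by (simp add: power2_eq_square flip: True)
  next
    case False
    define i where "i = k - (j + 2)"
    have i: "k = j + 2 + i" "k - j = i + 2" using False j by (auto simp: i_def)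
    have "(2 * D) ^ i * mu (j + 2) \<le> mu k" using doub(2)[of "j + 2"] i by (simp add: mu_def AD)
    also have "mu k \<le> L x (32 ^ (j + (i + 2)) * r0)" unfolding mu_def using r0 i by (intro order_trans[OF L_ball]) (auto simp: ac_simps)
    also have "\<dots> \<le> D ^ (i + 2) * L x (32 ^ j * r0)" by (rule LL)
    finally have "D ^ i * (2 ^ i * mu (j + 2)) \<le> D ^ i * (D\<^sup>2 * L x (32 ^ j * r0))"
      by (simp add: power_mult_distrib power_add power2_eq_square ac_simps)
    then have "2 ^ i * mu (j + 2) \<le> D\<^sup>2 * L x (32 ^ j * r0)"
      using D by (metis mult_le_cancel_left_pos order_less_le_trans zero_less_one zero_less_power)
    then show ?thesis unfolding i(2) by (simp add: power_add power_mult_distrib power_one_over field_simps)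
  qed
  define J where "J w = ennreal (cmod (f (fst w)) * cmod (g (snd w)) * kernel_bound L x (fst w) (snd w))" for w :: "'a \<times> 'a"
  have [measurable]: "J \<in> borel_measurable (M \<Otimes>\<^sub>M M)" unfolding J_def by measurable
  have "(\<integral>\<^sup>+w. indicator (off x (2 * r0) - off x (2 * (32 ^ k * r0))) w * J w \<partial>(M \<Otimes>\<^sub>M M))
      \<le> (\<integral>\<^sup>+w. (\<Sum>j<k. indicator (off x (R j) - off x (R (Suc j))) w * J w) \<partial>(M \<Otimes>\<^sub>M M))"
  proof (rule nn_integral_mono)
    fix w
    show "indicator (off x (2 * r0) - off x (2 * (32 ^ k * r0))) w * J w \<le> (\<Sum>j<k. indicator (off x (R j) - off x (R (Suc j))) w * J w)"
    proof (cases "w \<in> off x (2 * r0) - off x (2 * (32 ^ k * r0))")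
      case True
      then have w: "w \<in> off x (R 0)" "w \<notin> off x (R k)" by (auto simp: R_def)
      define j where "j = (LEAST j. w \<notin> off x (R j))"
      have j: "w \<notin> off x (R j)" unfolding j_def by (rule LeastI[of _ k]) (rule w(2))
      have jk: "j \<le> k" unfolding j_def by (rule Least_le) (rule w(2))
      obtain i where i: "j = Suc i" using j w(1) by (cases j) auto
      have "w \<in> off x (R i)" using not_less_Least[of i "\<lambda>j. w \<notin> off x (R j)"] i j_def by auto
      then have "J w \<le> indicator (off x (R i) - off x (R (Suc i))) w * J w" using j i by simp
      also have "\<dots> \<le> (\<Sum>j<k. indicator (off x (R j) - off x (R (Suc j))) w * J w)"
        using jk i by (intro member_le_sum[of i "{..<k}" "\<lambda>j. indicator (off x (R j) - off x (R (Suc j))) w * J w"]) auto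
      finally show ?thesis using True by simp
    qed simp
  qed
  also have "\<dots> = (\<Sum>j<k. \<integral>\<^sup>+w. indicator (off x (R j) - off x (R (Suc j))) w * J w \<partial>(M \<Otimes>\<^sub>M M))"
    by (rule nn_integral_sum) measurable
  also have "\<dots> \<le> (\<Sum>j<k. ennreal (A ^ 4 * (m1 * m2) * (1 / 4) ^ (k - j)))"
  proof (rule sum_mono)
    fix j assume "j \<in> {..<k}"
    then have j: "j < k" by simp
    have sub: "measure M (ball x (5 * R (Suc j))) \<le> mu (j + 2)"
    proof -
      have "5 * R (Suc j) \<le> 32 ^ (j + 2) * r0" using r0 by (simp add: R_def)
      then show ?thesis unfolding mu_def using fin_ball by (intro measure_mono_fmeasurable subset_ball) (auto simp: fmeasurable_def)
    qed
    have "(\<integral>\<^sup>+w. indicator (off x (R j) - off x (R (Suc j))) w * J w \<partial>(M \<Otimes>\<^sub>M M))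
        \<le> ennreal (1 / (L x (R j))\<^sup>2) * ((\<integral>\<^sup>+y\<in>ball x (R (Suc j)). ennreal (cmod (f y)) \<partial>M) * (\<integral>\<^sup>+y\<in>ball x (R (Suc j)). ennreal (cmod (g y)) \<partial>M))"
      unfolding J_def by (intro annulus_bound Rp) auto
    also have "\<dots> \<le> ennreal (1 / (L x (R j))\<^sup>2) * (ennreal (m1 * mu (j + 2)) * ennreal (m2 * mu (j + 2)))"
      using sub m by (intro mult_left_mono mult_mono order_trans[OF fm] order_trans[OF gm] Rp ennreal_leI) auto
    also have "\<dots> = ennreal (1 / (L x (R j))\<^sup>2 * ((m1 * mu (j + 2)) * (m2 * mu (j + 2))))"
      using m mu0 by (simp add: ennreal_mult3 del: times_divide_eq_left)
    also have "\<dots> \<le> ennreal (A ^ 4 * (m1 * m2) * (1 / 4) ^ (k - j))"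
    proof (rule ennreal_leI)
      have LR: "L x (32 ^ j * r0) \<le> L x (R j)" using r0 by (intro L_mono) (auto simp: R_def)
      then have LRp: "0 < L x (R j)" using Lp[of j] by linarith
      define q where "q = (2 * D)\<^sup>2 * (1 / 2) ^ (k - j)"
      have q0: "0 \<le> q" using D by (simp add: q_def)
      have "mu (j + 2) \<le> q * L x (R j)" using key[OF j] mult_left_mono[OF LR q0] by (simp add: q_def)
      then have "(mu (j + 2))\<^sup>2 \<le> (q * L x (R j))\<^sup>2" using mu0 by (intro power_mono) auto
      then have "(m1 * m2) * (mu (j + 2))\<^sup>2 \<le> (m1 * m2) * (q\<^sup>2 * (L x (R j))\<^sup>2)"
        using m by (intro mult_left_mono) (auto simp: power_mult_distrib)
      then have "1 / (L x (R j))\<^sup>2 * ((m1 * mu (j + 2)) * (m2 * mu (j + 2))) \<le> (m1 * m2) * q\<^sup>2"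
        using LRp by (simp add: divide_le_eq power2_eq_square ac_simps)
      also have "q\<^sup>2 = A ^ 4 * (1 / 4) ^ (k - j)"
      proof -
        have "((1 / 2 :: real) ^ (k - j))\<^sup>2 = (1 / 4) ^ (k - j)" by (simp add: power2_eq_square flip: power_mult_distrib)
        moreover have "((2 * D)\<^sup>2)\<^sup>2 = A ^ 4" unfolding AD by (simp flip: power_mult)
        ultimately show ?thesis by (simp add: q_def power_mult_distrib)
      qed
      finally show "1 / (L x (R j))\<^sup>2 * ((m1 * mu (j + 2)) * (m2 * mu (j + 2))) \<le> A ^ 4 * (m1 * m2) * (1 / 4) ^ (k - j)"
        by (simp add: ac_simps)
    qed
    finally show "(\<integral>\<^sup>+w. indicator (off x (R j) - off x (R (Suc j))) w * J w \<partial>(M \<Otimes>\<^sub>M M)) \<le> ennreal (A ^ 4 * (m1 * m2) * (1 / 4) ^ (k - j))" .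
  qed
  also have "\<dots> = ennreal (A ^ 4 * (m1 * m2) * (\<Sum>j<k. (1 / 4) ^ (k - j)))"
    using m CL by (subst sum_ennreal) (auto simp: sum_distrib_left)
  also have "\<dots> \<le> ennreal (A ^ 4 * (m1 * m2) * 1)"
  proof (intro ennreal_leI mult_left_mono)
    have "(\<Sum>j<k. (1 / 4 :: real) ^ (k - j)) = (1 - (1 / 4) ^ k) / 3"
    proof (induction k)
      case (Suc k)
      have "(\<Sum>j<Suc k. (1 / 4 :: real) ^ (Suc k - j)) = 1 / 4 * (\<Sum>j<k. (1 / 4) ^ (k - j)) + 1 / 4"
        by (simp add: sum_distrib_left Suc_diff_le)
      then show ?case unfolding Suc by (simp add: field_simps)
    qed simp
    also have "\<dots> \<le> 1"
    proof -
      have q: "(1 - q) / 3 \<le> 1" if "0 \<le> q" for q :: real using that by simp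
      show ?thesis by (rule q) simp
    qed
    finally show "(\<Sum>j<k. (1 / 4 :: real) ^ (k - j)) \<le> 1" .
  qed (use m CL in auto)
  finally show ?thesis by (simp add: J_def)
qed

end

text \<open>Dominated convergence for the indicators of the exceptional sets; the finite measure of
  \<open>B\<close> provides the majorant.\<close>

lemma (in ball_finite_space) eventually_small_measure:
  assumes [measurable]: "\<And>n. u n \<in> borel_measurable M" "g \<in> borel_measurable M" "B \<in> sets M"
    and fin: "emeasure M B < \<infinity>" and lim: "AE z in M. (\<lambda>n. u n z) \<longlonglongrightarrow> (g z :: complex)" and e: "0 < e" "0 < c"
  shows "\<forall>\<^sub>F n in sequentially. emeasure M {z \<in> B. e < cmod (u n z - g z)} \<le> ennreal c"
proof -
  define S where "S n = {z \<in> space M. z \<in> B \<and> e < cmod (u n z - g z)}" for n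
  have [measurable]: "S n \<in> sets M" for n unfolding S_def by measurable
  have finS: "emeasure M (S n) < \<infinity>" for n
    using emeasure_mono[of "S n" B M] fin by (auto simp: S_def intro: le_less_trans)
  have "(\<lambda>n. \<integral>z. indicator (S n) z \<partial>M) \<longlonglongrightarrow> (\<integral>z. (0::real) \<partial>M)"
  proof (rule integral_dominated_convergence[where w = "indicator B"])
    show "AE z in M. (\<lambda>n. indicator (S n) z :: real) \<longlonglongrightarrow> 0"
      using lim
    proof eventually_elim
      case (elim z)
      have "\<forall>\<^sub>F n in sequentially. dist (u n z) (g z) < e" using elim e(1) by (rule tendstoD)
      then have "\<forall>\<^sub>F n in sequentially. indicator (S n) z = (0::real)"
        by eventually_elim (auto simp: S_def dist_norm)
      then show ?case by (rule tendsto_eventually)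
    qed
  qed (use fin in \<open>auto simp: S_def indicator_def intro!: integrable_real_indicator\<close>)
  then have "(\<lambda>n. measure M (S n)) \<longlonglongrightarrow> 0" using finS by simp
  then have "\<forall>\<^sub>F n in sequentially. measure M (S n) < c" using e(2) by (rule order_tendstoD)
  then show ?thesis
  proof eventually_elim
    case (elim n)
    then have "emeasure M (S n) \<le> ennreal c"
      using finS[of n] by (simp add: emeasure_eq_ennreal_measure less_top ennreal_leI)
    then show ?case by (simp add: S_def)
  qed
qed

section \<open>From the product truncation to the Euclidean one\<close>

context cotlar_operator
begin

definition far :: "'a \<Rightarrow> real \<Rightarrow> ('a \<times> 'a) set" where
  "far x \<epsilon> = {(y1, y2). (dist x y1)\<^sup>2 + (dist x y2)\<^sup>2 > \<epsilon>\<^sup>2}"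

lemma far_sets [measurable]: "far x \<epsilon> \<in> sets (M \<Otimes>\<^sub>M M)"
proof -
  have "{w \<in> space (M \<Otimes>\<^sub>M M). \<epsilon>\<^sup>2 < (dist x (fst w))\<^sup>2 + (dist x (snd w))\<^sup>2} \<in> sets (M \<Otimes>\<^sub>M M)" by measurable
  then show ?thesis by (simp add: far_def case_prod_beta')
qed

lemma off_subset_far:
  assumes "0 < \<epsilon>" "\<epsilon> < a"
  shows "off x a \<subseteq> far x \<epsilon>"
proof
  fix w assume "w \<in> off x a"
  then have "\<epsilon> < dist x (fst w) \<or> \<epsilon> < dist x (snd w)" using assms by (auto simp: off_def max_def split: if_splits)
  then have "\<epsilon>\<^sup>2 < (dist x (fst w))\<^sup>2 \<or> \<epsilon>\<^sup>2 < (dist x (snd w))\<^sup>2" using assms(1) by (auto intro: power_strict_mono)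
  then have "\<epsilon>\<^sup>2 < (dist x (fst w))\<^sup>2 + (dist x (snd w))\<^sup>2" by (auto intro: less_le_trans)
  then show "w \<in> far x \<epsilon>" by (simp add: far_def case_prod_beta')
qed

text \<open>Two distances of at most \<open>\<epsilon> / 2\<close> have squares summing to at most
  half of \<open>\<epsilon>\<^sup>2\<close>. With \<open>r0 = \<epsilon> / 4\<close> the layers can
  therefore start at \<open>2 * r0\<close>.\<close>

lemma far_subset_off:
  assumes "0 < \<epsilon>"
  shows "far x \<epsilon> \<subseteq> off x (\<epsilon> / 2)"
proof
  fix w assume "w \<in> far x \<epsilon>"
  then have w: "\<epsilon>\<^sup>2 < (dist x (fst w))\<^sup>2 + (dist x (snd w))\<^sup>2" by (simp add: far_def case_prod_beta')
  show "w \<in> off x (\<epsilon> / 2)"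
  proof (rule ccontr)
    assume "w \<notin> off x (\<epsilon> / 2)"
    then have "dist x (fst w) \<le> \<epsilon> / 2" "dist x (snd w) \<le> \<epsilon> / 2" by (auto simp: off_def not_le)
    then have "(dist x (fst w))\<^sup>2 \<le> (\<epsilon> / 2)\<^sup>2" "(dist x (snd w))\<^sup>2 \<le> (\<epsilon> / 2)\<^sup>2" by (auto intro: power_mono)
    then have "\<epsilon>\<^sup>2 < (\<epsilon> / 2)\<^sup>2 + (\<epsilon> / 2)\<^sup>2" using w by linarith
    then show False using assms by (simp add: power2_eq_square field_simps)
  qed
qed

lemma far_minus_off:
  assumes [measurable]: "f \<in> borel_measurable M" "g \<in> borel_measurable M"
    and r0: "0 < r0" and k: "1 \<le> k" and m: "0 \<le> m1" "0 \<le> m2"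
    and doub: "measure M (ball x (32 ^ Suc k * r0)) \<le> A * measure M (ball x (32 ^ k * r0))"
      "\<And>j. 1 \<le> j \<Longrightarrow> j \<le> k \<Longrightarrow> A ^ (k - j) * measure M (ball x (32 ^ j * r0)) \<le> measure M (ball x (32 ^ k * r0))"
    and fm: "\<And>s. 0 < s \<Longrightarrow> ball_norm M f x s \<le> ennreal (m1 * measure M (ball x (5 * s)))"
    and gm: "\<And>s. 0 < s \<Longrightarrow> ball_norm M g x s \<le> ennreal (m2 * measure M (ball x (5 * s)))"
    and int: "kernel_integrable x (far x (4 * r0)) f g"
  shows "cmod (kernel_integral x (far x (4 * r0)) f g)
    \<le> cmod (kernel_integral x (off x (2 * (32 ^ k * r0))) f g) + CK * (A ^ 4 * (m1 * m2))"
proof -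
  define F where "F = far x (4 * r0)"
  define O' where "O' = off x (2 * (32 ^ k * r0))"
  have "32 ^ 1 * r0 \<le> 32 ^ k * r0" using r0 k by (intro mult_right_mono power_increasing) auto
  then have sub: "O' \<subseteq> F" unfolding O'_def F_def using r0 by (intro off_subset_far) auto
  have [measurable]: "F \<in> sets (M \<Otimes>\<^sub>M M)" "O' \<in> sets (M \<Otimes>\<^sub>M M)" by (auto simp: F_def O'_def)
  have iF: "kernel_integrable x F f g" using int by (simp add: F_def)
  have iO: "kernel_integrable x O' f g" by (rule set_integrable_subset[OF iF]) (use sub in auto)
  have iD: "kernel_integrable x (F - O') f g" by (rule set_integrable_subset[OF iF]) auto
  have "F = O' \<union> (F - O')" using sub by auto
  then have eq: "kernel_integral x F f g = kernel_integral x O' f g + kernel_integral x (F - O') f g"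
    using set_integral_Un[of O' "F - O'" "M \<Otimes>\<^sub>M M" "\<lambda>(y1, y2). K x y1 y2 * f y1 * g y2"] iO iD by simp
  have "ennreal (cmod (kernel_integral x (F - O') f g)) \<le> (\<integral>\<^sup>+w. ennreal (norm (indicator (F - O') w *\<^sub>R (case w of (y1, y2) \<Rightarrow> K x y1 y2 * f y1 * g y2))) \<partial>(M \<Otimes>\<^sub>M M))"
    unfolding set_lebesgue_integral_def using iD by (intro integral_norm_bound_ennreal) (simp add: set_integrable_def)
  also have "\<dots> \<le> (\<integral>\<^sup>+w. ennreal CK * (indicator (off x (2 * r0) - O') w * ennreal (cmod (f (fst w)) * cmod (g (snd w)) * kernel_bound L x (fst w) (snd w))) \<partial>(M \<Otimes>\<^sub>M M))"
  proof (rule nn_integral_mono)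
    fix w
    show "ennreal (norm (indicator (F - O') w *\<^sub>R (case w of (y1, y2) \<Rightarrow> K x y1 y2 * f y1 * g y2)))
        \<le> ennreal CK * (indicator (off x (2 * r0) - O') w * ennreal (cmod (f (fst w)) * cmod (g (snd w)) * kernel_bound L x (fst w) (snd w)))"
    proof (cases "w \<in> F - O'")
      case True
      then have w: "w \<in> off x (2 * r0) - O'"
        using far_subset_off[of "4 * r0" x] r0 by (auto simp: F_def)
      have "norm (case w of (y1, y2) \<Rightarrow> K x y1 y2 * f y1 * g y2) = cmod (K x (fst w) (snd w)) * (cmod (f (fst w)) * cmod (g (snd w)))"
        by (simp add: case_prod_beta norm_mult)
      also have "\<dots> \<le> CK * kernel_bound L x (fst w) (snd w) * (cmod (f (fst w)) * cmod (g (snd w)))"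
        by (intro mult_right_mono K_size) auto
      also have "\<dots> = CK * (cmod (f (fst w)) * cmod (g (snd w)) * kernel_bound L x (fst w) (snd w))" by simp
      finally have "ennreal (norm (case w of (y1, y2) \<Rightarrow> K x y1 y2 * f y1 * g y2)) \<le> ennreal CK * ennreal (cmod (f (fst w)) * cmod (g (snd w)) * kernel_bound L x (fst w) (snd w))"
        using CK by (simp add: ennreal_leI flip: ennreal_mult)
      then show ?thesis using True w by simp
    qed simp
  qed
  also have "\<dots> = ennreal CK * (\<integral>\<^sup>+w. indicator (off x (2 * r0) - O') w * ennreal (cmod (f (fst w)) * cmod (g (snd w)) * kernel_bound L x (fst w) (snd w)) \<partial>(M \<Otimes>\<^sub>M M))"
    by (rule nn_integral_cmult) measurable
  also have "\<dots> \<le> ennreal CK * ennreal (A ^ 4 * (m1 * m2))"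
    unfolding O'_def by (intro mult_left_mono near_annuli assms) auto
  also have "\<dots> = ennreal (CK * (A ^ 4 * (m1 * m2)))"
    using CK CL m by (subst ennreal_mult[symmetric]) auto
  finally have "cmod (kernel_integral x (F - O') f g) \<le> CK * (A ^ 4 * (m1 * m2))"
    using CK CL m by (subst (asm) ennreal_le_iff) auto
  then show ?thesis
    unfolding F_def[symmetric] O'_def[symmetric] eq
    using norm_triangle_ineq[of "kernel_integral x O' f g" "kernel_integral x (F - O') f g"] by linarith
qed

text \<open>The first three terms belong to regularity beyond the doubling ball, the weak type of
  the local part, and the layers below the doubling radius.\<close>

definition cotlar_const :: real where
  "cotlar_const = CK * omega_sum * CL\<^sup>2 + (4 * CW * A)\<^sup>2 + CK * A ^ 4 + 1"

lemma cotlar_const_pos: "0 < cotlar_const"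
  unfolding cotlar_const_def using CK CL omega_sum_nonneg by (intro add_nonneg_pos add_nonneg_nonneg mult_nonneg_nonneg) auto

text \<open>The common core of Cotlar's inequality and of the weak type of the maximal truncation:
  at no fewer than half of the points of a doubling ball \<open>cmod (g z)\<close> nearly bounds the
  truncation at \<open>x\<close>, and it is left open how \<open>g\<close> is averaged. The
  approximants \<open>U n\<close>, \<open>V n\<close> allow functions outside the domain of
  \<open>T\<close>.\<close>

lemma pre_cotlar:
  fixes U V :: "nat \<Rightarrow> 'a \<Rightarrow> complex"
  assumes [measurable]: "f1 \<in> borel_measurable M" "f2 \<in> borel_measurable M"
    and \<epsilon>: "0 < \<epsilon>" and pos: "emeasure M UNIV \<noteq> 0"
    and int: "kernel_integrable x (far x \<epsilon>) f1 f2"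
    and a: "0 \<le> a1" "0 \<le> a2" and m: "0 \<le> m1" "0 \<le> m2"
    and fa: "\<And>s. 0 < s \<Longrightarrow> ball_norm M f1 x s \<le> ennreal (a1 * L x s)"
      "\<And>s. 0 < s \<Longrightarrow> ball_norm M f2 x s \<le> ennreal (a2 * L x s)"
    and fm: "\<And>s. 0 < s \<Longrightarrow> ball_norm M f1 x s \<le> ennreal (m1 * measure M (ball x (5 * s)))"
      "\<And>s. 0 < s \<Longrightarrow> ball_norm M f2 x s \<le> ennreal (m2 * measure M (ball x (5 * s)))"
    and UV: "\<And>n. in_Lp M p1 (U n)" "\<And>n. in_Lp M p2 (V n)"
    and UVint: "\<And>n b. \<epsilon> < b \<Longrightarrow> kernel_integrable x (off x b) (U n) (V n)"
    and UVlim: "\<And>b. \<epsilon> < b \<Longrightarrow> (\<lambda>n. kernel_integral x (off x b) (U n) (V n)) \<longlonglongrightarrow> kernel_integral x (off x b) f1 f2"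
    and \<eta>: "\<And>n. 0 \<le> \<eta> n" "\<eta> \<longlonglongrightarrow> 0"
      "\<And>n. (\<integral>\<^sup>+y. ennreal (cmod (U n y - f1 y)) \<partial>M) \<le> ennreal (\<eta> n)"
      "\<And>n. (\<integral>\<^sup>+y. ennreal (cmod (V n y - f2 y)) \<partial>M) \<le> ennreal (\<eta> n)"
    and g: "g \<in> borel_measurable M" "AE z in M. (\<lambda>n. T (U n) (V n) z) \<longlonglongrightarrow> g z"
  shows "\<exists>r>0. 0 < measure M (ball x r) \<and> measure M (ball x (5 * r)) \<le> A * measure M (ball x r) \<and>
    (\<forall>\<delta>>0. emeasure M {z \<in> ball x r. cmod (g z) + cotlar_const * (a1 * a2 + m1 * m2) + \<delta> < cmod (kernel_integral x (far x \<epsilon>) f1 f2)}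
      \<le> ennreal (measure M (ball x r) / 2))"
proof -
  define r0 where "r0 = \<epsilon> / 4"
  have r0: "0 < r0" "4 * r0 = \<epsilon>" using \<epsilon> by (auto simp: r0_def)
  obtain k where k: "1 \<le> k" "0 < measure M (ball x (32 ^ k * r0))"
    "measure M (ball x (32 ^ Suc k * r0)) \<le> A * measure M (ball x (32 ^ k * r0))"
    "\<And>j. 1 \<le> j \<Longrightarrow> j \<le> k \<Longrightarrow> A ^ (k - j) * measure M (ball x (32 ^ j * r0)) \<le> measure M (ball x (32 ^ k * r0))"
    using doubling_radius[OF r0(1) pos, of x] by blast
  define r where "r = 32 ^ k * r0"
  define \<mu> where "\<mu> = measure M (ball x r)"
  define \<nu> where "\<nu> = measure M (ball x (32 * r))"
  \<comment> \<open>Since \<open>1 \<le> k\<close>, the product truncation at \<open>2 * r\<close>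
    lies inside the Euclidean truncation at \<open>\<epsilon>\<close>.\<close>
  have "32 ^ 1 * r0 \<le> r" unfolding r_def using r0 k(1) by (intro mult_right_mono power_increasing) auto
  then have r: "0 < r" "\<epsilon> < 2 * r" using r0 by auto
  have mono: "measure M (ball x s) \<le> measure M (ball x s')" if "s \<le> s'" for s s'
    using that fin_ball by (intro measure_mono_fmeasurable subset_ball) (auto simp: fmeasurable_def)
  have \<mu>: "0 < \<mu>" using k(2) by (simp add: \<mu>_def r_def)
  have \<nu>A: "\<nu> \<le> A * \<mu>" using k(3) by (simp add: \<nu>_def \<mu>_def r_def mult.assoc)
  have \<nu>: "0 < \<nu>" using \<mu> mono[of r "32 * r"] r by (simp add: \<nu>_def \<mu>_def)
  have L2: "0 < L x (2 * r)" using r by (intro L_pos) auto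
  define N where "N = CK * (A ^ 4 * (m1 * m2))"
  have near: "cmod (kernel_integral x (far x \<epsilon>) f1 f2) \<le> cmod (kernel_integral x (off x (2 * r)) f1 f2) + N"
    using far_minus_off[OF _ _ r0(1) k(1) m k(3,4) fm, of ] int unfolding r0(2) r_def[symmetric] N_def by auto
  define Q where "Q a1 a2 m1 m2 = CK * omega_sum * CL\<^sup>2 * (a1 * a2) + (4 * CW * A)\<^sup>2 * (m1 * m2)" for a1 a2 m1 m2 :: real
  have QN: "Q a1 a2 m1 m2 + N \<le> cotlar_const * (a1 * a2 + m1 * m2)"
  proof -
    have "0 \<le> CK * omega_sum * CL\<^sup>2 * (m1 * m2)" "0 \<le> (4 * CW * A)\<^sup>2 * (a1 * a2)" "0 \<le> CK * A ^ 4 * (a1 * a2)"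
      using CK CL omega_sum_nonneg a m by (auto intro!: mult_nonneg_nonneg)
    moreover have "0 \<le> a1 * a2 + m1 * m2" using a m by auto
    ultimately show ?thesis unfolding Q_def N_def cotlar_const_def by (simp add: algebra_simps)
  qed
  \<comment> \<open>The errors \<open>\<eta> n\<close> of the approximants are absorbed into the
    bounds on averages. The bounds with \<open>L\<close> are needed only for radii from
    \<open>2 * r\<close> on, where \<open>L\<close> is at least \<open>L x (2 * r)\<close>, and
    those with the measure only at the ball of measure \<open>\<nu>\<close>.\<close>
  define a1' a2' m1' m2' where "a1' n = a1 + \<eta> n / L x (2 * r)" and "a2' n = a2 + \<eta> n / L x (2 * r)"
    and "m1' n = m1 + \<eta> n / \<nu>" and "m2' n = m2 + \<eta> n / \<nu>" for n
  have nn: "0 \<le> a1' n" "0 \<le> a2' n" "0 \<le> m1' n" "0 \<le> m2' n" for n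
    using a m \<eta>(1)[of n] L2 \<nu> by (auto simp: a1'_def a2'_def m1'_def m2'_def)
  have Qlim: "(\<lambda>n. Q (a1' n) (a2' n) (m1' n) (m2' n)) \<longlonglongrightarrow> Q a1 a2 m1 m2"
  proof -
    have "(\<lambda>n. Q (a1' n) (a2' n) (m1' n) (m2' n)) \<longlonglongrightarrow> Q (a1 + 0 / L x (2 * r)) (a2 + 0 / L x (2 * r)) (m1 + 0 / \<nu>) (m2 + 0 / \<nu>)"
      unfolding Q_def a1'_def a2'_def m1'_def m2'_def using L2 \<nu> by (intro tendsto_intros \<eta>(2)) auto
    then show ?thesis by simp
  qed
  have approx: "ball_norm M u x s \<le> ball_norm M f x s + ennreal (\<eta> n)"
    if [measurable]: "u \<in> borel_measurable M" "f \<in> borel_measurable M"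
      and le: "(\<integral>\<^sup>+y. ennreal (cmod (u y - f y)) \<partial>M) \<le> ennreal (\<eta> n)" for u f :: "'a \<Rightarrow> complex" and n s
  proof -
    have "ball_norm M u x s \<le> (\<integral>\<^sup>+y. ennreal (cmod (f y)) * indicator (ball x s) y + ennreal (cmod (u y - f y)) \<partial>M)"
    proof (rule nn_integral_mono)
      fix y
      have "cmod (u y) \<le> cmod (f y) + cmod (u y - f y)" using norm_triangle_sub[of "u y" "f y"] by simp
      then show "ennreal (cmod (u y)) * indicator (ball x s) y \<le> ennreal (cmod (f y)) * indicator (ball x s) y + ennreal (cmod (u y - f y))"
        by (auto simp: indicator_def ennreal_leI simp flip: ennreal_plus)
    qed
    also have "\<dots> = ball_norm M f x s + (\<integral>\<^sup>+y. ennreal (cmod (u y - f y)) \<partial>M)"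
      by (rule nn_integral_add) auto
    finally show ?thesis using le by (meson add_left_mono order_trans)
  qed
  have la: "ball_norm M u x s \<le> ennreal ((b + \<eta> n / L x (2 * r)) * L x s)"
    if "u \<in> borel_measurable M" "f \<in> borel_measurable M" "(\<integral>\<^sup>+y. ennreal (cmod (u y - f y)) \<partial>M) \<le> ennreal (\<eta> n)"
      and b: "0 \<le> b" "\<And>s. 0 < s \<Longrightarrow> ball_norm M f x s \<le> ennreal (b * L x s)" and s: "2 * r \<le> s"
    for u f :: "'a \<Rightarrow> complex" and n s b
  proof -
    have LL: "L x (2 * r) \<le> L x s" using r s by (intro L_mono) auto
    have "ball_norm M u x s \<le> ennreal (b * L x s) + ennreal (\<eta> n)"
      using approx[OF that(1-3), of s] b(2)[of s] r s by (meson add_right_mono less_le_trans mult_pos_pos order_trans zero_less_numeral)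
    also have "\<dots> = ennreal (b * L x s + \<eta> n)"
      using b(1) LL L2 \<eta>(1) by (intro ennreal_plus[symmetric]) auto
    also have "\<dots> \<le> ennreal ((b + \<eta> n / L x (2 * r)) * L x s)"
    proof (rule ennreal_leI)
      have "\<eta> n * L x (2 * r) \<le> \<eta> n * L x s" using LL \<eta>(1) by (intro mult_left_mono)
      then have "\<eta> n \<le> \<eta> n / L x (2 * r) * L x s" using L2 by (simp add: field_simps)
      then show "b * L x s + \<eta> n \<le> (b + \<eta> n / L x (2 * r)) * L x s" by (simp add: distrib_right)
    qed
    finally show ?thesis .
  qed
  have lm: "ball_norm M u x (2 * r) \<le> ennreal ((b + \<eta> n / \<nu>) * \<nu>)"
    if "u \<in> borel_measurable M" "f \<in> borel_measurable M" "(\<integral>\<^sup>+y. ennreal (cmod (u y - f y)) \<partial>M) \<le> ennreal (\<eta> n)"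
      and b: "0 \<le> b" "\<And>s. 0 < s \<Longrightarrow> ball_norm M f x s \<le> ennreal (b * measure M (ball x (5 * s)))"
    for u f :: "'a \<Rightarrow> complex" and n b
  proof -
    have "ball_norm M f x (2 * r) \<le> ennreal (b * \<nu>)"
    proof -
      have "ball_norm M f x (2 * r) \<le> ennreal (b * measure M (ball x (5 * (2 * r))))"
        using r by (intro b(2)) auto
      also have "\<dots> \<le> ennreal (b * \<nu>)"
        unfolding \<nu>_def using r b(1) by (intro ennreal_leI mult_left_mono mono) auto
      finally show ?thesis .
    qed
    then have "ball_norm M u x (2 * r) \<le> ennreal (b * \<nu>) + ennreal (\<eta> n)"
      using approx[OF that(1-3), of "2 * r"] by (meson add_right_mono order_trans)
    also have "\<dots> = ennreal (b * \<nu> + \<eta> n)"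
      using b(1) \<nu> \<eta>(1) by (intro ennreal_plus[symmetric]) auto
    finally show ?thesis using \<nu> by (simp add: distrib_right)
  qed
  have "emeasure M {z \<in> ball x r. cmod (g z) + cotlar_const * (a1 * a2 + m1 * m2) + \<delta> < cmod (kernel_integral x (far x \<epsilon>) f1 f2)}
      \<le> ennreal (\<mu> / 2)" if \<delta>: "0 < \<delta>" for \<delta>
  proof -
    \<comment> \<open>One quarter of the ball is spent on the weak type and one on the convergence
      of \<open>T (U n) (V n)\<close> to \<open>g\<close>. The four shares of
      \<open>\<delta>\<close> pay for the positive level, the kernel integrals, the constants and
      the values of \<open>T\<close>.\<close>
    define G where "G n = {z \<in> ball x r. cmod (T (U n) (V n) z) + (CK * omega_sum * CL\<^sup>2 * (a1' n * a2' n) + (4 * CW * A)\<^sup>2 * (m1' n * m2' n) + \<delta> / 4)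
        < cmod (kernel_integral x (off x (2 * r)) (U n) (V n))}" for n
    have Tm [measurable]: "T (U n) (V n) \<in> borel_measurable M" for n by (intro T_measurable UV)
    note g(1) [measurable]
    have Gle: "emeasure M (G n) \<le> ennreal (\<mu> / 4)" for n
      unfolding G_def \<mu>_def
    proof (rule most_points_estimate)
      show "ball_norm M (U n) x s \<le> ennreal (a1' n * L x s)" if "2 * r \<le> s" for s
        unfolding a1'_def using that by (intro la[of "U n" f1] in_LpD(1)[OF UV(1)] \<eta> a fa) auto
      show "ball_norm M (V n) x s \<le> ennreal (a2' n * L x s)" if "2 * r \<le> s" for s
        unfolding a2'_def using that by (intro la[of "V n" f2] in_LpD(1)[OF UV(2)] \<eta> a fa) auto
      show "ball_norm M (U n) x (2 * r) \<le> ennreal (m1' n * measure M (ball x (32 * r)))"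
        unfolding m1'_def \<nu>_def[symmetric] by (intro lm[of "U n" f1] in_LpD(1)[OF UV(1)] \<eta> m fm) auto
      show "ball_norm M (V n) x (2 * r) \<le> ennreal (m2' n * measure M (ball x (32 * r)))"
        unfolding m2'_def \<nu>_def[symmetric] by (intro lm[of "V n" f2] in_LpD(1)[OF UV(2)] \<eta> m fm) auto
    qed (use UV UVint r nn \<delta> \<mu> \<nu>A in \<open>auto simp: \<mu>_def \<nu>_def\<close>)
    have ev1: "\<forall>\<^sub>F n in sequentially. dist (kernel_integral x (off x (2 * r)) (U n) (V n)) (kernel_integral x (off x (2 * r)) f1 f2) < \<delta> / 4"
      using UVlim[OF r(2)] \<delta> by (intro tendstoD) auto
    have ev2: "\<forall>\<^sub>F n in sequentially. dist (Q (a1' n) (a2' n) (m1' n) (m2' n)) (Q a1 a2 m1 m2) < \<delta> / 4"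
      using Qlim \<delta> by (intro tendstoD) auto
    have ev3: "\<forall>\<^sub>F n in sequentially. emeasure M {z \<in> ball x r. \<delta> / 4 < cmod (T (U n) (V n) z - g z)} \<le> ennreal (\<mu> / 4)"
      using fin_ball \<delta> \<mu> g by (intro eventually_small_measure) auto
    obtain n where n: "dist (kernel_integral x (off x (2 * r)) (U n) (V n)) (kernel_integral x (off x (2 * r)) f1 f2) < \<delta> / 4"
      "dist (Q (a1' n) (a2' n) (m1' n) (m2' n)) (Q a1 a2 m1 m2) < \<delta> / 4"
      "emeasure M {z \<in> ball x r. \<delta> / 4 < cmod (T (U n) (V n) z - g z)} \<le> ennreal (\<mu> / 4)"
      using eventually_happens[OF eventually_conj[OF ev1 eventually_conj[OF ev2 ev3]]] by auto
    have mS: "G n \<in> sets M" "{z \<in> ball x r. \<delta> / 4 < cmod (T (U n) (V n) z - g z)} \<in> sets M"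
    proof -
      have "{z \<in> space M. z \<in> ball x r \<and> cmod (T (U n) (V n) z) + (CK * omega_sum * CL\<^sup>2 * (a1' n * a2' n) + (4 * CW * A)\<^sup>2 * (m1' n * m2' n) + \<delta> / 4)
        < cmod (kernel_integral x (off x (2 * r)) (U n) (V n))} \<in> sets M" by measurable
      then show "G n \<in> sets M" by (simp add: G_def)
      have "{z \<in> space M. z \<in> ball x r \<and> \<delta> / 4 < cmod (T (U n) (V n) z - g z)} \<in> sets M" by measurable
      then show "{z \<in> ball x r. \<delta> / 4 < cmod (T (U n) (V n) z - g z)} \<in> sets M" by simp
    qed
    have "{z \<in> ball x r. cmod (g z) + cotlar_const * (a1 * a2 + m1 * m2) + \<delta> < cmod (kernel_integral x (far x \<epsilon>) f1 f2)}
        \<subseteq> G n \<union> {z \<in> ball x r. \<delta> / 4 < cmod (T (U n) (V n) z - g z)}"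
    proof
      fix z assume z: "z \<in> {z \<in> ball x r. cmod (g z) + cotlar_const * (a1 * a2 + m1 * m2) + \<delta> < cmod (kernel_integral x (far x \<epsilon>) f1 f2)}"
      show "z \<in> G n \<union> {z \<in> ball x r. \<delta> / 4 < cmod (T (U n) (V n) z - g z)}"
      proof (cases "\<delta> / 4 < cmod (T (U n) (V n) z - g z)")
        case False
        have "cmod (T (U n) (V n) z) \<le> cmod (g z) + \<delta> / 4"
          using False norm_triangle_ineq2[of "T (U n) (V n) z" "g z"] by linarith
        moreover have "Q (a1' n) (a2' n) (m1' n) (m2' n) \<le> Q a1 a2 m1 m2 + \<delta> / 4"
          using n(2) by (simp add: dist_real_def abs_if split: if_splits)
        moreover have "cmod (kernel_integral x (off x (2 * r)) f1 f2) \<le> cmod (kernel_integral x (off x (2 * r)) (U n) (V n)) + \<delta> / 4"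
          using n(1) norm_triangle_ineq3[of "kernel_integral x (off x (2 * r)) (U n) (V n)" "kernel_integral x (off x (2 * r)) f1 f2"]
          unfolding dist_norm by linarith
        ultimately have "cmod (T (U n) (V n) z) + (Q (a1' n) (a2' n) (m1' n) (m2' n) + \<delta> / 4) < cmod (kernel_integral x (off x (2 * r)) (U n) (V n))"
          using z near QN \<delta> by (simp only: mem_Collect_eq) linarith
        then show ?thesis using z by (simp add: G_def Q_def)
      qed (use z in auto)
    qed
    then have "emeasure M {z \<in> ball x r. cmod (g z) + cotlar_const * (a1 * a2 + m1 * m2) + \<delta> < cmod (kernel_integral x (far x \<epsilon>) f1 f2)}
        \<le> emeasure M (G n \<union> {z \<in> ball x r. \<delta> / 4 < cmod (T (U n) (V n) z - g z)})"
      using mS by (intro emeasure_mono) auto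
    also have "\<dots> \<le> emeasure M (G n) + emeasure M {z \<in> ball x r. \<delta> / 4 < cmod (T (U n) (V n) z - g z)}"
      using mS by (rule emeasure_subadditive)
    also have "\<dots> \<le> ennreal (\<mu> / 4) + ennreal (\<mu> / 4)" by (intro add_mono Gle n(3))
    also have "\<dots> = ennreal (\<mu> / 2)" using \<mu> by (simp flip: ennreal_plus)
    finally show ?thesis .
  qed
  moreover have "measure M (ball x (5 * r)) \<le> A * \<mu>"
    using mono[of "5 * r" "32 * r"] r \<nu>A by (simp add: \<nu>_def)
  ultimately show ?thesis using r \<mu> by (intro exI[of _ r]) (auto simp: \<mu>_def)
qed

end

section \<open>Truncations of integrable functions\<close>

context cotlar_operator
begin

text \<open>On the truncation region the kernel is bounded by \<open>CK / (L x b)\<^sup>2\<close>,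
  so for integrable functions the integral converges absolutely at every \<open>x\<close>.\<close>

lemma L1_kernel:
  assumes f: "integrable M f" and g: "integrable M g" and b: "0 < b"
  shows "kernel_integrable x (off x b) f g"
    "cmod (kernel_integral x (off x b) f g) \<le> CK / (L x b)\<^sup>2 * (L1_norm M f * L1_norm M g)"
proof -
  define C where "C = CK / (L x b)\<^sup>2"
  have C: "0 \<le> C" using CK by (simp add: C_def)
  have [measurable]: "f \<in> borel_measurable M" "g \<in> borel_measurable M" using f g by auto
  define F where "F w = indicator (off x b) w *\<^sub>R (case w of (y1, y2) \<Rightarrow> K x y1 y2 * f y1 * g y2)" for w
  have Fm [measurable]: "F \<in> borel_measurable (M \<Otimes>\<^sub>M M)" unfolding F_def by measurable
  have "(\<integral>\<^sup>+w. ennreal (norm (F w)) \<partial>(M \<Otimes>\<^sub>M M)) \<le> (\<integral>\<^sup>+w. ennreal C * (ennreal (cmod (f (fst w))) * ennreal (cmod (g (snd w)))) \<partial>(M \<Otimes>\<^sub>M M))"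
  proof (rule nn_integral_mono)
    fix w
    show "ennreal (norm (F w)) \<le> ennreal C * (ennreal (cmod (f (fst w))) * ennreal (cmod (g (snd w))))"
    proof (cases "w \<in> off x b")
      case True
      then have w: "b \<le> max (dist x (fst w)) (dist x (snd w))" by (simp add: off_def)
      have "norm (F w) = cmod (K x (fst w) (snd w)) * (cmod (f (fst w)) * cmod (g (snd w)))"
        using True by (simp add: F_def case_prod_beta norm_mult)
      also have "\<dots> \<le> C * (cmod (f (fst w)) * cmod (g (snd w)))"
      proof (rule mult_right_mono)
        have "cmod (K x (fst w) (snd w)) \<le> CK * kernel_bound L x (fst w) (snd w)" by (rule K_size)
        also have "\<dots> \<le> CK * (1 / (L x b)\<^sup>2)" by (intro mult_left_mono kernel_bound_le b w CK)
        finally show "cmod (K x (fst w) (snd w)) \<le> C" by (simp add: C_def)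
      qed auto
      finally show ?thesis using C by (simp add: ennreal_leI ennreal_mult3)
    qed (simp add: F_def)
  qed
  also have "\<dots> = ennreal C * (nn_norm M f * nn_norm M g)"
    by (simp add: nn_integral_cmult nn_integral_tensor[of "\<lambda>y. ennreal (cmod (f y))" "\<lambda>y. ennreal (cmod (g y))"])
  also have "\<dots> = ennreal (C * (L1_norm M f * L1_norm M g))"
    using f g C by (simp add: nn_integral_eq_integral ennreal_mult3)
  finally have le: "(\<integral>\<^sup>+w. ennreal (norm (F w)) \<partial>(M \<Otimes>\<^sub>M M)) \<le> ennreal (C * (L1_norm M f * L1_norm M g))" .
  then have int: "integrable (M \<Otimes>\<^sub>M M) F"
    by (intro integrableI_bounded Fm) (auto intro: le_less_trans)
  then show "kernel_integrable x (off x b) f g" by (simp add: set_integrable_def F_def[abs_def])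
  have "ennreal (cmod (\<integral>w. F w \<partial>(M \<Otimes>\<^sub>M M))) \<le> ennreal (C * (L1_norm M f * L1_norm M g))"
    using integral_norm_bound_ennreal[OF int] le by (rule order_trans)
  then have "cmod (\<integral>w. F w \<partial>(M \<Otimes>\<^sub>M M)) \<le> C * (L1_norm M f * L1_norm M g)"
    using C by (subst (asm) ennreal_le_iff) auto
  then show "cmod (kernel_integral x (off x b) f g) \<le> CK / (L x b)\<^sup>2 * (L1_norm M f * L1_norm M g)"
    by (simp add: set_lebesgue_integral_def F_def[abs_def] C_def)
qed

lemma L1_kernel_far:
  assumes "integrable M f" "integrable M g" "0 < \<epsilon>"
  shows "kernel_integrable x (far x \<epsilon>) f g"
proof (rule set_integrable_subset)
  show "kernel_integrable x (off x (\<epsilon> / 2)) f g" using L1_kernel(1)[OF assms(1,2)] assms(3) by simp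
  show "far x \<epsilon> \<subseteq> off x (\<epsilon> / 2)" by (rule far_subset_off[OF assms(3)])
  show "far x \<epsilon> \<in> sets (M \<Otimes>\<^sub>M M)" by simp
qed

text \<open>Bilinearity and the bound of \<open>L1_kernel\<close>, with one argument changed at a
  time.\<close>

lemma L1_kernel_tendsto:
  assumes U: "\<And>n. integrable M (U n)" "(\<lambda>n. \<integral>y. cmod (U n y - f y) \<partial>M) \<longlonglongrightarrow> 0" and f: "integrable M f"
    and V: "\<And>n. integrable M (V n)" "(\<lambda>n. \<integral>y. cmod (V n y - g y) \<partial>M) \<longlonglongrightarrow> 0" and g: "integrable M g"
    and b: "0 < b"
  shows "(\<lambda>n. kernel_integral x (off x b) (U n) (V n)) \<longlonglongrightarrow> kernel_integral x (off x b) f g"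
proof -
  define C where "C = CK / (L x b)\<^sup>2"
  define u v where "u n = (\<integral>y. cmod (U n y - f y) \<partial>M)" and "v n = (\<integral>y. cmod (V n y - g y) \<partial>M)" for n
  have uv: "0 \<le> u n" "0 \<le> v n" for n by (simp_all add: u_def v_def)
  have le: "norm (kernel_integral x (off x b) (U n) (V n) - kernel_integral x (off x b) f g)
      \<le> C * (u n * (L1_norm M g + v n)) + C * (L1_norm M f * v n)" for n
  proof -
    have i1: "integrable M (\<lambda>y. U n y - f y)" and i2: "integrable M (\<lambda>y. V n y - g y)"
      using U(1)[of n] V(1)[of n] f g by (auto intro: Bochner_Integration.integrable_diff)
    note k = L1_kernel(1)[OF _ _ b]
    have 1: "kernel_integral x (off x b) (\<lambda>y. U n y - f y) (V n) = kernel_integral x (off x b) (U n) (V n) - kernel_integral x (off x b) f (V n)"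
      using set_integral_diff(2)[OF k[OF U(1)[of n] V(1)[of n], of x] k[OF f V(1)[of n], of x]]
      by (simp add: case_prod_beta' algebra_simps)
    have 2: "kernel_integral x (off x b) f (\<lambda>y. V n y - g y) = kernel_integral x (off x b) f (V n) - kernel_integral x (off x b) f g"
      using set_integral_diff(2)[OF k[OF f V(1)[of n], of x] k[OF f g, of x]]
      by (simp add: case_prod_beta' algebra_simps)
    have "L1_norm M (V n) \<le> (\<integral>y. cmod (g y) + cmod (V n y - g y) \<partial>M)"
      using V(1)[of n] g norm_triangle_sub by (intro integral_mono integrable_norm Bochner_Integration.integrable_add) auto
    then have Vn: "L1_norm M (V n) \<le> L1_norm M g + v n"
      using V(1)[of n] g by (simp add: v_def)
    have C: "0 \<le> C" using CK by (simp add: C_def)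
    have "kernel_integral x (off x b) (U n) (V n) - kernel_integral x (off x b) f g
        = kernel_integral x (off x b) (\<lambda>y. U n y - f y) (V n) + kernel_integral x (off x b) f (\<lambda>y. V n y - g y)"
      unfolding 1 2 by simp
    also have "norm \<dots> \<le> C * (u n * L1_norm M (V n)) + C * (L1_norm M f * v n)"
      using L1_kernel(2)[OF i1 V(1)[of n] b, of x] L1_kernel(2)[OF f i2 b, of x]
      by (intro order_trans[OF norm_triangle_ineq] add_mono) (auto simp: C_def u_def v_def)
    also have "\<dots> \<le> C * (u n * (L1_norm M g + v n)) + C * (L1_norm M f * v n)"
      using C uv Vn by (intro add_right_mono mult_left_mono) auto
    finally show ?thesis .
  qed
  have "(\<lambda>n. C * (u n * (L1_norm M g + v n)) + C * (L1_norm M f * v n)) \<longlonglongrightarrow>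
      C * (0 * (L1_norm M g + 0)) + C * (L1_norm M f * 0)"
    unfolding u_def v_def by (intro tendsto_intros U V)
  then have lim: "(\<lambda>n. C * (u n * (L1_norm M g + v n)) + C * (L1_norm M f * v n)) \<longlonglongrightarrow> 0"
    by (simp only: mult_zero_left mult_zero_right add_0_left)
  show ?thesis by (rule LIM_zero_cancel, rule Lim_null_comparison[OF always_eventually lim], rule allI, rule le)
qed

lemma kernel_integral_zero:
  assumes "(AE y in M. f y = 0) \<or> (AE y in M. g y = 0)"
  shows "kernel_integral x S f g = 0"
proof -
  have "AE w in M \<Otimes>\<^sub>M M. f (fst w) = 0 \<or> g (snd w) = 0"
    using assms
  proof
    assume "AE y in M. f y = 0"
    from MM.AE_pairI[OF this AE_I2[of M "\<lambda>_. True"]] show ?thesis by (auto elim: eventually_mono)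
  next
    assume "AE y in M. g y = 0"
    from MM.AE_pairI[OF AE_I2[of M "\<lambda>_. True"] this] show ?thesis by (auto elim: eventually_mono)
  qed
  then show ?thesis
    unfolding set_lebesgue_integral_def by (intro integral_eq_zero_AE) (auto elim!: eventually_mono)
qed

lemma truncated_operator_eq: "truncated_operator M K \<epsilon> f g x = kernel_integral x (far x \<epsilon>) f g"
  by (simp add: truncated_operator_def far_def)

section \<open>Maximal functions\<close>

lemma nn_integral_ball_le_maximal_lam:
  fixes f :: "'a \<Rightarrow> complex"
  assumes s: "0 < s"
  shows "ball_norm M f x s \<le> maximal_lam M L f x * ennreal (L x s)"
proof -
  have p: "ennreal (L x s) \<noteq> 0" "ennreal (L x s) \<noteq> top" using L_pos[OF s, of x] by auto
  have "ball_norm M f x s / ennreal (L x s) \<le> maximal_lam M L f x"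
    unfolding maximal_lam_def using s by (intro SUP_upper2[of s]) auto
  then have "ball_norm M f x s / ennreal (L x s) * ennreal (L x s) \<le> maximal_lam M L f x * ennreal (L x s)"
    by (rule mult_right_mono) simp
  then show ?thesis using p by (simp add: ennreal_divide_times ennreal_mult_divide_eq)
qed

text \<open>When \<open>ball x (5 * s)\<close> has measure zero, \<open>maximal_5\<close> carries no
  information about it; but then both sides are 0.\<close>

lemma nn_integral_ball_le_maximal_5:
  fixes f :: "'a \<Rightarrow> 'b::real_normed_vector"
  assumes s: "0 < s"
  shows "(\<integral>\<^sup>+y\<in>ball x s. ennreal (norm (f y)) \<partial>M) \<le> maximal_5 M f x * emeasure M (ball x (5 * s))"
proof (cases "emeasure M (ball x (5 * s)) = 0")
  case True
  have "emeasure M (ball x s) \<le> emeasure M (ball x (5 * s))" using s by (intro emeasure_mono subset_ball) auto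
  then have "ball x s \<in> null_sets M" using True by (intro null_setsI) auto
  then have "AE y in M. y \<notin> ball x s" by (rule AE_not_in)
  then have "(\<integral>\<^sup>+y\<in>ball x s. ennreal (norm (f y)) \<partial>M) = (\<integral>\<^sup>+y. 0 \<partial>M)"
    by (intro nn_integral_cong_AE) (auto elim: eventually_mono)
  then show ?thesis by simp
next
  case False
  have fin: "emeasure M (ball x (5 * s)) \<noteq> top" using fin_ball by (simp add: less_top)
  have "(\<integral>\<^sup>+y\<in>ball x s. ennreal (norm (f y)) \<partial>M) / emeasure M (ball x (5 * s)) \<le> maximal_5 M f x"
    unfolding maximal_5_def using s by (intro SUP_upper2[of s]) auto
  then have "(\<integral>\<^sup>+y\<in>ball x s. ennreal (norm (f y)) \<partial>M) / emeasure M (ball x (5 * s)) * emeasure M (ball x (5 * s)) \<le> maximal_5 M f x * emeasure M (ball x (5 * s))"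
    by (rule mult_right_mono) simp
  then show ?thesis using False fin by (simp add: ennreal_divide_times ennreal_divide_self less_top)
qed

lemma AE_zero_of_balls:
  fixes f :: "'a \<Rightarrow> complex"
  assumes [measurable]: "f \<in> borel_measurable M" and z: "\<And>s. 0 < s \<Longrightarrow> ball_norm M f x s = 0"
  shows "AE y in M. f y = 0"
proof -
  have "AE y in M. y \<in> ball x (real (Suc n)) \<longrightarrow> f y = 0" for n
  proof -
    have "(\<integral>\<^sup>+y. ennreal (cmod (f y)) * indicator (ball x (real (Suc n))) y \<partial>M) = 0" by (rule z) simp
    then have "AE y in M. ennreal (cmod (f y)) * indicator (ball x (real (Suc n))) y = 0"
      by (subst (asm) nn_integral_0_iff_AE) auto
    then show ?thesis by eventually_elim (auto simp: indicator_def split: if_splits)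
  qed
  then have "AE y in M. \<forall>n. y \<in> ball x (real (Suc n)) \<longrightarrow> f y = 0" unfolding AE_all_countable by blast
  then show ?thesis
  proof eventually_elim
    case (elim y)
    obtain n :: nat where "dist x y < real n" using reals_Archimedean2 by blast
    then have "y \<in> ball x (real (Suc n))" by simp
    then show ?case using elim by blast
  qed
qed

text \<open>
  Covers both meanings of \<open>T f1 f2\<close>: constant sequences give the operator itself on \<open>L\<^sup>p\<^sup>1 \<times> L\<^sup>p\<^sup>2\<close>,
  where the truncated integrals need not converge absolutely for every \<open>x\<close>, and \<open>L\<^sup>1\<close>-approximations
  give the extension by density.
\<close>

definition approximates :: "real \<Rightarrow> 'a \<Rightarrow> ('a \<Rightarrow> complex) \<Rightarrow> ('a \<Rightarrow> complex) \<Rightarrow> ('a \<Rightarrow> complex) \<Rightarrow> bool" where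
  "approximates \<epsilon> x f1 f2 g \<longleftrightarrow> g \<in> borel_measurable M \<and>
    (\<exists>U V \<eta>. (\<forall>n::nat. in_Lp M p1 (U n) \<and> in_Lp M p2 (V n)) \<and>
      (\<forall>n b. \<epsilon> < b \<longrightarrow> kernel_integrable x (off x b) (U n) (V n)) \<and>
      (\<forall>b. \<epsilon> < b \<longrightarrow> (\<lambda>n. kernel_integral x (off x b) (U n) (V n)) \<longlonglongrightarrow> kernel_integral x (off x b) f1 f2) \<and>
      (\<forall>n::nat. 0 \<le> \<eta> n) \<and> \<eta> \<longlonglongrightarrow> 0 \<and>
      (\<forall>n. (\<integral>\<^sup>+y. ennreal (cmod (U n y - f1 y)) \<partial>M) \<le> ennreal (\<eta> n)) \<and>
      (\<forall>n. (\<integral>\<^sup>+y. ennreal (cmod (V n y - f2 y)) \<partial>M) \<le> ennreal (\<eta> n)) \<and>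
      (AE z in M. (\<lambda>n. T (U n) (V n) z) \<longlonglongrightarrow> g z))"

lemma approximates_self:
  assumes f: "in_Lp M p1 f1" and g: "in_Lp M p2 f2" and int: "kernel_integrable x (far x \<epsilon>) f1 f2" and \<epsilon>: "0 < \<epsilon>"
  shows "approximates \<epsilon> x f1 f2 (T f1 f2)"
proof -
  have "kernel_integrable x (off x b) f1 f2" if "\<epsilon> < b" for b
    by (rule set_integrable_subset[OF int]) (use off_subset_far[OF \<epsilon> that] in auto)
  then show ?thesis
    unfolding approximates_def using T_measurable[OF f g] f g
    by - (rule conjI, simp, rule exI[of _ "\<lambda>_. f1"], rule exI[of _ "\<lambda>_. f2"], rule exI[of _ "\<lambda>_. 0"], auto)
qed

lemma approximates_L1:
  assumes f: "integrable M f1" "integrable M f2" and \<epsilon>: "0 < \<epsilon>"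
    and U: "\<And>n::nat. in_Lp M p1 (U n)" "\<And>n. integrable M (U n)" "(\<lambda>n. \<integral>y. cmod (U n y - f1 y) \<partial>M) \<longlonglongrightarrow> 0"
    and V: "\<And>n::nat. in_Lp M p2 (V n)" "\<And>n. integrable M (V n)" "(\<lambda>n. \<integral>y. cmod (V n y - f2 y) \<partial>M) \<longlonglongrightarrow> 0"
    and g: "g \<in> borel_measurable M" "AE z in M. (\<lambda>n. T (U n) (V n) z) \<longlonglongrightarrow> g z"
  shows "approximates \<epsilon> x f1 f2 g"
proof -
  define u v where "u n = (\<integral>y. cmod (U n y - f1 y) \<partial>M)" and "v n = (\<integral>y. cmod (V n y - f2 y) \<partial>M)" for n
  have uv: "0 \<le> u n" "0 \<le> v n" for n by (simp_all add: u_def v_def)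
  have lim: "(\<lambda>n. u n + v n) \<longlonglongrightarrow> 0" using tendsto_add[OF U(3) V(3)] by (simp add: u_def v_def)
  have "(\<integral>\<^sup>+y. ennreal (cmod (U n y - f1 y)) \<partial>M) = ennreal (u n)" "(\<integral>\<^sup>+y. ennreal (cmod (V n y - f2 y)) \<partial>M) = ennreal (v n)" for n
    unfolding u_def v_def using U(2)[of n] V(2)[of n] f by (auto intro!: nn_integral_eq_integral)
  then have le: "(\<integral>\<^sup>+y. ennreal (cmod (U n y - f1 y)) \<partial>M) \<le> ennreal (u n + v n)" "(\<integral>\<^sup>+y. ennreal (cmod (V n y - f2 y)) \<partial>M) \<le> ennreal (u n + v n)" for n
    using uv by (auto intro!: ennreal_leI)
  have k: "kernel_integrable x (off x b) (U n) (V n)" if "\<epsilon> < b" for b n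
    using that \<epsilon> by (intro L1_kernel U V) auto
  have kl: "(\<lambda>n. kernel_integral x (off x b) (U n) (V n)) \<longlonglongrightarrow> kernel_integral x (off x b) f1 f2" if "\<epsilon> < b" for b
    using that \<epsilon> by (intro L1_kernel_tendsto U V f) auto
  have uv': "0 \<le> u n + v n" for n using uv by simp
  show ?thesis
    unfolding approximates_def
    by (rule conjI, rule g(1), rule exI[of _ U], rule exI[of _ V], rule exI[of _ "\<lambda>n. u n + v n"], intro conjI allI impI)
      (rule U(1) V(1) k kl uv' lim le g(2) | assumption)+
qed

lemma pre_cotlar_approximates:
  assumes fm: "f1 \<in> borel_measurable M" "f2 \<in> borel_measurable M"
    and \<epsilon>: "0 < \<epsilon>" and pos: "emeasure M UNIV \<noteq> 0"
    and int: "kernel_integrable x (far x \<epsilon>) f1 f2"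
    and a: "0 \<le> a1" "0 \<le> a2" and m: "0 \<le> m1" "0 \<le> m2"
    and b: "\<And>s. 0 < s \<Longrightarrow> ball_norm M f1 x s \<le> ennreal (a1 * L x s)"
      "\<And>s. 0 < s \<Longrightarrow> ball_norm M f2 x s \<le> ennreal (a2 * L x s)"
      "\<And>s. 0 < s \<Longrightarrow> ball_norm M f1 x s \<le> ennreal (m1 * measure M (ball x (5 * s)))"
      "\<And>s. 0 < s \<Longrightarrow> ball_norm M f2 x s \<le> ennreal (m2 * measure M (ball x (5 * s)))"
    and ap: "approximates \<epsilon> x f1 f2 g"
  shows "\<exists>r>0. 0 < measure M (ball x r) \<and> measure M (ball x (5 * r)) \<le> A * measure M (ball x r) \<and>
    (\<forall>\<delta>>0. emeasure M {z \<in> ball x r. cmod (g z) + cotlar_const * (a1 * a2 + m1 * m2) + \<delta> < cmod (kernel_integral x (far x \<epsilon>) f1 f2)}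
      \<le> ennreal (measure M (ball x r) / 2))"
proof -
  obtain U V \<eta> where *: "\<forall>n::nat. in_Lp M p1 (U n) \<and> in_Lp M p2 (V n)"
    "\<forall>n b. \<epsilon> < b \<longrightarrow> kernel_integrable x (off x b) (U n) (V n)"
    "\<forall>b. \<epsilon> < b \<longrightarrow> (\<lambda>n. kernel_integral x (off x b) (U n) (V n)) \<longlonglongrightarrow> kernel_integral x (off x b) f1 f2"
    "\<forall>n::nat. 0 \<le> \<eta> n" "\<eta> \<longlonglongrightarrow> 0"
    "\<forall>n. (\<integral>\<^sup>+y. ennreal (cmod (U n y - f1 y)) \<partial>M) \<le> ennreal (\<eta> n)"
    "\<forall>n. (\<integral>\<^sup>+y. ennreal (cmod (V n y - f2 y)) \<partial>M) \<le> ennreal (\<eta> n)"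
    "AE z in M. (\<lambda>n. T (U n) (V n) z) \<longlonglongrightarrow> g z" "g \<in> borel_measurable M"
    using ap unfolding approximates_def by blast
  show ?thesis
    by (rule pre_cotlar[OF fm \<epsilon> pos int a m b, where U = U and V = V and \<eta> = \<eta>]) (use * in auto)
qed

text \<open>If the truncated integral does not converge absolutely, its value is 0 by convention, so
  integrability may be assumed. Chebyshev for \<open>cmod (g z) powr \<eta>\<close> then removes at
  most a quarter and \<open>pre_cotlar_approximates\<close> at most half of a doubling ball, and any
  remaining point gives the bound.\<close>

lemma cotlar_inequality:
  assumes \<eta>: "0 < \<eta>" and [measurable]: "f1 \<in> borel_measurable M" "f2 \<in> borel_measurable M" and \<epsilon>: "0 < \<epsilon>"
    and ap: "kernel_integrable x (far x \<epsilon>) f1 f2 \<Longrightarrow> approximates \<epsilon> x f1 f2 g"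
  shows "ennreal (cmod (kernel_integral x (far x \<epsilon>) f1 f2)) \<le> ennreal (cotlar_const + (4 * A) powr (1 / \<eta>)) *
    (maximal_lam M L f1 x * maximal_lam M L f2 x + maximal_5_eta M \<eta> (\<lambda>y. cmod (g y)) x + maximal_5 M f1 x * maximal_5 M f2 x)"
    (is "_ \<le> ennreal ?C * ?R")
proof (cases "kernel_integral x (far x \<epsilon>) f1 f2 = 0 \<or> ?R = top")
  case True
  have "0 < ?C" using cotlar_const_pos by (simp add: add_pos_nonneg)
  then show ?thesis using True by (auto simp: ennreal_mult_top)
next
  case False
  then have nz: "kernel_integral x (far x \<epsilon>) f1 f2 \<noteq> 0" and fin: "?R \<noteq> top" by auto
  then have int: "kernel_integrable x (far x \<epsilon>) f1 f2"
    using not_integrable_integral_eq unfolding set_lebesgue_integral_def set_integrable_def by blast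
  have nAE: "\<not> (AE y in M. f1 y = 0)" "\<not> (AE y in M. f2 y = 0)"
    using kernel_integral_zero[of f1 f2, where x = x and S = "far x \<epsilon>"] nz by auto
  have pos: "emeasure M UNIV \<noteq> 0"
  proof
    assume "emeasure M UNIV = 0"
    then have "AE y in M. f1 y = 0" by (intro AE_I[of _ _ UNIV]) (auto simp: sets_M)
    then show False using nAE by simp
  qed
  \<comment> \<open>In \<open>ennreal\<close>, 0 times infinity is 0. Finiteness of a product
    therefore says nothing about its factors until both are known to be nonzero.\<close>
  have lam0: "maximal_lam M L f x \<noteq> 0" if "f \<in> borel_measurable M" "\<not> (AE y in M. f y = 0)" for f :: "'a \<Rightarrow> complex"
  proof
    assume "maximal_lam M L f x = 0"
    then have "ball_norm M f x s = 0" if "0 < s" for s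
      using nn_integral_ball_le_maximal_lam[OF that, where x = x and f = f] by simp
    then show False using AE_zero_of_balls[OF that(1)] that(2) by blast
  qed
  have five0: "maximal_5 M f x \<noteq> 0" if "f \<in> borel_measurable M" "\<not> (AE y in M. f y = 0)" for f :: "'a \<Rightarrow> complex"
  proof
    assume "maximal_5 M f x = 0"
    then have "ball_norm M f x s = 0" if "0 < s" for s
      using nn_integral_ball_le_maximal_5[OF that, where x = x and f = f] by simp
    then show False using AE_zero_of_balls[OF that(1)] that(2) by blast
  qed
  have "maximal_lam M L f1 x * maximal_lam M L f2 x \<noteq> top" "maximal_5 M f1 x * maximal_5 M f2 x \<noteq> top"
    and eta: "maximal_5_eta M \<eta> (\<lambda>y. cmod (g y)) x \<noteq> top"
    using fin by (auto simp: ennreal_add_eq_top)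
  then have "maximal_lam M L f1 x \<noteq> top" "maximal_lam M L f2 x \<noteq> top" "maximal_5 M f1 x \<noteq> top" "maximal_5 M f2 x \<noteq> top"
    using lam0[OF _ nAE(1)] lam0[OF _ nAE(2)] five0[OF _ nAE(1)] five0[OF _ nAE(2)] by (auto simp: ennreal_mult_eq_top_iff)
  then obtain a1 a2 m1 m2 where am: "maximal_lam M L f1 x = ennreal a1" "maximal_lam M L f2 x = ennreal a2"
    "maximal_5 M f1 x = ennreal m1" "maximal_5 M f2 x = ennreal m2" "0 \<le> a1" "0 \<le> a2" "0 \<le> m1" "0 \<le> m2"
    using ennreal_cases by (metis (no_types))
  define q' where "q' = maximal_5 M (\<lambda>y. norm (cmod (g y)) powr \<eta>) x"
  have "q' \<noteq> top" using eta unfolding maximal_5_eta_def q'_def[symmetric] by (auto simp: ennreal_powr_def)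
  then obtain q where q: "q' = ennreal q" "0 \<le> q" by (cases q') auto
  have eta_q: "maximal_5_eta M \<eta> (\<lambda>y. cmod (g y)) x = ennreal (q powr (1 / \<eta>))"
    unfolding maximal_5_eta_def q'_def[symmetric] q(1) using q(2) by (simp add: ennreal_powr_def)
  have gm [measurable]: "g \<in> borel_measurable M" using ap[OF int] by (simp add: approximates_def)
  define P where "P = cotlar_const * (a1 * a2 + m1 * m2)"
  define k where "k = cmod (kernel_integral x (far x \<epsilon>) f1 f2)"
  obtain r where r: "0 < r" "0 < measure M (ball x r)" "measure M (ball x (5 * r)) \<le> A * measure M (ball x r)"
    "\<And>\<delta>. 0 < \<delta> \<Longrightarrow> emeasure M {z \<in> ball x r. cmod (g z) + P + \<delta> < k} \<le> ennreal (measure M (ball x r) / 2)"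
  proof -
    have *: "ball_norm M f x s \<le> ennreal (a * L x s)" if "0 < s" "maximal_lam M L f x = ennreal a" "0 \<le> a" for s a and f :: "'a \<Rightarrow> complex"
      using nn_integral_ball_le_maximal_lam[OF that(1), where x = x and f = f] that L_pos[OF that(1), of x] by (simp add: ennreal_mult)
    have **: "ball_norm M f x s \<le> ennreal (m * measure M (ball x (5 * s)))" if "0 < s" "maximal_5 M f x = ennreal m" "0 \<le> m" for s m and f :: "'a \<Rightarrow> complex"
      using nn_integral_ball_le_maximal_5[OF that(1), where x = x and f = f] that unfolding emeasure_ball by (simp add: ennreal_mult)
    have "\<exists>r>0. 0 < measure M (ball x r) \<and> measure M (ball x (5 * r)) \<le> A * measure M (ball x r) \<and>
      (\<forall>\<delta>>0. emeasure M {z \<in> ball x r. cmod (g z) + cotlar_const * (a1 * a2 + m1 * m2) + \<delta> < cmod (kernel_integral x (far x \<epsilon>) f1 f2)}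
        \<le> ennreal (measure M (ball x r) / 2))"
      by (rule pre_cotlar_approximates[OF _ _ \<epsilon> pos int am(5-8) *[OF _ am(1,5)] *[OF _ am(2,6)] **[OF _ am(3,7)] **[OF _ am(4,8)] ap[OF int]]) auto
    then show ?thesis using that unfolding P_def k_def by blast
  qed
  define \<mu> where "\<mu> = measure M (ball x r)"
  have "k \<le> (4 * A * q + \<delta>) powr (1 / \<eta>) + P + \<delta>" if \<delta>: "0 < \<delta>" for \<delta>
  proof (rule ccontr)
    assume neg: "\<not> k \<le> (4 * A * q + \<delta>) powr (1 / \<eta>) + P + \<delta>"
    \<comment> \<open>The factor \<open>A\<close> pays for the passage from \<open>5 * r\<close> to
      \<open>r\<close>, the factor 4 leaves a quarter of the ball, and \<open>\<delta>\<close> keeps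
      \<open>\<tau>\<close> positive when \<open>q = 0\<close>.\<close>
    define \<tau> where "\<tau> = 4 * A * q + \<delta>"
    have \<tau>: "0 < \<tau>" unfolding \<tau>_def using \<delta> q CL by (intro add_nonneg_pos) auto
    define S1 where "S1 = {z \<in> ball x r. cmod (g z) + P + \<delta> < k}"
    define S2 where "S2 = {z \<in> ball x r. \<tau> < cmod (g z) powr \<eta>}"
    have "{z \<in> space M. z \<in> ball x r \<and> cmod (g z) + P + \<delta> < k} \<in> sets M" by measurable
    then have S1m [measurable]: "S1 \<in> sets M" by (simp add: S1_def)
    have "{z \<in> space M. z \<in> ball x r \<and> \<tau> < cmod (g z) powr \<eta>} \<in> sets M" by measurable
    then have S2m [measurable]: "S2 \<in> sets M" by (simp add: S2_def)
    have sub: "ball x r \<subseteq> S1 \<union> S2"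
    proof
      fix z assume z: "z \<in> ball x r"
      show "z \<in> S1 \<union> S2"
      proof (cases "\<tau> < cmod (g z) powr \<eta>")
        case False
        then have "(cmod (g z) powr \<eta>) powr (1 / \<eta>) \<le> \<tau> powr (1 / \<eta>)" using \<eta> by (intro powr_mono2) auto
        then have "cmod (g z) \<le> \<tau> powr (1 / \<eta>)" using \<eta> by (simp add: powr_powr)
        then show ?thesis using neg z by (simp add: S1_def \<tau>_def)
      qed (use z in \<open>simp add: S2_def\<close>)
    qed
    have "ennreal \<tau> * emeasure M S2 = (\<integral>\<^sup>+z. ennreal \<tau> * indicator S2 z \<partial>M)" by (simp add: nn_integral_cmult_indicator)
    also have "\<dots> \<le> (\<integral>\<^sup>+z\<in>ball x r. ennreal (norm (norm (cmod (g z)) powr \<eta>)) \<partial>M)"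
      by (intro nn_integral_mono) (auto simp: S2_def indicator_def intro!: ennreal_leI)
    also have "\<dots> \<le> q' * emeasure M (ball x (5 * r))"
      unfolding q'_def by (rule nn_integral_ball_le_maximal_5[OF r(1)])
    also have "\<dots> \<le> ennreal (q * (A * \<mu>))"
      unfolding q(1) emeasure_ball using q(2) r(3) by (subst ennreal_mult[symmetric]) (auto simp: \<mu>_def intro!: ennreal_leI mult_left_mono)
    also have "\<dots> \<le> ennreal (\<tau> * (\<mu> / 4))"
    proof (rule ennreal_leI)
      have "4 * A * q * (\<mu> / 4) \<le> \<tau> * (\<mu> / 4)" unfolding \<tau>_def using \<delta> by (intro mult_right_mono) (auto simp: \<mu>_def)
      then show "q * (A * \<mu>) \<le> \<tau> * (\<mu> / 4)" by (simp add: ac_simps)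
    qed
    finally have S2: "emeasure M S2 \<le> ennreal (\<mu> / 4)"
      using \<tau> by (simp add: ennreal_mult ennreal_mult_le_mult_iff \<mu>_def del: times_divide_eq_right)
    have "ennreal \<mu> = emeasure M (ball x r)" by (simp add: \<mu>_def emeasure_ball)
    also have "\<dots> \<le> emeasure M (S1 \<union> S2)" using sub by (intro emeasure_mono) auto
    also have "\<dots> \<le> emeasure M S1 + emeasure M S2" by (intro emeasure_subadditive) auto
    also have "\<dots> \<le> ennreal (\<mu> / 2) + ennreal (\<mu> / 4)"
      using r(4)[OF \<delta>] S2 by (intro add_mono) (auto simp: S1_def \<mu>_def)
    also have "\<dots> = ennreal (\<mu> / 2 + \<mu> / 4)" by (intro ennreal_plus[symmetric]) (auto simp: \<mu>_def)
    finally have "\<mu> \<le> \<mu> / 2 + \<mu> / 4" by (subst (asm) ennreal_le_iff) (auto simp: \<mu>_def)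
    then show False using r(2) by (simp add: \<mu>_def)
  qed
  then have le: "k \<le> (4 * A * q + 1 / real (Suc n)) powr (1 / \<eta>) + P + 1 / real (Suc n)" for n by simp
  have "(\<lambda>n. (4 * A * q + 1 / real (Suc n)) powr (1 / \<eta>) + P + 1 / real (Suc n)) \<longlonglongrightarrow> (4 * A * q + 0) powr (1 / \<eta>) + P + 0"
    using LIMSEQ_Suc[OF lim_1_over_n[where 'a=real]] \<eta> q CL
    by (intro tendsto_add tendsto_powr2 tendsto_const) (auto intro!: always_eventually)
  then have "k \<le> (4 * A * q + 0) powr (1 / \<eta>) + P + 0" using le by (intro LIMSEQ_le_const) auto
  then have "k \<le> (4 * A) powr (1 / \<eta>) * q powr (1 / \<eta>) + cotlar_const * (a1 * a2 + m1 * m2)"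
    using q CL by (simp add: powr_mult P_def)
  also have "\<dots> \<le> ?C * (a1 * a2 + q powr (1 / \<eta>) + m1 * m2)"
  proof -
    have "0 \<le> (4 * A) powr (1 / \<eta>) * (a1 * a2 + m1 * m2)" "0 \<le> cotlar_const * q powr (1 / \<eta>)"
      using am cotlar_const_pos by auto
    then show ?thesis by (simp add: algebra_simps)
  qed
  finally have "ennreal k \<le> ennreal (?C * (a1 * a2 + q powr (1 / \<eta>) + m1 * m2))" by (rule ennreal_leI)
  also have "\<dots> = ennreal ?C * ?R"
    unfolding am(1-4) eta_q using am(5-8) cotlar_const_pos by (simp add: ennreal_mult ennreal_plus)
  finally show ?thesis by (simp add: k_def)
qed

section \<open>The weak type estimate for the maximal truncation\<close>

text \<open>Fatou's lemma for indicators: a strict inequality for \<open>g\<close> at a point holds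
  for the approximants from some index on.\<close>

lemma weak_type_limit:
  assumes U: "\<And>n::nat. in_Lp M p1 (U n)" "\<And>n. integrable M (U n)" "(\<lambda>n. \<integral>y. cmod (U n y) \<partial>M) \<longlonglongrightarrow> b1"
    and V: "\<And>n::nat. in_Lp M p2 (V n)" "\<And>n. integrable M (V n)" "(\<lambda>n. \<integral>y. cmod (V n y) \<partial>M) \<longlonglongrightarrow> b2"
    and g: "g \<in> borel_measurable M" "AE z in M. (\<lambda>n. T (U n) (V n) z) \<longlonglongrightarrow> g z" and t: "0 < t"
  shows "emeasure M {z. t < cmod (g z)} \<le> ennreal (CW * sqrt (b1 * b2 / t))"
proof -
  note [measurable] = T_measurable[OF U(1) V(1)] g(1)
  define S where "S n = {z \<in> space M. t < cmod (T (U n) (V n) z)}" for n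
  have [measurable]: "S n \<in> sets M" for n unfolding S_def by measurable
  have gS [measurable]: "{z \<in> space M. t < cmod (g z)} \<in> sets M" by measurable
  have "emeasure M {z \<in> space M. t < cmod (g z)} = (\<integral>\<^sup>+z. indicator {z \<in> space M. t < cmod (g z)} z \<partial>M)"
    by (rule nn_integral_indicator[OF gS, symmetric])
  also have "\<dots> \<le> (\<integral>\<^sup>+z. liminf (\<lambda>n. indicator (S n) z) \<partial>M)"
  proof (rule nn_integral_mono_AE)
    show "AE z in M. (indicator {z \<in> space M. t < cmod (g z)} z :: ennreal) \<le> liminf (\<lambda>n. indicator (S n) z)"
      using g(2)
    proof eventually_elim
      case (elim z)
      show ?case
      proof (cases "t < cmod (g z)")
        case True
        have "\<forall>\<^sub>F n in sequentially. t < cmod (T (U n) (V n) z)"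
          using tendsto_norm[OF elim] True by (rule order_tendstoD)
        then have "\<forall>\<^sub>F n in sequentially. (1::ennreal) \<le> indicator (S n) z"
          by eventually_elim (simp add: S_def)
        then have "1 \<le> liminf (\<lambda>n. indicator (S n) z :: ennreal)" by (rule Liminf_bounded)
        then show ?thesis by (simp add: True)
      qed simp
    qed
  qed
  also have "\<dots> \<le> liminf (\<lambda>n. \<integral>\<^sup>+z. indicator (S n) z \<partial>M)"
    by (rule nn_integral_liminf) measurable
  also have "\<dots> \<le> liminf (\<lambda>n. ennreal (CW * sqrt (L1_norm M (U n) * L1_norm M (V n) / t)))"
  proof (intro Liminf_mono always_eventually allI)
    fix n
    have "(\<integral>\<^sup>+z. indicator (S n) z \<partial>M) = emeasure M (S n)" by (rule nn_integral_indicator) measurable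
    then show "(\<integral>\<^sup>+z. indicator (S n) z \<partial>M) \<le> ennreal (CW * sqrt (L1_norm M (U n) * L1_norm M (V n) / t))"
      using weak[OF U(1)[of n] U(2)[of n] V(1)[of n] V(2)[of n] t] by (simp add: S_def)
  qed
  also have "\<dots> = ennreal (CW * sqrt (b1 * b2 / t))"
    using t by (intro lim_imp_Liminf tendsto_ennrealI tendsto_intros U V) auto
  finally show ?thesis by simp
qed

text \<open>The shares \<open>t / 3\<close> for \<open>g\<close>, \<open>t / 2\<close> for the
  maximal products and \<open>t / 6\<close> for the slack add up to \<open>t\<close>. Outside the
  three sets a truncation above \<open>t\<close> would force every point of a doubling ball into one
  of two sets, of at most a half and a quarter of its measure. The third set controls the density of
  a level set of \<open>g\<close> in place of an average of powers.\<close>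

lemma maximal_level_set:
  assumes f: "integrable M f1" "integrable M f2" and pos: "emeasure M UNIV \<noteq> 0"
    and ap: "\<And>\<epsilon> x. 0 < \<epsilon> \<Longrightarrow> approximates \<epsilon> x f1 f2 g"
    and \<alpha>: "0 \<le> \<alpha>1" "0 \<le> \<alpha>2" "cotlar_const * (CL ^ 6 + 1) * (\<alpha>1 * \<alpha>2) \<le> t / 2" and t: "0 < t"
  shows "{x. ennreal t < maximal_truncation M K f1 f2 x} \<subseteq>
    stopping_set 5 (\<lambda>y. ennreal (cmod (f1 y))) (ennreal \<alpha>1) \<union> stopping_set 5 (\<lambda>y. ennreal (cmod (f2 y))) (ennreal \<alpha>2) \<union>
    stopping_set 5 (indicator {z. t / 3 < cmod (g z)}) (ennreal (1 / (4 * A)))"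
proof
  fix x assume "x \<in> {x. ennreal t < maximal_truncation M K f1 f2 x}"
  then obtain \<epsilon> where \<epsilon>: "0 < \<epsilon>" "ennreal t < ennreal (cmod (kernel_integral x (far x \<epsilon>) f1 f2))"
    by (auto simp: maximal_truncation_def less_SUP_iff truncated_operator_eq)
  then have k: "t < cmod (kernel_integral x (far x \<epsilon>) f1 f2)" using t by (simp add: ennreal_less_iff)
  have gm [measurable]: "g \<in> borel_measurable M" using ap[OF zero_less_one] by (simp add: approximates_def)
  show "x \<in> stopping_set 5 (\<lambda>y. ennreal (cmod (f1 y))) (ennreal \<alpha>1) \<union> stopping_set 5 (\<lambda>y. ennreal (cmod (f2 y))) (ennreal \<alpha>2) \<union>
    stopping_set 5 (indicator {z. t / 3 < cmod (g z)}) (ennreal (1 / (4 * A)))"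
  proof (rule ccontr)
    assume neg: "\<not> ?thesis"
    have m: "ball_norm M f x s \<le> ennreal (\<alpha> * measure M (ball x (5 * s)))"
      if "x \<notin> stopping_set 5 (\<lambda>y. ennreal (cmod (f y))) (ennreal \<alpha>)" "0 < s" "0 \<le> \<alpha>" for f :: "'a \<Rightarrow> complex" and \<alpha> s
      using not_stopping_set[OF that(1,2)] that(3) unfolding emeasure_ball by (simp add: ennreal_mult)
    \<comment> \<open>From \<open>ball x (5 * s)\<close> to \<open>L x s\<close> takes three
      doublings, hence \<open>CL ^ 3\<close> for each function and \<open>CL ^ 6\<close> for the
      product.\<close>
    have l: "ball_norm M f x s \<le> ennreal (CL ^ 3 * \<alpha> * L x s)"
      if "x \<notin> stopping_set 5 (\<lambda>y. ennreal (cmod (f y))) (ennreal \<alpha>)" "0 < s" "0 \<le> \<alpha>" for f :: "'a \<Rightarrow> complex" and \<alpha> s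
    proof (rule order_trans[OF m[OF that] ennreal_leI])
      have "measure M (ball x (5 * s)) \<le> L x (5 * s)" using that(2) by (intro L_ball) auto
      also have "\<dots> \<le> L x (2 ^ 3 * s)" using that(2) by (intro L_mono) auto
      also have "\<dots> \<le> CL ^ 3 * L x s" by (rule L_pow[OF that(2)])
      finally have "\<alpha> * measure M (ball x (5 * s)) \<le> \<alpha> * (CL ^ 3 * L x s)" using that(3) by (rule mult_left_mono)
      then show "\<alpha> * measure M (ball x (5 * s)) \<le> CL ^ 3 * \<alpha> * L x s" by (simp add: ac_simps)
    qed
    have n1: "x \<notin> stopping_set 5 (\<lambda>y. ennreal (cmod (f1 y))) (ennreal \<alpha>1)"
      and n2: "x \<notin> stopping_set 5 (\<lambda>y. ennreal (cmod (f2 y))) (ennreal \<alpha>2)"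
      and n3: "x \<notin> stopping_set 5 (indicator {z. t / 3 < cmod (g z)}) (ennreal (1 / (4 * A)))" using neg by auto
    have CL3: "0 \<le> CL ^ 3 * \<alpha>1" "0 \<le> CL ^ 3 * \<alpha>2" using CL \<alpha> by auto
    obtain r where r: "0 < r" "0 < measure M (ball x r)" "measure M (ball x (5 * r)) \<le> A * measure M (ball x r)"
      "\<And>\<delta>. 0 < \<delta> \<Longrightarrow> emeasure M {z \<in> ball x r. cmod (g z) + cotlar_const * ((CL ^ 3 * \<alpha>1) * (CL ^ 3 * \<alpha>2) + \<alpha>1 * \<alpha>2) + \<delta> < cmod (kernel_integral x (far x \<epsilon>) f1 f2)} \<le> ennreal (measure M (ball x r) / 2)"
      using pre_cotlar_approximates[OF borel_measurable_integrable[OF f(1)] borel_measurable_integrable[OF f(2)] \<epsilon>(1) pos L1_kernel_far[OF f \<epsilon>(1)]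
        CL3 \<alpha>(1,2) l[OF n1 _ \<alpha>(1)] l[OF n2 _ \<alpha>(2)] m[OF n1 _ \<alpha>(1)] m[OF n2 _ \<alpha>(2)] ap[OF \<epsilon>(1)]] by blast
    define \<mu> where "\<mu> = measure M (ball x r)"
    define S1 where "S1 = {z \<in> ball x r. cmod (g z) + cotlar_const * ((CL ^ 3 * \<alpha>1) * (CL ^ 3 * \<alpha>2) + \<alpha>1 * \<alpha>2) + t / 6 < cmod (kernel_integral x (far x \<epsilon>) f1 f2)}"
    define S2 where "S2 = {z \<in> ball x r. t / 3 < cmod (g z)}"
    have "{z \<in> space M. z \<in> ball x r \<and> cmod (g z) + cotlar_const * ((CL ^ 3 * \<alpha>1) * (CL ^ 3 * \<alpha>2) + \<alpha>1 * \<alpha>2) + t / 6 < cmod (kernel_integral x (far x \<epsilon>) f1 f2)} \<in> sets M" by measurable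
    then have S1m: "S1 \<in> sets M" by (simp add: S1_def)
    have "{z \<in> space M. z \<in> ball x r \<and> t / 3 < cmod (g z)} \<in> sets M" by measurable
    then have S2m: "S2 \<in> sets M" by (simp add: S2_def)
    have Ple: "cotlar_const * ((CL ^ 3 * \<alpha>1) * (CL ^ 3 * \<alpha>2) + \<alpha>1 * \<alpha>2) \<le> t / 2"
    proof -
      have "CL ^ 3 * CL ^ 3 = CL ^ 6" by (simp flip: power_add)
      then have "(CL ^ 3 * \<alpha>1) * (CL ^ 3 * \<alpha>2) + \<alpha>1 * \<alpha>2 = (CL ^ 6 + 1) * (\<alpha>1 * \<alpha>2)"
        by (metis (no_types, lifting) distrib_right mult.assoc mult.commute mult_1)
      then show ?thesis using \<alpha>(3) by (simp add: mult.assoc)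
    qed
    have sub: "ball x r \<subseteq> S1 \<union> S2"
    proof
      fix z assume "z \<in> ball x r"
      then show "z \<in> S1 \<union> S2" using Ple k by (simp add: S1_def S2_def) linarith
    qed
    have "ennreal \<mu> \<le> emeasure M S1 + emeasure M S2"
    proof -
      have "ennreal \<mu> = emeasure M (ball x r)" by (simp add: \<mu>_def emeasure_ball)
      also have "\<dots> \<le> emeasure M (S1 \<union> S2)" using sub S1m S2m by (intro emeasure_mono) auto
      also have "\<dots> \<le> emeasure M S1 + emeasure M S2" using S1m S2m by (rule emeasure_subadditive)
      finally show ?thesis .
    qed
    also have "\<dots> \<le> ennreal (\<mu> / 2) + emeasure M S2"
      using r(4)[of "t / 6"] t by (intro add_right_mono) (simp add: S1_def \<mu>_def)
    finally have "ennreal \<mu> \<le> ennreal (\<mu> / 2) + emeasure M S2" .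
    moreover have "emeasure M S2 \<le> ennreal (1 / (4 * A)) * emeasure M (ball x (5 * r))"
    proof -
      have "(\<integral>\<^sup>+y\<in>ball x r. indicator {z. t / 3 < cmod (g z)} y \<partial>M) = (\<integral>\<^sup>+y. indicator S2 y \<partial>M)"
        by (intro nn_integral_cong) (auto simp: S2_def indicator_def)
      then show ?thesis using not_stopping_set[OF n3 r(1)] S2m by simp
    qed
    moreover have "ennreal (1 / (4 * A)) * emeasure M (ball x (5 * r)) \<le> ennreal (\<mu> / 4)"
    proof -
      have A0: "0 < A" using A_ge by linarith
      have "1 / (4 * A) * measure M (ball x (5 * r)) \<le> 1 / (4 * A) * (A * \<mu>)"
        using r(3) A0 unfolding \<mu>_def by (intro mult_left_mono) auto
      also have "\<dots> = \<mu> / 4" using A0 by simp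
      finally show ?thesis
        unfolding emeasure_ball using A0 by (subst ennreal_mult[symmetric]) (auto intro!: ennreal_leI)
    qed
    ultimately have "ennreal \<mu> \<le> ennreal (\<mu> / 2) + ennreal (\<mu> / 4)" by (meson add_left_mono order_trans)
    also have "\<dots> = ennreal (\<mu> / 2 + \<mu> / 4)" by (intro ennreal_plus[symmetric]) (auto simp: \<mu>_def)
    finally have "\<mu> \<le> \<mu> / 2 + \<mu> / 4" by (subst (asm) ennreal_le_iff) (auto simp: \<mu>_def)
    then show False using r(2) by (simp add: \<mu>_def)
  qed
qed

end

lemma ennreal_mult_le_imp_le_divide:
  assumes "ennreal a * e \<le> ennreal b" "0 < a" "0 \<le> b"
  shows "e \<le> ennreal (b / a)"
proof (cases e)
  case (real r)
  then have "a * r \<le> b" using assms by (simp flip: ennreal_mult)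
  then show ?thesis using real assms by (auto intro!: ennreal_leI simp: field_simps)
next
  case top
  then show ?thesis using assms by (auto simp: ennreal_mult_top top_unique)
qed

lemma convergent_if_steps_summable:
  fixes h :: "nat \<Rightarrow> 'a::banach"
  assumes "\<forall>\<^sub>F n in sequentially. norm (h (Suc n) - h n) \<le> c n" "summable c"
  shows "convergent h"
proof -
  have "summable (\<lambda>n. h (Suc n) - h n)" by (rule summable_comparison_test_ev[OF assms])
  then have "(\<lambda>n. \<Sum>i<n. h (Suc i) - h i) \<longlonglongrightarrow> (\<Sum>n. h (Suc n) - h n)" by (rule summable_LIMSEQ)
  then have "(\<lambda>n. (h n - h 0) + h 0) \<longlonglongrightarrow> (\<Sum>n. h (Suc n) - h n) + h 0"
    unfolding sum_lessThan_telescope by (rule tendsto_add[OF _ tendsto_const])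
  then show ?thesis by (auto simp: convergent_def)
qed

section \<open>The extension of the operator to integrable functions\<close>

context cotlar_operator
begin

lemma L1_approximation:
  assumes f: "integrable M f" and d: "0 < \<delta>"
  shows "\<exists>u. integrable M u \<and> in_Lp M p1 u \<and> in_Lp M p2 u \<and> (\<integral>y. cmod (u y - f y) \<partial>M) < \<delta>"
proof -
  define tr where "tr n x = indicator (UNIV \<inter> {x. cmod (f x) \<le> real n}) x * f x" for n x
  have f1: "in_Lp M 1 f" using f by (simp add: in_Lp_def)
  note [measurable] = in_LpD(1)[OF f1]
  have "(\<lambda>n. \<integral>x. cmod (tr n x - f x) powr 1 \<partial>M) \<longlonglongrightarrow> 0"
    unfolding tr_def by (rule truncation_tendsto(1)[OF f1]) (auto simp: incseq_def)
  then have "(\<lambda>n. \<integral>x. cmod (tr n x - f x) \<partial>M) \<longlonglongrightarrow> 0" by simp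
  then have "\<forall>\<^sub>F n in sequentially. (\<integral>x. cmod (tr n x - f x) \<partial>M) < \<delta>" using d by (rule order_tendstoD)
  then obtain n where n: "(\<integral>x. cmod (tr n x - f x) \<partial>M) < \<delta>" by (auto simp: eventually_sequentially)
  have int: "integrable M (tr n)"
  proof (rule Bochner_Integration.integrable_bound[OF f])
    have "{x \<in> space M. cmod (f x) \<le> real n} \<in> sets M" by measurable
    then show "tr n \<in> borel_measurable M" unfolding tr_def by simp
  qed (auto simp: tr_def indicator_def)
  have "in_Lp M q (tr n)" if "1 \<le> q" for q
    by (rule in_Lp_bounded(1)[OF int _ that, of "real n"]) (auto simp: tr_def indicator_def)
  then show ?thesis using int n by (intro exI[of _ "tr n"]) auto
qed

text \<open>One argument is changed at a time, so the common bound \<open>b\<close> is needed for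
  the old first and the new second function.\<close>

lemma T_step_weak:
  assumes U: "in_Lp M p1 u" "integrable M u" "in_Lp M p1 u'" "integrable M u'"
    and V: "in_Lp M p2 v" "integrable M v" "in_Lp M p2 v'" "integrable M v'"
    and le: "(\<integral>y. cmod (u' y - u y) \<partial>M) \<le> d" "(\<integral>y. cmod (v' y - v y) \<partial>M) \<le> d"
      "L1_norm M u \<le> b" "L1_norm M v' \<le> b" and t: "0 < t"
  shows "emeasure M {x. 2 * t < cmod (T u' v' x - T u v x)} \<le> ennreal (2 * CW * sqrt (d * b / t))"
proof -
  define a a' where "a = T (\<lambda>y. u' y - u y) v'" and "a' = T u (\<lambda>y. v' y - v y)"
  have d: "0 \<le> d" "0 \<le> b"
    by (rule order_trans[OF _ le(1)], simp) (rule order_trans[OF _ le(3)], simp)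
  have du: "in_Lp M p1 (\<lambda>y. u' y - u y)" "integrable M (\<lambda>y. u' y - u y)"
    and dv: "in_Lp M p2 (\<lambda>y. v' y - v y)" "integrable M (\<lambda>y. v' y - v y)"
    using U V by (auto intro!: in_Lp_diff)
  have [measurable]: "a \<in> borel_measurable M" "a' \<in> borel_measurable M"
    unfolding a_def a'_def by (intro T_measurable du dv U V)+
  have eq: "AE x in M. T u' v' x - T u v x = a x + a' x"
    using T_diff1[OF U(3,1) V(3)] T_diff2[OF U(1) V(3,1)] by eventually_elim (simp add: a_def a'_def)
  have m: "{x \<in> space M. t < cmod (a x)} \<in> sets M" "{x \<in> space M. t < cmod (a' x)} \<in> sets M" by measurable
  have "AE x in M. x \<in> {x. 2 * t < cmod (T u' v' x - T u v x)} \<longrightarrow> x \<in> {x. t < cmod (a x)} \<union> {x. t < cmod (a' x)}"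
    using eq
  proof eventually_elim
    case (elim x)
    show ?case using elim norm_triangle_ineq[of "a x" "a' x"] by auto
  qed
  then have "emeasure M {x. 2 * t < cmod (T u' v' x - T u v x)} \<le> emeasure M ({x. t < cmod (a x)} \<union> {x. t < cmod (a' x)})"
    by (rule emeasure_mono_AE) (use m in simp)
  also have "\<dots> \<le> emeasure M {x. t < cmod (a x)} + emeasure M {x. t < cmod (a' x)}"
    using m by (intro emeasure_subadditive) simp_all
  also have "\<dots> \<le> ennreal (CW * sqrt (d * b / t)) + ennreal (CW * sqrt (d * b / t))"
  proof (rule add_mono)
    have "emeasure M {x. t < cmod (a x)} \<le> ennreal (CW * sqrt ((\<integral>y. cmod (u' y - u y) \<partial>M) * L1_norm M v' / t))"
      unfolding a_def by (rule weak[OF du V(3,4) t])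
    also have "\<dots> \<le> ennreal (CW * sqrt (d * b / t))"
      using CW t d le by (intro ennreal_leI mult_left_mono real_sqrt_le_mono divide_right_mono mult_mono) auto
    finally show "emeasure M {x. t < cmod (a x)} \<le> ennreal (CW * sqrt (d * b / t))" .
    have "emeasure M {x. t < cmod (a' x)} \<le> ennreal (CW * sqrt (L1_norm M u * (\<integral>y. cmod (v' y - v y) \<partial>M) / t))"
      unfolding a'_def by (rule weak[OF U(1,2) dv t])
    also have "\<dots> \<le> ennreal (CW * sqrt (b * d / t))"
      using CW t d le by (intro ennreal_leI mult_left_mono real_sqrt_le_mono divide_right_mono mult_mono) auto
    finally show "emeasure M {x. t < cmod (a' x)} \<le> ennreal (CW * sqrt (d * b / t))" by (simp add: mult.commute)
  qed
  also have "\<dots> = ennreal (2 * CW * sqrt (d * b / t))"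
    using CW d t by (subst ennreal_plus[symmetric]) auto
  finally show ?thesis .
qed

text \<open>The weak type bound is a square root, so errors of order \<open>8 ^ -n\<close> tested at
  level \<open>2 ^ -n\<close> leave exceptional sets of measure of order \<open>2 ^ -n\<close>.
  Borel-Cantelli then makes the increments of \<open>T (U n) (V n)\<close> summable almost
  everywhere.\<close>

lemma L1_extension_exists:
  assumes f: "integrable M f1" and g: "integrable M f2"
  shows "\<exists>h. L1_extension_value M p1 p2 T f1 f2 h"
proof -
  define \<delta> :: "nat \<Rightarrow> real" where "\<delta> n = (1 / 8) ^ n" for n
  have \<delta>: "0 < \<delta> n" "\<delta> n \<le> 1" "\<delta> (Suc n) \<le> \<delta> n" for n
    by (auto simp: \<delta>_def power_le_one intro!: power_decreasing)
  have "\<forall>n. \<exists>u. integrable M u \<and> in_Lp M p1 u \<and> in_Lp M p2 u \<and> (\<integral>y. cmod (u y - f1 y) \<partial>M) < \<delta> n"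
    by (intro allI L1_approximation f \<delta>)
  from choice[OF this] obtain U where U: "\<And>n. integrable M (U n)" "\<And>n. in_Lp M p1 (U n)" "\<And>n. (\<integral>y. cmod (U n y - f1 y) \<partial>M) < \<delta> n"
    by blast
  have "\<forall>n. \<exists>u. integrable M u \<and> in_Lp M p1 u \<and> in_Lp M p2 u \<and> (\<integral>y. cmod (u y - f2 y) \<partial>M) < \<delta> n"
    by (intro allI L1_approximation g \<delta>)
  from choice[OF this] obtain V where V: "\<And>n. integrable M (V n)" "\<And>n. in_Lp M p2 (V n)" "\<And>n. (\<integral>y. cmod (V n y - f2 y) \<partial>M) < \<delta> n"
    by blast
  define b where "b = L1_norm M f1 + L1_norm M f2 + 1"
  have b: "L1_norm M (F n) \<le> L1_norm M f + 1" "(\<integral>y. cmod (F (Suc n) y - F n y) \<partial>M) \<le> 2 * \<delta> n"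
    if F: "\<And>n. integrable M (F n)" "\<And>n. (\<integral>y. cmod (F n y - f y) \<partial>M) < \<delta> n" and f: "integrable M f"
    for F :: "nat \<Rightarrow> 'a \<Rightarrow> complex" and f n
  proof -
    have "L1_norm M (F n) \<le> (\<integral>y. cmod (f y) + cmod (F n y - f y) \<partial>M)"
      using F(1)[of n] f by (intro integral_mono integrable_norm Bochner_Integration.integrable_add Bochner_Integration.integrable_diff norm_triangle_sub)
    also have "\<dots> = L1_norm M f + (\<integral>y. cmod (F n y - f y) \<partial>M)"
      using F(1)[of n] f by (intro Bochner_Integration.integral_add integrable_norm Bochner_Integration.integrable_diff)
    finally show "L1_norm M (F n) \<le> L1_norm M f + 1" using F(2)[of n] \<delta>(2)[of n] by linarith
    have "(\<integral>y. cmod (F (Suc n) y - F n y) \<partial>M) \<le> (\<integral>y. cmod (F (Suc n) y - f y) + cmod (F n y - f y) \<partial>M)"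
      using F(1)[of n] F(1)[of "Suc n"] f
      by (intro integral_mono integrable_norm Bochner_Integration.integrable_add Bochner_Integration.integrable_diff)
        (auto intro: norm_triangle_ineq4[of "F (Suc n) y - f y" "F n y - f y" for y, simplified])
    also have "\<dots> = (\<integral>y. cmod (F (Suc n) y - f y) \<partial>M) + (\<integral>y. cmod (F n y - f y) \<partial>M)"
      using F(1)[of n] F(1)[of "Suc n"] f by (intro Bochner_Integration.integral_add integrable_norm Bochner_Integration.integrable_diff)
    finally show "(\<integral>y. cmod (F (Suc n) y - F n y) \<partial>M) \<le> 2 * \<delta> n" using F(2)[of n] F(2)[of "Suc n"] \<delta>(3)[of n] by linarith
  qed
  have f0: "0 \<le> L1_norm M f1" "0 \<le> L1_norm M f2" by auto
  define h where "h n = T (U n) (V n)" for n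
  have [measurable]: "h n \<in> borel_measurable M" for n unfolding h_def by (intro T_measurable U V)
  define S where "S n = {x \<in> space M. 2 * (1 / 2) ^ n < cmod (h (Suc n) x - h n x)}" for n
  define c where "c n = 2 * CW * sqrt (2 * b) * (1 / 2) ^ n" for n :: nat
  have c0: "0 \<le> c n" for n using CW f0 by (simp add: c_def b_def)
  have sq: "sqrt (2 * \<delta> n * b / (1 / 2) ^ n) = sqrt (2 * b) * (1 / 2) ^ n" for n
  proof -
    have "(8::real) ^ n = 2 ^ n * (2 ^ n * 2 ^ n)" by (simp flip: power_mult_distrib)
    then have eq: "2 * \<delta> n * b / (1 / 2) ^ n = 2 * b * ((1 / 2) ^ n)\<^sup>2"
      by (simp add: \<delta>_def power_divide power2_eq_square field_simps)
    show ?thesis unfolding eq real_sqrt_mult real_sqrt_abs by simp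
  qed
  have [measurable]: "S n \<in> sets M" for n unfolding S_def by measurable
  have Sle: "emeasure M (S n) \<le> ennreal (c n)" for n
  proof -
    have "L1_norm M (U n) \<le> b" "L1_norm M (V (Suc n)) \<le> b"
      unfolding b_def using b(1)[OF U(1,3) f, of n] b(1)[OF V(1,3) g, of "Suc n"] f0 by linarith+
    moreover have "0 < (1 / 2 :: real) ^ n" by simp
    ultimately have "emeasure M {x. 2 * (1 / 2) ^ n < cmod (h (Suc n) x - h n x)} \<le> ennreal (2 * CW * sqrt (2 * \<delta> n * b / (1 / 2) ^ n))"
      unfolding h_def by (intro T_step_weak U V b(2)[OF U(1,3) f] b(2)[OF V(1,3) g])
    then show ?thesis unfolding sq by (simp only: S_def c_def mult.assoc space_M UNIV_I simp_thms)
  qed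
  have "AE x in M. \<forall>\<^sub>F n in sequentially. x \<in> space M - S n"
  proof (rule borel_cantelli_AE1)
    show fin: "emeasure M (S n) < \<infinity>" for n using Sle[of n] by (simp add: le_less_trans)
    have le: "norm (measure M (S n)) \<le> c n" for n
      using Sle[of n] c0[of n] fin[of n] by (simp add: emeasure_eq_ennreal_measure less_top)
    have "summable c" unfolding c_def by (intro summable_mult summable_geometric) auto
    then show "summable (\<lambda>n. measure M (S n))" by (rule summable_comparison_test'[where N = 0]) (rule le)
  qed measurable
  then have conv: "AE x in M. (\<lambda>n. h n x) \<longlonglongrightarrow> lim (\<lambda>n. h n x)"
  proof eventually_elim
    case (elim x)
    have "\<forall>\<^sub>F n in sequentially. norm (h (Suc n) x - h n x) \<le> 2 * (1 / 2) ^ n"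
      using elim by eventually_elim (simp add: S_def not_less)
    moreover have "summable (\<lambda>n. 2 * (1 / 2 :: real) ^ n)" by (intro summable_mult summable_geometric) auto
    ultimately have "convergent (\<lambda>n. h n x)" by (rule convergent_if_steps_summable)
    then show ?case by (simp add: convergent_LIMSEQ_iff)
  qed
  have \<delta>0: "\<delta> \<longlonglongrightarrow> 0" unfolding \<delta>_def by (rule LIMSEQ_realpow_zero) auto
  have lim: "(\<lambda>n. \<integral>y. cmod (F n y - f y) \<partial>M) \<longlonglongrightarrow> 0" if "\<And>n. (\<integral>y. cmod (F n y - f y) \<partial>M) < \<delta> n" for F :: "nat \<Rightarrow> 'a \<Rightarrow> complex" and f
    by (rule tendsto_sandwich[OF _ _ tendsto_const \<delta>0]) (auto intro!: always_eventually less_imp_le that)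
  have "(\<lambda>x. lim (\<lambda>n. h n x)) \<in> borel_measurable M" by measurable
  then show ?thesis
    unfolding L1_extension_value_def
    using U(1,2) V(1,2) lim[OF U(3)] lim[OF V(3)] conv unfolding h_def
    by (intro exI[of _ "\<lambda>x. lim (\<lambda>n. T (U n) (V n) x)"] conjI exI[of _ U] exI[of _ V]) auto
qed

lemma extension_approximates:
  assumes "integrable M f1" "integrable M f2" "L1_extension_value M p1 p2 T f1 f2 g" "0 < \<epsilon>"
  shows "approximates \<epsilon> x f1 f2 g"
proof -
  obtain u v where *: "\<forall>n::nat. integrable M (u n) \<and> in_Lp M p1 (u n) \<and> integrable M (v n) \<and> in_Lp M p2 (v n)"
    "(\<lambda>n. \<integral>x. cmod (u n x - f1 x) \<partial>M) \<longlonglongrightarrow> 0" "(\<lambda>n. \<integral>x. cmod (v n x - f2 x) \<partial>M) \<longlonglongrightarrow> 0"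
    "AE x in M. (\<lambda>n. T (u n) (v n) x) \<longlonglongrightarrow> g x" "g \<in> borel_measurable M"
    using assms(3) unfolding L1_extension_value_def by blast
  have "\<And>n. in_Lp M p1 (u n)" "\<And>n. integrable M (u n)" "\<And>n. in_Lp M p2 (v n)" "\<And>n. integrable M (v n)"
    using *(1) by blast+
  from approximates_L1[OF assms(1,2,4) this(1,2) *(2) this(3,4) *(3,5,4)] show ?thesis .
qed

lemma L1_norm_tendsto:
  assumes U: "\<And>n::nat. integrable M (U n :: 'a \<Rightarrow> complex)" and f: "integrable M f" and l: "(\<lambda>n. \<integral>y. cmod (U n y - f y) \<partial>M) \<longlonglongrightarrow> 0"
  shows "(\<lambda>n. \<integral>y. cmod (U n y) \<partial>M) \<longlonglongrightarrow> L1_norm M f"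
proof (rule LIM_zero_cancel, rule Lim_null_comparison[OF always_eventually l], rule allI)
  fix n
  have "norm (L1_norm M (U n) - L1_norm M f) = norm (\<integral>y. cmod (U n y) - cmod (f y) \<partial>M)"
    using U f by simp
  also have "\<dots> \<le> (\<integral>y. norm (cmod (U n y) - cmod (f y)) \<partial>M)" by (rule integral_norm_bound)
  also have "\<dots> \<le> (\<integral>y. cmod (U n y - f y) \<partial>M)"
    using U[of n] f norm_triangle_ineq3
    by (intro integral_mono integrable_norm Bochner_Integration.integrable_diff) auto
  finally show "norm (L1_norm M (U n) - L1_norm M f) \<le> (\<integral>y. cmod (U n y - f y) \<partial>M)" .
qed

text \<open>The first summand comes from the stopping sets of the two functions; the second from the
  level set of the extension at \<open>t / 3\<close>, whence \<open>sqrt 3\<close>.\<close>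

definition weak_max_const :: real where
  "weak_max_const = 2 * sqrt (2 * cotlar_const * (CL ^ 6 + 1)) + 4 * A * CW * sqrt 3"

lemma weak_max_const_nonneg: "0 \<le> weak_max_const"
  unfolding weak_max_const_def using cotlar_const_pos CL CW by simp

text \<open>The levels \<open>b1 / s\<close> and \<open>b2 / s\<close> give both stopping sets the
  same bound \<open>s\<close> on their measure. The condition of \<open>maximal_level_set\<close> on
  the product of the levels then determines \<open>s\<close>.\<close>

lemma maximal_truncation_weak_type:
  assumes f: "integrable M f1" "integrable M f2" and t: "0 < t"
  shows "emeasure M {x. ennreal t < maximal_truncation M K f1 f2 x}
    \<le> ennreal (weak_max_const * sqrt (L1_norm M f1 * L1_norm M f2 / t))"
proof -
  define b1 b2 where "b1 = L1_norm M f1" and "b2 = L1_norm M f2"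
  have b0: "0 \<le> b1" "0 \<le> b2" by (auto simp: b1_def b2_def)
  note [measurable] = borel_measurable_integrable[OF f(1)] borel_measurable_integrable[OF f(2)]
  consider "emeasure M UNIV = 0" | "b1 = 0 \<or> b2 = 0" | "emeasure M UNIV \<noteq> 0" "0 < b1" "0 < b2"
    using b0 by fastforce
  then show ?thesis
  proof cases
    case 1
    then have "emeasure M {x. ennreal t < maximal_truncation M K f1 f2 x} \<le> 0"
      using emeasure_mono[of "{x. ennreal t < maximal_truncation M K f1 f2 x}" UNIV M] sets_M by simp
    then show ?thesis by simp
  next
    case 2
    then have "(AE y in M. f1 y = 0) \<or> (AE y in M. f2 y = 0)"
      using f by (auto simp: b1_def b2_def integral_nonneg_eq_0_iff_AE)
    then have "maximal_truncation M K f1 f2 x = 0" for x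
      by (auto simp: maximal_truncation_def truncated_operator_eq kernel_integral_zero)
    then show ?thesis by simp
  next
    case 3
    obtain g where g: "L1_extension_value M p1 p2 T f1 f2 g" using L1_extension_exists[OF f] by blast
    obtain u v where *: "\<forall>n::nat. integrable M (u n) \<and> in_Lp M p1 (u n) \<and> integrable M (v n) \<and> in_Lp M p2 (v n)"
      "(\<lambda>n. \<integral>x. cmod (u n x - f1 x) \<partial>M) \<longlonglongrightarrow> 0" "(\<lambda>n. \<integral>x. cmod (v n x - f2 x) \<partial>M) \<longlonglongrightarrow> 0"
      "AE x in M. (\<lambda>n. T (u n) (v n) x) \<longlonglongrightarrow> g x" and gm [measurable]: "g \<in> borel_measurable M"
      using g unfolding L1_extension_value_def by blast
    have uv: "\<And>n. in_Lp M p1 (u n)" "\<And>n. integrable M (u n)" "\<And>n. in_Lp M p2 (v n)" "\<And>n. integrable M (v n)"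
      using *(1) by blast+
    have gw: "emeasure M {z. t / 3 < cmod (g z)} \<le> ennreal (CW * sqrt (b1 * b2 / (t / 3)))"
      unfolding b1_def b2_def
      by (rule weak_type_limit[OF uv(1,2) L1_norm_tendsto[OF uv(2) f(1) *(2)] uv(3,4) L1_norm_tendsto[OF uv(4) f(2) *(3)] gm *(4)])
        (use t in simp)
    define c where "c = cotlar_const * (CL ^ 6 + 1)"
    have "0 < CL ^ 6 + 1" using CL by (intro add_nonneg_pos) auto
    then have c: "0 < c" unfolding c_def using cotlar_const_pos by simp
    define s where "s = sqrt (b1 * b2 / (t / (2 * c)))"
    have s: "0 < s" "s\<^sup>2 = b1 * b2 * (2 * c) / t" using 3 c t by (auto simp: s_def)
    have lim: "cotlar_const * (CL ^ 6 + 1) * (b1 / s * (b2 / s)) \<le> t / 2"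
    proof -
      have "c * (b1 / s * (b2 / s)) = c * (b1 * b2) / s\<^sup>2" by (simp add: power2_eq_square)
      also have "\<dots> = t / 2" unfolding s(2) using 3 c t by (simp add: field_simps)
      finally show ?thesis by (simp add: c_def)
    qed
    define S where "S f b = stopping_set 5 (\<lambda>y. ennreal (cmod (f y))) (ennreal (b / s))" for f :: "'a \<Rightarrow> complex" and b
    define S3 where "S3 = stopping_set 5 (indicator {z. t / 3 < cmod (g z)}) (ennreal (1 / (4 * A)))"
    have gS: "{z \<in> space M. t / 3 < cmod (g z)} \<in> sets M" by measurable
    then have [measurable]: "{z. t / 3 < cmod (g z)} \<in> sets M" by simp
    have Sm: "S f b \<in> sets M" if [measurable]: "f \<in> borel_measurable M" for f b
      unfolding S_def by (intro open_sets_M open_stopping_set) auto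
    have S3m: "S3 \<in> sets M" unfolding S3_def by (intro open_sets_M open_stopping_set) auto
    have Sw: "emeasure M (S f b) \<le> ennreal s" if f: "integrable M f" "L1_norm M f = b" "0 < b" for f b
    proof -
      have "ennreal (b / s) * emeasure M (S f b) \<le> nn_norm M f"
        unfolding S_def by (rule weak_type_stopping_set) (use f in auto)
      also have "\<dots> = ennreal b" using f by (simp add: nn_integral_eq_integral)
      finally have "emeasure M (S f b) \<le> ennreal (b / (b / s))" by (rule ennreal_mult_le_imp_le_divide) (use f s in auto)
      then show ?thesis using f by simp
    qed
    have S3w: "emeasure M S3 \<le> ennreal (4 * A * (CW * sqrt (b1 * b2 / (t / 3))))"
    proof -
      have "ennreal (1 / (4 * A)) * emeasure M S3 \<le> (\<integral>\<^sup>+y. indicator {z. t / 3 < cmod (g z)} y \<partial>M)"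
        unfolding S3_def by (rule weak_type_stopping_set) auto
      also have "\<dots> = emeasure M {z. t / 3 < cmod (g z)}" by (rule nn_integral_indicator) measurable
      also note gw
      finally have "emeasure M S3 \<le> ennreal (CW * sqrt (b1 * b2 / (t / 3)) / (1 / (4 * A)))"
        by (rule ennreal_mult_le_imp_le_divide) (use CL CW b0 t in auto)
      then show ?thesis by (simp add: mult.commute)
    qed
    have "{x. ennreal t < maximal_truncation M K f1 f2 x} \<subseteq> S f1 b1 \<union> S f2 b2 \<union> S3"
      unfolding S_def S3_def
      by (rule maximal_level_set[OF f 3(1) extension_approximates[OF f g] _ _ lim t]) (use b0 s in auto)
    then have "emeasure M {x. ennreal t < maximal_truncation M K f1 f2 x} \<le> emeasure M (S f1 b1 \<union> S f2 b2 \<union> S3)"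
      by (rule emeasure_mono) (intro sets.Un Sm S3m; measurable)
    also have "\<dots> \<le> emeasure M (S f1 b1 \<union> S f2 b2) + emeasure M S3"
      by (intro emeasure_subadditive sets.Un Sm S3m; measurable)
    also have "\<dots> \<le> (emeasure M (S f1 b1) + emeasure M (S f2 b2)) + emeasure M S3"
      by (intro add_right_mono emeasure_subadditive Sm; measurable)
    also have "\<dots> \<le> (ennreal s + ennreal s) + ennreal (4 * A * (CW * sqrt (b1 * b2 / (t / 3))))"
      using 3 f by (intro add_mono Sw S3w) (auto simp: b1_def b2_def)
    also have "\<dots> = ennreal (2 * s + 4 * A * (CW * sqrt (b1 * b2 / (t / 3))))"
      using s CL CW b0 t by (simp flip: ennreal_plus)
    also have "2 * s + 4 * A * (CW * sqrt (b1 * b2 / (t / 3))) = weak_max_const * sqrt (b1 * b2 / t)"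
    proof -
      have "s = sqrt (2 * c * (b1 * b2 / t))" by (simp add: s_def field_simps)
      then have "s = sqrt (2 * c) * sqrt (b1 * b2 / t)" by (simp only: real_sqrt_mult)
      moreover have "sqrt (b1 * b2 / (t / 3)) = sqrt (3 * (b1 * b2 / t))" by (simp add: field_simps)
      then have "sqrt (b1 * b2 / (t / 3)) = sqrt 3 * sqrt (b1 * b2 / t)" by (simp only: real_sqrt_mult)
      ultimately show ?thesis by (simp add: weak_max_const_def c_def algebra_simps)
    qed
    finally show ?thesis by (simp add: b1_def b2_def)
  qed
qed

lemma weak_L_half_maximal_truncation:
  assumes f: "integrable M f1" "integrable M f2"
  shows "weak_L_half M (maximal_truncation M K f1 f2)
    \<le> ennreal ((weak_max_const\<^sup>2 + 1) * L1_norm M f1 * L1_norm M f2)"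
  unfolding weak_L_half_def
proof (rule SUP_least)
  fix t :: real assume "t \<in> {0<..}"
  then have t: "0 < t" by simp
  define b where "b = L1_norm M f1 * L1_norm M f2"
  have b: "0 \<le> b" by (simp add: b_def)
  have "ennreal t * (emeasure M {x \<in> space M. ennreal t < maximal_truncation M K f1 f2 x})\<^sup>2
      \<le> ennreal t * (ennreal (weak_max_const * sqrt (b / t)))\<^sup>2"
    using maximal_truncation_weak_type[OF f t] by (intro mult_left_mono power_mono) (auto simp: b_def)
  also have "\<dots> = ennreal (t * (weak_max_const * sqrt (b / t))\<^sup>2)"
    using weak_max_const_nonneg b t by (subst ennreal_power) (auto simp: ennreal_mult' simp del: power_mult_distrib)
  also have "t * (weak_max_const * sqrt (b / t))\<^sup>2 = weak_max_const\<^sup>2 * b" using b t by (simp add: power_mult_distrib)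
  also have "\<dots> \<le> (weak_max_const\<^sup>2 + 1) * b" using b by (intro mult_right_mono) auto
  finally show "ennreal t * (emeasure M {x \<in> space M. ennreal t < maximal_truncation M K f1 f2 x})\<^sup>2
      \<le> ennreal ((weak_max_const\<^sup>2 + 1) * L1_norm M f1 * L1_norm M f2)"
    by (simp add: b_def mult.assoc ennreal_leI)
qed

section \<open>Measurability of the maximal truncation\<close>

lemma truncated_operator_measurable:
  assumes [measurable]: "f1 \<in> borel_measurable M" "f2 \<in> borel_measurable M"
  shows "truncated_operator M K \<epsilon> f1 f2 \<in> borel_measurable M"
proof -
  have "(\<lambda>x. \<integral>w. (if \<epsilon>\<^sup>2 < (dist x (fst w))\<^sup>2 + (dist x (snd w))\<^sup>2 then K x (fst w) (snd w) * f1 (fst w) * f2 (snd w) else 0) \<partial>(M \<Otimes>\<^sub>M M)) \<in> borel_measurable M"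
    by measurable
  also have "(\<lambda>x. \<integral>w. (if \<epsilon>\<^sup>2 < (dist x (fst w))\<^sup>2 + (dist x (snd w))\<^sup>2 then K x (fst w) (snd w) * f1 (fst w) * f2 (snd w) else 0) \<partial>(M \<Otimes>\<^sub>M M)) = truncated_operator M K \<epsilon> f1 f2"
    unfolding truncated_operator_def set_lebesgue_integral_def
    by (intro ext Bochner_Integration.integral_cong) (auto simp: indicator_def)
  finally show ?thesis .
qed

text \<open>The truncation region is given by a strict inequality, so it is the union of the regions
  for larger parameters. This one-sided continuity allows the supremum to be taken over
  rationals.\<close>

lemma truncated_operator_right_continuous:
  assumes f: "integrable M f1" "integrable M f2" and \<epsilon>: "0 < \<epsilon>"
    and e: "\<And>n. \<epsilon> < e n" "e \<longlonglongrightarrow> \<epsilon>"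
  shows "(\<lambda>n. truncated_operator M K (e n) f1 f2 x) \<longlonglongrightarrow> truncated_operator M K \<epsilon> f1 f2 x"
  unfolding truncated_operator_eq set_lebesgue_integral_def
proof (rule integral_dominated_convergence)
  have [measurable]: "f1 \<in> borel_measurable M" "f2 \<in> borel_measurable M" using f by auto
  show "(\<lambda>w. indicator (far x \<epsilon>) w *\<^sub>R (case w of (y1, y2) \<Rightarrow> K x y1 y2 * f1 y1 * f2 y2)) \<in> borel_measurable (M \<Otimes>\<^sub>M M)"
    "(\<lambda>w. indicator (far x (e n)) w *\<^sub>R (case w of (y1, y2) \<Rightarrow> K x y1 y2 * f1 y1 * f2 y2)) \<in> borel_measurable (M \<Otimes>\<^sub>M M)" for n
    by measurable
  show "integrable (M \<Otimes>\<^sub>M M) (\<lambda>w. norm (indicator (far x \<epsilon>) w *\<^sub>R (case w of (y1, y2) \<Rightarrow> K x y1 y2 * f1 y1 * f2 y2)))"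
    using L1_kernel_far[OF f \<epsilon>, of x] unfolding set_integrable_def by (rule integrable_norm)
  have ee: "\<epsilon>\<^sup>2 \<le> (e n)\<^sup>2" for n using e(1)[of n] \<epsilon> by (intro power_mono) auto
  show "AE w in M \<Otimes>\<^sub>M M. (\<lambda>n. indicator (far x (e n)) w *\<^sub>R (case w of (y1, y2) \<Rightarrow> K x y1 y2 * f1 y1 * f2 y2))
      \<longlonglongrightarrow> indicator (far x \<epsilon>) w *\<^sub>R (case w of (y1, y2) \<Rightarrow> K x y1 y2 * f1 y1 * f2 y2)"
  proof (rule AE_I2, rule tendsto_scaleR[OF _ tendsto_const])
    fix w
    have "\<forall>\<^sub>F n in sequentially. w \<in> far x (e n) \<longleftrightarrow> w \<in> far x \<epsilon>"
    proof (cases "w \<in> far x \<epsilon>")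
      case True
      have "(\<lambda>n. (e n)\<^sup>2) \<longlonglongrightarrow> \<epsilon>\<^sup>2" by (intro tendsto_intros e)
      moreover have "\<epsilon>\<^sup>2 < (dist x (fst w))\<^sup>2 + (dist x (snd w))\<^sup>2" using True by (simp add: far_def case_prod_beta')
      ultimately have "\<forall>\<^sub>F n in sequentially. (e n)\<^sup>2 < (dist x (fst w))\<^sup>2 + (dist x (snd w))\<^sup>2" by (rule order_tendstoD)
      then show ?thesis by (rule eventually_mono) (use True in \<open>simp add: far_def case_prod_beta'\<close>)
    next
      case False
      have "w \<notin> far x (e n)" for n using False ee[of n] by (auto simp: far_def case_prod_beta')
      then show ?thesis using False by simp
    qed
    then show "(\<lambda>n. indicator (far x (e n)) w :: real) \<longlonglongrightarrow> indicator (far x \<epsilon>) w"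
      by (intro tendsto_eventually) (auto elim!: eventually_mono simp: indicator_def)
  qed
  show "AE w in M \<Otimes>\<^sub>M M. norm (indicator (far x (e n)) w *\<^sub>R (case w of (y1, y2) \<Rightarrow> K x y1 y2 * f1 y1 * f2 y2))
      \<le> norm (indicator (far x \<epsilon>) w *\<^sub>R (case w of (y1, y2) \<Rightarrow> K x y1 y2 * f1 y1 * f2 y2))" for n
    using ee[of n] by (intro AE_I2) (auto simp: indicator_def far_def)
qed

lemma maximal_truncation_measurable:
  assumes f: "integrable M f1" "integrable M f2"
  shows "maximal_truncation M K f1 f2 \<in> borel_measurable M"
proof -
  note [measurable] = truncated_operator_measurable[OF borel_measurable_integrable[OF f(1)] borel_measurable_integrable[OF f(2)]]
  define Q :: "real set" where "Q = \<rat> \<inter> {0<..}"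
  have cQ: "countable Q" unfolding Q_def by (intro countable_Int1 countable_rat)
  have "maximal_truncation M K f1 f2 x = (SUP q\<in>Q. ennreal (cmod (truncated_operator M K q f1 f2 x)))" for x
    unfolding maximal_truncation_def
  proof (rule antisym)
    show "(SUP q\<in>Q. ennreal (cmod (truncated_operator M K q f1 f2 x))) \<le> (SUP \<epsilon>\<in>{0<..}. ennreal (cmod (truncated_operator M K \<epsilon> f1 f2 x)))"
      by (rule SUP_subset_mono) (auto simp: Q_def)
    show "(SUP \<epsilon>\<in>{0<..}. ennreal (cmod (truncated_operator M K \<epsilon> f1 f2 x))) \<le> (SUP q\<in>Q. ennreal (cmod (truncated_operator M K q f1 f2 x)))"
    proof (rule SUP_least)
      fix \<epsilon> :: real assume "\<epsilon> \<in> {0<..}"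
      then have \<epsilon>: "0 < \<epsilon>" by simp
      have "\<forall>n. \<exists>q. q \<in> \<rat> \<and> \<epsilon> < q \<and> q < \<epsilon> + 1 / real (Suc n)"
      proof
        fix n show "\<exists>q. q \<in> \<rat> \<and> \<epsilon> < q \<and> q < \<epsilon> + 1 / real (Suc n)"
          using Rats_dense_in_real[of \<epsilon> "\<epsilon> + 1 / real (Suc n)"] by auto
      qed
      from choice[OF this] obtain e where e: "\<And>n. e n \<in> \<rat>" "\<And>n. \<epsilon> < e n" "\<And>n. e n < \<epsilon> + 1 / real (Suc n)" by blast
      have "(\<lambda>n. \<epsilon> + 1 / real (Suc n)) \<longlonglongrightarrow> \<epsilon> + 0" by (intro tendsto_intros lim_1_over_n[THEN LIMSEQ_Suc])
      then have lim: "(\<lambda>n. \<epsilon> + 1 / real (Suc n)) \<longlonglongrightarrow> \<epsilon>" by (simp only: add_0_right)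
      have "e \<longlonglongrightarrow> \<epsilon>"
        by (rule tendsto_sandwich[OF always_eventually[OF allI[OF less_imp_le[OF e(2)]]] always_eventually[OF allI[OF less_imp_le[OF e(3)]]] tendsto_const lim])
      then have lim': "(\<lambda>n. ennreal (cmod (truncated_operator M K (e n) f1 f2 x))) \<longlonglongrightarrow> ennreal (cmod (truncated_operator M K \<epsilon> f1 f2 x))"
        by (intro tendsto_ennrealI tendsto_norm truncated_operator_right_continuous f \<epsilon> e)
      have "e n \<in> Q" for n using e(1,2)[of n] \<epsilon> by (auto simp: Q_def)
      then have le: "ennreal (cmod (truncated_operator M K (e n) f1 f2 x)) \<le> (SUP q\<in>Q. ennreal (cmod (truncated_operator M K q f1 f2 x)))" for n
        by (rule SUP_upper)
      show "ennreal (cmod (truncated_operator M K \<epsilon> f1 f2 x)) \<le> (SUP q\<in>Q. ennreal (cmod (truncated_operator M K q f1 f2 x)))"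
        by (rule LIMSEQ_le_const2[OF lim'], rule exI[of _ 0], intro allI impI, rule le)
    qed
  qed
  then have "maximal_truncation M K f1 f2 = (\<lambda>x. SUP q\<in>Q. ennreal (cmod (truncated_operator M K q f1 f2 x)))" by (rule ext)
  also have "\<dots> \<in> borel_measurable M" using cQ by measurable
  finally show ?thesis .
qed

lemma cotlar_at_extension:
  assumes "0 < \<eta>" "integrable M f1" "integrable M f2" "L1_extension_value M p1 p2 T f1 f2 g"
  shows "cotlar_at M L K \<eta> (cotlar_const + (4 * A) powr (1 / \<eta>)) f1 f2 g x"
  unfolding cotlar_at_def maximal_truncation_def truncated_operator_eq
  by (intro SUP_least cotlar_inequality extension_approximates assms) (use assms in auto)

text \<open>Absolute convergence of the truncated integrals is not assumed;
  \<open>cotlar_inequality\<close> asks for \<open>approximates\<close> only where it holds.\<close>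

lemma cotlar_at_Lp:
  assumes "0 < \<eta>" "in_Lp M p1 f1" "in_Lp M p2 f2"
  shows "cotlar_at M L K \<eta> (cotlar_const + (4 * A) powr (1 / \<eta>)) f1 f2 (T f1 f2) x"
  unfolding cotlar_at_def maximal_truncation_def truncated_operator_eq
  by (intro SUP_least cotlar_inequality approximates_self assms) (use assms in auto)

end

section \<open>Normalising the kernel and the dominating function\<close>

text \<open>On a dyadic interval \<open>\<omega> t / t\<close> is at least the value of
  \<open>\<omega>\<close> at the left end divided by the right end, and the interval has half the
  right end as its length.\<close>

lemma dini_modulus_summable:
  assumes "dini_modulus \<omega>"
  shows "summable (\<lambda>k. \<omega> ((1 / 2) ^ Suc k))"
proof -
  have mono: "mono_on {0..} \<omega>" and zero: "\<omega> 0 = 0" and int: "set_integrable lborel {0<..1} (\<lambda>t. \<omega> t / t)"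
    using assms by (auto simp: dini_modulus_def)
  have nonneg: "0 \<le> \<omega> t" if "0 \<le> t" for t using mono_onD[OF mono, of 0 t] that zero by simp
  define I where "I S = set_lebesgue_integral lborel S (\<lambda>t. \<omega> t / t)" for S
  define a :: "nat \<Rightarrow> real" where "a n = (1 / 2) ^ n" for n
  have a: "0 < a n" "a n \<le> 1" "a n = 2 * a (Suc n)" for n by (auto simp: a_def power_le_one)
  have si: "set_integrable lborel S (\<lambda>t. \<omega> t / t)" if "S \<subseteq> {0<..1}" "S \<in> sets lborel" for S
    by (rule set_integrable_subset[OF int that(2,1)])
  have block: "\<omega> (a (Suc n)) / 2 \<le> I {a (Suc n)<..a n}" for n
  proof -
    have "set_lebesgue_integral lborel {a (Suc n)<..a n} (\<lambda>t. \<omega> (a (Suc n)) / a n) \<le> I {a (Suc n)<..a n}"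
      unfolding I_def
    proof (rule set_integral_mono)
      show "set_integrable lborel {a (Suc n)<..a n} (\<lambda>t. \<omega> t / t)"
        using a(1)[of "Suc n"] a(2)[of n] by (intro si) auto
      show "set_integrable lborel {a (Suc n)<..a n} (\<lambda>t. \<omega> (a (Suc n)) / a n)"
        unfolding set_integrable_def using a(3)[of n] a(1)[of "Suc n"]
        by (intro integrable_scaleR_left integrable_real_indicator) auto
      fix t assume t: "t \<in> {a (Suc n)<..a n}"
      have "0 < t" using t a(1)[of "Suc n"] by simp
      then show "\<omega> (a (Suc n)) / a n \<le> \<omega> t / t"
        using t a(1)[of "Suc n"] a(1)[of n] by (intro frac_le nonneg mono_onD[OF mono]) auto
    qed
    moreover have "set_lebesgue_integral lborel {a (Suc n)<..a n} (\<lambda>t. \<omega> (a (Suc n)) / a n) = \<omega> (a (Suc n)) / 2"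
      unfolding set_lebesgue_integral_def using a(1)[of "Suc n"] a(3)[of n] by (simp add: field_simps)
    ultimately show ?thesis by (simp only:)
  qed
  have "(\<Sum>k<n. \<omega> (a (Suc k)) / 2) \<le> I {a n<..1}" for n
  proof (induction n)
    case 0
    then show ?case by (simp add: I_def a_def set_lebesgue_integral_def)
  next
    case (Suc n)
    have "{a (Suc n)<..1} = {a (Suc n)<..a n} \<union> {a n<..1}" using a(1)[of "Suc n"] a(2,3)[of n] by auto
    moreover have "I ({a (Suc n)<..a n} \<union> {a n<..1}) = I {a (Suc n)<..a n} + I {a n<..1}"
      unfolding I_def using a(1)[of "Suc n"] a(1)[of n] a(2)[of n] by (intro set_integral_Un si) auto
    ultimately show ?case using Suc.IH block[of n] by simp
  qed
  moreover have "I {a n<..1} \<le> I {0<..1}" for n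
    unfolding I_def set_lebesgue_integral_def
  proof (rule integral_mono)
    show "integrable lborel (\<lambda>t. indicator {a n<..1} t *\<^sub>R (\<omega> t / t))"
      unfolding set_integrable_def[symmetric] using a(1)[of n] by (intro si) auto
    show "integrable lborel (\<lambda>t. indicator {0<..1} t *\<^sub>R (\<omega> t / t))" using int unfolding set_integrable_def .
    show "indicator {a n<..1} t *\<^sub>R (\<omega> t / t) \<le> indicator {0<..1} t *\<^sub>R (\<omega> t / t)" for t
      using a(1)[of n] nonneg[of t] by (auto simp: indicator_def)
  qed
  ultimately have "(\<Sum>k<n. \<omega> (a (Suc k)) / 2) \<le> I {0<..1}" for n by (rule order_trans)
  then have "summable (\<lambda>k. \<omega> (a (Suc k)) / 2)"
    by (intro summableI_nonneg_bounded) (use a(1) nonneg in \<open>auto simp: less_imp_le\<close>)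
  then have "summable (\<lambda>k. 2 * (\<omega> (a (Suc k)) / 2))" by (rule summable_mult)
  then show ?thesis by (simp add: a_def)
qed

lemma ball_finite_spaceI:
  assumes "metric_measure_space M" "upper_doubling M lam"
  shows "ball_finite_space M"
proof
  have s: "sets M = sets borel" using assms by (simp add: metric_measure_space_def)
  then show "sets M = sets borel" .
  show "emeasure M A = (SUP K\<in>{K. K \<subseteq> A \<and> compact K}. emeasure M K)" if "A \<in> sets borel" for A
    using assms(1) that s by (simp add: metric_measure_space_def)
  fix x r
  show "emeasure M (ball x r) < \<infinity>"
  proof (cases "0 < r")
    case True
    then have "emeasure M (ball x r) \<le> ennreal (lam x r)" using assms(2) by (simp add: upper_doubling_def)
    then show ?thesis by (rule le_less_trans) simp
  next
    case False
    then have "ball x r = {}" by simp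
    then show ?thesis by (simp only: emeasure_empty) simp
  qed
qed

lemma dominated_spaceI:
  assumes "metric_measure_space M" "upper_doubling M lam"
  obtains CL where "dominated_space M lam CL"
proof -
  interpret ball_finite_space M by (rule ball_finite_spaceI[OF assms])
  note ud = assms(2)[unfolded upper_doubling_def]
  obtain C where C: "0 < C" "\<And>x r. 0 < r \<Longrightarrow> lam x r \<le> C * lam x (r / 2)"
    using ud[THEN conjunct2, THEN conjunct2] by auto
  have pos: "0 < lam x r" and le: "emeasure M (ball x r) \<le> ennreal (lam x r)" if "0 < r" for x r
    using ud[THEN conjunct1] that by auto
  have mono: "lam x r \<le> lam x s" if "0 < r" "r \<le> s" for x r s
    using ud[THEN conjunct2, THEN conjunct1] that by auto
  have "dominated_space M lam (max 1 C)"
  proof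
    fix x r assume r: "(0::real) < r"
    show "0 < lam x r" by (rule pos[OF r])
    show "measure M (ball x r) \<le> lam x r" using le[OF r, of x] pos[OF r, of x] by (simp add: emeasure_ball)
    have "C * lam x r \<le> max 1 C * lam x r" using pos[OF r, of x] by (intro mult_right_mono) auto
    then show "lam x (2 * r) \<le> max 1 C * lam x r" using C(2)[of "2 * r" x] r by simp
  qed (simp_all add: mono)
  then show ?thesis by (rule that)
qed

text \<open>Nothing is assumed about \<open>K x x x\<close>, not even measurability.\<close>

definition off_diagonal :: "('a \<Rightarrow> 'a \<Rightarrow> 'a \<Rightarrow> complex) \<Rightarrow> 'a \<Rightarrow> 'a \<Rightarrow> 'a \<Rightarrow> complex" where
  "off_diagonal K x y1 y2 = (if x = y1 \<and> x = y2 then 0 else K x y1 y2)"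

lemma truncated_operator_off_diagonal:
  "truncated_operator M (off_diagonal K) \<epsilon> f1 f2 x = truncated_operator M K \<epsilon> f1 f2 x"
  unfolding truncated_operator_def set_lebesgue_integral_def
  by (intro Bochner_Integration.integral_cong) (auto simp: off_diagonal_def indicator_def split: if_splits)

lemma maximal_truncation_off_diagonal:
  "maximal_truncation M (off_diagonal K) f1 f2 = maximal_truncation M K f1 f2"
  by (simp add: maximal_truncation_def truncated_operator_off_diagonal fun_eq_iff)

text \<open>The kernel may be changed on the diagonal without affecting the representation: where
  the supports do not both contain \<open>x\<close>, the product of the two functions vanishes at
  \<open>(x, x)\<close>. The constant is the \<open>p\<close>-th power of the norm bound.\<close>

lemma bilinear_operatorI:
  fixes M :: "'a::{metric_space, second_countable_topology} measure"
  assumes M: "ball_finite_space M" and T: "bilinear_CZ_operator M lam p1 p2 p K T"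
  obtains CT where "bilinear_operator M p1 p2 p CT (off_diagonal K) T"
proof -
  interpret ball_finite_space M by (rule M)
  have ex: "1 < p1" "1 < p2" "1 < p" "1 / p = 1 / p1 + 1 / p2" and b: "bounded_bilinear_Lp M p1 p2 p T"
    and Kl: "locally_integrable_off_diagonal M K"
    and rep: "\<And>f g. f \<in> borel_measurable M \<Longrightarrow> bounded (range f) \<Longrightarrow> compact (supp f) \<Longrightarrow>
        g \<in> borel_measurable M \<Longrightarrow> bounded (range g) \<Longrightarrow> compact (supp g) \<Longrightarrow>
        AE x in M. x \<notin> supp f \<inter> supp g \<longrightarrow> T f g x = (\<integral>(y1, y2). K x y1 y2 * f y1 * g y2 \<partial>(M \<Otimes>\<^sub>M M))"
    using T unfolding bilinear_CZ_operator_def CZ_kernel_def by blast+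
  from b obtain C where C: "0 < C" "\<And>f g. in_Lp M p1 f \<Longrightarrow> in_Lp M p2 g \<Longrightarrow> in_Lp M p (T f g)"
    "\<And>f g. in_Lp M p1 f \<Longrightarrow> in_Lp M p2 g \<Longrightarrow> Lp_norm M p (T f g) \<le> C * Lp_norm M p1 f * Lp_norm M p2 g"
    and lin: "\<And>f g h a b. in_Lp M p1 f \<Longrightarrow> in_Lp M p1 g \<Longrightarrow> in_Lp M p2 h \<Longrightarrow>
        AE x in M. T (\<lambda>y. a * f y + b * g y) h x = a * T f h x + b * T g h x"
      "\<And>f g h a b. in_Lp M p1 h \<Longrightarrow> in_Lp M p2 f \<Longrightarrow> in_Lp M p2 g \<Longrightarrow>
        AE x in M. T h (\<lambda>y. a * f y + b * g y) x = a * T h f x + b * T h g x"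
    unfolding bounded_bilinear_Lp_def by blast
  have "bilinear_operator M p1 p2 p (C powr p) (off_diagonal K) T"
  proof
    fix f g assume f: "in_Lp M p1 f" and g: "in_Lp M p2 g"
    define I where "I q h = (\<integral>x. cmod (h x) powr q \<partial>M)" for q and h :: "'a \<Rightarrow> complex"
    have I: "0 \<le> I q h" for q h by (simp add: I_def)
    have "I p (T f g) = Lp_norm M p (T f g) powr p"
      using ex(3) I by (simp add: Lp_norm_def I_def[symmetric] powr_powr)
    also have "\<dots> \<le> (C * Lp_norm M p1 f * Lp_norm M p2 g) powr p"
      using ex C(3)[OF f g] by (intro powr_mono2) (auto simp: Lp_norm_def)
    also have "\<dots> = C powr p * I p1 f powr (p / p1) * I p2 g powr (p / p2)"
      using C(1) by (simp add: Lp_norm_def I_def[symmetric] powr_mult powr_powr)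
    finally show "(\<integral>x. cmod (T f g x) powr p \<partial>M) \<le>
        C powr p * (\<integral>x. cmod (f x) powr p1 \<partial>M) powr (p / p1) * (\<integral>x. cmod (g x) powr p2 \<partial>M) powr (p / p2)"
      by (simp add: I_def)
  next
    have "(\<lambda>w. indicator (- diagonal3) w *\<^sub>R (case w of (x, y1, y2) \<Rightarrow> K x y1 y2)) \<in> borel_measurable (M \<Otimes>\<^sub>M M \<Otimes>\<^sub>M M)"
      using Kl by (simp add: locally_integrable_off_diagonal_def set_borel_measurable_def)
    also have "(\<lambda>w. indicator (- diagonal3) w *\<^sub>R (case w of (x, y1, y2) \<Rightarrow> K x y1 y2)) = (\<lambda>(x, y1, y2). off_diagonal K x y1 y2)"
      by (auto simp: fun_eq_iff off_diagonal_def diagonal3_def indicator_def)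
    finally show "(\<lambda>(x, y1, y2). off_diagonal K x y1 y2) \<in> borel_measurable (M \<Otimes>\<^sub>M M \<Otimes>\<^sub>M M)" .
  next
    fix f g :: "'a \<Rightarrow> complex"
    assume fg: "f \<in> borel_measurable M" "bounded (range f)" "compact (supp f)"
      "g \<in> borel_measurable M" "bounded (range g)" "compact (supp g)"
    show "AE x in M. x \<notin> supp f \<inter> supp g \<longrightarrow> T f g x = (\<integral>(y1, y2). off_diagonal K x y1 y2 * f y1 * g y2 \<partial>(M \<Otimes>\<^sub>M M))"
      using rep[OF fg]
    proof eventually_elim
      case (elim x)
      show ?case
      proof
        assume x: "x \<notin> supp f \<inter> supp g"
        then have "f x = 0 \<or> g x = 0" using closure_subset unfolding supp_def by fastforce
        then have "(\<lambda>(y1, y2). off_diagonal K x y1 y2 * f y1 * g y2) = (\<lambda>(y1, y2). K x y1 y2 * f y1 * g y2)"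
          by (auto simp: fun_eq_iff off_diagonal_def)
        then show "T f g x = (\<integral>(y1, y2). off_diagonal K x y1 y2 * f y1 * g y2 \<partial>(M \<Otimes>\<^sub>M M))" using elim x by simp
      qed
    qed
  qed (use ex C lin in \<open>auto simp: off_diagonal_def\<close>)
  then show ?thesis by (rule that)
qed

text \<open>The regularity conditions never compare with a point of the diagonal, because moving one
  variable by at most half of the larger distance cannot reach it. So all of them survive the change
  of the diagonal values.\<close>

lemma cz_operatorI:
  fixes M :: "'a::{metric_space, second_countable_topology} measure"
  assumes M: "metric_measure_space M" "upper_doubling M lam" and T: "bilinear_CZ_operator M lam p1 p2 p K T"
  obtains CT CL CK \<omega> where "cz_operator M p1 p2 p CT (off_diagonal K) T lam CL CK \<omega>"
proof -
  obtain CL where "dominated_space M lam CL" using dominated_spaceI[OF M] .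
  then interpret dominated_space M lam CL .
  obtain CT where "bilinear_operator M p1 p2 p CT (off_diagonal K) T"
    using bilinear_operatorI[OF ball_finite_spaceI[OF M] T] .
  then interpret bilinear_operator M p1 p2 p CT "off_diagonal K" T .
  obtain CK \<omega> where CK: "0 < CK" and \<omega>: "dini_modulus \<omega>" and
    size: "\<And>x y1 y2. x \<noteq> y1 \<or> x \<noteq> y2 \<Longrightarrow> cmod (K x y1 y2) \<le> CK * kernel_bound lam x y1 y2" and
    reg0: "\<And>x y1 y2 x'. x \<noteq> y1 \<or> x \<noteq> y2 \<Longrightarrow> dist x x' \<le> max (dist x y1) (dist x y2) / 2 \<Longrightarrow>
      cmod (K x y1 y2 - K x' y1 y2) \<le> CK * kernel_bound lam x y1 y2 * \<omega> (dist x x' / (dist x y1 + dist x y2))" and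
    reg1: "\<And>x y1 y2 y1'. x \<noteq> y1 \<or> x \<noteq> y2 \<Longrightarrow> dist y1 y1' \<le> max (dist x y1) (dist x y2) / 2 \<Longrightarrow>
      cmod (K x y1 y2 - K x y1' y2) \<le> CK * kernel_bound lam x y1 y2 * \<omega> (dist y1 y1' / (dist x y1 + dist x y2))" and
    reg2: "\<And>x y1 y2 y2'. x \<noteq> y1 \<or> x \<noteq> y2 \<Longrightarrow> dist y2 y2' \<le> max (dist x y1) (dist x y2) / 2 \<Longrightarrow>
      cmod (K x y1 y2 - K x y1 y2') \<le> CK * kernel_bound lam x y1 y2 * \<omega> (dist y2 y2' / (dist x y1 + dist x y2))"
    using T unfolding bilinear_CZ_operator_def CZ_kernel_def by blast
  have off: "off_diagonal K x y1 y2 = K x y1 y2" if "x \<noteq> y1 \<or> x \<noteq> y2" for x y1 y2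
    using that by (auto simp: off_diagonal_def)
  have far: "x \<noteq> y \<or> x \<noteq> y'" if "u \<noteq> y \<or> u \<noteq> y'" "dist u x \<le> max (dist u y) (dist u y') / 2" for u x y y' :: 'a
  proof (rule ccontr)
    assume "\<not> (x \<noteq> y \<or> x \<noteq> y')"
    then show False using that zero_less_dist_iff[of u x] by auto
  qed
  have far1: "x \<noteq> z \<or> x \<noteq> y'" if "x \<noteq> y \<or> x \<noteq> y'" "dist y z \<le> max (dist x y) (dist x y') / 2" for x y y' z :: 'a
  proof (rule ccontr)
    assume "\<not> (x \<noteq> z \<or> x \<noteq> y')"
    then show False using that zero_less_dist_iff[of x y] by (auto simp: dist_commute)
  qed
  have "cz_operator M p1 p2 p CT (off_diagonal K) T lam CL CK \<omega>"
  proof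
    show "cmod (off_diagonal K x y1 y2) \<le> CK * kernel_bound lam x y1 y2" for x y1 y2
      using size[of x y1 y2] CK by (auto simp: off_diagonal_def)
    show "cmod (off_diagonal K x y1 y2 - off_diagonal K x' y1 y2) \<le> CK * kernel_bound lam x y1 y2 * \<omega> (dist x x' / (dist x y1 + dist x y2))"
      if "x \<noteq> y1 \<or> x \<noteq> y2" "dist x x' \<le> max (dist x y1) (dist x y2) / 2" for x y1 y2 x'
      unfolding off[OF that(1)] off[OF far[OF that]] by (rule reg0[OF that])
    show "cmod (off_diagonal K x y1 y2 - off_diagonal K x y1' y2) \<le> CK * kernel_bound lam x y1 y2 * \<omega> (dist y1 y1' / (dist x y1 + dist x y2))"
      if "x \<noteq> y1 \<or> x \<noteq> y2" "dist y1 y1' \<le> max (dist x y1) (dist x y2) / 2" for x y1 y2 y1'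
      unfolding off[OF that(1)] off[OF far1[OF that]] by (rule reg1[OF that])
    show "cmod (off_diagonal K x y1 y2 - off_diagonal K x y1 y2') \<le> CK * kernel_bound lam x y1 y2 * \<omega> (dist y2 y2' / (dist x y1 + dist x y2))"
      if "x \<noteq> y1 \<or> x \<noteq> y2" "dist y2 y2' \<le> max (dist x y1) (dist x y2) / 2" for x y1 y2 y2'
    proof -
      have "x \<noteq> y1 \<or> x \<noteq> y2'" using far1[of x y2 y1 y2'] that by (auto simp: max.commute)
      then show ?thesis unfolding off[OF that(1)] by (subst off) (auto intro: reg2[OF that])
    qed
  qed (use CK \<omega> dini_modulus_summable in \<open>auto simp: dini_modulus_def\<close>)
  then show ?thesis by (rule that)
qed

context cz_operator
begin

text \<open>
  The infimum makes the dominating function comparable at nearby points. As it lies below \<open>L\<close>, and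
  kernel bounds decrease in the dominating function, the kernel estimates persist.
\<close>

definition regularised :: "'a \<Rightarrow> real \<Rightarrow> real" where
  "regularised x r = (INF z. L z (r + dist x z))"

lemma regularised_le:
  assumes "0 < r"
  shows "regularised x r \<le> L z (r + dist x z)"
  unfolding regularised_def
proof (rule cINF_lower)
  show "bdd_below (range (\<lambda>z. L z (r + dist x z)))"
  proof (rule bdd_belowI2)
    fix z
    have "0 < L z (r + dist x z)" using assms by (intro L_pos add_pos_nonneg) auto
    then show "0 \<le> L z (r + dist x z)" by simp
  qed
qed simp

lemma le_regularised:
  assumes "\<And>z. c \<le> L z (r + dist x z)"
  shows "c \<le> regularised x r"
  unfolding regularised_def using assms by (intro cINF_greatest) auto

lemma regularised_mono_const:
  assumes "0 < r" and "\<And>z. L z (r + dist x z) \<le> CL * L z (s + dist y z)"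
  shows "regularised x r \<le> CL * regularised y s"
proof -
  have "regularised x r / CL \<le> regularised y s"
  proof (rule le_regularised)
    fix z
    have "regularised x r \<le> CL * L z (s + dist y z)" using regularised_le[OF assms(1)] assms(2) by (rule order_trans)
    then show "regularised x r / CL \<le> L z (s + dist y z)" using CL by (simp add: field_simps)
  qed
  then show ?thesis using CL by (simp add: field_simps)
qed

text \<open>Positivity is the delicate point, since an infimum of positive numbers may vanish. As
  the measure is not zero, some large ball has positive measure, which is a lower bound for the
  regularised function at that radius; its doubling carries the positivity down to
  \<open>r\<close>.\<close>

lemma regular_cz_operator_regularised:
  assumes pos: "emeasure M UNIV \<noteq> 0" and gd: "geometrically_doubling N TYPE('a)"
  shows "regular_cz_operator M p1 p2 p CT K T regularised CL CK \<omega> N"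
proof -
  have ball: "measure M (ball x r) \<le> regularised x r" if "0 < r" for x r
  proof (rule le_regularised)
    fix z
    have "ball x r \<subseteq> ball z (r + dist x z)"
    proof
      fix y assume "y \<in> ball x r"
      then show "y \<in> ball z (r + dist x z)" using dist_triangle[of z y x] by (simp add: dist_commute)
    qed
    then have "measure M (ball x r) \<le> measure M (ball z (r + dist x z))"
      by (intro measure_mono_fmeasurable) (auto simp: fmeasurable_def fin_ball[unfolded infinity_ennreal_def])
    also have "\<dots> \<le> L z (r + dist x z)" using that by (intro L_ball add_pos_nonneg) auto
    finally show "measure M (ball x r) \<le> L z (r + dist x z)" .
  qed
  have doub: "regularised x (2 * r) \<le> CL * regularised x r" if r: "0 < r" for x r
  proof (rule regularised_mono_const)
    fix z
    have "L z (2 * r + dist x z) \<le> L z (2 * (r + dist x z))" using r by (intro L_mono add_pos_nonneg) auto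
    also have "\<dots> \<le> CL * L z (r + dist x z)" using r by (intro L_double add_pos_nonneg) auto
    finally show "L z (2 * r + dist x z) \<le> CL * L z (r + dist x z)" .
  qed (use r in simp)
  have pos': "0 < regularised x r" if r: "0 < r" for x r
  proof -
    have pw: "regularised x (2 ^ n * r) \<le> CL ^ n * regularised x r" for n
    proof (induction n)
      case (Suc n)
      have "regularised x (2 ^ Suc n * r) \<le> CL * regularised x (2 ^ n * r)" using doub[of "2 ^ n * r" x] r by (simp add: ac_simps)
      also have "\<dots> \<le> CL * (CL ^ n * regularised x r)" using Suc CL by (intro mult_left_mono) auto
      finally show ?case by (simp add: ac_simps)
    qed simp
    have "\<exists>n. 0 < measure M (ball x (2 ^ n * r))"
    proof (rule ccontr)
      assume "\<nexists>n. 0 < measure M (ball x (2 ^ n * r))"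
      then have "measure M (ball x (2 ^ n * r)) = 0" for n by (simp add: zero_less_measure_iff)
      then have "emeasure M (\<Union>n. ball x (2 ^ n * r)) = 0"
        by (intro emeasure_UN_eq_0) (auto simp: emeasure_ball)
      moreover have "(\<Union>n. ball x (2 ^ n * r)) = UNIV"
      proof -
        have "y \<in> (\<Union>n. ball x (2 ^ n * r))" for y
        proof -
          obtain n where "dist x y / r < 2 ^ n" using real_arch_pow[of 2 "dist x y / r"] by auto
          then show ?thesis using r by (auto simp: field_simps)
        qed
        then show ?thesis by blast
      qed
      ultimately show False using pos by simp
    qed
    then obtain n where "0 < measure M (ball x (2 ^ n * r))" ..
    also have "\<dots> \<le> regularised x (2 ^ n * r)" using r by (intro ball) auto
    also have "\<dots> \<le> CL ^ n * regularised x r" by (rule pw)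
    finally show ?thesis using CL by (simp add: zero_less_mult_iff)
  qed
  have kb: "kernel_bound L x y1 y2 \<le> kernel_bound regularised x y1 y2" for x y1 y2
  proof (cases "x = y1 \<and> x = y2")
    case False
    define l where "l r = (if 0 < r then regularised x r else 0)" for r
    have l: "l (dist x y) \<le> L0 x (dist x y)" "0 \<le> l (dist x y)" for y
      using regularised_le[of "dist x y" x x] pos'[of "dist x y" x] by (auto simp: l_def L0_def less_imp_le)
    have "0 < l (dist x y1) + l (dist x y2)"
    proof (cases "x = y1")
      case True
      then show ?thesis using False pos'[of "dist x y2" x] by (simp add: l_def)
    next
      case False
      then show ?thesis using l(2)[of y2] pos'[of "dist x y1" x] by (simp add: l_def add_pos_nonneg)
    qed
    then have "1 / (L0 x (dist x y1) + L0 x (dist x y2))\<^sup>2 \<le> 1 / (l (dist x y1) + l (dist x y2))\<^sup>2"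
      using l by (intro divide_left_mono power_mono add_mono mult_pos_pos zero_less_power) (auto intro: less_le_trans add_mono)
    then show ?thesis unfolding kernel_bound_L0 by (simp add: kernel_bound_def l_def Let_def)
  qed (auto simp: kernel_bound_def)
  have om: "0 \<le> \<omega> t" if "0 \<le> t" for t using mono_onD[OF omega_mono, of 0 t] that omega_0 by simp
  have kb': "CK * kernel_bound L x y1 y2 * \<omega> (dist u v / (dist x y1 + dist x y2))
      \<le> CK * kernel_bound regularised x y1 y2 * \<omega> (dist u v / (dist x y1 + dist x y2))" for x y1 y2 u v
    using CK kb by (intro mult_right_mono mult_left_mono om) auto
  show ?thesis
  proof
    fix x r s
    assume r: "(0::real) < r"
    show "0 < regularised x r" using r by (rule pos')
    show "measure M (ball x r) \<le> regularised x r" using r by (rule ball)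
    show "regularised x (2 * r) \<le> CL * regularised x r" using r by (rule doub)
    show "regularised x r \<le> regularised x s" if "r \<le> s"
    proof (rule le_regularised)
      fix z
      have "regularised x r \<le> L z (r + dist x z)" by (rule regularised_le[OF r])
      also have "\<dots> \<le> L z (s + dist x z)" using r that by (intro L_mono add_pos_nonneg) auto
      finally show "regularised x r \<le> L z (s + dist x z)" .
    qed
  next
    fix x y :: 'a and s :: real assume s: "0 < s" and xy: "dist x y \<le> s"
    show "regularised x s \<le> CL * regularised y s"
    proof (rule regularised_mono_const[OF s])
      fix z
      \<comment> \<open>For \<open>dist x y \<le> s\<close> the radius in the infimum at most
        doubles, so one doubling of \<open>L\<close> gives comparability with the same
        constant.\<close>
      have "s + dist x z \<le> 2 * (s + dist y z)"
      proof -
        have "dist x z \<le> s + dist y z" using xy dist_triangle[of x z y] by linarith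
        moreover have "dist y z \<le> 2 * dist y z" by simp
        ultimately show ?thesis unfolding distrib_left by linarith
      qed
      then have "L z (s + dist x z) \<le> L z (2 * (s + dist y z))"
        using s by (intro L_mono add_pos_nonneg) auto
      also have "\<dots> \<le> CL * L z (s + dist y z)" using s by (intro L_double add_pos_nonneg) auto
      finally show "L z (s + dist x z) \<le> CL * L z (s + dist y z)" .
    qed
  next
    show "cmod (K x y1 y2) \<le> CK * kernel_bound regularised x y1 y2" for x y1 y2
      using K_size kb CK by (blast intro: order_trans mult_left_mono)
    show "cmod (K x y1 y2 - K x' y1 y2) \<le> CK * kernel_bound regularised x y1 y2 * \<omega> (dist x x' / (dist x y1 + dist x y2))"
      if "x \<noteq> y1 \<or> x \<noteq> y2" "dist x x' \<le> max (dist x y1) (dist x y2) / 2" for x y1 y2 x'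
      using K_reg0[OF that] kb' by (rule order_trans)
    show "cmod (K x y1 y2 - K x y1' y2) \<le> CK * kernel_bound regularised x y1 y2 * \<omega> (dist y1 y1' / (dist x y1 + dist x y2))"
      if "x \<noteq> y1 \<or> x \<noteq> y2" "dist y1 y1' \<le> max (dist x y1) (dist x y2) / 2" for x y1 y2 y1'
      using K_reg1[OF that] kb' by (rule order_trans)
    show "cmod (K x y1 y2 - K x y1 y2') \<le> CK * kernel_bound regularised x y1 y2 * \<omega> (dist y2 y2' / (dist x y1 + dist x y2))"
      if "x \<noteq> y1 \<or> x \<noteq> y2" "dist y2 y2' \<le> max (dist x y1) (dist x y2) / 2" for x y1 y2 y2'
      using K_reg2[OF that] kb' by (rule order_trans)
  qed (use CL CK omega_mono omega_0 omega_summable gd in auto)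
qed

text \<open>For the zero measure all level sets are null. Otherwise the weak type obtained with
  \<open>regularised\<close> is carried back to \<open>L\<close>. This matters: a smaller dominating
  function has a larger \<open>maximal_lam\<close>, so Cotlar's inequality is the stronger statement
  for \<open>L\<close>.\<close>

lemma cotlar_operator_exists:
  assumes gd: "geometrically_doubling N TYPE('a)"
  obtains CW where "cotlar_operator M p1 p2 p CT K T L CL CK \<omega> CW"
proof (cases "emeasure M UNIV = 0")
  case True
  have "emeasure M S = 0" for S using emeasure_mono[of S UNIV M] True sets_M by simp
  then have "cotlar_operator M p1 p2 p CT K T L CL CK \<omega> 0" by unfold_locales auto
  then show ?thesis by (rule that)
next
  case False
  interpret R: regular_cz_operator M p1 p2 p CT K T regularised CL CK \<omega> N
    by (rule regular_cz_operator_regularised[OF False gd])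
  have "cotlar_operator M p1 p2 p CT K T L CL CK \<omega> (4 * R.weak_const)"
    by unfold_locales (use R.weak_const_ge R.weak_type in auto)
  then show ?thesis by (rule that)
qed

end

theorem theorem2p9:
  fixes M :: "'a::{metric_space, second_countable_topology} measure"
    and lam :: "'a \<Rightarrow> real \<Rightarrow> real"
    and N :: nat
    and p1 p2 p :: real
    and K :: "'a \<Rightarrow> 'a \<Rightarrow> 'a \<Rightarrow> complex"
    and T :: "('a \<Rightarrow> complex) \<Rightarrow> ('a \<Rightarrow> complex) \<Rightarrow> 'a \<Rightarrow> complex"
  assumes "metric_measure_space M"
    and "upper_doubling M lam"
    and "geometrically_doubling N TYPE('a)"
    and "bilinear_CZ_operator M lam p1 p2 p K T"
  shows
    "(\<exists>C>0. \<forall>f1 f2. integrable M f1 \<longrightarrow> integrable M f2 \<longrightarrow>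
        maximal_truncation M K f1 f2 \<in> borel_measurable M \<and>
        weak_L_half M (maximal_truncation M K f1 f2)
          \<le> ennreal (C * (\<integral>x. cmod (f1 x) \<partial>M) * (\<integral>x. cmod (f2 x) \<partial>M))) \<and>
     (\<forall>\<eta>. 0 < \<eta> \<longrightarrow> \<eta> < 1 / 2 \<longrightarrow>
        (\<exists>C>0.
           (\<forall>f1 f2 x. in_Lp M p1 f1 \<longrightarrow> in_Lp M p2 f2 \<longrightarrow>
              cotlar_at M lam K \<eta> C f1 f2 (T f1 f2) x) \<and>
           (\<forall>f1 f2. integrable M f1 \<longrightarrow> integrable M f2 \<longrightarrow>
              (\<exists>g. L1_extension_value M p1 p2 T f1 f2 g) \<and>
              (\<forall>g x. L1_extension_value M p1 p2 T f1 f2 g \<longrightarrow>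
                 cotlar_at M lam K \<eta> C f1 f2 g x))))"
proof -
  obtain CT CL CK \<omega> where "cz_operator M p1 p2 p CT (off_diagonal K) T lam CL CK \<omega>"
    using cz_operatorI[OF assms(1,2,4)] .
  then obtain CW where "cotlar_operator M p1 p2 p CT (off_diagonal K) T lam CL CK \<omega> CW"
    using cz_operator.cotlar_operator_exists assms(3) by blast
  then interpret cotlar_operator M p1 p2 p CT "off_diagonal K" T lam CL CK \<omega> CW .
  \<comment> \<open>The point \<open>(x, x)\<close> never belongs to the truncation region, so the
    maximal truncations of the two kernels agree.\<close>
  have at: "cotlar_at M lam K \<eta> C f1 f2 g x \<longleftrightarrow> cotlar_at M lam (off_diagonal K) \<eta> C f1 f2 g x" for \<eta> C f1 f2 g x
    by (simp add: cotlar_at_def maximal_truncation_off_diagonal)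
  show ?thesis
  proof (intro conjI allI impI)
    show "\<exists>C>0. \<forall>f1 f2. integrable M f1 \<longrightarrow> integrable M f2 \<longrightarrow>
        maximal_truncation M K f1 f2 \<in> borel_measurable M \<and>
        weak_L_half M (maximal_truncation M K f1 f2)
          \<le> ennreal (C * L1_norm M f1 * L1_norm M f2)"
      \<comment> \<open>The summand 1 gives positivity without a lower bound for
        \<open>weak_max_const\<close>.\<close>
      using maximal_truncation_measurable weak_L_half_maximal_truncation
      unfolding maximal_truncation_off_diagonal
      by (intro exI[of _ "weak_max_const\<^sup>2 + 1"]) (auto intro: add_nonneg_pos)
  next
    fix \<eta> :: real assume \<eta>: "0 < \<eta>"
    have pos: "0 < cotlar_const + (4 * A) powr (1 / \<eta>)" using cotlar_const_pos by (simp add: add_pos_nonneg)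
    show "\<exists>C>0.
           (\<forall>f1 f2 x. in_Lp M p1 f1 \<longrightarrow> in_Lp M p2 f2 \<longrightarrow>
              cotlar_at M lam K \<eta> C f1 f2 (T f1 f2) x) \<and>
           (\<forall>f1 f2. integrable M f1 \<longrightarrow> integrable M f2 \<longrightarrow>
              (\<exists>g. L1_extension_value M p1 p2 T f1 f2 g) \<and>
              (\<forall>g x. L1_extension_value M p1 p2 T f1 f2 g \<longrightarrow>
                 cotlar_at M lam K \<eta> C f1 f2 g x))"
      unfolding at using pos cotlar_at_Lp[OF \<eta>] cotlar_at_extension[OF \<eta>] L1_extension_exists
      by (intro exI[of _ "cotlar_const + (4 * A) powr (1 / \<eta>)"]) blast
  qed
qed

end
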